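(* Let $k$ be a field of characteristic zero, let $X\subset \mathbb{P}^n_k$ be a smooth, irreducible, non-degenerate projective variety, let $\mathcal{I}\subset\mathcal{O}_{\mathbb{P}^n_k}$ be the sheaf of ideals defining $X$, and let $C_X\subset \mathbb{A}^{n+1}_k$ be the affine cone over $X$. (1) If $H^1(\mathbb{P}^n_k, \mathcal{I}^2(d))=0$ for all $d\geq 0$, then the sheaf of Kähler differentials $\Omega_{C_X}$ is torsion-free. (2) If in addition $X$ is assumed to be projectively normal, then an equivalence holds: for projectively normal $X$, the sheaf $\Omega_{C_X}$ is torsion-free if and only if the first infinitesimal neighbourhood of $X$ in $\mathbb{P}^n_k$ is also projectively normal (equivalently, if and only if $H^1(\mathbb{P}^n_k,\mathcal{I}^2(d))=0$ for all $d\ge 0$).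
   Context: Non-degenerate means not contained in any hyperplane of $\mathbb{P}^n_k$. The affine cone over $X$ is $C_X=\operatorname{Spec}(S/I)$, where $S=k[x_0,\dots,x_n]$ and $I=\bigoplus_d H^0(\mathbb{P}^n_k,\mathcal{I}(d))\subset S$ is the homogeneous ideal of $X$. $\Omega_{C_X}=\Omega_{C_X/k}$ is the sheaf of Kähler differentials over $k$; it is torsion-free if its torsion subsheaf vanishes, equivalently if the natural map $\Omega_{C_X}\to\Omega_{C_X}^{\vee\vee}$ to the double dual is injective. A closed subscheme $Y\subset\mathbb{P}^n_k$ with ideal sheaf $\mathcal{J}$ is called projectively normal if the restriction map $H^0(\mathbb{P}^n_k,\mathcal{O}_{\mathbb{P}^n_k}(d))\to H^0(Y,\mathcal{O}_Y(d))$ is surjective for all $d\ge 0$, or equivalently $H^1(\mathbb{P}^n_k,\mathcal{J}(d))=0$ for all $d\ge 0$. The first infinitesimal neighbourhood of $X$ in $\mathbb{P}^n_k$ is the closed subscheme defined by the ideal sheaf $\mathcal{I}^2$. *)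

theory Defs
  imports
    "HOL-Algebra.Module"
    "HOL-Algebra.QuotRing"
    "HOL-Algebra.Algebraic_Closure_Type"
    "HOL-Analysis.Abstract_Topology"
    "HOL-Computational_Algebra.Fraction_Field"
    "HOL-Library.Poly_Mapping"
    "HOL-Library.Extended_Nat"
begin

section \<open>Topological spaces and sheaves of functions\<close>

definition irreducible_in :: "'a topology \<Rightarrow> 'a set \<Rightarrow> bool" where
  "irreducible_in T Z \<longleftrightarrow> Z \<noteq> {} \<and> Z \<subseteq> topspace T \<and>
     (\<forall>A B. closedin T A \<and> closedin T B \<and> Z \<subseteq> A \<union> B \<longrightarrow> Z \<subseteq> A \<or> Z \<subseteq> B)"

definition krull_dim :: "'a topology \<Rightarrow> 'a set \<Rightarrow> enat" where
  "krull_dim T Z = Sup {enat m | m. \<exists>C :: nat \<Rightarrow> 'a set.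
     (\<forall>i\<le>m. irreducible_in T (C i) \<and> closedin T (C i) \<and> C i \<subseteq> Z) \<and>
     (\<forall>i<m. C i \<subset> C (Suc i))}"

text \<open>
  A sheaf on \<open>T\<close> is represented by the map sending an open set \<open>U\<close> to its set of sections, a
  section over \<open>U\<close> being the function that sends a point of \<open>U\<close> to the germ of the section there.
  Outside \<open>U\<close> a section has the value 0, so \<open>res V s\<close> is the restriction of \<open>s\<close> to \<open>V\<close>, and
  the zero function is the only section over the empty set.
\<close>

type_synonym ('a, 'b) fsheaf = "'a set \<Rightarrow> ('a \<Rightarrow> 'b) set"

definition res :: "'a set \<Rightarrow> ('a \<Rightarrow> 'b::zero) \<Rightarrow> 'a \<Rightarrow> 'b" where
  "res V s = (\<lambda>p. if p \<in> V then s p else 0)"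

definition stalk :: "'a topology \<Rightarrow> ('a, 'b) fsheaf \<Rightarrow> 'a \<Rightarrow> 'b set" where
  "stalk T F p = {s p | s V. openin T V \<and> p \<in> V \<and> s \<in> F V}"

text \<open>
  The product of two sheaves of modules inside a common sheaf of rings: the sheaf associated with
  \<open>V \<mapsto> F(V) G(V)\<close>.
\<close>

definition sheaf_mult ::
  "'a topology \<Rightarrow> ('a, 'b::comm_ring_1) fsheaf \<Rightarrow> ('a, 'b) fsheaf \<Rightarrow> ('a, 'b) fsheaf" where
  "sheaf_mult T F G U = {s. (\<forall>p. p \<notin> U \<longrightarrow> s p = 0) \<and>
     (\<forall>p\<in>U. \<exists>V. openin T V \<and> p \<in> V \<and> V \<subseteq> U \<and>
        (\<exists>m f g. (\<forall>i<m. f i \<in> F V \<and> g i \<in> G V) \<and>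
           res V s = (\<lambda>q. \<Sum>i<(m::nat). f i q * g i q)))}"

text \<open>
  For a subsheaf \<open>G\<close> of \<open>F\<close>, the sections over \<open>U\<close> of the quotient sheaf \<open>F/G\<close>, that is, of the
  sheaf associated with \<open>V \<mapsto> F(V)/G(V)\<close>. The germ at \<open>q\<close> of such a section is a coset of the
  stalk \<open>G\<^sub>q\<close>. The map on sections over \<open>U\<close> induced by \<open>F \<rightarrow> F/G\<close> is \<open>quot_proj T G U\<close>.
\<close>

definition quot_proj ::
  "'a topology \<Rightarrow> ('a, 'b::ab_group_add) fsheaf \<Rightarrow> 'a set \<Rightarrow> ('a \<Rightarrow> 'b) \<Rightarrow> 'a \<Rightarrow> 'b set" where
  "quot_proj T G U s = (\<lambda>q. if q \<in> U then {s q + x | x. x \<in> stalk T G q} else {})"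

definition quot_sections ::
  "'a topology \<Rightarrow> ('a, 'b::ab_group_add) fsheaf \<Rightarrow> ('a, 'b) fsheaf \<Rightarrow> ('a, 'b set) fsheaf" where
  "quot_sections T F G U = {t. (\<forall>q. q \<notin> U \<longrightarrow> t q = {}) \<and>
     (\<forall>p\<in>U. \<exists>V. openin T V \<and> p \<in> V \<and> V \<subseteq> U \<and>
        (\<exists>s\<in>F V. \<forall>q\<in>V. t q = quot_proj T G V s q))}"

section \<open>First sheaf cohomology\<close>

text \<open>
  \<open>H\<^sup>1(T, F)\<close> is the first Cech cohomology group, i.e. the direct limit of \<open>H\<^sup>1(\<U>, F)\<close> over all open
  covers \<open>\<U>\<close> ordered by refinement. In degree one it agrees with derived functor cohomology for every
  sheaf of abelian groups on every topological space. Elements of the limit are classes of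
  pairs \<open>(\<U>, c)\<close> with \<open>c\<close> a 1-cocycle on \<open>\<U>\<close>; two such are identified if their pullbacks to a
  common refinement differ by a coboundary.
\<close>

definition open_cover :: "'a topology \<Rightarrow> 'a set set \<Rightarrow> bool" where
  "open_cover T \<U> \<longleftrightarrow> (\<forall>U\<in>\<U>. openin T U) \<and> \<Union>\<U> = topspace T"

definition cech_cocycles ::
  "'a topology \<Rightarrow> ('a, 'b::ab_group_add) fsheaf \<Rightarrow>
   ('a set set \<times> ('a set \<Rightarrow> 'a set \<Rightarrow> 'a \<Rightarrow> 'b)) set" where
  "cech_cocycles T F = {(\<U>, c). open_cover T \<U> \<and>
     (\<forall>U\<in>\<U>. \<forall>V\<in>\<U>. c U V \<in> F (U \<inter> V)) \<and>
     (\<forall>U\<in>\<U>. \<forall>V\<in>\<U>. \<forall>W\<in>\<U>. \<forall>p\<in>U \<inter> V \<inter> W. c V W p - c U W p + c U V p = 0)}"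

definition cech_cohomologous ::
  "'a topology \<Rightarrow> ('a, 'b::ab_group_add) fsheaf \<Rightarrow>
   ('a set set \<times> ('a set \<Rightarrow> 'a set \<Rightarrow> 'a \<Rightarrow> 'b)) rel" where
  "cech_cohomologous T F = {((\<U>, c), (\<U>', c')).
     (\<U>, c) \<in> cech_cocycles T F \<and> (\<U>', c') \<in> cech_cocycles T F \<and>
     (\<exists>\<V> r r' b. open_cover T \<V> \<and>
        (\<forall>V\<in>\<V>. r V \<in> \<U> \<and> V \<subseteq> r V \<and> r' V \<in> \<U>' \<and> V \<subseteq> r' V \<and> b V \<in> F V) \<and>
        (\<forall>V\<in>\<V>. \<forall>W\<in>\<V>. \<forall>p\<in>V \<inter> W.
           c (r V) (r W) p - c' (r' V) (r' W) p = b W p - b V p))}"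

definition cech_H1 ::
  "'a topology \<Rightarrow> ('a, 'b::ab_group_add) fsheaf \<Rightarrow>
   ('a set set \<times> ('a set \<Rightarrow> 'a set \<Rightarrow> 'a \<Rightarrow> 'b)) set set" where
  "cech_H1 T F = cech_cocycles T F // cech_cohomologous T F"

definition H1_vanishes :: "'a topology \<Rightarrow> ('a, 'b::ab_group_add) fsheaf \<Rightarrow> bool" where
  "H1_vanishes T F \<longleftrightarrow> is_singleton (cech_H1 T F)"

section \<open>Modules and Kaehler differentials\<close>

text \<open>
  The fields \<open>mult\<close> and \<open>one\<close> of the record type of modules play no role for a module.
\<close>

definition free_module :: "('a, 'm) ring_scheme \<Rightarrow> 'i set \<Rightarrow> ('a, 'i \<Rightarrow> 'a) module" where
  "free_module R B =
    \<lparr>carrier = {f. (\<forall>i. f i \<in> carrier R) \<and> (\<forall>i. i \<notin> B \<longrightarrow> f i = \<zero>\<^bsub>R\<^esub>) \<and> finite {i. f i \<noteq> \<zero>\<^bsub>R\<^esub>}},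
     monoid.mult = undefined, monoid.one = undefined,
     ring.zero = (\<lambda>_. \<zero>\<^bsub>R\<^esub>), ring.add = (\<lambda>f g i. f i \<oplus>\<^bsub>R\<^esub> g i),
     module.smult = (\<lambda>a f i. a \<otimes>\<^bsub>R\<^esub> f i)\<rparr>"

definition submodule_gen ::
  "('a, 'm) ring_scheme \<Rightarrow> ('a, 'b) module \<Rightarrow> 'b set \<Rightarrow> 'b set" where
  "submodule_gen R M A = \<Inter>{H. submodule H R M \<and> A \<subseteq> H}"

definition quot_module :: "('a, 'b) module \<Rightarrow> 'b set \<Rightarrow> ('a, 'b set) module" where
  "quot_module M N =
    \<lparr>carrier = a_rcosets\<^bsub>M\<^esub> N, monoid.mult = undefined, monoid.one = undefined,
     ring.zero = N, ring.add = set_add M,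
     module.smult = (\<lambda>a C. \<Union>x\<in>C. N +>\<^bsub>M\<^esub> (a \<odot>\<^bsub>M\<^esub> x))\<rparr>"

text \<open>
  For a commutative ring \<open>R\<close> that is a \<open>k\<close>-algebra by \<open>h : k \<rightarrow> R\<close>, \<open>\<Omega>\<^bsub>R/k\<^esub>\<close> is the free module on
  symbols \<open>dx\<close>, \<open>x \<in> R\<close>, modulo additivity, the Leibniz rule and \<open>d(h(c)) = 0\<close>.
\<close>

definition dsym :: "('a, 'm) ring_scheme \<Rightarrow> 'a \<Rightarrow> 'a \<Rightarrow> 'a" where
  "dsym R x = (\<lambda>y. if y = x then \<one>\<^bsub>R\<^esub> else \<zero>\<^bsub>R\<^esub>)"

definition kaehler_relations :: "('a, 'm) ring_scheme \<Rightarrow> ('k \<Rightarrow> 'a) \<Rightarrow> ('a \<Rightarrow> 'a) set" where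
  "kaehler_relations R h = (let F = free_module R (carrier R) in
     {dsym R (x \<oplus>\<^bsub>R\<^esub> y) \<ominus>\<^bsub>F\<^esub> (dsym R x \<oplus>\<^bsub>F\<^esub> dsym R y) | x y. x \<in> carrier R \<and> y \<in> carrier R} \<union>
     {dsym R (x \<otimes>\<^bsub>R\<^esub> y) \<ominus>\<^bsub>F\<^esub> (x \<odot>\<^bsub>F\<^esub> dsym R y \<oplus>\<^bsub>F\<^esub> y \<odot>\<^bsub>F\<^esub> dsym R x) | x y.
        x \<in> carrier R \<and> y \<in> carrier R} \<union>
     {dsym R (h c) | c. True})"

definition kaehler :: "('a, 'm) ring_scheme \<Rightarrow> ('k \<Rightarrow> 'a) \<Rightarrow> ('a, ('a \<Rightarrow> 'a) set) module" where
  "kaehler R h = (let F = free_module R (carrier R) in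
     quot_module F (submodule_gen R F (kaehler_relations R h)))"

definition torsion_elements :: "('a, 'm) ring_scheme \<Rightarrow> ('a, 'b) module \<Rightarrow> 'b set" where
  "torsion_elements R M = {x \<in> carrier M. \<exists>a\<in>carrier R.
     (\<forall>b\<in>carrier R. a \<otimes>\<^bsub>R\<^esub> b = \<zero>\<^bsub>R\<^esub> \<longrightarrow> b = \<zero>\<^bsub>R\<^esub>) \<and> a \<odot>\<^bsub>M\<^esub> x = \<zero>\<^bsub>M\<^esub>}"

definition torsion_free_module :: "('a, 'm) ring_scheme \<Rightarrow> ('a, 'b) module \<Rightarrow> bool" where
  "torsion_free_module R M \<longleftrightarrow> torsion_elements R M = {\<zero>\<^bsub>M\<^esub>}"

text \<open>
  For a local ring \<open>R\<close>, whose maximal ideal \<open>\<mm>\<close> is the set of non-units: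
  the \<open>R/\<mm>\<close>-vector space \<open>M \<otimes> R/\<mm> = M/\<mm>M\<close> has dimension \<open>r\<close>, i.e. the classes of some
  \<open>w\<^sub>0, \<dots>, w\<^sub>r\<^sub>-\<^sub>1 \<in> M\<close> form a basis.
\<close>

definition nonunits :: "('a, 'm) ring_scheme \<Rightarrow> 'a set" where
  "nonunits R = carrier R - Units R"

definition fibre_has_dim :: "('a, 'm) ring_scheme \<Rightarrow> ('a, 'b) module \<Rightarrow> nat \<Rightarrow> bool" where
  "fibre_has_dim R M r \<longleftrightarrow>
    (let mM = submodule_gen R M {a \<odot>\<^bsub>M\<^esub> x | a x. a \<in> nonunits R \<and> x \<in> carrier M} in
     \<exists>w \<in> {..<r} \<rightarrow> carrier M.
       (\<forall>x\<in>carrier M. \<exists>c \<in> {..<r} \<rightarrow> carrier R.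
          x \<ominus>\<^bsub>M\<^esub> (\<Oplus>\<^bsub>M\<^esub>i\<in>{..<r}. c i \<odot>\<^bsub>M\<^esub> w i) \<in> mM) \<and>
       (\<forall>c \<in> {..<r} \<rightarrow> carrier R.
          (\<Oplus>\<^bsub>M\<^esub>i\<in>{..<r}. c i \<odot>\<^bsub>M\<^esub> w i) \<in> mM \<longrightarrow> (\<forall>i<r. c i \<in> nonunits R)))"

section \<open>Projective space\<close>

text \<open>
  \<open>S = k[x\<^sub>0, \<dots>, x\<^sub>n]\<close>: the variables are indexed by a finite type \<open>'v\<close> with \<open>n + 1\<close> elements. Its
  linear order only serves to make \<open>S\<close> an instance of \<open>idom\<close> (any finite type carries one).
\<close>

type_synonym ('v, 'k) mpoly = "('v \<Rightarrow>\<^sub>0 nat) \<Rightarrow>\<^sub>0 'k"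

abbreviation polyring :: "('v::{finite,linorder}, 'k::field) mpoly ring" where
  "polyring \<equiv> ring_of_type_algebra"

definition const :: "'k::field \<Rightarrow> ('v::{finite,linorder}, 'k) mpoly" where
  "const c = Poly_Mapping.single 0 c"

definition var :: "'v \<Rightarrow> ('v::{finite,linorder}, 'k::field) mpoly" where
  "var i = Poly_Mapping.single (Poly_Mapping.single i 1) 1"

definition mdeg :: "('v::finite \<Rightarrow>\<^sub>0 nat) \<Rightarrow> nat" where
  "mdeg m = (\<Sum>i\<in>UNIV. Poly_Mapping.lookup m i)"

definition homog :: "nat \<Rightarrow> ('v::{finite,linorder}, 'k::field) mpoly \<Rightarrow> bool" where
  "homog d f \<longleftrightarrow> (\<forall>m\<in>Poly_Mapping.keys f. mdeg m = d)"

definition hcomp :: "nat \<Rightarrow> ('v::{finite,linorder}, 'k::field) mpoly \<Rightarrow> ('v, 'k) mpoly" where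
  "hcomp d f = (\<Sum>m\<in>{m\<in>Poly_Mapping.keys f. mdeg m = d}.
     Poly_Mapping.single m (Poly_Mapping.lookup f m))"

text \<open>
  \<open>\<P>\<^sup>n = Proj S\<close>: the points are the homogeneous prime ideals not containing the irrelevant ideal,
  with the Zariski topology.
\<close>

type_synonym ('v, 'k) proj_point = "('v, 'k) mpoly set"

definition proj_points :: "('v::{finite,linorder}, 'k::field) proj_point set" where
  "proj_points = {p. primeideal p polyring \<and> (\<forall>f\<in>p. \<forall>d. hcomp d f \<in> p) \<and> (\<exists>i. var i \<notin> p)}"

definition basic_open :: "('v::{finite,linorder}, 'k::field) mpoly \<Rightarrow> ('v, 'k) proj_point set" where
  "basic_open f = {p\<in>proj_points. f \<notin> p}"

definition Pn :: "('v::{finite,linorder}, 'k::field) proj_point topology" where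
  "Pn = topology_generated_by {basic_open f | f d. homog d f}"

text \<open>
  The sheaf \<open>\<O>(d)\<close>, \<open>d \<ge> 0\<close>: sections are locally fractions \<open>a/b\<close> with \<open>a\<close>, \<open>b\<close> homogeneous and
  \<open>deg a = deg b + d\<close>. As \<open>S\<close> is a domain, all stalks \<open>S(d)\<^bsub>(p)\<^esub>\<close> are subsets of the fraction field
  of \<open>S\<close>.
\<close>

definition OPn :: "nat \<Rightarrow> (('v::{finite,linorder}, 'k::field) proj_point, ('v, 'k) mpoly fract) fsheaf"
  where
  "OPn d U = {s. (\<forall>p. p \<notin> U \<longrightarrow> s p = 0) \<and>
     (\<forall>p\<in>U. \<exists>V. openin Pn V \<and> p \<in> V \<and> V \<subseteq> U \<and>
        (\<exists>e a b. homog (e + d) a \<and> homog e b \<and> (\<forall>q\<in>V. b \<notin> q \<and> s q = Fract a b)))}"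

text \<open>
  \<open>\<J>(d) = \<J> \<otimes> \<O>(d)\<close>, identified with the subsheaf \<open>\<J> \<cdot> \<O>(d)\<close> of \<open>\<O>(d)\<close> (\<open>\<O>(d)\<close> is flat).
\<close>

definition twist ::
  "(('v::{finite,linorder}, 'k::field) proj_point, ('v, 'k) mpoly fract) fsheaf \<Rightarrow> nat \<Rightarrow>
   (('v, 'k) proj_point, ('v, 'k) mpoly fract) fsheaf" where
  "twist \<J> d = sheaf_mult Pn \<J> (OPn d)"

text \<open>
  The closed subscheme \<open>Y\<close> of \<open>\<P>\<^sup>n\<close> with ideal sheaf \<open>\<J>\<close> is projectively normal: the restriction map
  \<open>H\<^sup>0(\<P>\<^sup>n, \<O>(d)) \<rightarrow> H\<^sup>0(Y, \<O>\<^sub>Y(d))\<close> is surjective for all \<open>d \<ge> 0\<close>. Here \<open>\<O>\<^sub>Y(d)\<close> is viewed as the sheaf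
  \<open>\<O>(d)/\<J>(d)\<close> on \<open>\<P>\<^sup>n\<close>, i.e. as its direct image under \<open>Y \<rightarrow> \<P>\<^sup>n\<close>.
\<close>

definition projectively_normal ::
  "(('v::{finite,linorder}, 'k::field) proj_point, ('v, 'k) mpoly fract) fsheaf \<Rightarrow> bool" where
  "projectively_normal \<J> \<longleftrightarrow> (\<forall>d.
     quot_proj Pn (twist \<J> d) (topspace Pn) ` OPn d (topspace Pn) =
     quot_sections Pn (OPn d) (twist \<J> d) (topspace Pn))"

section \<open>Projective varieties\<close>

text \<open>
  A projective variety is a closed subset \<open>Z\<close> of \<open>\<P>\<^sup>n\<close> with its reduced structure: its ideal sheaf
  consists of the sections of \<open>\<O>\<close> whose value lies in the maximal ideal of the local ring
  at every point of \<open>Z\<close>.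
\<close>

definition max_ideal_at ::
  "('v::{finite,linorder}, 'k::field) proj_point \<Rightarrow> ('v, 'k) mpoly fract set" where
  "max_ideal_at p = {Fract a b | a b e. homog e a \<and> homog e b \<and> a \<in> p \<and> b \<notin> p}"

definition ideal_sheaf ::
  "('v::{finite,linorder}, 'k::field) proj_point set \<Rightarrow>
   (('v, 'k) proj_point, ('v, 'k) mpoly fract) fsheaf" where
  "ideal_sheaf Z U = {s\<in>OPn 0 U. \<forall>p\<in>U \<inter> Z. s p \<in> max_ideal_at p}"

definition ideal_sheaf_sq ::
  "('v::{finite,linorder}, 'k::field) proj_point set \<Rightarrow>
   (('v, 'k) proj_point, ('v, 'k) mpoly fract) fsheaf" where
  "ideal_sheaf_sq Z = sheaf_mult Pn (ideal_sheaf Z) (ideal_sheaf Z)"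

definition nondegenerate :: "('v::{finite,linorder}, 'k::field) proj_point set \<Rightarrow> bool" where
  "nondegenerate Z \<longleftrightarrow> (\<forall>l. homog 1 l \<and> l \<noteq> 0 \<longrightarrow> \<not> Z \<subseteq> {p\<in>proj_points. l \<in> p})"

definition local_ring_Pn ::
  "('v::{finite,linorder}, 'k::field) proj_point \<Rightarrow> ('v, 'k) mpoly fract ring" where
  "local_ring_Pn p = ring_of_type_algebra\<lparr>carrier := stalk Pn (OPn 0) p\<rparr>"

definition local_ring ::
  "('v::{finite,linorder}, 'k::field) proj_point set \<Rightarrow> ('v, 'k) proj_point \<Rightarrow>
   ('v, 'k) mpoly fract set ring" where
  "local_ring Z p = local_ring_Pn p Quot stalk Pn (ideal_sheaf Z) p"

definition local_ring_const ::
  "('v::{finite,linorder}, 'k::field) proj_point set \<Rightarrow> ('v, 'k) proj_point \<Rightarrow>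
   'k \<Rightarrow> ('v, 'k) mpoly fract set" where
  "local_ring_const Z p c =
     stalk Pn (ideal_sheaf Z) p +>\<^bsub>local_ring_Pn p\<^esub> Fract (const c) 1"

text \<open>
  An irreducible projective variety \<open>Z\<close> over the field \<open>k\<close> is smooth (of relative dimension
  \<open>dim Z\<close>) if \<open>\<Omega>\<^bsub>Z/k\<^esub> \<otimes> \<kappa>(p)\<close> has dimension \<open>dim Z\<close> over \<open>\<kappa>(p)\<close> for every, not necessarily closed,
  point \<open>p\<close> of \<open>Z\<close>; flatness is automatic over a field.
\<close>

definition smooth_variety :: "('v::{finite,linorder}, 'k::field) proj_point set \<Rightarrow> bool" where
  "smooth_variety Z \<longleftrightarrow> (\<forall>p\<in>Z. \<exists>r. krull_dim Pn Z = enat r \<and>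
     fibre_has_dim (local_ring Z p) (kaehler (local_ring Z p) (local_ring_const Z p)) r)"

section \<open>The affine cone\<close>

text \<open>
  \<open>I = \<Oplus>\<^sub>d H\<^sup>0(\<P>\<^sup>n, \<I>(d))\<close>, where a homogeneous polynomial of degree \<open>d\<close> is regarded as a global section
  of \<open>\<O>(d)\<close>.
\<close>

definition homogeneous_ideal ::
  "('v::{finite,linorder}, 'k::field) proj_point set \<Rightarrow> ('v, 'k) mpoly set" where
  "homogeneous_ideal Z = {f. \<forall>d.
     res (topspace Pn) (\<lambda>_. Fract (hcomp d f) 1) \<in> twist (ideal_sheaf Z) d (topspace Pn)}"

text \<open>
  The affine cone \<open>C\<^sub>Z\<close> is the spectrum of this ring. It is an affine integral scheme, so that the
  quasi-coherent sheaf \<open>\<Omega>\<^bsub>C\<^sub>Z\<^esub>\<close> is given by its module of global sections, and its torsion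
  subsheaf by the torsion elements of that module.
\<close>

definition cone_ring ::
  "('v::{finite,linorder}, 'k::field) proj_point set \<Rightarrow> ('v, 'k) mpoly set ring" where
  "cone_ring Z = polyring Quot homogeneous_ideal Z"

definition cone_const ::
  "('v::{finite,linorder}, 'k::field) proj_point set \<Rightarrow> 'k \<Rightarrow> ('v, 'k) mpoly set" where
  "cone_const Z c = homogeneous_ideal Z +>\<^bsub>polyring\<^esub> const c"

definition cone_differentials_torsion_free ::
  "('v::{finite,linorder}, 'k::field) proj_point set \<Rightarrow> bool" where
  "cone_differentials_torsion_free Z \<longleftrightarrow>
     torsion_free_module (cone_ring Z) (kaehler (cone_ring Z) (cone_const Z))"

end

theory Submission
  imports Defs "HOL-Computational_Algebra.Polynomial_Factorial" "HOL-Library.Function_Algebras"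
begin

text \<open>
  Let \<open>P\<close> be the homogeneous ideal of \<open>Z\<close>. Since \<open>H\<^sup>1(\<P>\<^sup>n, \<O>(d)) = 0\<close>, both the vanishing of
  \<open>H\<^sup>1(\<I>\<^sup>2(d))\<close> and the projective normality of the first infinitesimal neighbourhood say that global
  sections of \<open>\<O>(d)/\<I>\<^sup>2(d)\<close> lift to forms of degree \<open>d\<close>. By the exact sequence
  \<open>P/P\<^sup>2 \<rightarrow> \<Omega>\<^sub>S \<otimes> S/P \<rightarrow> \<Omega> \<rightarrow> 0\<close>, torsion-freeness of the differentials \<open>\<Omega>\<close> of the cone means that a
  vector \<open>w\<close> is the gradient modulo \<open>P\<close> of an element of \<open>P\<close> as soon as some multiple \<open>a w\<close>,
  \<open>a \<notin> P\<close>, is one.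

  Smoothness gives local pivots in the Jacobian of \<open>P\<close>. With them, such a \<open>w\<close> is locally on \<open>Z\<close> the
  gradient of a fraction \<open>g/b\<close> with \<open>g \<in> P\<close>, and in characteristic 0 the elements of \<open>P\<close> with
  vanishing gradient modulo \<open>P\<close> lie locally in \<open>P\<^sup>2\<close>. So the \<open>g/b\<close> form a section of \<open>\<I>/\<I>\<^sup>2(d)\<close>, and a
  form lifting it lies in \<open>P\<close> and has gradient \<open>w\<close>.

  Conversely, if \<open>Z\<close> is projectively normal, a section of \<open>\<O>(d)/\<I>\<^sup>2(d)\<close> is modulo \<open>\<I>\<^sup>2(d)\<close> the sum
  of a form and of local fractions \<open>g/b\<close> with \<open>g \<in> P\<close>. The components of the gradients of \<open>g/b\<close> are
  sections of \<open>\<O>\<^sub>Z(d - 1)\<close>, hence lift to a vector \<open>w\<close> of forms, and torsion-freeness provides an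
  element of \<open>P\<close> with gradient \<open>w\<close>. For \<open>d = 0\<close> the products of the gradient with the variables lift to
  constants, which vanish because \<open>Z\<close> lies in no hyperplane.
\<close>

section \<open>Polynomials in several variables\<close>

text \<open>The cone over a smooth \<open>Z\<close> is smooth away from its vertex, so torsion
  differentials are supported at the vertex, and the graded pieces of a module on the punctured cone
  are spaces of sections on \<open>Z\<close>. This is why a condition on global sections controls
  torsion. The gradient modulo \<open>P\<close> does not have \<open>idl_prod P P\<close> as its
  kernel on \<open>P\<close> but \<open>dker P\<close>, which in characteristic 0 is the symbolic
  square of \<open>P\<close>. Smoothness makes the two agree locally on \<open>Z\<close>; the gap
  between them lives at the vertex. What smoothness contributes is that the fibres of the
  differentials at a point p and at the generic point \<open>P\<close> have the same dimension. A
  Jacobian minor that is invertible and maximal at p then turns out to be maximal at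
  \<open>P\<close> as well, and so describes all gradients of elements of \<open>P\<close> near p.
  All sheaves are handled inside the fraction field of S, as families of localizations
  \<open>Fr J d p\<close>. As \<open>idl_prod P P\<close> need not be saturated, membership in a
  stalk is expressed as membership after multiplication by a form outside p.\<close>

lemma poly_mapping_sum_singles:
  "(\<Sum>m\<in>Poly_Mapping.keys f. Poly_Mapping.single m (Poly_Mapping.lookup f m)) = f"
  by (rule poly_mapping_eqI)
    (simp add: lookup_sum lookup_single when_def in_keys_iff)

lemma poly_mapping_induct [case_names single add]:
  fixes f :: "'a \<Rightarrow>\<^sub>0 'b::comm_monoid_add"
  assumes s: "\<And>m c. Q (Poly_Mapping.single m c)" and a: "\<And>f g. Q f \<Longrightarrow> Q g \<Longrightarrow> Q (f + g)"
  shows "Q f"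
proof -
  have "Q (\<Sum>m\<in>A. Poly_Mapping.single m (c m))" if "finite A" for A and c :: "'a \<Rightarrow> 'b"
    using that
  proof (induction A)
    case empty
    \<comment> \<open>The zero polynomial is a monomial with coefficient 0.\<close>
    show ?case using s[of undefined 0] by simp
  qed (auto intro: s a)
  from this[OF finite_keys] show ?thesis by (metis poly_mapping_sum_singles)
qed

lemma single_const_mult: "Poly_Mapping.single m c = const c * Poly_Mapping.single m 1"
  by (simp add: const_def mult_single)

lemma const_mult: "const (a * b) = const a * const b"
  by (simp add: const_def mult_single)

lemma const_0 [simp]: "const 0 = 0" and const_1 [simp]: "const 1 = 1"
  by (simp_all add: const_def)

lemma const_eq_0_iff [simp]:
  "(const c :: ('v::{finite,linorder}, 'k::field) mpoly) = 0 \<longleftrightarrow> c = 0"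
proof
  assume "(const c :: ('v, 'k) mpoly) = 0"
  then have "Poly_Mapping.lookup (const c :: ('v, 'k) mpoly) 0 = 0" by simp
  then show "c = 0" by (simp add: const_def)
qed simp

lemma monom_induct [case_names zero add]:
  fixes m :: "'v::finite \<Rightarrow>\<^sub>0 nat"
  assumes z: "Q 0" and a: "\<And>m i. Q m \<Longrightarrow> Q (m + Poly_Mapping.single i 1)"
  shows "Q m"
proof (induction m rule: poly_mapping_induct)
  have *: "Q (m + Poly_Mapping.single i c)" if "Q m" for m i c
  proof (induction c)
    case (Suc c)
    have "m + Poly_Mapping.single i (Suc c)
      = (m + Poly_Mapping.single i c) + Poly_Mapping.single i 1"
      by (simp add: add.assoc flip: single_add)
    then show ?case using a[OF Suc] by simp
  qed (simp add: that)
  have **: "Q g \<Longrightarrow> Q (f + g)" for f g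
  proof (induction f arbitrary: g rule: poly_mapping_induct)
    case (single m c)
    then show ?case using *[of g m c] by (simp add: add.commute)
  next
    case (add f f')
    then show ?case by (simp add: add.assoc)
  qed
  show "Q (Poly_Mapping.single m c)" for m c using *[OF z, of m c] by simp
  show "Q f \<Longrightarrow> Q g \<Longrightarrow> Q (f + g)" for f g using ** by blast
qed

lemma single_monom_add:
  "Poly_Mapping.single (m + Poly_Mapping.single i 1) 1 = Poly_Mapping.single m 1 * var i"
  by (simp add: var_def mult_single)

lemma mpoly_ring_induct [case_names const var add mult]:
  fixes f :: "('v::{finite,linorder}, 'k::field) mpoly"
  assumes "\<And>c. Q (const c)" and "\<And>i. Q (var i)"
    and "\<And>f g. Q f \<Longrightarrow> Q g \<Longrightarrow> Q (f + g)" and "\<And>f g. Q f \<Longrightarrow> Q g \<Longrightarrow> Q (f * g)"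
  shows "Q f"
proof (induction f rule: poly_mapping_induct)
  case (single m c)
  have "Q (Poly_Mapping.single m 1)"
  proof (induction m rule: monom_induct)
    case zero
    then show ?case using assms(1)[of 1] by simp
  next
    case (add m i)
    show ?case unfolding single_monom_add using add.IH assms(2,4) by blast
  qed
  then show ?case using assms(1,4) by (metis single_const_mult)
qed (use assms in auto)

subsection \<open>Partial derivatives\<close>

text \<open>Truncated subtraction is harmless: if x_i does not occur in m, the coefficient is
  multiplied by 0.\<close>

definition pd :: "'v \<Rightarrow> ('v::{finite,linorder}, 'k::field) mpoly \<Rightarrow> ('v, 'k) mpoly" where
  "pd i f = (\<Sum>m\<in>Poly_Mapping.keys f. Poly_Mapping.single (m - Poly_Mapping.single i 1)
     (of_nat (Poly_Mapping.lookup m i) * Poly_Mapping.lookup f m))"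

lemma pd_superset:
  assumes "finite A" "Poly_Mapping.keys f \<subseteq> A"
  shows "pd i f = (\<Sum>m\<in>A. Poly_Mapping.single (m - Poly_Mapping.single i 1)
     (of_nat (Poly_Mapping.lookup m i) * Poly_Mapping.lookup f m))"
  unfolding pd_def by (rule sum.mono_neutral_left) (use assms in \<open>auto simp: in_keys_iff\<close>)

lemma pd_single:
  "pd i (Poly_Mapping.single m c) =
     Poly_Mapping.single (m - Poly_Mapping.single i 1) (of_nat (Poly_Mapping.lookup m i) * c)"
  by (subst pd_superset[of "{m}"]) (auto split: if_splits)

lemma pd_0 [simp]: "pd i 0 = 0"
  by (simp add: pd_def)

lemma pd_add: "pd i (f + g) = pd i f + pd i g"
proof -
  let ?A = "Poly_Mapping.keys f \<union> Poly_Mapping.keys g"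
  show ?thesis
    by (subst (1 2 3) pd_superset[of ?A])
      (use Poly_Mapping.keys_add[of f g] in
        \<open>auto simp: lookup_add distrib_left single_add sum.distrib\<close>)
qed

lemma pd_uminus: "pd i (- f) = - pd i f"
  using pd_add[of i f "- f"] by (simp add: eq_neg_iff_add_eq_0 add.commute)

lemma pd_diff: "pd i (f - g) = pd i f - pd i g"
  using pd_add[of i f "- g"] by (simp add: pd_uminus)

lemma pd_sum: "pd i (sum f A) = (\<Sum>a\<in>A. pd i (f a))"
  by (induction A rule: infinite_finite_induct) (auto simp: pd_add)

lemma pd_const [simp]: "pd i (const c) = 0"
  by (simp add: const_def pd_single)

lemma pd_1 [simp]: "pd i 1 = 0"
  using pd_const[of i 1] by simp

lemma pd_var: "pd i (var j) = (if i = j then 1 else 0)"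
  by (auto simp: var_def pd_single lookup_single when_def)

text \<open>Truncated subtraction commutes with adding exponents only where the exponent is
  positive; hence the four cases in \<open>pd_mult\<close>.\<close>

lemma pd_mult_single_aux:
  fixes m n :: "'v::{finite,linorder} \<Rightarrow>\<^sub>0 nat"
  assumes "Poly_Mapping.lookup m i > 0"
  shows "m + n - Poly_Mapping.single i 1 = (m - Poly_Mapping.single i 1) + n"
  by (rule poly_mapping_eqI) (use assms in \<open>auto simp: lookup_add lookup_minus lookup_single when_def\<close>)

lemma pd_mult: "pd i (f * g) = pd i f * g + f * pd i g"
proof (induction f rule: poly_mapping_induct)
  case (single m c)
  show ?case
  proof (induction g rule: poly_mapping_induct)
    case (single n d)
    consider "Poly_Mapping.lookup m i = 0" "Poly_Mapping.lookup n i = 0"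
      | "Poly_Mapping.lookup m i = 0" "Poly_Mapping.lookup n i > 0"
      | "Poly_Mapping.lookup m i > 0" "Poly_Mapping.lookup n i = 0"
      | "Poly_Mapping.lookup m i > 0" "Poly_Mapping.lookup n i > 0" by auto
    then show ?case
    proof cases
      case 2
      then show ?thesis using pd_mult_single_aux[of n i m]
        by (simp add: mult_single pd_single lookup_add ac_simps)
    next
      case 3
      then show ?thesis using pd_mult_single_aux[of m i n]
        by (simp add: mult_single pd_single lookup_add ac_simps)
    next
      case 4
      then show ?thesis using pd_mult_single_aux[of m i n] pd_mult_single_aux[of n i m]
        by (simp add: mult_single pd_single lookup_add ac_simps ring_distribs single_add)
    qed (simp add: mult_single pd_single lookup_add)
  qed (simp add: pd_add algebra_simps)
qed (simp add: pd_add algebra_simps)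

lemma pd_const_mult: "pd i (const c * f) = const c * pd i f"
  by (simp add: pd_mult)

lemma pd_commute: "pd i (pd j f) = pd j (pd i f)"
  by (induction f rule: mpoly_ring_induct) (auto simp: pd_add pd_mult pd_var algebra_simps)

lemma lookup_pd:
  fixes f :: "('v::{finite,linorder}, 'k::field) mpoly"
  shows "Poly_Mapping.lookup (pd i f) m =
    of_nat (Suc (Poly_Mapping.lookup m i)) * Poly_Mapping.lookup f (m + Poly_Mapping.single i 1)"
proof (induction f rule: poly_mapping_induct)
  case (single n c)
  show ?case
  proof (cases "Poly_Mapping.lookup n i = 0")
    case True
    then have "n \<noteq> m + Poly_Mapping.single i 1" by (auto simp: lookup_add)
    then show ?thesis using True by (simp add: pd_single lookup_single when_def)
  next
    case False
    have "n - Poly_Mapping.single i 1 = m \<longleftrightarrow> n = m + Poly_Mapping.single i 1"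
    proof
      assume "n - Poly_Mapping.single i 1 = m"
      then show "n = m + Poly_Mapping.single i 1"
        by (intro poly_mapping_eqI)
          (use False in \<open>auto simp: lookup_add lookup_minus lookup_single when_def\<close>)
    qed auto
    then show ?thesis by (auto simp: pd_single lookup_single when_def lookup_add)
  qed
qed (simp add: pd_add lookup_add algebra_simps)

subsection \<open>The grading\<close>

lemma mdeg_0 [simp]: "mdeg 0 = 0"
  by (simp add: mdeg_def)

lemma mdeg_add: "mdeg (m + n) = mdeg m + mdeg n"
  by (simp add: mdeg_def lookup_add sum.distrib)

lemma mdeg_single [simp]: "mdeg (Poly_Mapping.single i c) = c"
  by (simp add: mdeg_def lookup_single when_def)

lemma mdeg_eq_0_iff: "mdeg m = 0 \<longleftrightarrow> m = 0"
  by (auto simp: mdeg_def intro: poly_mapping_eqI)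

lemma lookup_hcomp:
  "Poly_Mapping.lookup (hcomp d f) m = (if mdeg m = d then Poly_Mapping.lookup f m else 0)"
  by (auto simp: hcomp_def lookup_sum lookup_single when_def in_keys_iff sum.delta' if_distrib
      intro!: sum.neutral)

lemma hcomp_add: "hcomp d (f + g) = hcomp d f + hcomp d g"
  by (rule poly_mapping_eqI) (simp add: lookup_hcomp lookup_add)

lemma hcomp_0 [simp]: "hcomp d 0 = 0"
  by (rule poly_mapping_eqI) (simp add: lookup_hcomp)

lemma hcomp_diff: "hcomp d (f - g) = hcomp d f - hcomp d g"
  by (rule poly_mapping_eqI) (simp add: lookup_hcomp lookup_minus)

lemma hcomp_sum: "hcomp d (sum f A) = (\<Sum>a\<in>A. hcomp d (f a))"
  by (induction A rule: infinite_finite_induct) (auto simp: hcomp_add)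

lemma homog_iff: "homog d f \<longleftrightarrow> (\<forall>m. Poly_Mapping.lookup f m \<noteq> 0 \<longrightarrow> mdeg m = d)"
  by (auto simp: homog_def in_keys_iff)

lemma homog_hcomp [simp]: "homog d (hcomp d f)"
  by (auto simp: homog_iff lookup_hcomp)

lemma hcomp_homog: "homog d f \<Longrightarrow> hcomp e f = (if e = d then f else 0)"
  by (rule poly_mapping_eqI) (auto simp: lookup_hcomp homog_iff)

lemma homog_0 [simp]: "homog d 0"
  by (simp add: homog_iff)

lemma homog_add: "homog d f \<Longrightarrow> homog d g \<Longrightarrow> homog d (f + g)"
  using homog_hcomp[of d "f + g"] by (simp add: hcomp_add hcomp_homog)

lemma homog_diff: "homog d f \<Longrightarrow> homog d g \<Longrightarrow> homog d (f - g)"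
  using homog_hcomp[of d "f - g"] by (simp add: hcomp_diff hcomp_homog)

lemma homog_uminus: "homog d f \<Longrightarrow> homog d (- f)"
  using homog_diff[of d 0 f] by simp

lemma homog_sum: "(\<And>a. a \<in> A \<Longrightarrow> homog d (f a)) \<Longrightarrow> homog d (sum f A)"
  by (induction A rule: infinite_finite_induct) (auto intro: homog_add)

lemma homog_mult: "homog d f \<Longrightarrow> homog e g \<Longrightarrow> homog (d + e) (f * g)"
  using Poly_Mapping.keys_mult[of f g] by (fastforce simp: homog_def mdeg_add)

lemma homog_const [simp]: "homog 0 (const c)"
  by (auto simp: homog_def const_def)

lemma homog_1 [simp]: "homog 0 1"
  using homog_const[of 1] by simp

lemma homog_var [simp]: "homog 1 (var i)" "homog (Suc 0) (var i)"
  by (auto simp: homog_def var_def)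

lemma homog_power: "homog d f \<Longrightarrow> homog (k * d) (f ^ k)"
  by (induction k) (auto intro: homog_mult)

lemma homog_var_power [simp]: "homog k (var i ^ k)"
  using homog_power[of 1 "var i" k] by simp

lemma homog_0_const:
  assumes "homog 0 f" shows "f = const (Poly_Mapping.lookup f 0)"
proof (rule poly_mapping_eqI)
  fix m
  show "Poly_Mapping.lookup f m = Poly_Mapping.lookup (const (Poly_Mapping.lookup f 0)) m"
    using assms by (auto simp: homog_iff const_def lookup_single when_def mdeg_eq_0_iff)
qed

text \<open>The inserted 0 gives the zero polynomial degree 0, so the polynomials of degree 0 are
  exactly the constants.\<close>

definition topdeg :: "('v::{finite,linorder}, 'k::field) mpoly \<Rightarrow> nat" where
  "topdeg f = Max (insert 0 (mdeg ` Poly_Mapping.keys f))"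

lemma hcomp_gt_topdeg: "d > topdeg f \<Longrightarrow> hcomp d f = 0"
proof (rule poly_mapping_eqI)
  fix m assume "d > topdeg f"
  moreover have "mdeg m \<le> topdeg f" if "m \<in> Poly_Mapping.keys f"
    unfolding topdeg_def using that by (intro Max_ge) auto
  ultimately show "Poly_Mapping.lookup (hcomp d f) m = Poly_Mapping.lookup 0 m"
    by (cases "Poly_Mapping.lookup f m = 0") (auto simp: lookup_hcomp in_keys_iff)
qed

lemma sum_hcomp: "topdeg f \<le> n \<Longrightarrow> (\<Sum>d\<le>n. hcomp d f) = f"
proof (rule poly_mapping_eqI)
  fix m assume "topdeg f \<le> n"
  then have "mdeg m \<le> n" if "Poly_Mapping.lookup f m \<noteq> 0"
    using hcomp_gt_topdeg[of f "mdeg m"] lookup_hcomp[of "mdeg m" f m] that by force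
  then show "Poly_Mapping.lookup (\<Sum>d\<le>n. hcomp d f) m = Poly_Mapping.lookup f m"
    by (auto simp: lookup_sum lookup_hcomp)
qed

lemma homog_induct_sum:
  assumes "Q 0" "\<And>f g. Q f \<Longrightarrow> Q g \<Longrightarrow> Q (f + g)" "\<And>d. Q (hcomp d f)"
  shows "Q f"
proof -
  have "Q (\<Sum>d\<le>n. hcomp d f)" for n
    by (induction n) (use assms in auto)
  from this[of "topdeg f"] show ?thesis by (simp add: sum_hcomp)
qed

lemma hcomp_mult_homog: "homog e g \<Longrightarrow> hcomp d (g * f) = (if e \<le> d then g * hcomp (d - e) f else 0)"
proof -
  assume g: "homog e g"
  define n where "n = max (topdeg f) d"
  have "hcomp d (g * f) = hcomp d (g * (\<Sum>l\<le>n. hcomp l f))"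
    by (simp add: sum_hcomp n_def)
  also have "\<dots> = (\<Sum>l\<le>n. hcomp d (g * hcomp l f))"
    by (simp add: sum_distrib_left hcomp_sum)
  also have "\<dots> = (\<Sum>l\<le>n. if l + e = d then g * hcomp l f else 0)"
    by (intro sum.cong refl, subst hcomp_homog[OF homog_mult[OF g homog_hcomp]]) auto
  also have "\<dots> = (if e \<le> d then g * hcomp (d - e) f else 0)"
  proof (cases "e \<le> d")
    case True
    then have "(\<Sum>l\<le>n. if l + e = d then g * hcomp l f else 0)
      = (\<Sum>l\<le>n. if l = d - e then g * hcomp l f else 0)"
      by (intro sum.cong) auto
    also have "\<dots> = g * hcomp (d - e) f" by (subst sum.delta) (auto simp: n_def)
    finally show ?thesis using True by simp
  qed (auto intro!: sum.neutral)
  finally show ?thesis .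
qed

lemma pd_hcomp: "pd i (hcomp (Suc d) f) = hcomp d (pd i f)"
  by (rule poly_mapping_eqI) (auto simp: lookup_pd lookup_hcomp mdeg_add)

lemma pd_homog: "homog (Suc d) f \<Longrightarrow> homog d (pd i f)"
  using homog_hcomp[of d "pd i f"] by (simp add: hcomp_homog flip: pd_hcomp)

lemma pd_homog_0: "homog 0 f \<Longrightarrow> pd i f = 0"
  using pd_const[of i "Poly_Mapping.lookup f 0"] homog_0_const[of f] by simp

text \<open>On a monomial, \<open>var i * pd i\<close> multiplies by the exponent of x_i, and the
  exponents add up to the degree.\<close>

lemma euler: "homog d f \<Longrightarrow> (\<Sum>i\<in>UNIV. var i * pd i f) = of_nat d * f"
proof -
  assume f: "homog d f"
  have 1: "(\<Sum>i\<in>UNIV. var i * pd i (Poly_Mapping.single m c))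
      = of_nat (mdeg m) * Poly_Mapping.single m c"
    for m :: "'a \<Rightarrow>\<^sub>0 nat" and c :: 'b
  proof -
    have "var i * pd i (Poly_Mapping.single m c)
        = Poly_Mapping.single m (of_nat (Poly_Mapping.lookup m i) * c)" for i
    proof (cases "Poly_Mapping.lookup m i = 0")
      case False
      then have "Poly_Mapping.single i 1 + (m - Poly_Mapping.single i 1) = m"
        by (intro poly_mapping_eqI) (auto simp: lookup_add lookup_minus lookup_single when_def)
      then show ?thesis by (simp add: var_def pd_single mult_single)
    qed (simp add: pd_single)
    then have "(\<Sum>i\<in>UNIV. var i * pd i (Poly_Mapping.single m c))
      = Poly_Mapping.single m ((\<Sum>i\<in>UNIV. of_nat (Poly_Mapping.lookup m i)) * c)"
      by (intro poly_mapping_eqI) (simp add: lookup_sum lookup_single when_def sum_distrib_right)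
    also have "\<dots> = of_nat (mdeg m) * Poly_Mapping.single m c"
      by (simp add: mdeg_def mult_single flip: single_of_nat)
    finally show ?thesis .
  qed
  have "(\<Sum>i\<in>UNIV. var i * pd i f)
      = (\<Sum>i\<in>UNIV. var i * pd i (\<Sum>m\<in>Poly_Mapping.keys f. Poly_Mapping.single m (Poly_Mapping.lookup f m)))"
    by (simp add: poly_mapping_sum_singles)
  also have "\<dots> = (\<Sum>m\<in>Poly_Mapping.keys f. \<Sum>i\<in>UNIV. var i * pd i (Poly_Mapping.single m (Poly_Mapping.lookup f m)))"
    by (subst sum.swap) (simp add: pd_sum sum_distrib_left)
  also have "\<dots> = (\<Sum>m\<in>Poly_Mapping.keys f. of_nat d * Poly_Mapping.single m (Poly_Mapping.lookup f m))"
    by (intro sum.cong refl) (use f in \<open>simp add: 1 homog_def\<close>)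
  also have "\<dots> = of_nat d * f"
    by (simp add: poly_mapping_sum_singles flip: sum_distrib_left)
  finally show ?thesis .
qed

lemma var_neq_0 [simp]: "(var i :: ('v::{finite,linorder}, 'k::field) mpoly) \<noteq> 0"
proof
  assume "(var i :: ('v, 'k) mpoly) = 0"
  then have "Poly_Mapping.lookup (var i :: ('v, 'k) mpoly) (Poly_Mapping.single i 1) = 0" by simp
  then show False by (simp add: var_def)
qed

subsection \<open>Polynomials in a subset of the variables\<close>

definition polys_in :: "'v set \<Rightarrow> ('v::{finite,linorder}, 'k::field) mpoly set" where
  "polys_in V = {f. \<forall>m\<in>Poly_Mapping.keys f. Poly_Mapping.keys m \<subseteq> V}"

lemma polys_in_0 [simp]: "0 \<in> polys_in V"
  by (simp add: polys_in_def)

lemma polys_in_const [simp]: "const c \<in> polys_in V"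
  by (auto simp: polys_in_def const_def)

lemma polys_in_1 [simp]: "1 \<in> polys_in V"
  using polys_in_const[of 1] by simp

lemma polys_in_var: "i \<in> V \<Longrightarrow> var i \<in> polys_in V"
  by (auto simp: polys_in_def var_def)

lemma polys_in_add: "f \<in> polys_in V \<Longrightarrow> g \<in> polys_in V \<Longrightarrow> f + g \<in> polys_in V"
  using Poly_Mapping.keys_add[of f g] by (auto simp: polys_in_def)

lemma polys_in_mult: "f \<in> polys_in V \<Longrightarrow> g \<in> polys_in V \<Longrightarrow> f * g \<in> polys_in V"
proof -
  assume fg: "f \<in> polys_in V" "g \<in> polys_in V"
  have "Poly_Mapping.keys m \<subseteq> V" if m: "m \<in> Poly_Mapping.keys (f * g)" for m
  proof -
    obtain a b where ab: "m = a + b" "a \<in> Poly_Mapping.keys f" "b \<in> Poly_Mapping.keys g"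
      using Poly_Mapping.keys_mult[of f g] m by blast
    then have "Poly_Mapping.keys a \<subseteq> V" "Poly_Mapping.keys b \<subseteq> V"
      using fg by (auto simp: polys_in_def)
    then show ?thesis unfolding ab(1) using Poly_Mapping.keys_add[of a b] by blast
  qed
  then show ?thesis by (simp add: polys_in_def)
qed

lemma polys_in_uminus: "f \<in> polys_in V \<Longrightarrow> - f \<in> polys_in V"
  by (simp add: polys_in_def)

lemma polys_in_diff: "f \<in> polys_in V \<Longrightarrow> g \<in> polys_in V \<Longrightarrow> f - g \<in> polys_in V"
  using polys_in_add[of f V "- g"] polys_in_uminus[of g V] by simp

lemma polys_in_power: "f \<in> polys_in V \<Longrightarrow> f ^ k \<in> polys_in V"
  by (induction k) (auto intro: polys_in_mult)

lemma polys_in_sum: "(\<And>a. a \<in> A \<Longrightarrow> f a \<in> polys_in V) \<Longrightarrow> sum f A \<in> polys_in V"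
  by (induction A rule: infinite_finite_induct) (auto intro: polys_in_add)

lemma polys_in_UNIV [simp]: "polys_in UNIV = UNIV"
  by (auto simp: polys_in_def)

lemma polys_in_empty: "f \<in> polys_in {} \<Longrightarrow> homog 0 f"
  by (auto simp: polys_in_def homog_def mdeg_eq_0_iff)

lemma pd_polys_in: "f \<in> polys_in V \<Longrightarrow> pd i f \<in> polys_in V"
  unfolding pd_def
proof (rule polys_in_sum)
  fix m assume "f \<in> polys_in V" "m \<in> Poly_Mapping.keys f"
  then have "Poly_Mapping.keys m \<subseteq> V" by (auto simp: polys_in_def)
  then have "Poly_Mapping.keys (m - Poly_Mapping.single i 1) \<subseteq> V"
    by (auto simp: in_keys_iff lookup_minus)
  then show "Poly_Mapping.single (m - Poly_Mapping.single i 1)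
     (of_nat (Poly_Mapping.lookup m i) * Poly_Mapping.lookup f m) \<in> polys_in V"
    by (auto simp: polys_in_def)
qed

lemma pd_not_in: "f \<in> polys_in V \<Longrightarrow> i \<notin> V \<Longrightarrow> pd i f = 0"
  unfolding pd_def
proof (rule sum.neutral, safe)
  fix m assume "f \<in> polys_in V" "i \<notin> V" "m \<in> Poly_Mapping.keys f"
  then have "i \<notin> Poly_Mapping.keys m" unfolding polys_in_def by blast
  then have "Poly_Mapping.lookup m i = 0" by (simp add: in_keys_iff)
  then show "Poly_Mapping.single (m - Poly_Mapping.single i 1)
     (of_nat (Poly_Mapping.lookup m i) * Poly_Mapping.lookup f m) = 0"
    by simp
qed

section \<open>Univariate polynomials with coefficients in fewer variables\<close>

definition upolys_in :: "'v set \<Rightarrow> ('v::{finite,linorder}, 'k::field) mpoly poly set" where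
  "upolys_in V = {F. \<forall>l. coeff F l \<in> polys_in V}"

lemma upolys_in_add: "F \<in> upolys_in V \<Longrightarrow> G \<in> upolys_in V \<Longrightarrow> F + G \<in> upolys_in V"
  by (auto simp: upolys_in_def polys_in_add)

lemma upolys_in_diff: "F \<in> upolys_in V \<Longrightarrow> G \<in> upolys_in V \<Longrightarrow> F - G \<in> upolys_in V"
  by (auto simp: upolys_in_def polys_in_diff)

lemma upolys_in_mult: "F \<in> upolys_in V \<Longrightarrow> G \<in> upolys_in V \<Longrightarrow> F * G \<in> upolys_in V"
  by (auto simp: upolys_in_def coeff_mult intro!: polys_in_sum polys_in_mult)

lemma upolys_in_monom: "c \<in> polys_in V \<Longrightarrow> monom c n \<in> upolys_in V"
  by (auto simp: upolys_in_def)

lemma upolys_in_smult: "c \<in> polys_in V \<Longrightarrow> F \<in> upolys_in V \<Longrightarrow> smult c F \<in> upolys_in V"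
  by (auto simp: upolys_in_def polys_in_mult)

lemma upolys_in_0 [simp]: "0 \<in> upolys_in V"
  by (auto simp: upolys_in_def)

lemma polys_in_insert_decomp:
  assumes "f \<in> polys_in (insert j V)"
  obtains F where "F \<in> upolys_in V" "f = poly F (var j)"
proof -
  have mono: "\<exists>F \<in> upolys_in V. Poly_Mapping.single m c = poly F (var j)"
    if "Poly_Mapping.keys m \<subseteq> insert j V" for m and c :: 'b
    using that
  proof (induction m rule: monom_induct)
    case zero
    show ?case by (intro bexI[of _ "monom (const c) 0"])
        (auto simp: poly_monom const_def upolys_in_monom simp flip: const_def)
  next
    case (add m i)
    have k: "Poly_Mapping.keys (m + Poly_Mapping.single i 1) = insert i (Poly_Mapping.keys m)"
      by (auto simp: in_keys_iff lookup_add lookup_single when_def split: if_splits)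
    then obtain F where F: "F \<in> upolys_in V" "Poly_Mapping.single m c = poly F (var j)"
      using add by auto
    have e: "Poly_Mapping.single (m + Poly_Mapping.single i 1) c = Poly_Mapping.single m c * var i"
      by (simp add: var_def mult_single)
    show ?case
    proof (cases "i = j")
      case True
      show ?thesis unfolding e F(2)
        by (rule bexI[of _ "F * monom 1 1"])
          (auto simp: True poly_monom intro!: F upolys_in_mult upolys_in_monom)
    next
      case False
      then have "i \<in> V" using k add by auto
      then show ?thesis unfolding e F(2)
        by (intro bexI[of _ "F * monom (var i) 0"])
          (auto simp: poly_monom intro!: F upolys_in_mult upolys_in_monom polys_in_var)
    qed
  qed
  have "\<exists>F \<in> upolys_in V. (\<Sum>m\<in>A. Poly_Mapping.single m (Poly_Mapping.lookup f m)) = poly F (var j)"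
    if "finite A" "A \<subseteq> Poly_Mapping.keys f" for A using that
  proof (induction A)
    case (insert m A)
    then have "Poly_Mapping.keys m \<subseteq> insert j V" using assms by (auto simp: polys_in_def)
    then obtain F G where "F \<in> upolys_in V" "Poly_Mapping.single m (Poly_Mapping.lookup f m) = poly F (var j)"
      "G \<in> upolys_in V" "(\<Sum>m\<in>A. Poly_Mapping.single m (Poly_Mapping.lookup f m)) = poly G (var j)"
      using mono insert by (metis insert_subset)
    then show ?case using insert by (intro bexI[of _ "F + G"]) (auto intro: upolys_in_add)
  qed (auto intro!: bexI[of _ 0])
  from this[OF finite_keys order_refl] show ?thesis
    using that by (auto simp: poly_mapping_sum_singles)
qed

section \<open>Ideals\<close>

definition idl :: "'a::comm_ring_1 set \<Rightarrow> bool" where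
  "idl J \<longleftrightarrow> 0 \<in> J \<and> (\<forall>a\<in>J. \<forall>b\<in>J. a + b \<in> J) \<and> (\<forall>a\<in>J. \<forall>r. r * a \<in> J)"

lemma idl_0: "idl J \<Longrightarrow> 0 \<in> J"
  and idl_add: "idl J \<Longrightarrow> a \<in> J \<Longrightarrow> b \<in> J \<Longrightarrow> a + b \<in> J"
  and idl_mult: "idl J \<Longrightarrow> a \<in> J \<Longrightarrow> r * a \<in> J"
  and idl_mult2: "idl J \<Longrightarrow> a \<in> J \<Longrightarrow> a * r \<in> J"
  by (auto simp: idl_def mult.commute)

lemma idl_uminus: "idl J \<Longrightarrow> a \<in> J \<Longrightarrow> - a \<in> J"
  using idl_mult[of J a "- 1"] by simp

lemma idl_diff: "idl J \<Longrightarrow> a \<in> J \<Longrightarrow> b \<in> J \<Longrightarrow> a - b \<in> J"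
  using idl_add[of J a "- b"] idl_uminus[of J b] by simp

lemma idl_sum: "idl J \<Longrightarrow> (\<And>a. a \<in> A \<Longrightarrow> f a \<in> J) \<Longrightarrow> sum f A \<in> J"
  by (induction A rule: infinite_finite_induct) (auto intro: idl_add simp: idl_0)

lemma idl_add_iff: "idl J \<Longrightarrow> a \<in> J \<Longrightarrow> a + b \<in> J \<longleftrightarrow> b \<in> J"
  using idl_add idl_diff by (metis add_diff_cancel_left')

lemma idl_diff_iff: "idl J \<Longrightarrow> a - b \<in> J \<Longrightarrow> a \<in> J \<longleftrightarrow> b \<in> J"
  using idl_add_iff[of J "a - b" b] by simp

lemma idl_poly: "idl J \<Longrightarrow> (\<And>l. coeff F l \<in> J) \<Longrightarrow> poly F x \<in> J"
  unfolding poly_altdef by (intro idl_sum idl_mult2)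

text \<open>Finite sums of products, built one summand at a time so that proofs go by induction on
  the sum. With \<open>A = UNIV\<close> this is the ideal generated by B.\<close>

inductive_set idl_prod :: "'a::comm_ring_1 set \<Rightarrow> 'a set \<Rightarrow> 'a set" for A B where
  zero: "0 \<in> idl_prod A B"
| add: "a \<in> A \<Longrightarrow> b \<in> B \<Longrightarrow> s \<in> idl_prod A B \<Longrightarrow> a * b + s \<in> idl_prod A B"

lemma idl_prod_mem: "a \<in> A \<Longrightarrow> b \<in> B \<Longrightarrow> a * b \<in> idl_prod A B"
  using idl_prod.add[OF _ _ idl_prod.zero] by force

lemma idl_idl_prod:
  assumes A: "idl A" shows "idl (idl_prod A B)"
proof -
  have "s + t \<in> idl_prod A B" if "s \<in> idl_prod A B" "t \<in> idl_prod A B" for s t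
    using that by (induction) (auto simp: add.assoc intro: idl_prod.add)
  moreover have "r * s \<in> idl_prod A B" if "s \<in> idl_prod A B" for r s
    using that
  proof induction
    case (add a b s)
    then have "(r * a) * b + r * s \<in> idl_prod A B" by (intro idl_prod.add idl_mult[OF A])
    then show ?case by (simp add: algebra_simps)
  qed (simp add: idl_prod.zero)
  ultimately show ?thesis by (auto simp: idl_def idl_prod.zero)
qed

lemma idl_prod_subset: "idl A \<Longrightarrow> idl_prod A B \<subseteq> A"
proof
  fix s assume "idl A" "s \<in> idl_prod A B"
  from this(2,1) show "s \<in> A" by induction (auto intro: idl_0 idl_add idl_mult2)
qed

definition prime_idl :: "'a::comm_ring_1 set \<Rightarrow> bool" where
  "prime_idl P \<longleftrightarrow> idl P \<and> 1 \<notin> P \<and> (\<forall>a b. a * b \<in> P \<longrightarrow> a \<in> P \<or> b \<in> P)"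

lemma prime_idl_idl: "prime_idl P \<Longrightarrow> idl P"
  and prime_idl_one: "prime_idl P \<Longrightarrow> 1 \<notin> P"
  by (auto simp: prime_idl_def)

lemma prime_idl_mult_iff: "prime_idl P \<Longrightarrow> a * b \<in> P \<longleftrightarrow> a \<in> P \<or> b \<in> P"
  unfolding prime_idl_def using idl_mult idl_mult2 by blast

lemma prime_idl_power: "prime_idl P \<Longrightarrow> a ^ k \<in> P \<Longrightarrow> a \<in> P"
  by (induction k) (auto simp: prime_idl_mult_iff prime_idl_one)

lemma prime_idl_prod_notin: "prime_idl P \<Longrightarrow> (\<And>a. a \<in> A \<Longrightarrow> f a \<notin> P) \<Longrightarrow> prod f A \<notin> P"
  by (induction A rule: infinite_finite_induct) (auto simp: prime_idl_mult_iff prime_idl_one)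

lemma const_notin: "prime_idl P \<Longrightarrow> c \<noteq> 0 \<Longrightarrow> const c \<notin> P"
proof
  assume "prime_idl P" "c \<noteq> 0" "const c \<in> P"
  then have "const (inverse c) * const c \<in> P" by (intro idl_mult prime_idl_idl)
  then show False using \<open>prime_idl P\<close> \<open>c \<noteq> 0\<close> by (simp add: prime_idl_one flip: const_mult)
qed

text \<open>In characteristic 0 the number n is an invertible constant. Through this fact minimal
  polynomials become separable in \<open>minpoly_pderiv\<close>.\<close>

lemma of_nat_notin:
  fixes P :: "('v::{finite,linorder}, 'k::field_char_0) mpoly set"
  assumes "prime_idl P" "n > 0" shows "of_nat n \<notin> P"
proof -
  have "(of_nat n :: ('v, 'k) mpoly) = const (of_nat n)"
    unfolding const_def by (metis single_of_nat)
  then show ?thesis using const_notin[OF assms(1), of "of_nat n"] assms(2) by simp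
qed

subsection \<open>Hilbert's basis theorem\<close>

text \<open>Some subsequence is monotone; if it decreases, it is constant from the point where it
  attains its minimum.\<close>

lemma nat_incseq_subseq:
  fixes s :: "nat \<Rightarrow> nat"
  obtains r where "strict_mono r" "incseq (s \<circ> r)"
proof -
  obtain r :: "nat \<Rightarrow> nat" where r: "strict_mono r" "monoseq (\<lambda>n. s (r n))"
    using seq_monosub[of s] by blast
  show ?thesis
  proof (cases "incseq (\<lambda>n. s (r n))")
    case True
    then show ?thesis using that r by (auto simp: o_def)
  next
    case False
    then have d: "decseq (\<lambda>n. s (r n))" using r(2) by (auto simp: monoseq_iff)
    obtain N where N: "\<And>n. s (r N) \<le> s (r n)"
      using ex_has_least_nat[of "\<lambda>_. True" 0 "\<lambda>n. s (r n)"] by auto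
    have "incseq (s \<circ> (\<lambda>n. r (N + n)))"
      using N d by (intro monoI) (metis comp_def decseqD le_add1 order_trans)
    moreover have "strict_mono (\<lambda>n. r (N + n))" using r(1) by (auto simp: strict_mono_def)
    ultimately show ?thesis using that by blast
  qed
qed

lemma dickson_subseq:
  fixes s :: "nat \<Rightarrow> ('v \<Rightarrow> nat)"
  assumes "finite V"
  shows "\<exists>r. strict_mono r \<and> (\<forall>v\<in>V. incseq (\<lambda>n. s (r n) v))"
  using assms
proof (induction V)
  case empty
  show ?case by (intro exI[of _ id]) (auto simp: strict_mono_def)
next
  case (insert v V)
  then obtain r where r: "strict_mono r" "\<And>v. v \<in> V \<Longrightarrow> incseq (\<lambda>n. s (r n) v)" by auto
  obtain r' where r': "strict_mono r'" "incseq ((\<lambda>n. s (r n) v) \<circ> r')"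
    using nat_incseq_subseq by blast
  have "incseq (\<lambda>n. s (r (r' n)) w)" if "w \<in> V" for w
    using r(2)[OF that] r'(1) by (auto simp: incseq_def strict_mono_less_eq)
  then show ?case using r r'
    by (intro exI[of _ "r \<circ> r'"]) (auto simp: strict_mono_def o_def)
qed

text \<open>The minimal elements of M under divisibility serve as \<open>M0\<close>. Infinitely many
  of them would contain a sequence weakly increasing in every exponent, hence two comparable
  ones.\<close>

lemma dickson:
  fixes M :: "('v::finite \<Rightarrow>\<^sub>0 nat) set"
  obtains M0 where "finite M0" "M0 \<subseteq> M" "\<And>m. m \<in> M \<Longrightarrow> \<exists>n\<in>M0. \<exists>t. m = n + t"
proof -
  define le where "le n m \<longleftrightarrow> (\<exists>t. m = n + t)" for n m :: "'v \<Rightarrow>\<^sub>0 nat"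
  have leI: "le n m" if "\<And>v. Poly_Mapping.lookup n v \<le> Poly_Mapping.lookup m v" for n m
    unfolding le_def using that
    by (intro exI[of _ "m - n"] poly_mapping_eqI) (auto simp: lookup_add lookup_minus)
  have trans: "le a b \<Longrightarrow> le b c \<Longrightarrow> le a c" for a b c
    unfolding le_def by (auto simp: add.assoc)
  have deg: "le a b \<Longrightarrow> a \<noteq> b \<Longrightarrow> mdeg a < mdeg b" for a b
    by (auto simp: le_def mdeg_add mdeg_eq_0_iff neq0_conv[symmetric] simp del: neq0_conv)
  define M0 where "M0 = {m\<in>M. \<forall>n\<in>M. le n m \<longrightarrow> n = m}"
  have "\<exists>n\<in>M0. le n m" if "m \<in> M" for m
    using that
  proof (induction "mdeg m" arbitrary: m rule: less_induct)
    case less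
    show ?case
    proof (cases "m \<in> M0")
      case True
      then show ?thesis by (intro bexI[of _ m]) (auto simp: le_def intro: exI[of _ 0])
    next
      case False
      then obtain n where "n \<in> M" "le n m" "n \<noteq> m" using less.prems by (auto simp: M0_def)
      then show ?thesis using less.hyps[of n] deg trans by blast
    qed
  qed
  moreover have "finite M0"
  proof (rule ccontr)
    assume "infinite M0"
    then obtain s :: "nat \<Rightarrow> _" where s: "inj s" "range s \<subseteq> M0"
      using infinite_countable_subset by blast
    obtain r where r: "strict_mono r" "\<And>v. incseq (\<lambda>n. Poly_Mapping.lookup (s (r n)) v)"
      using dickson_subseq[of UNIV "\<lambda>n. Poly_Mapping.lookup (s n)"] by auto
    have "le (s (r 0)) (s (r 1))"
      by (rule leI) (use r(2) in \<open>auto simp: incseq_def\<close>)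
    moreover have "s (r 0) \<in> M0" "s (r 1) \<in> M0" using s(2) by auto
    ultimately have "s (r 0) = s (r 1)" by (auto simp: M0_def)
    then have "r 0 = r 1" using s(1) by (auto dest: injD)
    then show False using r(1) by (metis strict_mono_less zero_less_one less_irrefl)
  qed
  ultimately show ?thesis using that[of M0] by (auto simp: M0_def le_def)
qed

lemma finite_mdeg_le: "finite {m :: 'v::finite \<Rightarrow>\<^sub>0 nat. mdeg m \<le> d}"
proof -
  have "Poly_Mapping.lookup m i \<le> mdeg m" for m :: "'v \<Rightarrow>\<^sub>0 nat" and i
    unfolding mdeg_def by (rule member_le_sum) auto
  then have "Poly_Mapping.lookup ` {m :: 'v \<Rightarrow>\<^sub>0 nat. mdeg m \<le> d}
      \<subseteq> {f. \<forall>i. (i \<in> UNIV \<longrightarrow> f i \<in> {..d}) \<and> (i \<notin> UNIV \<longrightarrow> f i = 0)}"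
    by (auto intro: order_trans)
  then have "finite (Poly_Mapping.lookup ` {m :: 'v \<Rightarrow>\<^sub>0 nat. mdeg m \<le> d})"
    by (rule finite_subset) (intro finite_set_of_finite_funs; simp)
  moreover have "inj_on Poly_Mapping.lookup {m :: 'v \<Rightarrow>\<^sub>0 nat. mdeg m \<le> d}"
    by (auto intro: inj_onI poly_mapping_eqI)
  ultimately show ?thesis using finite_imageD by blast
qed

text \<open>The degree-lexicographic rank of a monomial, as a natural number.\<close>

lemma monomial_rank:
  obtains rk :: "('v::{finite,linorder} \<Rightarrow>\<^sub>0 nat) \<Rightarrow> nat" where "inj rk"
    "\<And>m n t. rk m < rk n \<Longrightarrow> rk (m + t) < rk (n + t)"
proof -
  define ls :: "('v \<Rightarrow>\<^sub>0 nat) \<Rightarrow> ('v \<Rightarrow>\<^sub>0 nat) \<Rightarrow> bool"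
    where "ls m n \<longleftrightarrow> mdeg m < mdeg n \<or> mdeg m = mdeg n \<and> m < n" for m n
  define rk where "rk n = card {m. ls m n}" for n
  have fin: "finite {m. ls m n}" for n
    by (rule finite_subset[OF _ finite_mdeg_le[of "mdeg n"]]) (auto simp: ls_def)
  have lt: "rk m < rk n" if "ls m n" for m n
    unfolding rk_def by (rule psubset_card_mono[OF fin]) (use that in \<open>auto simp: ls_def\<close>)
  have tot: "ls m n \<or> m = n \<or> ls n m" for m n unfolding ls_def by auto
  have iff: "rk m < rk n \<longleftrightarrow> ls m n" for m n
    using tot[of m n] lt[of m n] lt[of n m] by auto
  have "inj rk" using tot iff by (auto intro!: injI) (metis less_irrefl)
  moreover have "ls (m + t) (n + t)" if "ls m n" for m n t
    using that by (auto simp: ls_def mdeg_add add_strict_right_mono)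
  ultimately show ?thesis using that[of rk] iff by blast
qed

lemma lookup_single_mult:
  fixes w :: "('v::{finite,linorder}, 'k::field) mpoly"
  shows "Poly_Mapping.lookup (Poly_Mapping.single t c * w) (t + a) = c * Poly_Mapping.lookup w a"
  by (induction w rule: poly_mapping_induct)
    (auto simp: mult_single lookup_single when_def distrib_left lookup_add)

text \<open>Groebner reduction: by Dickson's lemma finitely many leading monomials divide all
  leading monomials of J, and subtracting multiples of the corresponding elements lowers the rank of
  the leading monomial, a natural number. Generation is stated as minimality among ideals, ready for
  the ideal of those g with \<open>C * g\<close> in the square in
  \<open>dker_generic\<close>.\<close>

theorem hilbert_basis:
  fixes J :: "('v::{finite,linorder}, 'k::field) mpoly set"
  assumes J: "idl J"
  obtains B where "finite B" "B \<subseteq> J" "\<And>I. idl I \<Longrightarrow> B \<subseteq> I \<Longrightarrow> J \<subseteq> I"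
proof -
  obtain rk :: "('v \<Rightarrow>\<^sub>0 nat) \<Rightarrow> nat" where rk: "inj rk"
    "\<And>m n t. rk m < rk n \<Longrightarrow> rk (m + t) < rk (n + t)" using monomial_rank by blast
  define lm where "lm f m \<longleftrightarrow> m \<in> Poly_Mapping.keys f \<and> (\<forall>n\<in>Poly_Mapping.keys f. rk n \<le> rk m)"
    for f :: "('v, 'k) mpoly" and m
  have lm_ex: "\<exists>m. lm f m" if "f \<noteq> 0" for f :: "('v, 'k) mpoly"
  proof -
    have "Poly_Mapping.keys f \<noteq> {}"
    proof
      assume "Poly_Mapping.keys f = {}"
      then have "f = 0" by (intro poly_mapping_eqI) (auto simp: in_keys_iff set_eq_iff)
      then show False using that by simp
    qed
    then have "Max (rk ` Poly_Mapping.keys f) \<in> rk ` Poly_Mapping.keys f"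
      by (intro Max_in) simp_all
    then obtain m where m: "m \<in> Poly_Mapping.keys f" "rk m = Max (rk ` Poly_Mapping.keys f)"
      by (auto elim!: imageE)
    have "rk n \<le> rk m" if "n \<in> Poly_Mapping.keys f" for n
      unfolding m(2) by (intro Max_ge) (simp_all add: that)
    then show ?thesis using m(1) unfolding lm_def by blast
  qed
  obtain M0 where M0: "finite M0" "M0 \<subseteq> {m. \<exists>f\<in>J. lm f m}"
    "\<And>m. m \<in> {m. \<exists>f\<in>J. lm f m} \<Longrightarrow> \<exists>n\<in>M0. \<exists>t. m = n + t"
    using dickson[of "{m. \<exists>f\<in>J. lm f m}"] by blast
  then have "\<forall>m\<in>M0. \<exists>f. f \<in> J \<and> lm f m" by blast
  from bchoice[OF this] obtain g where g: "\<And>m. m \<in> M0 \<Longrightarrow> g m \<in> J \<and> lm (g m) m" by blast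
  have "J \<subseteq> I" if I: "idl I" "g ` M0 \<subseteq> I" for I
  proof
    fix f assume "f \<in> J"
    have main: "f \<in> I" if "f \<in> J" "lm f m" for f m
      using that
    proof (induction "rk m" arbitrary: f m rule: less_induct)
      case less
      then obtain n t where n: "n \<in> M0" "m = n + t" using M0(3)[of m] by auto
      define c where "c = Poly_Mapping.lookup f m / Poly_Mapping.lookup (g n) n"
      \<comment> \<open>The coefficient c makes h cancel the leading term of f; all other monomials
        of h have smaller rank because ranks respect products.\<close>
      define h where "h = Poly_Mapping.single t c * g n"
      have gn: "Poly_Mapping.lookup (g n) n \<noteq> 0" using g[OF n(1)] by (auto simp: lm_def in_keys_iff)
      have lookup_h: "Poly_Mapping.lookup h (t + a) = c * Poly_Mapping.lookup (g n) a" for a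
        unfolding h_def by (rule lookup_single_mult)
      have keys_h: "\<exists>a\<in>Poly_Mapping.keys (g n). b = t + a" if "b \<in> Poly_Mapping.keys h" for b
        using that Poly_Mapping.keys_mult[of "Poly_Mapping.single t c" "g n"]
        unfolding h_def by (auto split: if_splits)
      have h: "h \<in> J" "h \<in> I"
        unfolding h_def using g[OF n(1)] n(1) I(2) by (auto intro!: idl_mult J I(1))
      have small: "rk b < rk m" if b: "b \<in> Poly_Mapping.keys (f - h)" for b
      proof -
        have "Poly_Mapping.lookup h m = Poly_Mapping.lookup f m"
          using lookup_h[of n] gn by (simp add: n(2) c_def add.commute)
        then have "b \<noteq> m" using b by (auto simp: in_keys_iff lookup_minus)
        moreover have "rk b \<le> rk m"
        proof (cases "b \<in> Poly_Mapping.keys f")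
          case True
          then show ?thesis using less.prems by (auto simp: lm_def)
        next
          case False
          then have "b \<in> Poly_Mapping.keys h" using b by (auto simp: in_keys_iff lookup_minus)
          then obtain a where a: "a \<in> Poly_Mapping.keys (g n)" "b = t + a" using keys_h by blast
          then have "rk a \<le> rk n" using g[OF n(1)] by (auto simp: lm_def)
          then have "a = n \<or> rk a < rk n" using rk(1) by (auto simp: order_le_less dest: injD)
          then show ?thesis using rk(2)[of a n t] by (auto simp: a(2) n(2) add.commute)
        qed
        ultimately show ?thesis using rk(1) by (auto simp: order_le_less dest: injD)
      qed
      have "f - h \<in> I"
      proof (cases "f - h = 0")
        case False
        then obtain m' where m': "lm (f - h) m'" using lm_ex by blast
        show ?thesis
          by (rule less.hyps[OF _ _ m']) (use small m' h less.prems J in \<open>auto simp: lm_def intro: idl_diff\<close>)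
      qed (simp add: idl_0 I)
      then show ?case using idl_diff_iff[OF I(1)] h by blast
    qed
    show "f \<in> I"
      by (cases "f = 0") (use lm_ex main \<open>f \<in> J\<close> in \<open>auto simp: idl_0 I(1)\<close>)
  qed
  then show ?thesis using that[of "g ` M0"] M0(1) g by blast
qed


section \<open>Derivations and symbolic squares\<close>

definition der :: "('v \<Rightarrow> ('v, 'k) mpoly) \<Rightarrow> ('v::{finite,linorder}, 'k::field) mpoly \<Rightarrow> ('v, 'k) mpoly" where
  "der E f = (\<Sum>i\<in>UNIV. E i * pd i f)"

lemma der_0 [simp]: "der E 0 = 0"
  by (simp add: der_def)

lemma der_1 [simp]: "der E 1 = 0"
  by (simp add: der_def)

lemma der_const [simp]: "der E (const c) = 0"
  by (simp add: der_def)

lemma der_add: "der E (f + g) = der E f + der E g"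
  by (simp add: der_def pd_add distrib_left sum.distrib)

lemma der_mult: "der E (f * g) = der E f * g + f * der E g"
  by (simp add: der_def pd_mult distrib_left sum.distrib sum_distrib_left sum_distrib_right ac_simps)

lemma der_var: "der E (var i) = E i"
  by (simp add: der_def pd_var if_distrib cong: if_cong)

lemma der_power: "der E (f ^ k) = of_nat k * f ^ (k - 1) * der E f"
proof (induction k)
  case (Suc k)
  show ?case by (cases k) (use Suc in \<open>auto simp: der_mult algebra_simps\<close>)
qed simp

lemma der_eq_pd: "der (\<lambda>i. if i = j then 1 else 0) f = pd j f"
  by (simp add: der_def if_distrib[of "\<lambda>x. x * _"] cong: if_cong)

lemma der_poly:
  "der E (poly F x) = poly (map_poly (der E) F) x + poly (pderiv F) x * der E x"
  by (induction F) (auto simp: map_poly_pCons der_add der_mult pderiv_pCons algebra_simps)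

lemma coeff_map_der: "coeff (map_poly (der E) F) l = der E (coeff F l)"
  by (simp add: coeff_map_poly)

lemma pd_poly:
  "pd i (poly F (var j)) =
     poly (map_poly (pd i) F) (var j) + (if i = j then poly (pderiv F) (var j) else 0)"
  using der_poly[of "\<lambda>l. if l = i then 1 else 0" F "var j"]
  by (simp add: der_eq_pd[abs_def] pd_var)

subsection \<open>Division by a minimal polynomial modulo a prime\<close>

text \<open>The leading coefficient of H is no unit, so each cancellation of a leading term costs
  one factor of it.\<close>

lemma pseudo_division:
  assumes H: "H \<in> upolys_in V" "degree H > 0" and "F \<in> upolys_in V"
  shows "\<exists>k Q R. R \<in> upolys_in V \<and> Q \<in> upolys_in V \<and>
    smult (lead_coeff H ^ k) F = Q * H + R \<and> degree R < degree H"
  using assms(3)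
proof (induction "degree F" arbitrary: F rule: less_induct)
  case less
  show ?case
  proof (cases "degree F < degree H")
    case True
    then show ?thesis using less.prems by (intro exI[of _ 0] exI[of _ F]) auto
  next
    case False
    define c where "c = lead_coeff H"
    define T where "T = monom (lead_coeff F) (degree F - degree H)"
    define F1 where "F1 = smult c F - T * H"
    have cT: "c \<in> polys_in V" "T \<in> upolys_in V"
      using H less.prems by (auto simp: c_def T_def upolys_in_def)
    then have F1: "F1 \<in> upolys_in V"
      unfolding F1_def using H less.prems by (intro upolys_in_diff upolys_in_smult upolys_in_mult)
    have "coeff F1 l = 0" if "l \<ge> degree F" for l
    proof (cases "l = degree F")
      case True
      have "coeff (T * H) (degree F) = lead_coeff F * lead_coeff H"
        using False by (simp add: T_def coeff_monom_mult)
      then show ?thesis using True by (simp add: F1_def c_def)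
    next
      case l: False
      then have "l - (degree F - degree H) > degree H" using that False by auto
      then show ?thesis using l that
        by (auto simp: F1_def T_def c_def coeff_monom_mult coeff_eq_0)
    qed
    then have "degree F1 < degree F"
      using False H(2) by (metis degree_0 gr0I leI le_degree le_zero_eq leading_coeff_0_iff linorder_not_less)
    then obtain k Q R where IH: "R \<in> upolys_in V" "Q \<in> upolys_in V"
      "smult (c ^ k) F1 = Q * H + R" "degree R < degree H"
      using less.hyps F1 unfolding c_def by blast
    have "smult (c ^ Suc k) F = smult (c ^ k) (F1 + T * H)"
      by (simp add: F1_def mult.commute)
    also have "\<dots> = (Q + smult (c ^ k) T) * H + R"
      unfolding smult_add_right IH(3) by (simp add: algebra_simps)
    finally show ?thesis
      using IH cT unfolding c_def[symmetric]
      by (intro exI[of _ "Suc k"] exI[of _ "Q + smult (c ^ k) T"] exI[of _ R])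
        (auto intro!: upolys_in_add upolys_in_smult polys_in_power)
  qed
qed

text \<open>In the fraction field of S/P, the image of x_j is transcendental over the subfield
  generated by the x_v with v in V. Working with polynomials modulo P avoids constructing that
  field.\<close>

definition transc :: "('v::{finite,linorder}, 'k::field) mpoly set \<Rightarrow> 'v set \<Rightarrow> 'v \<Rightarrow> bool" where
  "transc P V j \<longleftrightarrow> (\<forall>F\<in>upolys_in V. poly F (var j) \<in> P \<longrightarrow> (\<forall>l. coeff F l \<in> P))"

text \<open>The minimal polynomial of x_j over the field generated by the variables in V, with
  denominators cleared: instead of being monic, its leading coefficient is nonzero modulo P.\<close>

definition minpoly :: "('v::{finite,linorder}, 'k::field) mpoly set \<Rightarrow> 'v set \<Rightarrow> 'v \<Rightarrow> ('v, 'k) mpoly poly \<Rightarrow> bool" where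
  "minpoly P V j H \<longleftrightarrow> H \<in> upolys_in V \<and> poly H (var j) \<in> P \<and> lead_coeff H \<notin> P \<and> degree H > 0 \<and>
     (\<forall>F\<in>upolys_in V. degree F < degree H \<longrightarrow> poly F (var j) \<in> P \<longrightarrow> (\<forall>l. coeff F l \<in> P))"

text \<open>Dropping the top coefficients that lie in P makes the degree of the polynomial equal to
  its degree modulo P.\<close>

lemma truncate_mod:
  assumes P: "prime_idl P" and F: "F \<in> upolys_in V" "\<not> (\<forall>l. coeff F l \<in> P)"
  obtains F' where "F' \<in> upolys_in V" "degree F' \<le> degree F" "lead_coeff F' \<notin> P"
    "poly F x - poly F' x \<in> P"
proof -
  define A where "A = {l. coeff F l \<notin> P}"
  have "A \<subseteq> {..degree F}"
    using idl_0[OF prime_idl_idl[OF P]] by (auto simp: A_def) (metis coeff_eq_0 leI)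
  then have A: "finite A" "A \<noteq> {}" using F(2) by (auto simp: A_def finite_subset)
  define d where "d = Max A"
  have d: "coeff F d \<notin> P" "d \<le> degree F" and dA: "\<And>l. coeff F l \<notin> P \<Longrightarrow> l \<le> d"
    using Max_in[OF A] \<open>A \<subseteq> _\<close> A by (auto simp: A_def d_def)
  define F' where "F' = poly_cutoff (Suc d) F"
  have c: "coeff F' l = (if l \<le> d then coeff F l else 0)" for l
    by (auto simp: F'_def coeff_poly_cutoff)
  have "coeff F d \<noteq> 0" using d(1) idl_0[OF prime_idl_idl[OF P]] by metis
  then have deg: "degree F' = d"
    by (intro antisym degree_le le_degree) (auto simp: c)
  have "poly (F - F') x \<in> P"
    using dA idl_0[OF prime_idl_idl[OF P]] by (intro idl_poly prime_idl_idl P) (force simp: c)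
  then show ?thesis using that[of F'] deg d F(1) by (auto simp: c upolys_in_def)
qed

lemma transc_or_minpoly:
  assumes P: "prime_idl P"
  obtains "transc P V j" | H where "minpoly P V j H"
proof (cases "transc P V j")
  case False
  define A where "A F \<longleftrightarrow> F \<in> upolys_in V \<and> poly F (var j) \<in> P \<and> \<not> (\<forall>l. coeff F l \<in> P)" for F
  obtain H0 where H0: "A H0" "\<And>F. A F \<Longrightarrow> degree H0 \<le> degree F"
    using False ex_has_least_nat[of A _ degree] by (auto simp: transc_def A_def) metis
  have H0': "H0 \<in> upolys_in V" "\<not> (\<forall>l. coeff H0 l \<in> P)" using H0(1) by (auto simp: A_def)
  obtain H where H: "H \<in> upolys_in V" "degree H \<le> degree H0" "lead_coeff H \<notin> P"
    "poly H0 (var j) - poly H (var j) \<in> P"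
    using truncate_mod[OF P H0'] by blast
  have HP: "poly H (var j) \<in> P"
    using H(4) H0(1) idl_diff_iff[OF prime_idl_idl[OF P]] by (auto simp: A_def)
  have "degree H > 0"
  proof (rule ccontr)
    assume "\<not> degree H > 0"
    then obtain c where "H = [:c:]" by (auto elim: degree_eq_zeroE)
    then show False using HP H(3) by simp
  qed
  then have "minpoly P V j H"
    using H HP H0(2) by (force simp: minpoly_def A_def)
  then show ?thesis using that by blast
qed (use that in blast)

text \<open>Separability: \<open>pderiv H\<close> has smaller degree, so if it vanished at x_j, its
  leading coefficient, the degree of H times the leading coefficient of H, would lie in P.\<close>

lemma minpoly_pderiv:
  fixes P :: "('v::{finite,linorder}, 'k::field_char_0) mpoly set"
  assumes P: "prime_idl P" and H: "minpoly P V j H"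
  shows "poly (pderiv H) (var j) \<notin> P"
proof
  assume a: "poly (pderiv H) (var j) \<in> P"
  have d: "degree (pderiv H) < degree H" "degree H > 0"
    using H by (auto simp: minpoly_def degree_pderiv)
  have "pderiv H \<in> upolys_in V"
    using H by (auto simp: minpoly_def upolys_in_def coeff_pderiv intro!: polys_in_mult)
      (metis const_def polys_in_const single_of_nat of_nat_Suc)
  then have "coeff (pderiv H) (degree H - 1) \<in> P" using H d a by (auto simp: minpoly_def)
  then show False using H d of_nat_notin[OF P, of "degree H"] by (auto simp: coeff_pderiv minpoly_def prime_idl_mult_iff[OF P])
qed

lemma minpoly_divide:
  assumes P: "prime_idl P" and H: "minpoly P V j H" and F: "F \<in> upolys_in V"
  obtains c Q R where "c \<in> polys_in V" "c \<notin> P" "Q \<in> upolys_in V" "R \<in> upolys_in V"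
    "degree R < degree H" "smult c F = Q * H + R"
    "c * poly F (var j) = poly Q (var j) * poly H (var j) + poly R (var j)"
    "poly F (var j) \<in> P \<Longrightarrow> poly R (var j) \<in> P \<and> (\<forall>l. coeff R l \<in> P)"
proof -
  have H': "H \<in> upolys_in V" "degree H > 0" "lead_coeff H \<notin> P" "poly H (var j) \<in> P"
    using H by (auto simp: minpoly_def)
  note I = prime_idl_idl[OF P]
  obtain k Q R where *: "R \<in> upolys_in V" "Q \<in> upolys_in V"
    "smult (lead_coeff H ^ k) F = Q * H + R" "degree R < degree H"
    using pseudo_division[OF H'(1,2) F] by blast
  have e: "lead_coeff H ^ k * poly F (var j) = poly Q (var j) * poly H (var j) + poly R (var j)"
    using arg_cong[OF *(3), of "\<lambda>p. poly p (var j)"] by simp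
  have "poly R (var j) \<in> P" if "poly F (var j) \<in> P"
  proof -
    have "poly R (var j) = lead_coeff H ^ k * poly F (var j) - poly Q (var j) * poly H (var j)"
      using e by simp
    then show ?thesis using that H'(4) by (simp add: idl_diff idl_mult I)
  qed
  moreover have "lead_coeff H ^ k \<notin> P" using H'(3) prime_idl_power[OF P] by blast
  moreover have "lead_coeff H ^ k \<in> polys_in V"
    using H'(1) by (auto simp: upolys_in_def intro: polys_in_power)
  ultimately show ?thesis using that * e H by (auto simp: minpoly_def)
qed

subsection \<open>Kernel of the differential on a prime\<close>

text \<open>For a prime P in characteristic 0 this is the second symbolic power:
  \<open>dker_generic\<close> provides a multiplier outside P that carries it into the square of
  P.\<close>

definition dker :: "('v::{finite,linorder}, 'k::field) mpoly set \<Rightarrow> ('v, 'k) mpoly set" where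
  "dker P = {g\<in>P. \<forall>i. pd i g \<in> P}"

lemma idl_dker: "idl P \<Longrightarrow> idl (dker P)"
  by (auto simp: idl_def dker_def pd_add pd_mult)

text \<open>The variables are adjoined one at a time. If x_j is transcendental over the earlier
  ones, the coefficients of g as a polynomial in x_j lie in \<open>dker P\<close>. Otherwise write c
  g = Q H + R with the minimal polynomial H. All coefficients of R lie in P, so applying
  \<open>pd j\<close> shows that Q times the derivative of H lies in P at x_j. By separability Q
  does too, hence Q H is in the square of P, and the coefficients of R turn out to be in
  \<open>dker P\<close>.\<close>

lemma dker_generic_in:
  fixes P :: "('v::{finite,linorder}, 'k::field_char_0) mpoly set"
  assumes P: "prime_idl P" and "finite V" "g \<in> polys_in V" "g \<in> dker P"
  shows "\<exists>c. c \<notin> P \<and> c * g \<in> idl_prod P P"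
  using assms(2-)
proof (induction V arbitrary: g)
  case empty
  then have g: "g = const (Poly_Mapping.lookup g 0)" using polys_in_empty homog_0_const by blast
  have "g \<in> P" using empty by (simp add: dker_def)
  then have "Poly_Mapping.lookup g 0 = 0" using const_notin[OF P, of "Poly_Mapping.lookup g 0"] g by auto
  then have "g = 0" using g by simp
  then show ?case using prime_idl_one[OF P] by (intro exI[of _ 1]) (auto intro: idl_prod.zero)
next
  case (insert j V)
  note I = prime_idl_idl[OF P]
  note I2 = idl_idl_prod[OF I, of P]
  have gP: "g \<in> P" "\<And>i. pd i g \<in> P" using insert.prems by (auto simp: dker_def)
  have comb: "\<exists>c. c \<notin> P \<and> c * poly F (var j) \<in> idl_prod P P"
    if F: "F \<in> upolys_in V" "\<And>l. coeff F l \<in> dker P" for F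
  proof -
    have "\<exists>c. c \<notin> P \<and> c * coeff F l \<in> idl_prod P P" for l
      using insert.IH F by (auto simp: upolys_in_def)
    then obtain c where c: "\<And>l. c l \<notin> P" "\<And>l. c l * coeff F l \<in> idl_prod P P" by metis
    define C where "C = (\<Prod>l\<le>degree F. c l)"
    have "C * coeff F l \<in> idl_prod P P" if "l \<le> degree F" for l
    proof -
      have "C = (\<Prod>i\<in>{..degree F} - {l}. c i) * c l"
        unfolding C_def using that by (subst prod.remove[of _ l]) (auto simp: mult.commute)
      then show ?thesis using idl_mult[OF I2 c(2)] by (simp add: mult.assoc)
    qed
    then have "C * poly F (var j) \<in> idl_prod P P"
      unfolding poly_altdef sum_distrib_left
      by (intro idl_sum[OF I2]) (auto simp flip: mult.assoc intro: idl_mult2[OF I2])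
    moreover have "C \<notin> P" unfolding C_def by (intro prime_idl_prod_notin P c)
    ultimately show ?thesis by blast
  qed
  have no_j: "pd j (coeff F l) = 0" if "F \<in> upolys_in V" for F l
    using that insert.hyps by (intro pd_not_in) (auto simp: upolys_in_def)
  have pdF: "map_poly (pd i) F \<in> upolys_in V" if "F \<in> upolys_in V" for i and F :: "('v, 'k) mpoly poly"
    using that by (auto simp: upolys_in_def coeff_map_poly pd_polys_in)
  have map_j: "map_poly (pd j) F = 0" if "F \<in> upolys_in V" for F
    by (rule poly_eqI) (simp add: coeff_map_poly no_j that)
  obtain F where F: "F \<in> upolys_in V" "g = poly F (var j)"
    using polys_in_insert_decomp insert.prems by blast
  show ?case
  proof (rule transc_or_minpoly[OF P, of V j])
    assume tr: "transc P V j"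
    have "coeff F l \<in> dker P" for l
    proof -
      have "pd i (coeff F l) \<in> P" for i
      proof (cases "i = j")
        case False
        then have "poly (map_poly (pd i) F) (var j) \<in> P"
          using gP(2)[of i] by (simp add: F(2) pd_poly)
        then show ?thesis using tr pdF[OF F(1), of i] by (auto simp: transc_def coeff_map_poly)
      qed (simp add: no_j F idl_0[OF I])
      then show ?thesis using tr gP F by (auto simp: transc_def dker_def)
    qed
    then show ?thesis unfolding F(2) by (rule comb[OF F(1)])
  next
    fix H assume H: "minpoly P V j H"
    have H': "H \<in> upolys_in V" "poly H (var j) \<in> P" using H by (auto simp: minpoly_def)
    obtain c Q R where d: "c \<in> polys_in V" "c \<notin> P" "Q \<in> upolys_in V" "R \<in> upolys_in V"
      "degree R < degree H"
      "c * g = poly Q (var j) * poly H (var j) + poly R (var j)"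
      "poly R (var j) \<in> P" "\<And>l. coeff R l \<in> P"
      using minpoly_divide[OF P H F(1)] gP(1) unfolding F(2) by metis
    have pdeq: "pd i c * g + c * pd i g = pd i (poly Q (var j)) * poly H (var j)
        + poly Q (var j) * pd i (poly H (var j)) + pd i (poly R (var j))" for i
      using arg_cong[OF d(6), of "pd i"] by (simp add: pd_add pd_mult)
    have inP: "poly Q (var j) * pd i (poly H (var j)) + pd i (poly R (var j)) \<in> P" for i
    proof -
      have "poly Q (var j) * pd i (poly H (var j)) + pd i (poly R (var j))
          = pd i c * g + c * pd i g - pd i (poly Q (var j)) * poly H (var j)"
        using pdeq[of i] by (simp add: algebra_simps)
      also have "\<dots> \<in> P" by (intro idl_diff[OF I] idl_add[OF I] idl_mult[OF I] gP H')
      finally show ?thesis .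
    qed
    have "pd j (poly R (var j)) \<in> P"
      using d(4,8) by (auto simp: pd_poly map_j coeff_pderiv intro!: idl_poly[OF I] idl_mult[OF I])
    then have "poly Q (var j) * pd j (poly H (var j)) \<in> P"
      using inP[of j] idl_add_iff[OF I] by (metis add.commute)
    then have Q: "poly Q (var j) \<in> P"
      using minpoly_pderiv[OF P H] H'(1) by (auto simp: pd_poly map_j prime_idl_mult_iff[OF P])
    have "coeff R l \<in> dker P" for l
    proof -
      have "pd i (coeff R l) \<in> P" for i
      proof (cases "i = j")
        case False
        have "pd i (poly R (var j)) \<in> P"
          using inP[of i] idl_add_iff[OF I] idl_mult2[OF I Q] by blast
        then have "poly (map_poly (pd i) R) (var j) \<in> P" using False by (simp add: pd_poly)
        moreover have "degree (map_poly (pd i) R) < degree H"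
          using d(5) degree_le[of "degree R" "map_poly (pd i) R"]
          by (auto simp: coeff_map_poly coeff_eq_0 intro: le_less_trans)
        ultimately show ?thesis using H pdF[OF d(4), of i] by (auto simp: minpoly_def coeff_map_poly)
      qed (simp add: no_j d idl_0[OF I])
      then show ?thesis using d by (auto simp: dker_def)
    qed
    then obtain c' where c': "c' \<notin> P" "c' * poly R (var j) \<in> idl_prod P P"
      using comb[OF d(4)] by blast
    have "c' * c * g = c' * (poly Q (var j) * poly H (var j)) + c' * poly R (var j)"
      by (simp add: mult.assoc d(6) distrib_left)
    also have "\<dots> \<in> idl_prod P P"
      by (intro idl_add[OF I2] idl_mult[OF I2] c' idl_prod_mem Q H')
    finally show ?thesis using c' d(2) prime_idl_mult_iff[OF P] by blast
  qed
qed

text \<open>Finitely many generators of \<open>dker P\<close> need finitely many multipliers, whose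
  product serves for all elements.\<close>

lemma dker_generic:
  fixes P :: "('v::{finite,linorder}, 'k::field_char_0) mpoly set"
  assumes P: "prime_idl P"
  obtains a where "a \<notin> P" "\<And>g. g \<in> dker P \<Longrightarrow> a * g \<in> idl_prod P P"
proof -
  note I = prime_idl_idl[OF P]
  note I2 = idl_idl_prod[OF I, of P]
  obtain B where B: "finite B" "B \<subseteq> dker P" "\<And>J. idl J \<Longrightarrow> B \<subseteq> J \<Longrightarrow> dker P \<subseteq> J"
    using hilbert_basis[OF idl_dker[OF I]] by blast
  have "\<forall>g\<in>B. \<exists>c. c \<notin> P \<and> c * g \<in> idl_prod P P"
    using dker_generic_in[OF P finite[of UNIV]] B(2) by auto
  then obtain c where c: "\<And>g. g \<in> B \<Longrightarrow> c g \<notin> P" "\<And>g. g \<in> B \<Longrightarrow> c g * g \<in> idl_prod P P"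
    by metis
  define C where "C = prod c B"
  have "idl {g. C * g \<in> idl_prod P P}"
    using I2 by (auto simp: idl_def distrib_left mult.left_commute[of C])
  moreover have "C * g \<in> idl_prod P P" if "g \<in> B" for g
  proof -
    have "C = prod c (B - {g}) * c g"
      unfolding C_def using that B(1) by (subst prod.remove[of _ g]) (auto simp: mult.commute)
    then show ?thesis using idl_mult[OF I2 c(2)[OF that]] by (simp add: mult.assoc)
  qed
  ultimately have "dker P \<subseteq> {g. C * g \<in> idl_prod P P}" using B(3) by blast
  moreover have "C \<notin> P" unfolding C_def by (intro prime_idl_prod_notin P c)
  ultimately show ?thesis using that by blast
qed

subsection \<open>Extension of derivations\<close>

lemma map_der_upolys: "F \<in> upolys_in V \<Longrightarrow> i \<notin> V \<Longrightarrow> map_poly (der (E(i := x))) F = map_poly (der E) F"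
proof (rule poly_eqI)
  fix l assume "F \<in> upolys_in V" "i \<notin> V"
  then have "pd i (coeff F l) = 0" by (intro pd_not_in) (auto simp: upolys_in_def)
  then show "coeff (map_poly (der (E(i := x))) F) l = coeff (map_poly (der E) F) l"
    by (auto simp: coeff_map_der der_def intro!: sum.cong)
qed

lemma der_scale: "der (\<lambda>i. c * E i) f = c * der E f"
  by (simp add: der_def sum_distrib_left mult.assoc)

lemma map_der_scale: "map_poly (der (\<lambda>i. c * E i)) F = smult c (map_poly (der E) F)"
  by (rule poly_eqI) (simp add: coeff_map_poly der_scale)

text \<open>A derivation of \<open>k(V)(x\<^sub>j)\<close> over \<open>k(V)\<close> extends to the fraction field of \<open>S/P\<close>.\<close>

lemma derivation_extends:
  fixes P :: "('v::{finite,linorder}, 'k::field_char_0) mpoly set"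
  assumes P: "prime_idl P" and j: "j \<notin> V" "transc P V j" and "finite U" "U \<inter> insert j V = {}"
  shows "\<exists>E. (\<forall>v\<in>V. E v = 0) \<and> E j \<notin> P \<and> (\<forall>g\<in>P \<inter> polys_in (insert j V \<union> U). der E g \<in> P)"
  using assms(4,5)
proof (induction U)
  note I = prime_idl_idl[OF P]
  case empty
  \<comment> \<open>With no further variables the derivation is the partial derivative by x_j;
    transcendence puts all coefficients of an element of P into P.\<close>
  define E :: "'v \<Rightarrow> ('v, 'k) mpoly" where "E = (\<lambda>i. if i = j then 1 else 0)"
  have "der E g \<in> P" if g: "g \<in> P" "g \<in> polys_in (insert j V)" for g
  proof -
    obtain F where F: "F \<in> upolys_in V" "g = poly F (var j)" using polys_in_insert_decomp g by blast
    then have c: "coeff F l \<in> P" for l using j(2) g by (auto simp: transc_def)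
    have "map_poly (pd j) F = 0"
      by (rule poly_eqI) (use F(1) j(1) in \<open>auto simp: coeff_map_poly upolys_in_def intro: pd_not_in\<close>)
    then show ?thesis unfolding E_def der_eq_pd F(2)
      by (auto simp: pd_poly coeff_pderiv intro!: idl_poly[OF I] idl_mult[OF I] c)
  qed
  then show ?case using j(1) prime_idl_one[OF P] by (intro exI[of _ E]) (auto simp: E_def)
next
  note I = prime_idl_idl[OF P]
  case (insert l U)
  define W where "W = insert j V \<union> U"
  have l: "l \<notin> W" "l \<notin> V" "l \<noteq> j" using insert by (auto simp: W_def)
  have W: "insert j V \<union> insert l U = insert l W" by (auto simp: W_def)
  obtain E where E: "\<And>v. v \<in> V \<Longrightarrow> E v = 0" "E j \<notin> P" "\<And>g. g \<in> P \<Longrightarrow> g \<in> polys_in W \<Longrightarrow> der E g \<in> P"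
    using insert by (auto simp: W_def)
  have mapP: "poly (map_poly (der E) F) x \<in> P"
    if "F \<in> upolys_in W" "\<And>l. coeff F l \<in> P" for F x
    using that by (intro idl_poly[OF I]) (auto simp: coeff_map_der upolys_in_def intro: E(3))
  have "\<exists>E. (\<forall>v\<in>V. E v = 0) \<and> E j \<notin> P \<and> (\<forall>g\<in>P \<inter> polys_in (insert l W). der E g \<in> P)"
  proof (rule transc_or_minpoly[OF P, of W l])
    assume tr: "transc P W l"
    \<comment> \<open>The value at a transcendental x_l is free; 0 is chosen.\<close>
    have "der (E(l := 0)) g \<in> P" if g: "g \<in> P" "g \<in> polys_in (insert l W)" for g
    proof -
      obtain F where F: "F \<in> upolys_in W" "g = poly F (var l)" using polys_in_insert_decomp g by blast
      then have "coeff F i \<in> P" for i using tr g by (auto simp: transc_def)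
      then show ?thesis using F l by (simp add: der_poly map_der_upolys der_var mapP)
    qed
    then show ?thesis using E l by (intro exI[of _ "E(l := 0)"]) auto
  next
    fix H assume H: "minpoly P W l H"
    have H': "H \<in> upolys_in W" "poly H (var l) \<in> P" using H by (auto simp: minpoly_def)
    define h where "h = poly (pderiv H) (var l)"
    have h: "h \<notin> P" unfolding h_def by (rule minpoly_pderiv[OF P H])
    \<comment> \<open>The chain rule applied to H(x_l) = 0 prescribes h times the value at x_l,
      where h is the derivative of H at x_l. Multiplying the old derivation by h avoids the
      division.\<close>
    define E' where "E' = (\<lambda>i. h * E i)(l := - poly (map_poly (der E) H) (var l))"
    have E'F: "der E' (poly F (var l)) = h * poly (map_poly (der E) F) (var l) + poly (pderiv F) (var l) * E' l"
      if "F \<in> upolys_in W" for F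
      unfolding E'_def using that l(1) by (simp add: der_poly map_der_upolys der_var map_der_scale)
    have E'H: "der E' (poly H (var l)) = 0"
      using E'F[OF H'(1)] by (simp add: h_def E'_def mult.commute)
    have "der E' g \<in> P" if g: "g \<in> P" "g \<in> polys_in (insert l W)" for g
    proof -
      obtain F where F: "F \<in> upolys_in W" "g = poly F (var l)" using polys_in_insert_decomp g by blast
      obtain c Q R where d: "c \<in> polys_in W" "c \<notin> P" "R \<in> upolys_in W"
        "c * g = poly Q (var l) * poly H (var l) + poly R (var l)" "\<And>i. coeff R i \<in> P"
        using minpoly_divide[OF P H F(1)] g(1) unfolding F(2) by metis
      have R: "der E' (poly R (var l)) \<in> P"
        unfolding E'F[OF d(3)] using d(5)
        by (intro idl_add[OF I] idl_mult[OF I] idl_mult2[OF I] mapP d idl_poly[OF I])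
          (auto simp: coeff_pderiv intro!: idl_mult[OF I])
      have "c * der E' g = der E' (poly Q (var l)) * poly H (var l) + der E' (poly R (var l)) - der E' c * g"
        using arg_cong[OF d(4), of "der E'"] by (simp add: der_add der_mult E'H algebra_simps)
      also have "\<dots> \<in> P" by (intro idl_add[OF I] idl_diff[OF I] idl_mult[OF I] R H' g)
      finally show ?thesis using d(2) by (simp add: prime_idl_mult_iff[OF P])
    qed
    then show ?thesis using E l h
      by (intro exI[of _ E']) (auto simp: E'_def prime_idl_mult_iff[OF P])
  qed
  then show ?case by (simp only: W)
qed

text \<open>If every derivation of the fraction field of \<open>S/P\<close> over \<open>k(z)\<close> vanishes, this field is
  algebraic over \<open>k(z)\<close>.\<close>

lemma not_transc:
  fixes P :: "('v::{finite,linorder}, 'k::field_char_0) mpoly set"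
  assumes P: "prime_idl P"
    and nd: "\<forall>E. (\<forall>v\<in>z. E v = 0) \<and> (\<forall>g\<in>P. der E g \<in> P) \<longrightarrow> (\<forall>j. E j \<in> P)"
    and "z \<subseteq> V" "j \<notin> V"
  shows "\<not> transc P V j"
proof
  assume tr: "transc P V j"
  have "insert j V \<union> - insert j V = UNIV" by blast
  then obtain E where "\<And>v. v \<in> V \<Longrightarrow> E v = 0" "E j \<notin> P" "\<And>g. g \<in> P \<Longrightarrow> der E g \<in> P"
    using derivation_extends[OF P assms(4) tr, of "- insert j V"] by auto
  then show False using nd assms(3) by blast
qed

text \<open>Euclid's algorithm with H: a polynomial of degree at least that of H is replaced by its
  remainder modulo H, and one of lower positive degree by the remainder of H modulo it. Values at
  x_j stay in J and outside P while the degree drops, until x_j has disappeared.\<close>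

lemma eliminate_variable:
  fixes P :: "('v::{finite,linorder}, 'k::field_char_0) mpoly set"
  assumes P: "prime_idl P" and H: "minpoly P V j H" and J: "idl J" "P \<subseteq> J"
    and "A \<in> upolys_in V" "poly A (var j) \<in> J" "poly A (var j) \<notin> P"
  shows "\<exists>a\<in>J \<inter> polys_in V. a \<notin> P"
  using assms(5-)
proof (induction "degree A" arbitrary: A rule: less_induct)
  case less
  note I = prime_idl_idl[OF P]
  have H': "H \<in> upolys_in V" "poly H (var j) \<in> P" "lead_coeff H \<notin> P" "degree H > 0"
    using H by (auto simp: minpoly_def)
  have "\<not> (\<forall>l. coeff A l \<in> P)" using less.prems(3) idl_poly[OF I] by blast
  then obtain A' where A': "A' \<in> upolys_in V" "degree A' \<le> degree A" "lead_coeff A' \<notin> P"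
    "poly A (var j) - poly A' (var j) \<in> P"
    using truncate_mod[OF P less.prems(1)] by blast
  have A'J: "poly A' (var j) \<in> J" "poly A' (var j) \<notin> P"
    using A'(4) less.prems J idl_diff_iff[OF J(1)] idl_diff_iff[OF I] by blast+
  consider "degree A' = 0" | "degree A' > 0" "degree A' \<ge> degree H" | "degree A' > 0" "degree A' < degree H"
    by linarith
  then show ?case
  proof cases
    case 1
    then obtain a where a: "A' = [:a:]" by (auto elim: degree_eq_zeroE)
    have "coeff A' 0 \<in> polys_in V" using A'(1) by (auto simp: upolys_in_def)
    then show ?thesis using a A'J by auto
  next
    case 2
    obtain c Q R where d: "c \<notin> P" "Q \<in> upolys_in V" "R \<in> upolys_in V" "degree R < degree H"
      "c * poly A' (var j) = poly Q (var j) * poly H (var j) + poly R (var j)"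
      using minpoly_divide[OF P H A'(1)] by metis
    have "c * poly A' (var j) - poly R (var j) \<in> P"
      using H'(2) by (simp add: d(5) idl_mult[OF I])
    moreover have "c * poly A' (var j) \<in> J" "c * poly A' (var j) \<notin> P"
      using A'J d(1) by (auto simp: prime_idl_mult_iff[OF P] intro: idl_mult J)
    ultimately have "poly R (var j) \<in> J" "poly R (var j) \<notin> P"
      using J idl_diff_iff[OF J(1)] idl_diff_iff[OF I] by blast+
    then show ?thesis using less.hyps[of R] d(3,4) 2 A'(2) by linarith
  next
    case 3
    obtain k Q R where d: "R \<in> upolys_in V" "Q \<in> upolys_in V"
      "smult (lead_coeff A' ^ k) H = Q * A' + R" "degree R < degree A'"
      using pseudo_division[OF A'(1) 3(1) H'(1)] by blast
    have e: "lead_coeff A' ^ k * poly H (var j) = poly Q (var j) * poly A' (var j) + poly R (var j)"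
      using arg_cong[OF d(3), of "\<lambda>p. poly p (var j)"] by simp
    \<comment> \<open>Otherwise Q vanishes at x_j modulo P and has smaller degree than H, so its
      leading coefficient is in P; but the leading coefficient of \<open>Q * A'\<close> is a product
      of leading coefficients of \<open>A'\<close> and H, none of them in P.\<close>
    have "poly R (var j) \<notin> P"
    proof
      assume R: "poly R (var j) \<in> P"
      have "poly Q (var j) * poly A' (var j) = lead_coeff A' ^ k * poly H (var j) - poly R (var j)"
        using e by simp
      also have "\<dots> \<in> P" using H'(2) R by (intro idl_diff[OF I] idl_mult[OF I])
      finally have QP: "poly Q (var j) \<in> P" using A'J by (simp add: prime_idl_mult_iff[OF P])
      have lk: "lead_coeff A' ^ k \<notin> P" using A'(3) prime_idl_power[OF P] by blast
      have nz: "lead_coeff A' ^ k * lead_coeff H \<notin> P"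
        using lk H'(3) by (simp add: prime_idl_mult_iff[OF P])
      have QA: "Q * A' = smult (lead_coeff A' ^ k) H - R" using d(3) by simp
      have c: "coeff (Q * A') (degree H) = lead_coeff A' ^ k * lead_coeff H"
        unfolding QA using 3 d(4) by (simp add: coeff_eq_0)
      have c0: "coeff (Q * A') (degree H) \<noteq> 0"
        unfolding c using nz idl_0[OF I] by metis
      have "degree (Q * A') = degree H"
      proof (rule antisym)
        show "degree (Q * A') \<le> degree H"
          unfolding QA using 3 d(4) by (intro degree_diff_le) auto
        show "degree H \<le> degree (Q * A')"
          using c0 by (rule le_degree)
      qed
      moreover have "A' \<noteq> 0" "Q \<noteq> 0" using c0 by auto
      ultimately have "degree Q + degree A' = degree H" by (simp add: degree_mult_eq)
      then have "degree Q < degree H" using 3 by linarith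
      then have "coeff Q (degree Q) \<in> P" using H d(2) QP by (auto simp: minpoly_def)
      moreover have "coeff (Q * A') (degree H) = lead_coeff Q * lead_coeff A'"
        using \<open>degree (Q * A') = degree H\<close> by (metis lead_coeff_mult)
      ultimately show False using nz c idl_mult2[OF I] by metis
    qed
    moreover have "poly R (var j) \<in> J"
    proof -
      have "poly R (var j) = lead_coeff A' ^ k * poly H (var j) - poly Q (var j) * poly A' (var j)"
        using e by simp
      also have "\<dots> \<in> J" using H'(2) A'J(1) J by (intro idl_diff idl_mult) auto
      finally show ?thesis .
    qed
    ultimately show ?thesis using less.hyps[of R] d A'(2) by linarith
  qed
qed

text \<open>By \<open>nd\<close> every variable outside z is algebraic over the remaining ones, so
  the variables in U can be removed from an element of J one after the other.\<close>

lemma eliminate: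
  fixes P :: "('v::{finite,linorder}, 'k::field_char_0) mpoly set"
  assumes P: "prime_idl P"
    and nd: "\<forall>E. (\<forall>v\<in>z. E v = 0) \<and> (\<forall>g\<in>P. der E g \<in> P) \<longrightarrow> (\<forall>j. E j \<in> P)"
    and J: "idl J" "P \<subseteq> J" and "finite U" and "a \<in> J" "a \<in> polys_in (z \<union> U)" "a \<notin> P"
  shows "\<exists>q\<in>J \<inter> polys_in z. q \<notin> P"
  using assms(5-)
proof (induction U arbitrary: a)
  case (insert j U)
  show ?case
  proof (cases "j \<in> z")
    case True
    then show ?thesis using insert by (metis Un_insert_right insert_absorb UnI1)
  next
    case False
    then have j: "j \<notin> z \<union> U" using insert by auto
    then have "\<not> transc P (z \<union> U) j" using not_transc[OF P nd] by blast
    then obtain H where "minpoly P (z \<union> U) j H" using transc_or_minpoly[OF P] by blast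
    moreover obtain A where "A \<in> upolys_in (z \<union> U)" "a = poly A (var j)"
      using polys_in_insert_decomp insert.prems by (metis Un_insert_right)
    ultimately obtain a' where "a' \<in> J" "a' \<in> polys_in (z \<union> U)" "a' \<notin> P"
      using eliminate_variable[OF P _ J] insert.prems by blast
    then show ?thesis using insert.IH by blast
  qed
qed auto

lemma topdeg_pd:
  assumes "topdeg f > 0" shows "topdeg (pd i f) < topdeg f"
proof -
  have "mdeg m < topdeg f" if "m \<in> Poly_Mapping.keys (pd i f)" for m
  proof -
    have "m + Poly_Mapping.single i 1 \<in> Poly_Mapping.keys f"
      using that by (auto simp: in_keys_iff lookup_pd)
    then have "mdeg (m + Poly_Mapping.single i 1) \<le> topdeg f"
      unfolding topdeg_def by (intro Max_ge) auto
    then show ?thesis by (simp add: mdeg_add)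
  qed
  then show ?thesis using assms by (auto simp: topdeg_def)
qed

lemma topdeg_0_const: "topdeg f = 0 \<Longrightarrow> f = const (Poly_Mapping.lookup f 0)"
  using sum_hcomp[of f 0] homog_0_const[of f] homog_hcomp[of 0 f] by simp

text \<open>In characteristic 0 a positive exponent survives as a coefficient of the
  derivative.\<close>

lemma ex_pd_nonzero:
  fixes q :: "('v::{finite,linorder}, 'k::field_char_0) mpoly"
  assumes "topdeg q > 0" "q \<in> polys_in z"
  obtains i where "i \<in> z" "pd i q \<noteq> 0"
proof -
  have "\<exists>m\<in>Poly_Mapping.keys q. mdeg m \<noteq> 0"
  proof (rule ccontr)
    assume "\<not> ?thesis"
    then have "topdeg q = 0" unfolding topdeg_def by (intro Max_eqI) auto
    then show False using assms by simp
  qed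
  then obtain m where m: "m \<in> Poly_Mapping.keys q" "mdeg m \<noteq> 0" by blast
  then obtain i where i: "Poly_Mapping.lookup m i \<noteq> 0" by (auto simp: mdeg_def)
  then have "i \<in> Poly_Mapping.keys m" by (simp add: in_keys_iff)
  then have "i \<in> z" using m(1) assms(2) unfolding polys_in_def by blast
  moreover have "m = (m - Poly_Mapping.single i 1) + Poly_Mapping.single i 1"
    using i by (intro poly_mapping_eqI) (auto simp: lookup_add lookup_minus lookup_single when_def)
  then have "Poly_Mapping.lookup (pd i q) (m - Poly_Mapping.single i 1) \<noteq> 0"
    using m(1) by (auto simp: lookup_pd in_keys_iff simp del: of_nat_Suc)
  then have "pd i q \<noteq> 0" by auto
  ultimately show ?thesis using that by blast
qed

text \<open>
  \<open>b\<close> and \<open>f\<^sub>y\<close> (\<open>y \<in> Y\<close>) exhibit the Jacobian of \<open>P\<close> as having constant rank \<open>|Y|\<close> on \<open>b \<noteq> 0\<close>.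
\<close>

definition pivots :: "('v::{finite,linorder}, 'k::field) mpoly set \<Rightarrow> 'v set \<Rightarrow> ('v, 'k) mpoly \<Rightarrow>
    ('v \<Rightarrow> ('v, 'k) mpoly) \<Rightarrow> bool" where
  "pivots P Y b f \<longleftrightarrow> (\<forall>y\<in>Y. f y \<in> P) \<and>
     (\<forall>y\<in>Y. \<forall>y'\<in>Y. pd y' (f y) - (if y' = y then b else 0) \<in> P)"

text \<open>Modulo P, b times the gradient of any element of P is a combination of the gradients of
  the \<open>f y\<close>, the coefficients being its own entries at Y.\<close>

definition pivots_span :: "('v::{finite,linorder}, 'k::field) mpoly set \<Rightarrow> 'v set \<Rightarrow> ('v, 'k) mpoly \<Rightarrow>
    ('v \<Rightarrow> ('v, 'k) mpoly) \<Rightarrow> bool" where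
  "pivots_span P Y b f \<longleftrightarrow>
     (\<forall>g\<in>P. \<forall>j. b * pd j g - (\<Sum>y\<in>Y. pd y g * pd j (f y)) \<in> P)"

text \<open>
  The derivations \<open>D\<^sub>j = b\<partial>\<^sub>j - \<Sum>\<^sub>y (\<partial>\<^sub>j f\<^sub>y)\<partial>\<^sub>y\<close>, \<open>j \<notin> Y\<close>, preserve \<open>P\<close> and \<open>dker P\<close>, hence also the
  annihilator of \<open>dker P / P\<^sup>2\<close>. The latter contains a polynomial in the variables outside \<open>Y\<close> that is
  not in \<open>P\<close>, and applying the \<open>D\<^sub>j\<close> reduces that polynomial to a constant times a power of \<open>b\<close>.
\<close>

theorem dker_subset_square:
  fixes P :: "('v::{finite,linorder}, 'k::field_char_0) mpoly set"
  assumes P: "prime_idl P" and b: "b \<notin> P" and piv: "pivots P Y b f" "pivots_span P Y b f"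
  obtains K where "\<And>g. g \<in> dker P \<Longrightarrow> b ^ K * g \<in> idl_prod P P"
proof -
  note I = prime_idl_idl[OF P]
  note I2 = idl_idl_prod[OF I, of P]
  define z where "z = - Y"
  define \<aa> where "\<aa> = {a. \<forall>g\<in>dker P. a * g \<in> idl_prod P P}"
  define D where "D j = der (\<lambda>i. if i = j then b else if i \<in> Y then - pd j (f i) else 0)" for j
  have D_eq: "D j g = b * pd j g - (\<Sum>y\<in>Y. pd y g * pd j (f y))" if "j \<in> z" for j g
  proof -
    have "D j g = (\<Sum>i\<in>UNIV. (if i = j then b * pd j g else 0) - (if i \<in> Y then pd i g * pd j (f i) else 0))"
      unfolding D_def der_def using that by (intro sum.cong) (auto simp: z_def)
    also have "\<dots> = b * pd j g - (\<Sum>y\<in>Y. pd y g * pd j (f y))"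
      by (simp add: sum_subtractf flip: sum.inter_restrict)
    finally show ?thesis .
  qed
  have D_mult: "D j (u * v) = D j u * v + u * D j v" for j u v by (simp add: D_def der_mult)
  have DP: "D j g \<in> P" if "j \<in> z" "g \<in> P" for j g
    using piv(2) that by (auto simp: D_eq pivots_span_def)
  have Dker: "D j g \<in> dker P" if j: "j \<in> z" and g: "g \<in> dker P" for j g
  proof -
    have gP: "g \<in> P" "\<And>i. pd i g \<in> P" using g by (auto simp: dker_def)
    have "pd i (D j g) \<in> P" for i
    proof -
      \<comment> \<open>The second derivatives of g recombine to \<open>D j (pd i g)\<close>; what
        remains has a first derivative of g as a factor.\<close>
      have "pd i (D j g) = pd i b * pd j g - (\<Sum>y\<in>Y. pd y g * pd i (pd j (f y))) + D j (pd i g)"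
        using j by (simp add: D_eq pd_diff pd_mult pd_sum sum.distrib pd_commute[of i j] pd_commute[of i _ g])
      also have "\<dots> \<in> P"
        by (intro idl_add[OF I] idl_diff[OF I] idl_sum[OF I] idl_mult[OF I] idl_mult2[OF I] DP j gP)
      finally show ?thesis .
    qed
    then show ?thesis using DP j gP by (simp add: dker_def)
  qed
  have D2: "D j s \<in> idl_prod P P" if "j \<in> z" "s \<in> idl_prod P P" for j s
    using that(2)
  proof induction
    case (add u v s)
    have "D j (u * v + s) = D j u * v + (u * D j v + D j s)"
      by (simp add: D_def der_add der_mult)
    then show ?case using add DP that(1) by (auto intro!: idl_prod.add)
  qed (simp add: D_def idl_prod.zero)
  have Ia: "idl \<aa>"
    using I2 by (auto simp: \<aa>_def idl_def distrib_right mult.assoc)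
  have Pa: "P \<subseteq> \<aa>" by (auto simp: \<aa>_def dker_def intro: idl_prod_mem)
  have Da: "D j a \<in> \<aa>" if j: "j \<in> z" and a: "a \<in> \<aa>" for j a
  proof -
    have "D j a * g \<in> idl_prod P P" if g: "g \<in> dker P" for g
    proof -
      have "D j a * g = D j (a * g) - a * D j g" by (simp add: D_mult)
      also have "\<dots> \<in> idl_prod P P"
        using a g Dker[OF j g] by (intro idl_diff[OF I2] D2 j) (auto simp: \<aa>_def)
      finally show ?thesis .
    qed
    then show ?thesis by (simp add: \<aa>_def)
  qed
  \<comment> \<open>For j in Y the pivot property gives \<open>der E (f j)\<close> = b E_j modulo P
    when E vanishes on z. So a derivation that preserves P is determined modulo P by its values
    outside Y.\<close>
  have nd': "E j \<in> P" if E: "\<And>v. v \<in> z \<Longrightarrow> E v = 0" "\<And>g. g \<in> P \<Longrightarrow> der E g \<in> P" for E j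
  proof (cases "j \<in> Y")
    case True
    have "der E (f j) - b * E j = (\<Sum>i\<in>UNIV. E i * (pd i (f j) - (if i = j then b else 0)))"
      by (simp add: der_def right_diff_distrib sum_subtractf mult.commute if_distrib[of "\<lambda>x. _ * x"] cong: if_cong)
    also have "\<dots> \<in> P"
    proof (rule idl_sum[OF I])
      fix i
      show "E i * (pd i (f j) - (if i = j then b else 0)) \<in> P"
      proof (cases "i \<in> Y")
        case i: True
        then show ?thesis
          using piv(1) True unfolding pivots_def by (intro idl_mult[OF I]) blast
      qed (use E(1)[of i] in \<open>simp add: z_def idl_0[OF I]\<close>)
    qed
    finally have "der E (f j) \<in> P \<longleftrightarrow> b * E j \<in> P" by (rule idl_diff_iff[OF I])
    moreover have "f j \<in> P" using piv(1) True unfolding pivots_def by blast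
    ultimately have "b * E j \<in> P" using E(2)[of "f j"] by simp
    then show ?thesis using b by (simp add: prime_idl_mult_iff[OF P])
  qed (use E(1) idl_0[OF I] in \<open>auto simp: z_def\<close>)
  then have nd: "\<forall>E. (\<forall>v\<in>z. E v = 0) \<and> (\<forall>g\<in>P. der E g \<in> P) \<longrightarrow> (\<forall>j. E j \<in> P)"
    by blast
  obtain a0 where a0: "a0 \<notin> P" "\<And>g. g \<in> dker P \<Longrightarrow> a0 * g \<in> idl_prod P P"
    using dker_generic[OF P] by blast
  then have "a0 \<in> \<aa>" by (auto simp: \<aa>_def)
  then obtain q where q: "q \<in> \<aa>" "q \<in> polys_in z" "q \<notin> P"
    using eliminate[OF P nd Ia Pa, of UNIV a0] a0(1) by auto
  have red: "\<exists>K. b ^ K \<in> \<aa>" if "q \<noteq> 0" "q \<in> polys_in z" "b ^ k * q \<in> \<aa>" for q k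
    using that
  proof (induction "topdeg q" arbitrary: q k rule: less_induct)
    case less
    show ?case
    proof (cases "topdeg q = 0")
      case True
      define c where "c = Poly_Mapping.lookup q 0"
      have c: "q = const c" using topdeg_0_const[OF True] by (simp add: c_def)
      then have "const (inverse c) * (b ^ k * q) = b ^ k"
        using less.prems(1) by (simp add: mult.left_commute flip: const_mult)
      then show ?thesis using idl_mult[OF Ia less.prems(3)] by metis
    next
      case False
      then obtain i where i: "i \<in> z" "pd i q \<noteq> 0" using ex_pd_nonzero[of q z] less.prems by auto
      have "pd y q = 0" if "y \<in> Y" for y using less.prems(2) that by (intro pd_not_in) (auto simp: z_def)
      then have Dq: "D i q = b * pd i q" by (simp add: D_eq[OF i(1)])
      \<comment> \<open>The additional factor b turns the term from differentiating
        \<open>b ^ k\<close> into a multiple of \<open>b ^ k * q\<close>, which is already in the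
        annihilator.\<close>
      have "b * D i (b ^ k * q) = of_nat k * D i b * (b ^ k * q) + b ^ Suc (Suc k) * pd i q"
      proof (cases k)
        case (Suc n)
        have "D i (b ^ k) = of_nat k * b ^ n * D i b" unfolding D_def Suc by (subst der_power) simp
        then show ?thesis by (simp add: D_mult Dq Suc algebra_simps)
      qed (simp add: Dq algebra_simps)
      then have "b ^ Suc (Suc k) * pd i q = b * D i (b ^ k * q) - of_nat k * D i b * (b ^ k * q)"
        by simp
      also have "\<dots> \<in> \<aa>" by (intro idl_diff[OF Ia] idl_mult[OF Ia] Da i less.prems)
      finally show ?thesis
        using less.hyps[OF topdeg_pd i(2) pd_polys_in] False less.prems by blast
    qed
  qed
  obtain K where "b ^ K \<in> \<aa>" using red[of q 0] q idl_0[OF I] by auto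
  then show ?thesis using that[of K] by (auto simp: \<aa>_def)
qed

section \<open>Homogeneous ideals and points of projective space\<close>

definition graded :: "('v::{finite,linorder}, 'k::field) mpoly set \<Rightarrow> bool" where
  "graded J \<longleftrightarrow> (\<forall>f\<in>J. \<forall>d. hcomp d f \<in> J)"

lemma gradedD: "graded J \<Longrightarrow> f \<in> J \<Longrightarrow> hcomp d f \<in> J"
  by (simp add: graded_def)

lemma graded_UNIV [simp]: "graded UNIV" and idl_UNIV [simp]: "idl UNIV"
  by (auto simp: graded_def idl_def)

lemma idl_mem_if_hcomp: "idl J \<Longrightarrow> (\<And>d. hcomp d f \<in> J) \<Longrightarrow> f \<in> J"
  by (rule homog_induct_sum) (auto intro: idl_0 idl_add)

lemma hcomp_mult: "hcomp E (a * c) = (\<Sum>j\<le>E. hcomp j a * hcomp (E - j) c)"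
proof -
  define n where "n = max (topdeg a) E"
  have "hcomp E (a * c) = hcomp E ((\<Sum>j\<le>n. hcomp j a) * c)" by (simp add: sum_hcomp n_def)
  also have "\<dots> = (\<Sum>j\<le>n. hcomp E (hcomp j a * c))" by (simp add: sum_distrib_right hcomp_sum)
  also have "\<dots> = (\<Sum>j\<le>n. if j \<le> E then hcomp j a * hcomp (E - j) c else 0)"
    by (simp add: hcomp_mult_homog[OF homog_hcomp])
  also have "\<dots> = (\<Sum>j\<le>E. hcomp j a * hcomp (E - j) c)"
    by (rule sum.mono_neutral_cong_right) (auto simp: n_def)
  finally show ?thesis .
qed

lemma idl_prod_add: "s \<in> idl_prod A B \<Longrightarrow> t \<in> idl_prod A B \<Longrightarrow> s + t \<in> idl_prod A B"
  by (induction rule: idl_prod.induct) (auto simp: add.assoc intro: idl_prod.add)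

lemma idl_prod_sum: "(\<And>i. i \<in> I \<Longrightarrow> f i \<in> idl_prod A B) \<Longrightarrow> sum f I \<in> idl_prod A B"
  by (induction I rule: infinite_finite_induct) (auto intro: idl_prod_add idl_prod.zero)

lemma graded_idl_prod: "graded A \<Longrightarrow> graded B \<Longrightarrow> graded (idl_prod A B)"
  unfolding graded_def[of "idl_prod A B"]
proof (intro ballI allI)
  fix s d assume AB: "graded A" "graded B" and "s \<in> idl_prod A B"
  from this(3) show "hcomp d s \<in> idl_prod A B"
    by induction (auto simp: hcomp_add hcomp_mult AB idl_prod.zero
        intro!: idl_prod_add idl_prod_sum idl_prod_mem gradedD)
qed

lemma idl_prod_UNIV: "idl J \<Longrightarrow> idl_prod J UNIV = J"
  using idl_prod_subset[of J UNIV] idl_prod_mem[of _ J 1 UNIV] by auto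

text \<open>For a and b outside J, take their highest components outside J. In the sum of the two
  degrees the component of \<open>a * b\<close> is the product of these, up to terms of J.\<close>

lemma prime_if_homogeneous:
  assumes J: "idl J" "graded J" "1 \<notin> J"
    and pr: "\<And>a b d e. homog d a \<Longrightarrow> homog e b \<Longrightarrow> a * b \<in> J \<Longrightarrow> a \<in> J \<or> b \<in> J"
  shows "prime_idl J"
  unfolding prime_idl_def
proof (intro conjI J allI impI)
  fix a b assume ab: "a * b \<in> J"
  show "a \<in> J \<or> b \<in> J"
  proof (rule ccontr)
    assume n: "\<not> (a \<in> J \<or> b \<in> J)"
    have ex: "\<exists>i. hcomp i f \<notin> J \<and> (\<forall>k>i. hcomp k f \<in> J)" if "f \<notin> J" for f
    proof -
      define A where "A = {i. hcomp i f \<notin> J}"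
      have "A \<subseteq> {..topdeg f}"
      proof
        fix i assume "i \<in> A"
        then have "hcomp i f \<noteq> 0" using idl_0[OF J(1)] by (auto simp: A_def)
        then show "i \<in> {..topdeg f}" using hcomp_gt_topdeg[of f i] by force
      qed
      moreover have "A \<noteq> {}" using idl_mem_if_hcomp[OF J(1)] that by (auto simp: A_def)
      ultimately have A: "finite A" "Max A \<in> A" by (auto simp: finite_subset)
      have "hcomp k f \<in> J" if "k > Max A" for k
      proof -
        have "k \<notin> A" using Max_ge[OF A(1), of k] that by auto
        then show ?thesis by (simp add: A_def)
      qed
      moreover have "hcomp (Max A) f \<notin> J" using A(2) unfolding A_def by blast
      ultimately show ?thesis by blast
    qed
    obtain i where i: "hcomp i a \<notin> J" "\<And>k. k > i \<Longrightarrow> hcomp k a \<in> J" using ex n by blast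
    obtain j where j: "hcomp j b \<notin> J" "\<And>k. k > j \<Longrightarrow> hcomp k b \<in> J" using ex n by blast
    have "(\<Sum>l\<in>{..i+j} - {i}. hcomp l a * hcomp (i + j - l) b) \<in> J"
    proof (rule idl_sum[OF J(1)])
      fix l assume "l \<in> {..i+j} - {i}"
      then have "l > i \<or> i + j - l > j" by auto
      then show "hcomp l a * hcomp (i + j - l) b \<in> J"
        using i(2) j(2) idl_mult[OF J(1)] idl_mult2[OF J(1)] by blast
    qed
    moreover have "hcomp (i + j) (a * b) =
        hcomp i a * hcomp j b + (\<Sum>l\<in>{..i+j} - {i}. hcomp l a * hcomp (i + j - l) b)"
      unfolding hcomp_mult by (subst sum.remove[of _ i]) auto
    ultimately have "hcomp i a * hcomp j b \<in> J"
      using idl_diff[OF J(1) gradedD[OF J(2) ab, of "i + j"]] by fastforce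
    then show False using pr i(1) j(1) homog_hcomp by blast
  qed
qed

lemma proj_points_iff:
  "p \<in> proj_points \<longleftrightarrow> prime_idl p \<and> graded p \<and> (\<exists>i. var i \<notin> p)"
proof -
  have "primeideal p (polyring :: ('a, 'b) mpoly ring) \<longleftrightarrow> prime_idl p"
  proof
    assume "primeideal p (polyring :: ('a, 'b) mpoly ring)"
    then interpret primeideal p "polyring :: ('a, 'b) mpoly ring" .
    have "1 \<notin> p" using I_notcarr one_imp_carrier by (auto simp: ring_of_type_algebra_def)
    moreover have "0 \<in> p" using additive_subgroup.zero_closed[OF additive_subgroup_axioms]
      by (simp add: ring_of_type_algebra_def)
    moreover have "a + b \<in> p" if "a \<in> p" "b \<in> p" for a b
      using additive_subgroup.a_closed[OF additive_subgroup_axioms that] by (simp add: ring_of_type_algebra_def)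
    moreover have "r * a \<in> p" if "a \<in> p" for a r
      using I_l_closed[OF that, of r] by (simp add: ring_of_type_algebra_def)
    moreover have "a \<in> p \<or> b \<in> p" if "a * b \<in> p" for a b
      using I_prime[of a b] that by (simp add: ring_of_type_algebra_def)
    ultimately show "prime_idl p" by (auto simp: prime_idl_def idl_def)
  next
    assume p: "prime_idl p"
    then have I: "idl p" by (rule prime_idl_idl)
    show "primeideal p (polyring :: ('a, 'b) mpoly ring)"
    proof (rule primeidealI2[OF _ cring_from_type_algebra])
      interpret ring "polyring :: ('a, 'b) mpoly ring" by (rule ring_from_type_algebra)
      have inv: "\<ominus>\<^bsub>polyring\<^esub> x = - x" for x :: "('a, 'b) mpoly"
        using minus_equality[of "- x" x] by (simp add: ring_of_type_algebra_def)
      have "subgroup p (add_monoid (polyring :: ('a, 'b) mpoly ring))"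
        using I inv by (intro subgroup.intro)
          (auto simp: ring_of_type_algebra_def idl_add idl_0 idl_uminus a_inv_def)
      then show "additive_subgroup p (polyring :: ('a, 'b) mpoly ring)"
        by (rule additive_subgroup.intro)
    qed (use p in \<open>auto simp: ring_of_type_algebra_def prime_idl_def idl_mult idl_mult2\<close>)
  qed
  then show ?thesis by (auto simp: proj_points_def graded_def)
qed

lemma proj_pointsD:
  assumes "p \<in> proj_points"
  shows "prime_idl p" "graded p" "idl p" "0 \<in> p" "1 \<notin> p"
  using assms by (auto simp: proj_points_iff prime_idl_idl idl_0 prime_idl_one)

lemma proj_points_var: "p \<in> proj_points \<Longrightarrow> \<exists>i. var i \<notin> p"
  by (simp add: proj_points_iff)

text \<open>By Zorn's lemma there is a largest graded ideal that contains J and no power of f. For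
  homogeneous a the ideal p + (a), called \<open>N\<close> below, is again graded, so maximality
  puts a power of f into it unless a is in p; primality then needs homogeneous elements
  only.\<close>

lemma homogeneous_avoidance:
  assumes J: "idl J" "graded J" and f: "homog m f" "\<And>K. f ^ K \<notin> J"
  obtains p where "prime_idl p" "graded p" "J \<subseteq> p" "f \<notin> p"
proof -
  define Av where "Av = {I. idl I \<and> graded I \<and> J \<subseteq> I \<and> (\<forall>K. f ^ K \<notin> I)}"
  have "\<exists>M\<in>Av. \<forall>N\<in>Av. M \<subseteq> N \<longrightarrow> N = M"
  proof (rule subset_Zorn_nonempty)
    show "Av \<noteq> {}" using assms by (auto simp: Av_def)
    fix Ch assume C: "Ch \<noteq> {}" "subset.chain Av Ch"
    then have CA: "\<And>I. I \<in> Ch \<Longrightarrow> I \<in> Av" and lin: "\<And>I I'. I \<in> Ch \<Longrightarrow> I' \<in> Ch \<Longrightarrow> I \<subseteq> I' \<or> I' \<subseteq> I"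
      by (auto simp: subset_chain_def)
    have "idl (\<Union>Ch)"
      unfolding idl_def
    proof (intro conjI ballI allI)
      show "0 \<in> \<Union>Ch" using C(1) CA by (auto simp: Av_def idl_def)
      show "r * a \<in> \<Union>Ch" if a: "a \<in> \<Union>Ch" for r a
      proof -
        obtain I where "I \<in> Ch" "a \<in> I" using a by blast
        then show ?thesis using CA[of I] by (auto simp: Av_def intro: idl_mult)
      qed
      show "a + b \<in> \<Union>Ch" if ab: "a \<in> \<Union>Ch" "b \<in> \<Union>Ch" for a b
      proof -
        obtain I I' where I: "I \<in> Ch" "a \<in> I" "I' \<in> Ch" "b \<in> I'" using ab by blast
        then obtain I'' where "I'' \<in> Ch" "a \<in> I''" "b \<in> I''" using lin by blast
        then show ?thesis using CA[of I''] by (auto simp: Av_def intro: idl_add)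
      qed
    qed
    moreover have "\<And>I. I \<in> Ch \<Longrightarrow> graded I" using CA by (simp add: Av_def)
    then have "graded (\<Union>Ch)" unfolding graded_def by blast
    moreover have "J \<subseteq> \<Union>Ch" using C(1) CA by (auto simp: Av_def)
    ultimately show "\<Union>Ch \<in> Av" using CA by (auto simp: Av_def)
  qed
  then obtain p where p: "p \<in> Av" and max: "\<And>N. N \<in> Av \<Longrightarrow> p \<subseteq> N \<Longrightarrow> N = p" by blast
  then have pI: "idl p" "graded p" "J \<subseteq> p" "\<And>K. f ^ K \<notin> p" by (auto simp: Av_def)
  have big: "\<exists>K. \<exists>r. f ^ K - r * a \<in> p" if a: "homog d a" "a \<notin> p" for d a
  proof -
    define N where "N = {x. \<exists>r. x - r * a \<in> p}"
    have "idl N" unfolding idl_def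
    proof (intro conjI ballI allI)
      show "0 \<in> N" using idl_0[OF pI(1)] by (auto simp: N_def intro!: exI[of _ 0])
      show "x + y \<in> N" if xy: "x \<in> N" "y \<in> N" for x y
      proof -
        obtain r s where "x - r * a \<in> p" "y - s * a \<in> p" using xy by (auto simp: N_def)
        from idl_add[OF pI(1) this] show ?thesis
          by (auto simp: N_def algebra_simps intro!: exI[of _ "r + s"])
      qed
      show "s * x \<in> N" if x: "x \<in> N" for s x
      proof -
        obtain r where "x - r * a \<in> p" using x by (auto simp: N_def)
        from idl_mult[OF pI(1) this, of s] show ?thesis
          by (auto simp: N_def algebra_simps intro!: exI[of _ "s * r"])
      qed
    qed
    moreover have "graded N" unfolding graded_def
    proof (intro ballI allI)
      fix x e assume "x \<in> N"
      then obtain r where "x - r * a \<in> p" unfolding N_def by blast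
      then have r: "x - a * r \<in> p" by (simp add: mult.commute)
      have "hcomp e (x - a * r) \<in> p" by (rule gradedD[OF pI(2) r])
      then have "hcomp e x - (if d \<le> e then hcomp (e - d) r else 0) * a \<in> p"
        by (auto simp: hcomp_diff hcomp_mult_homog[OF a(1)] mult.commute split: if_splits)
      then show "hcomp e x \<in> N" unfolding N_def by blast
    qed
    moreover have pN: "p \<subseteq> N" by (auto simp: N_def intro!: exI[of _ 0])
    moreover have "a \<in> N" using idl_0[OF pI(1)] by (auto simp: N_def intro!: exI[of _ 1])
    ultimately have "\<not> (\<forall>K. f ^ K \<notin> N)" using max[of N] pI(3) a(2) by (auto simp: Av_def)
    then show ?thesis by (auto simp: N_def)
  qed
  have "prime_idl p"
  proof (rule prime_if_homogeneous[OF pI(1,2)])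
    show "1 \<notin> p" using pI(4)[of 0] by simp
    fix a b d e assume ab: "homog d a" "homog e b" "a * b \<in> p"
    show "a \<in> p \<or> b \<in> p"
    proof (rule ccontr)
      assume "\<not> (a \<in> p \<or> b \<in> p)"
      then obtain K r L s where *: "f ^ K - r * a \<in> p" "f ^ L - s * b \<in> p"
        using big ab by metis
      have "f ^ (K + L) = (f ^ K - r * a) * f ^ L + r * a * (f ^ L - s * b) + r * s * (a * b)"
        by (simp add: power_add algebra_simps)
      also have "\<dots> \<in> p"
        by (intro idl_add[OF pI(1)] idl_mult2[OF pI(1) *(1)] idl_mult[OF pI(1)] * ab)
      finally show False using pI(4) by blast
    qed
  qed
  moreover have "f \<notin> p" using pI(4)[of 1] by simp
  ultimately show ?thesis using that pI by blast
qed

text \<open>The projective Nullstellensatz: a graded prime over J avoiding a variable would be a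
  point of projective space where J vanishes. It is the source of quasi-compactness below.\<close>

lemma var_power_mem:
  assumes "idl J" "graded J" "\<And>p. p \<in> proj_points \<Longrightarrow> \<exists>f\<in>J. f \<notin> p"
  shows "\<exists>K. var i ^ K \<in> J"
proof (rule ccontr)
  assume "\<not> ?thesis"
  then obtain p where "prime_idl p" "graded p" "J \<subseteq> p" "var i \<notin> p"
    using homogeneous_avoidance[OF assms(1,2), of 1 "var i"] by auto
  then show False using assms(3)[of p] by (auto simp: proj_points_iff)
qed

subsection \<open>The Zariski topology\<close>

lemma generic_point: "{0} \<in> proj_points"
  by (auto simp: proj_points_iff prime_idl_def idl_def graded_def)

lemma openin_basic_open: "homog d f \<Longrightarrow> openin Pn (basic_open f)"
  unfolding Pn_def by (rule topology_generated_by_Basis) blast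

lemma topspace_Pn [simp]: "topspace Pn = proj_points"
proof -
  have "\<Union>{basic_open f | f d. homog d f} = (proj_points :: ('v::{finite,linorder}, 'k::field) proj_point set)"
  proof
    have "basic_open 1 = (proj_points :: ('v, 'k) proj_point set)"
      by (auto simp: basic_open_def proj_pointsD)
    then show "(proj_points :: ('v, 'k) proj_point set) \<subseteq> \<Union>{basic_open f | f d. homog d f}"
      using homog_1 by blast
  qed (auto simp: basic_open_def)
  then show ?thesis by (simp add: Pn_def)
qed

text \<open>Points are prime, so basic open sets are closed under intersection and form a
  base.\<close>

lemma openin_Pn_base:
  assumes "openin Pn U" "p \<in> U"
  obtains f d where "homog d f" "p \<in> basic_open f" "basic_open f \<subseteq> U"
proof -
  have "generate_topology_on {basic_open f | f d. homog d f} U"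
    using assms(1) unfolding Pn_def by (rule openin_topology_generated_by)
  then have "\<forall>p\<in>U. \<exists>f d. homog d f \<and> p \<in> basic_open f \<and> basic_open f \<subseteq> U"
  proof induction
    case (Int a b)
    show ?case
    proof
      fix p assume "p \<in> a \<inter> b"
      then obtain f d g e where *: "homog d f" "p \<in> basic_open f" "basic_open f \<subseteq> a"
        "homog e g" "p \<in> basic_open g" "basic_open g \<subseteq> b" using Int.IH by blast
      have "basic_open (f * g) = basic_open f \<inter> basic_open g"
        by (auto simp: basic_open_def prime_idl_mult_iff proj_pointsD)
      then show "\<exists>f d. homog d f \<and> p \<in> basic_open f \<and> basic_open f \<subseteq> a \<inter> b"
        using * homog_mult by (metis Int_iff Int_mono)
    qed
  next
    case (UN K)
    then show ?case by (meson UnionE Union_upper order_trans)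
  qed blast+
  then show ?thesis using that assms(2) by blast
qed

lemma openin_Pn_subset: "openin Pn U \<Longrightarrow> U \<subseteq> proj_points"
  using openin_subset by fastforce

lemma generic_in_open: "openin Pn U \<Longrightarrow> p \<in> U \<Longrightarrow> {0} \<in> U"
proof -
  assume "openin Pn U" "p \<in> U"
  then obtain f d where f: "homog d f" "p \<in> basic_open f" "basic_open f \<subseteq> U" by (rule openin_Pn_base)
  then have "f \<noteq> 0" using proj_pointsD(4) by (auto simp: basic_open_def)
  then have "{0} \<in> basic_open f" using generic_point by (auto simp: basic_open_def)
  then show ?thesis using f by blast
qed

section \<open>Sheaves attached to homogeneous ideals\<close>

text \<open>\<open>Fr J d p\<close> is the degree \<open>d\<close> part of the localization of \<open>J\<close> at \<open>p\<close>.\<close>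

definition Fr :: "('v::{finite,linorder}, 'k::field) mpoly set \<Rightarrow> nat \<Rightarrow> ('v, 'k) proj_point \<Rightarrow>
    ('v, 'k) mpoly fract set" where
  "Fr J d p = {to_fract a / to_fract b | a b e. a \<in> J \<and> b \<notin> p \<and> homog (e + d) a \<and> homog e b}"

lemma FrI: "a \<in> J \<Longrightarrow> b \<notin> p \<Longrightarrow> homog (e + d) a \<Longrightarrow> homog e b \<Longrightarrow> to_fract a / to_fract b \<in> Fr J d p"
  unfolding Fr_def by blast

lemma FrE:
  assumes "x \<in> Fr J d p"
  obtains a b e where "x = to_fract a / to_fract b" "a \<in> J" "b \<notin> p" "homog (e + d) a" "homog e b"
  using assms unfolding Fr_def by blast

lemma Fr_to_fract: "1 \<notin> p \<Longrightarrow> a \<in> J \<Longrightarrow> homog d a \<Longrightarrow> to_fract a \<in> Fr J d p"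
  using FrI[of a J 1 p 0 d] by simp

lemma Fr_mono: "J \<subseteq> J' \<Longrightarrow> Fr J d p \<subseteq> Fr J' d p"
  unfolding Fr_def by blast

lemma proj_nonzero: "p \<in> proj_points \<Longrightarrow> b \<notin> p \<Longrightarrow> b \<noteq> 0"
  using proj_pointsD(4) by blast

lemma to_fract_power: "to_fract (x ^ n) = to_fract x ^ n"
  by (induction n) auto

context
  fixes p :: "('v::{finite,linorder}, 'k::field) proj_point"
  assumes p: "p \<in> proj_points"
begin

lemma Fr_0: "idl J \<Longrightarrow> 0 \<in> Fr J d p"
  using FrI[of 0 J 1 p 0 d] proj_pointsD(5)[OF p] by (simp add: idl_0)

lemma Fr_add:
  assumes J: "idl J" and x: "x \<in> Fr J d p" and y: "y \<in> Fr J d p"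
  shows "x + y \<in> Fr J d p"
proof -
  obtain a b e where x: "x = to_fract a / to_fract b" "a \<in> J" "b \<notin> p" "homog (e + d) a" "homog e b"
    using x by (rule FrE)
  obtain a' b' e' where y: "y = to_fract a' / to_fract b'" "a' \<in> J" "b' \<notin> p" "homog (e' + d) a'" "homog e' b'"
    using y by (rule FrE)
  have "b \<noteq> 0" "b' \<noteq> 0" using x y proj_nonzero[OF p] by auto
  then have "x + y = to_fract (a * b' + a' * b) / to_fract (b * b')"
    unfolding x(1) y(1) by (simp add: field_simps)
  moreover have "b * b' \<notin> p" using x y by (simp add: prime_idl_mult_iff proj_pointsD[OF p])
  moreover have "a * b' + a' * b \<in> J" using x y J by (intro idl_add idl_mult2)
  moreover have "homog (e + e' + d) (a * b' + a' * b)"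
    using homog_mult[OF x(4) y(5)] homog_mult[OF y(4) x(5)] by (intro homog_add) (simp_all add: ac_simps)
  moreover have "homog (e + e') (b * b')" using x y by (intro homog_mult)
  ultimately show ?thesis by (simp only: FrI[of _ _ _ _ "e + e'"] simp_thms)
qed

lemma Fr_mult:
  assumes x: "x \<in> Fr J d p" and y: "y \<in> Fr J' d' p"
  shows "x * y \<in> Fr (idl_prod J J') (d + d') p"
proof -
  obtain a b e where x: "x = to_fract a / to_fract b" "a \<in> J" "b \<notin> p" "homog (e + d) a" "homog e b"
    using x by (rule FrE)
  obtain a' b' e' where y: "y = to_fract a' / to_fract b'" "a' \<in> J'" "b' \<notin> p" "homog (e' + d') a'" "homog e' b'"
    using y by (rule FrE)
  have "a * a' \<in> idl_prod J J'" using x y by (intro idl_prod_mem)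
  moreover have "x * y = to_fract (a * a') / to_fract (b * b')" unfolding x(1) y(1) by simp
  moreover have "b * b' \<notin> p" using x y by (simp add: prime_idl_mult_iff proj_pointsD[OF p])
  moreover have "homog (e + e' + (d + d')) (a * a')"
    using homog_mult[OF x(4) y(4)] by (simp add: ac_simps)
  moreover have "homog (e + e') (b * b')" using x y by (intro homog_mult)
  ultimately show ?thesis by (simp only: FrI[of _ _ _ _ "e + e'"] simp_thms)
qed

lemma Fr_mult_UNIV:
  assumes "idl J" "x \<in> Fr J d p" "y \<in> Fr UNIV d' p"
  shows "x * y \<in> Fr J (d + d') p"
  using Fr_mult[OF assms(2,3)] by (simp add: idl_prod_UNIV assms)

lemma Fr_uminus: "idl J \<Longrightarrow> x \<in> Fr J d p \<Longrightarrow> - x \<in> Fr J d p"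
proof -
  assume J: "idl J" and x: "x \<in> Fr J d p"
  have "to_fract (- 1) = - (1 :: ('v, 'k) mpoly fract)" by simp
  moreover have "to_fract (- 1) \<in> Fr UNIV 0 p"
    using proj_pointsD(5)[OF p] by (intro Fr_to_fract homog_uminus) auto
  ultimately show ?thesis using Fr_mult_UNIV[OF J x, of "- 1" 0] by simp
qed

lemma Fr_diff: "idl J \<Longrightarrow> x \<in> Fr J d p \<Longrightarrow> y \<in> Fr J d p \<Longrightarrow> x - y \<in> Fr J d p"
  using Fr_add[of J x d "- y"] Fr_uminus[of J y d] by simp

lemma Fr_sum: "idl J \<Longrightarrow> (\<And>i. i \<in> A \<Longrightarrow> f i \<in> Fr J d p) \<Longrightarrow> sum f A \<in> Fr J d p"
  by (induction A rule: infinite_finite_induct) (auto intro: Fr_add Fr_0)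

lemma Fr_open:
  assumes x: "x \<in> Fr J d p"
  obtains V where "openin Pn V" "p \<in> V" "\<And>q. q \<in> V \<Longrightarrow> x \<in> Fr J d q"
proof -
  obtain a b e where x: "x = to_fract a / to_fract b" "a \<in> J" "b \<notin> p" "homog (e + d) a" "homog e b"
    using x by (rule FrE)
  then show ?thesis using p openin_basic_open[of e b]
    by (intro that[of "basic_open b"]) (auto simp: basic_open_def intro: FrI)
qed

text \<open>The numerator itself need not be in J, since J need not be saturated. Statements about
  stalks of \<open>idl_prod P P\<close> become statements about polynomials in this form.\<close>

lemma Fr_frac_iff:
  assumes J: "idl J" and b: "b \<noteq> 0" "homog e b" "homog (e + d) a" "b \<notin> p"
  shows "to_fract a / to_fract b \<in> Fr J d p \<longleftrightarrow> (\<exists>c l. homog l c \<and> c \<notin> p \<and> c * a \<in> J)"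
proof
  assume "to_fract a / to_fract b \<in> Fr J d p"
  then obtain a' b' e' where x: "to_fract a / to_fract b = to_fract a' / to_fract b'" "a' \<in> J" "b' \<notin> p"
    "homog e' b'" by (rule FrE)
  then have "to_fract (b' * a) = to_fract (a' * b)"
    using b(1) proj_nonzero[OF p x(3)] by (simp add: field_simps)
  then have "b' * a = a' * b" by (simp only: to_fract_eq_iff)
  then show "\<exists>c l. homog l c \<and> c \<notin> p \<and> c * a \<in> J" using x idl_mult2[OF J x(2)] by metis
next
  assume "\<exists>c l. homog l c \<and> c \<notin> p \<and> c * a \<in> J"
  then obtain c l where c: "homog l c" "c \<notin> p" "c * a \<in> J" by blast
  have "to_fract (c * a) / to_fract (c * b) \<in> Fr J d p"
    using c b homog_mult[OF c(1) b(3)] homog_mult[OF c(1) b(2)]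
    by (intro FrI[of _ _ _ _ "l + e"]) (auto simp: prime_idl_mult_iff proj_pointsD[OF p] ac_simps)
  moreover have "c \<noteq> 0" using c proj_nonzero[OF p] by blast
  ultimately show "to_fract a / to_fract b \<in> Fr J d p" by simp
qed

lemma Fr_eq_UNIV:
  assumes J: "idl J" and h: "h \<in> J" "homog l h" "h \<notin> p"
  shows "Fr J d p = Fr UNIV d p"
proof
  show "Fr UNIV d p \<subseteq> Fr J d p"
  proof
    fix x assume "x \<in> Fr UNIV d p"
    then obtain a b e where x: "x = to_fract a / to_fract b" "b \<notin> p" "homog (e + d) a" "homog e b"
      by (rule FrE)
    then show "x \<in> Fr J d p"
      using Fr_frac_iff[OF J proj_nonzero[OF p x(2)] x(4,3,2)] h idl_mult2[OF J h(1)] by blast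
  qed
qed (auto simp: Fr_def)

lemma Fr_div_var:
  assumes "x \<in> Fr UNIV (M + d) p" "var i \<notin> p"
  shows "x / to_fract (var i) ^ M \<in> Fr UNIV d p"
proof -
  obtain a b e where x: "x = to_fract a / to_fract b" "b \<notin> p" "homog (e + (M + d)) a" "homog e b"
    using assms(1) by (rule FrE)
  have "x / to_fract (var i) ^ M = to_fract a / to_fract (b * var i ^ M)"
    by (simp add: x(1) to_fract_power)
  moreover have "b * var i ^ M \<notin> p" using x(2) assms(2) prime_idl_power[of p]
    by (auto simp: prime_idl_mult_iff proj_pointsD[OF p])
  moreover have "homog (e + M) (b * var i ^ M)" using x(4) by (intro homog_mult) auto
  moreover have "homog (e + M + d) a" using x(3) by (simp add: add.assoc)
  ultimately show ?thesis by (simp only: FrI[of _ _ _ _ "e + M"] UNIV_I simp_thms)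
qed

end

lemma idl_prod_as_sum:
  "x \<in> idl_prod A B \<Longrightarrow> \<exists>m \<alpha> \<beta>. (\<forall>i<m. \<alpha> i \<in> A \<and> \<beta> i \<in> B) \<and> x = (\<Sum>i<(m::nat). \<alpha> i * \<beta> i)"
proof (induction rule: idl_prod.induct)
  case (add a b s)
  then obtain m \<alpha> \<beta> where *: "\<And>i. i < m \<Longrightarrow> \<alpha> i \<in> A \<and> \<beta> i \<in> B" "s = (\<Sum>i<(m::nat). \<alpha> i * \<beta> i)" by blast
  define \<alpha>' \<beta>' where "\<alpha>' = \<alpha>(m := a)" and "\<beta>' = \<beta>(m := b)"
  have "\<forall>i<Suc m. \<alpha>' i \<in> A \<and> \<beta>' i \<in> B" using * add by (auto simp: \<alpha>'_def \<beta>'_def less_Suc_eq)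
  moreover have "a * b + s = (\<Sum>i<Suc m. \<alpha>' i * \<beta>' i)" by (simp add: *(2) \<alpha>'_def \<beta>'_def add.commute)
  ultimately show ?case by blast
qed (auto intro: exI[of _ 0])

text \<open>
  To split a product of total degree \<open>e + (d + d')\<close> over a denominator of degree \<open>e\<close>, a
  homogeneous factor of degree \<open>j\<close> is divided by \<open>x\<^sub>i\<^sup>j\<close> and multiplied by \<open>x\<^sub>i\<^sup>d\<close>.
\<close>

lemma Fr_idl_prod:
  assumes p: "p \<in> proj_points" and J: "graded J" "graded J'" "idl J" "idl J'"
    and x: "x \<in> Fr (idl_prod J J') (d + d') p"
  shows "x \<in> idl_prod (Fr J d p) (Fr J' d' p)"
proof -
  obtain a b e where x: "x = to_fract a / to_fract b" "a \<in> idl_prod J J'" "b \<notin> p"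
    "homog (e + (d + d')) a" "homog e b" using x by (rule FrE)
  obtain i where i: "var i \<notin> p" using proj_points_var[OF p] by blast
  have vi: "var i ^ n \<notin> p" for n using i prime_idl_power proj_pointsD[OF p] by blast
  have prod_mem: "to_fract (u * v) / to_fract b \<in> idl_prod (Fr J d p) (Fr J' d' p)"
    if uv: "u \<in> J" "v \<in> J'" "homog j u" "homog j' v" "j + j' = e + (d + d')" for u v j j'
  proof -
    have "to_fract (u * var i ^ d) / to_fract (var i ^ j) \<in> Fr J d p"
      using uv vi by (intro FrI[of _ _ _ _ j] homog_mult idl_mult2[OF J(3)]) auto
    moreover have "to_fract (v * var i ^ j) / to_fract (b * var i ^ d) \<in> Fr J' d' p"
    proof (rule FrI)
      have "homog (j' + j) (v * var i ^ j)" using uv by (intro homog_mult) auto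
      then show "homog (e + d + d') (v * var i ^ j)" using uv(5) by (simp add: ac_simps)
      show "homog (e + d) (b * var i ^ d)" using x by (intro homog_mult) auto
      show "b * var i ^ d \<notin> p" using x vi by (simp add: prime_idl_mult_iff proj_pointsD[OF p])
      show "v * var i ^ j \<in> J'" using uv by (intro idl_mult2[OF J(4)])
    qed
    moreover have "to_fract (u * v) / to_fract b =
        (to_fract (u * var i ^ d) / to_fract (var i ^ j)) * (to_fract (v * var i ^ j) / to_fract (b * var i ^ d))"
      by (simp add: to_fract_power)
    ultimately show ?thesis by (simp only: idl_prod_mem)
  qed
  have "to_fract (hcomp (e + (d + d')) s) / to_fract b \<in> idl_prod (Fr J d p) (Fr J' d' p)"
    if "s \<in> idl_prod J J'" for s using that
  proof induction
    case (add u v s)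
    have "to_fract (hcomp (e + (d + d')) (u * v + s)) / to_fract b =
        (\<Sum>j\<le>e + (d + d'). to_fract (hcomp j u * hcomp (e + (d + d') - j) v) / to_fract b) +
        to_fract (hcomp (e + (d + d')) s) / to_fract b"
      by (simp add: hcomp_add hcomp_mult to_fract_sum add_divide_distrib sum_divide_distrib)
    also have "\<dots> \<in> idl_prod (Fr J d p) (Fr J' d' p)"
      using add J
      by (intro idl_prod_add idl_prod_sum prod_mem[OF _ _ homog_hcomp homog_hcomp] add.IH) (auto intro: gradedD homog_hcomp)
    finally show ?case .
  qed (simp add: idl_prod.zero)
  from this[OF x(2)] show ?thesis using hcomp_homog[OF x(4)] x(1) by simp
qed

subsection \<open>Divisibility by powers of variables\<close>

lemma var_power: "(var i :: ('v::{finite,linorder}, 'k::field) mpoly) ^ M = Poly_Mapping.single (Poly_Mapping.single i M) 1"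
  by (induction M) (auto simp: var_def mult_single simp flip: single_add)

lemma lookup_var_power_mult:
  "Poly_Mapping.lookup (var i ^ M * f) (m + Poly_Mapping.single i M) = Poly_Mapping.lookup f m"
  using lookup_single_mult[of "Poly_Mapping.single i M" 1 f m] by (simp add: var_power add.commute)

lemma lookup_var_power_mult_0:
  assumes "Poly_Mapping.lookup m i < M"
  shows "Poly_Mapping.lookup (var i ^ M * f) m = 0"
proof (rule ccontr)
  assume a: "Poly_Mapping.lookup (var i ^ M * f) m \<noteq> 0"
  have "m \<in> Poly_Mapping.keys (var i ^ M * f)" using a by (simp add: in_keys_iff)
  then obtain n where "m = Poly_Mapping.single i M + n"
    using Poly_Mapping.keys_mult[of "var i ^ M" f] by (auto simp: var_power split: if_splits)
  then show False using assms by (simp add: lookup_add)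
qed

lemma divide_var_power:
  fixes f :: "('v::{finite,linorder}, 'k::field) mpoly"
  assumes f: "homog (M + d) f" and div: "\<And>m. Poly_Mapping.lookup f m \<noteq> 0 \<Longrightarrow> M \<le> Poly_Mapping.lookup m i"
  obtains u where "f = var i ^ M * u" "homog d u"
proof -
  define u where "u = (\<Sum>m\<in>Poly_Mapping.keys f.
    Poly_Mapping.single (m - Poly_Mapping.single i M) (Poly_Mapping.lookup f m))"
  have m: "Poly_Mapping.single i M + (m - Poly_Mapping.single i M) = m" if "m \<in> Poly_Mapping.keys f" for m
    using div[of m] that
    by (intro poly_mapping_eqI) (auto simp: lookup_add lookup_minus lookup_single when_def in_keys_iff)
  have "var i ^ M * u = (\<Sum>m\<in>Poly_Mapping.keys f. Poly_Mapping.single m (Poly_Mapping.lookup f m))"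
    unfolding u_def sum_distrib_left by (intro sum.cong refl) (simp add: var_power mult_single m)
  then have "f = var i ^ M * u" by (simp add: poly_mapping_sum_singles)
  moreover have "homog d u" unfolding u_def
  proof (rule homog_sum)
    fix n assume n: "n \<in> Poly_Mapping.keys f"
    then have "mdeg n = M + d" using f by (simp add: homog_def)
    then have "mdeg (n - Poly_Mapping.single i M) = d"
      using arg_cong[OF m[OF n], of mdeg] by (simp add: mdeg_add)
    then show "homog d (Poly_Mapping.single (n - Poly_Mapping.single i M) (Poly_Mapping.lookup f n))"
      by (simp add: homog_def)
  qed
  ultimately show ?thesis using that by blast
qed

text \<open>Powers of two different variables are coprime, as the exponent of x_i in each monomial
  of f shows.\<close>

lemma divide_var_power_eq:
  fixes f g :: "('v::{finite,linorder}, 'k::field) mpoly"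
  assumes f: "homog (M + d) f" and eq: "var j ^ M * f = var i ^ M * g" "i \<noteq> j"
  obtains u where "f = var i ^ M * u" "homog d u"
proof (rule divide_var_power[OF f])
  fix m assume "Poly_Mapping.lookup f m \<noteq> 0"
  then have "Poly_Mapping.lookup (var i ^ M * g) (m + Poly_Mapping.single j M) \<noteq> 0"
    by (simp add: lookup_var_power_mult flip: eq(1))
  then have "\<not> Poly_Mapping.lookup (m + Poly_Mapping.single j M) i < M"
    using lookup_var_power_mult_0 by blast
  then show "M \<le> Poly_Mapping.lookup m i"
    using eq(2) by (simp add: lookup_add lookup_single when_def)
qed (use that in blast)

lemma single_variable_degree:
  fixes m :: "'v::finite \<Rightarrow>\<^sub>0 nat"
  assumes "UNIV = {i}" shows "mdeg m = Poly_Mapping.lookup m i"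
  by (simp add: mdeg_def assms)

subsection \<open>Global sections\<close>

text \<open>Homogeneous avoidance is applied to the ideal of denominators of \<open>s\<close>.\<close>

lemma denominator_power:
  fixes s :: "('v::{finite,linorder}, 'k::field) mpoly fract"
  assumes h: "homog m h" and s: "\<And>p. p \<in> proj_points \<Longrightarrow> h \<notin> p \<Longrightarrow> s \<in> Fr UNIV d p"
    and pos: "\<And>p. prime_idl p \<Longrightarrow> h \<notin> p \<Longrightarrow> \<exists>i. var i \<notin> p"
  shows "\<exists>K g. homog (K * m + d) g \<and> to_fract (h ^ K) * s = to_fract g"
proof -
  \<comment> \<open>Imposing the condition on each homogeneous component makes the ideal of
    denominators graded.\<close>
  define J where "J = {f. \<forall>e. \<exists>g. homog (e + d) g \<and> to_fract (hcomp e f) * s = to_fract g}"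
  have "idl J" unfolding idl_def
  proof (intro conjI ballI allI)
    show "0 \<in> J" by (auto simp: J_def intro!: exI[of _ 0])
    show "a + b \<in> J" if "a \<in> J" "b \<in> J" for a b
      unfolding J_def
    proof (intro CollectI allI)
      fix e
      obtain g g' where "homog (e + d) g" "to_fract (hcomp e a) * s = to_fract g"
        "homog (e + d) g'" "to_fract (hcomp e b) * s = to_fract g'"
        using \<open>a \<in> J\<close> \<open>b \<in> J\<close> unfolding J_def by blast
      then show "\<exists>g. homog (e + d) g \<and> to_fract (hcomp e (a + b)) * s = to_fract g"
        by (intro exI[of _ "g + g'"]) (auto simp: hcomp_add distrib_right intro: homog_add)
    qed
    show "r * a \<in> J" if "a \<in> J" for a r
      unfolding J_def
    proof (intro CollectI allI)
      fix e
      obtain g where g: "\<And>e. homog (e + d) (g e)" "\<And>e. to_fract (hcomp e a) * s = to_fract (g e)"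
        using \<open>a \<in> J\<close> unfolding J_def by (auto simp: choice_iff)
      define G where "G = (\<Sum>j\<le>e. hcomp j r * g (e - j))"
      have "homog (e + d) (hcomp j r * g (e - j))" if "j \<le> e" for j
      proof -
        have "homog (j + (e - j + d)) (hcomp j r * g (e - j))" by (intro homog_mult homog_hcomp g)
        then show ?thesis using that by simp
      qed
      then have "homog (e + d) G" unfolding G_def by (intro homog_sum) auto
      moreover have "to_fract (hcomp e (r * a)) * s = to_fract G"
        by (simp add: hcomp_mult G_def to_fract_sum sum_distrib_right mult.assoc g(2))
      ultimately show "\<exists>g. homog (e + d) g \<and> to_fract (hcomp e (r * a)) * s = to_fract g" by blast
    qed
  qed
  moreover have "graded J" unfolding graded_def
  proof (intro ballI allI)
    fix f e assume "f \<in> J"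
    then show "hcomp e f \<in> J"
      by (auto simp: J_def hcomp_homog[OF homog_hcomp] intro!: exI[of _ 0])
  qed
  moreover have "\<exists>K. h ^ K \<in> J"
  proof (rule ccontr)
    assume "\<not> ?thesis"
    then obtain p where p: "prime_idl p" "graded p" "J \<subseteq> p" "h \<notin> p"
      using homogeneous_avoidance[OF \<open>idl J\<close> \<open>graded J\<close> h] by blast
    then have pp: "p \<in> proj_points" using pos by (auto simp: proj_points_iff)
    then obtain a b e where ab: "s = to_fract a / to_fract b" "b \<notin> p" "homog (e + d) a" "homog e b"
      using s[OF pp p(4)] by (auto elim: FrE)
    have "b \<in> J" unfolding J_def
    proof (intro CollectI allI)
      fix e'
      have "to_fract b * s = to_fract a" using proj_nonzero[OF pp ab(2)] by (simp add: ab(1))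
      then show "\<exists>g. homog (e' + d) g \<and> to_fract (hcomp e' b) * s = to_fract g"
        using ab by (cases "e' = e") (auto simp: hcomp_homog intro: exI[of _ 0])
    qed
    then show False using p ab by blast
  qed
  then obtain K where "h ^ K \<in> J" by blast
  then have "\<exists>g. homog (K * m + d) g \<and> to_fract (hcomp (K * m) (h ^ K)) * s = to_fract g"
    unfolding J_def by blast
  then show ?thesis using hcomp_homog[OF homog_power[OF h, of K]] by auto
qed

lemma to_fract_var_power_neq_0 [simp]: "to_fract (var i ^ K) \<noteq> (0 :: ('v::{finite,linorder}, 'k::field) mpoly fract)"
  by simp

text \<open>By \<open>denominator_power\<close> s is a fraction over a power of each variable, with
  a common exponent M. Fractions over powers of two different variables that agree are
  polynomials.\<close>

lemma global_sections:
  fixes s :: "('v::{finite,linorder}, 'k::field) mpoly fract"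
  assumes s: "\<And>p. p \<in> proj_points \<Longrightarrow> s \<in> Fr UNIV d p"
  obtains g where "homog d g" "s = to_fract g"
proof -
  have "\<exists>g. homog d g \<and> s = to_fract g"
  proof -
  have "\<exists>K g. homog (K + d) g \<and> to_fract (var i ^ K) * s = to_fract g" for i
    using denominator_power[of 1 "var i" s d] s by auto
  then obtain K g where g: "\<And>i. homog (K i + d) (g i)" "\<And>i. to_fract (var i ^ K i) * s = to_fract (g i)"
    by metis
  define M where "M = (\<Sum>i\<in>UNIV. K i)"
  define G where "G i = var i ^ (M - K i) * g i" for i
  have KM: "K i \<le> M" for i unfolding M_def by (rule member_le_sum) auto
  have G: "homog (M + d) (G i)" "to_fract (var i ^ M) * s = to_fract (G i)" for i
  proof -
    show "homog (M + d) (G i)"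
      using homog_mult[OF homog_var_power[of "M - K i" i] g(1)[of i]] KM[of i] by (simp add: G_def)
    have "(var i ^ M :: ('v, 'k) mpoly) = var i ^ (M - K i) * var i ^ K i" using KM[of i] by (simp flip: power_add)
    then have "to_fract (var i ^ M) * s = to_fract (var i ^ (M - K i)) * (to_fract (var i ^ K i) * s)"
      by (simp only: to_fract_mult mult.assoc)
    then show "to_fract (var i ^ M) * s = to_fract (G i)"
      by (simp only: g(2) G_def to_fract_mult)
  qed
  have fin: ?thesis if "G i = var i ^ M * u" "homog d u" for i u
  proof -
    have "to_fract (var i ^ M) * s = to_fract (var i ^ M) * to_fract u"
      using G(2)[of i] that(1) by simp
    then have "s = to_fract u" by (simp only: mult_cancel_left to_fract_var_power_neq_0 simp_thms)
    then show ?thesis using \<open>homog d u\<close> by blast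
  qed
  obtain i0 :: 'v where True by blast
  show ?thesis
  proof (cases "\<exists>j. j \<noteq> i0")
    case True
    then obtain j where "j \<noteq> i0" by blast
    then have j: "i0 \<noteq> j" by (rule not_sym)
    have "to_fract (var j ^ M * G i0) = to_fract (var i0 ^ M * G j)"
      by (simp add: mult.left_commute flip: G(2))
    then have "var j ^ M * G i0 = var i0 ^ M * G j" by (simp only: to_fract_eq_iff)
    then show ?thesis using divide_var_power_eq[OF G(1) _ j] fin by metis
  next
    case False
    \<comment> \<open>With a single variable there is nothing to compare, but every form of degree M
      + d is divisible by the M-th power for reasons of degree.\<close>
    then have "UNIV = {i0}" by auto
    then have "M \<le> Poly_Mapping.lookup m i0" if "Poly_Mapping.lookup (G i0) m \<noteq> 0" for m
      using G(1)[of i0] that single_variable_degree[of i0 m] by (auto simp: homog_iff)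
    then show ?thesis using divide_var_power[OF G(1)] fin by metis
  qed
  qed
  then show ?thesis using that by blast
qed

subsection \<open>Vanishing of the first cohomology of \<open>\<O>(d)\<close>\<close>

lemma lower_part:
  fixes f :: "('v::{finite,linorder}, 'k::field) mpoly"
  assumes "homog (M + d) f"
  obtains l v where "f = l + var i ^ M * v" "homog (M + d) l" "homog d v"
    "\<And>m. Poly_Mapping.lookup l m = (if Poly_Mapping.lookup m i < M then Poly_Mapping.lookup f m else 0)"
proof -
  define l where "l = (\<Sum>m\<in>{m\<in>Poly_Mapping.keys f. Poly_Mapping.lookup m i < M}.
    Poly_Mapping.single m (Poly_Mapping.lookup f m))"
  have l: "Poly_Mapping.lookup l m = (if Poly_Mapping.lookup m i < M then Poly_Mapping.lookup f m else 0)" for m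
  proof -
    have "Poly_Mapping.lookup l m =
        (\<Sum>n\<in>{m\<in>Poly_Mapping.keys f. Poly_Mapping.lookup m i < M}. if n = m then Poly_Mapping.lookup f m else 0)"
      unfolding l_def lookup_sum by (intro sum.cong refl) (auto simp: lookup_single when_def)
    then show ?thesis by (auto simp: in_keys_iff)
  qed
  have hl: "homog (M + d) l" using assms by (auto simp: homog_iff l split: if_splits)
  obtain v where "f - l = var i ^ M * v" "homog d v"
    by (rule divide_var_power[OF homog_diff[OF assms hl]])
      (auto simp: lookup_minus l split: if_splits)
  then show ?thesis using that[of l v] l hl by (metis add_diff_cancel_left' add_diff_inverse diff_add_cancel diff_add_eq eq_diff_eq add.commute)
qed

text \<open>
  The last step of the vanishing: \<open>x\<^sub>i\<^sup>M g\<close> extends to a global section of \<open>K/\<O>(M + d)\<close> coming from \<open>G i\<close>,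
  for every \<open>i\<close>. The terms of \<open>w i = x\<^sub>0\<^sup>M G i - x\<^sub>i\<^sup>M G 0\<close> that are not divisible by \<open>x\<^sub>0\<^sup>M\<close> are
  divisible by \<open>x\<^sub>i\<^sup>M\<close>, and the quotient \<open>u\<close> does not depend on \<open>i\<close>.
\<close>

lemma descend_var_powers:
  fixes g :: "('v::{finite,linorder}, 'k::field) proj_point \<Rightarrow> ('v, 'k) mpoly fract"
  assumes G: "\<And>i p. p \<in> proj_points \<Longrightarrow> G i - to_fract (var i ^ M) * g p \<in> Fr UNIV (M + d) p"
  shows "\<exists>\<gamma>. \<forall>p\<in>proj_points. \<gamma> - g p \<in> Fr UNIV d p"
proof -
  let ?x = "\<lambda>i. to_fract (var i ^ M) :: ('v, 'k) mpoly fract"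
  have x0: "?x i \<noteq> 0" for i by (rule to_fract_var_power_neq_0)
  \<comment> \<open>The unknown \<open>g p\<close> cancels, so the difference is regular at every
    point and therefore a form.\<close>
  have w_ex: "\<exists>w. homog (M + (M + d)) w \<and> ?x j * G i - ?x i * G j = to_fract w" for i j
  proof -
    have "?x j * G i - ?x i * G j \<in> Fr UNIV (M + (M + d)) p" if p: "p \<in> proj_points" for p
    proof -
      have xF: "?x i \<in> Fr UNIV M p" for i using proj_pointsD(5)[OF p] by (intro Fr_to_fract) auto
      have "?x j * (G i - ?x i * g p) - ?x i * (G j - ?x j * g p) \<in> Fr UNIV (M + (M + d)) p"
        by (intro Fr_diff p idl_UNIV Fr_mult_UNIV xF G)
      then show ?thesis by (simp add: right_diff_distrib mult.left_commute)
    qed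
    then show ?thesis using global_sections[of "?x j * G i - ?x i * G j" "M + (M + d)"] by metis
  qed
  define w where "w i j = (SOME w. homog (M + (M + d)) w \<and> ?x j * G i - ?x i * G j = to_fract w)" for i j
  have w: "homog (M + (M + d)) (w i j)" "?x j * G i - ?x i * G j = to_fract (w i j)" for i j
    using someI_ex[OF w_ex[of j i]] unfolding w_def by blast+
  obtain o' :: 'v where True by blast
  have "\<exists>l v. w i o' = l + var o' ^ M * v \<and> homog (M + (M + d)) l \<and> homog (M + d) v \<and>
    (\<forall>m. Poly_Mapping.lookup l m = (if Poly_Mapping.lookup m o' < M then Poly_Mapping.lookup (w i o') m else 0))" for i
    using lower_part[OF w(1), of i o' o'] by metis
  then obtain l v where lv: "\<And>i. w i o' = l i + var o' ^ M * v i" "\<And>i. homog (M + (M + d)) (l i)"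
    "\<And>i. homog (M + d) (v i)"
    "\<And>i m. Poly_Mapping.lookup (l i) m = (if Poly_Mapping.lookup m o' < M then Poly_Mapping.lookup (w i o') m else 0)"
    by metis
  \<comment> \<open>Every monomial on either side has fewer than M factors x_o', whereas the
    difference of the two sides is divisible by the M-th power of x_o'.\<close>
  have l_eq: "var j ^ M * l i = var i ^ M * l j" if ij: "i \<noteq> o'" "j \<noteq> o'" for i j
  proof -
    have "to_fract (var j ^ M * w i o' - var i ^ M * w j o') = to_fract (var o' ^ M * w i j)"
      unfolding to_fract_diff to_fract_mult w(2)[symmetric] by (simp add: algebra_simps)
    then have "var j ^ M * w i o' - var i ^ M * w j o' = var o' ^ M * w i j" by (simp only: to_fract_eq_iff)
    then have e: "var j ^ M * l i - var i ^ M * l j = var o' ^ M * (w i j - var j ^ M * v i + var i ^ M * v j)"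
      unfolding lv(1) by (simp add: algebra_simps)
    have low: "Poly_Mapping.lookup (var a ^ M * l b) m = 0" if a: "a \<noteq> o'" "\<not> Poly_Mapping.lookup m o' < M" for a b m
    proof (cases "Poly_Mapping.lookup m a < M")
      case False
      define n where "n = m - Poly_Mapping.single a M"
      have m: "m = n + Poly_Mapping.single a M" unfolding n_def
        using False by (intro poly_mapping_eqI) (auto simp: lookup_add lookup_minus lookup_single when_def)
      have "Poly_Mapping.lookup m o' = Poly_Mapping.lookup n o'"
        unfolding m using a by (simp add: lookup_add lookup_single)
      then show ?thesis using a(2) by (simp add: m lookup_var_power_mult lv(4))
    qed (simp add: lookup_var_power_mult_0)
    show ?thesis
    proof (rule poly_mapping_eqI)
      fix m
      show "Poly_Mapping.lookup (var j ^ M * l i) m = Poly_Mapping.lookup (var i ^ M * l j) m"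
      proof (cases "Poly_Mapping.lookup m o' < M")
        case True
        then have "Poly_Mapping.lookup (var j ^ M * l i - var i ^ M * l j) m = 0"
          unfolding e by (rule lookup_var_power_mult_0)
        then show ?thesis by (simp add: lookup_minus)
      qed (use low ij in simp)
    qed
  qed
  have "\<exists>u. l i = var i ^ M * u \<and> homog (M + d) u" if i: "i \<noteq> o'" for i
  proof (cases "\<exists>j. j \<noteq> o' \<and> j \<noteq> i")
    case True
    then obtain j where j: "j \<noteq> o'" "j \<noteq> i" by blast
    then have ij: "i \<noteq> j" by simp
    show ?thesis by (rule divide_var_power_eq[OF lv(2) l_eq[OF i j(1)] ij]) blast
  next
    case False
    \<comment> \<open>On the projective line the degree 2M + d with fewer than M factors x_o' leaves
      at least M factors x_i.\<close>
    then have U: "UNIV = {o', i}" by auto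
    have "M \<le> Poly_Mapping.lookup m i" if m: "Poly_Mapping.lookup (l i) m \<noteq> 0" for m
    proof -
      have "mdeg m = Poly_Mapping.lookup m o' + Poly_Mapping.lookup m i"
        unfolding mdeg_def U using i by simp
      moreover have "mdeg m = M + (M + d)" using lv(2)[of i] m by (auto simp: homog_iff)
      moreover have "Poly_Mapping.lookup m o' < M" using m lv(4)[of i m] by (simp split: if_splits)
      ultimately show ?thesis by linarith
    qed
    then show ?thesis by (rule divide_var_power[OF lv(2)]) blast+
  qed
  then obtain u' where u': "\<And>i. i \<noteq> o' \<Longrightarrow> l i = var i ^ M * u' i" "\<And>i. i \<noteq> o' \<Longrightarrow> homog (M + d) (u' i)"
    by metis
  have u'_eq: "u' i = u' j" if "i \<noteq> o'" "j \<noteq> o'" for i j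
  proof -
    have "(var i ^ M * var j ^ M) * u' i = (var i ^ M * var j ^ M) * u' j"
      using l_eq[OF that] u'(1) that by (simp add: ac_simps)
    then show ?thesis by simp
  qed
  obtain u where u: "homog (M + d) u" "\<And>i. i \<noteq> o' \<Longrightarrow> l i = var i ^ M * u"
  proof (cases "\<exists>j. j \<noteq> o'")
    case True
    then obtain j where "j \<noteq> o'" by blast
    then show ?thesis using that[of "u' j"] u' u'_eq by metis
  qed (use that[of 0] in auto)
  define \<gamma> where "\<gamma> = (G o' + to_fract u) / ?x o'"
  have "\<gamma> - g p \<in> Fr UNIV d p" if p: "p \<in> proj_points" for p
  proof -
    obtain i where i: "var i \<notin> p" using proj_points_var[OF p] by blast
    \<comment> \<open>Up to adding a form, \<gamma> is obtained in the same way from every G i; at p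
      one uses an i with x_i outside p.\<close>
    have "\<exists>t. homog (M + d) t \<and> \<gamma> = (G i + to_fract t) / ?x i"
    proof (cases "i = o'")
      case False
      have "?x o' * G i - ?x i * G o' = ?x i * to_fract u + ?x o' * to_fract (v i)"
        unfolding w(2) lv(1) using u(2)[OF False] by simp
      then have "?x o' * (G i + to_fract (- v i)) = ?x i * (G o' + to_fract u)"
        by (simp add: algebra_simps)
      then have "\<gamma> = (G i + to_fract (- v i)) / ?x i"
        unfolding \<gamma>_def using x0[of i] x0[of o'] by (simp add: field_simps del: to_fract_eq_0_iff)
      then show ?thesis using homog_uminus[OF lv(3)] by blast
    qed (use u \<gamma>_def in blast)
    then obtain t where t: "homog (M + d) t" "\<gamma> = (G i + to_fract t) / ?x i" by blast
    have "\<gamma> - g p = (G i - ?x i * g p + to_fract t) / to_fract (var i) ^ M"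
      unfolding t(2) using x0[of i] by (simp add: field_simps to_fract_power del: to_fract_eq_0_iff)
    also have "\<dots> \<in> Fr UNIV d p"
      using t proj_pointsD(5)[OF p] i by (intro Fr_div_var p Fr_add G idl_UNIV Fr_to_fract) auto
    finally show ?thesis .
  qed
  then show ?thesis by blast
qed


text \<open>Over the empty set x is arbitrary, but \<open>res\<close> leaves only the zero
  function.\<close>

definition sectn :: "('v::{finite,linorder}, 'k::field) mpoly set \<Rightarrow> nat \<Rightarrow>
    (('v, 'k) proj_point, ('v, 'k) mpoly fract) fsheaf" where
  "sectn J d U = {res U (\<lambda>_. x) | x. \<forall>p\<in>U. x \<in> Fr J d p}"

text \<open>Sheaves are only ever evaluated on open sets; \<open>OPn\<close> and \<open>sectn UNIV\<close> agree there.\<close>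

definition is_sectn :: "(('v::{finite,linorder}, 'k::field) proj_point, ('v, 'k) mpoly fract) fsheaf \<Rightarrow>
    ('v, 'k) mpoly set \<Rightarrow> nat \<Rightarrow> bool" where
  "is_sectn F J d \<longleftrightarrow> (\<forall>U. openin Pn U \<longrightarrow> F U = sectn J d U)"

lemma is_sectnD: "is_sectn F J d \<Longrightarrow> openin Pn U \<Longrightarrow> F U = sectn J d U"
  by (simp add: is_sectn_def)

lemma sectnI: "(\<And>p. p \<in> U \<Longrightarrow> x \<in> Fr J d p) \<Longrightarrow> res U (\<lambda>_. x) \<in> sectn J d U"
  unfolding sectn_def by blast

lemma sectn_eqI:
  assumes "\<And>p. p \<notin> U \<Longrightarrow> s p = 0" "\<And>p. p \<in> U \<Longrightarrow> s p = x \<and> x \<in> Fr J d p"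
  shows "s \<in> sectn J d U"
proof -
  have "s = res U (\<lambda>_. x)" using assms by (auto simp: res_def)
  then show ?thesis using assms by (auto intro: sectnI)
qed

text \<open>
  The generic point \<open>{0}\<close> lies in every nonempty open set, so a section takes one value only.
\<close>

lemma is_sectn_OPn: "is_sectn (OPn d) UNIV d"
  unfolding is_sectn_def
proof (intro allI impI equalityI subsetI)
  fix U :: "('a, 'b) proj_point set" and s assume U: "openin Pn U" and "s \<in> OPn d U"
  then have s0: "\<And>p. p \<notin> U \<Longrightarrow> s p = 0"
    and s: "\<And>p. p \<in> U \<Longrightarrow> \<exists>V. openin Pn V \<and> p \<in> V \<and> V \<subseteq> U \<and>
      (\<exists>e a b. homog (e + d) a \<and> homog e b \<and> (\<forall>q\<in>V. b \<notin> q \<and> s q = Fract a b))"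
    by (auto simp: OPn_def)
  show "s \<in> sectn UNIV d U"
  proof (rule sectn_eqI[where x = "s {0}"])
    fix p assume "p \<in> U"
    from s[OF this] obtain V e a b where V: "openin Pn V" "p \<in> V" "homog (e + d) a" "homog e b"
      "\<And>q. q \<in> V \<Longrightarrow> b \<notin> q \<and> s q = Fract a b" by blast
    then have "s p = Fract a b" "s {0} = Fract a b" "b \<notin> p" using generic_in_open by blast+
    then show "s p = s {0} \<and> s {0} \<in> Fr UNIV d p"
      using V(3,4) by (auto simp: Fract_conv_to_fract intro: FrI)
  qed (rule s0)
next
  fix U :: "('a, 'b) proj_point set" and s assume U: "openin Pn U" and "s \<in> sectn UNIV d U"
  then obtain x where x: "s = res U (\<lambda>_. x)" "\<And>p. p \<in> U \<Longrightarrow> x \<in> Fr UNIV d p"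
    by (auto simp: sectn_def)
  have "\<exists>V. openin Pn V \<and> p \<in> V \<and> V \<subseteq> U \<and>
      (\<exists>e a b. homog (e + d) a \<and> homog e b \<and> (\<forall>q\<in>V. b \<notin> q \<and> s q = Fract a b))" if p: "p \<in> U" for p
  proof -
    obtain a b e where ab: "x = to_fract a / to_fract b" "b \<notin> p" "homog (e + d) a" "homog e b"
      using x(2)[OF p] by (rule FrE)
    have "p \<in> proj_points" using openin_Pn_subset[OF U] p by blast
    then show ?thesis using ab p U openin_basic_open[OF ab(4)]
      by (intro exI[of _ "U \<inter> basic_open b"] conjI openin_Int exI[of _ e] exI[of _ a] exI[of _ b])
        (auto simp: x(1) res_def Fract_conv_to_fract basic_open_def)
  qed
  then show "s \<in> OPn d U" by (auto simp: OPn_def x(1) res_def)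
qed

text \<open>Local sums of products are compared with their value at the generic point. Conversely,
  \<open>Fr_idl_prod\<close> splits a fraction into products at p, and the finitely many factors
  stay in the stalks on a neighbourhood.\<close>

lemma is_sectn_sheaf_mult:
  assumes F: "is_sectn F J d" and G: "is_sectn G J' d'"
    and J: "idl J" "idl J'" "graded J" "graded J'"
  shows "is_sectn (sheaf_mult Pn F G) (idl_prod J J') (d + d')"
  unfolding is_sectn_def
proof (intro allI impI equalityI subsetI)
  fix U s assume U: "openin Pn U" and "s \<in> sheaf_mult Pn F G U"
  then have s0: "\<And>p. p \<notin> U \<Longrightarrow> s p = 0"
    and s: "\<And>p. p \<in> U \<Longrightarrow> \<exists>V. openin Pn V \<and> p \<in> V \<and> V \<subseteq> U \<and>
        (\<exists>m f g. (\<forall>i<m. f i \<in> F V \<and> g i \<in> G V) \<and> res V s = (\<lambda>q. \<Sum>i<(m::nat). f i q * g i q))"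
    by (auto simp: sheaf_mult_def)
  show "s \<in> sectn (idl_prod J J') (d + d') U"
  proof (rule sectn_eqI[where x = "s {0}"])
    fix p assume "p \<in> U"
    then have pp: "p \<in> proj_points" using openin_Pn_subset[OF U] by blast
    from s[OF \<open>p \<in> U\<close>] obtain V m f g where V: "openin Pn V" "p \<in> V"
      and fg0: "\<forall>i<m. f i \<in> F V \<and> g i \<in> G V"
      and sV: "res V s = (\<lambda>q. \<Sum>i<(m::nat). f i q * g i q)"
      by blast
    have fg: "f i \<in> sectn J d V" "g i \<in> sectn J' d' V" if "i < m" for i
      using fg0 that by (simp_all add: is_sectnD[OF F V(1)] is_sectnD[OF G V(1)])
    have zV: "{0} \<in> V" by (rule generic_in_open[OF V])
    have sq: "s q = (\<Sum>i<m. f i q * g i q)" if "q \<in> V" for q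
      using fun_cong[OF sV, of q] that by (simp add: res_def)
    have *: "f i p = f i {0} \<and> f i p \<in> Fr J d p" "g i p = g i {0} \<and> g i p \<in> Fr J' d' p" if "i < m" for i
      using fg[OF that] V(2) zV by (auto simp: sectn_def res_def)
    then have "s p = s {0}" using V(2) zV by (auto simp: sq intro!: sum.cong)
    moreover have "s p \<in> Fr (idl_prod J J') (d + d') p"
      unfolding sq[OF V(2)] using *
      by (intro Fr_sum[OF pp] idl_idl_prod J Fr_mult[OF pp]) blast+
    ultimately show "s p = s {0} \<and> s {0} \<in> Fr (idl_prod J J') (d + d') p" by simp
  qed (rule s0)
next
  fix U s assume U: "openin Pn U" and "s \<in> sectn (idl_prod J J') (d + d') U"
  then obtain x where x: "s = res U (\<lambda>_. x)" "\<And>p. p \<in> U \<Longrightarrow> x \<in> Fr (idl_prod J J') (d + d') p"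
    by (auto simp: sectn_def)
  have "\<exists>V. openin Pn V \<and> p \<in> V \<and> V \<subseteq> U \<and>
      (\<exists>m f g. (\<forall>i<m. f i \<in> F V \<and> g i \<in> G V) \<and> res V s = (\<lambda>q. \<Sum>i<(m::nat). f i q * g i q))"
    if p: "p \<in> U" for p
  proof -
    have pp: "p \<in> proj_points" by (rule subsetD[OF openin_Pn_subset[OF U] p])
    have xF: "x \<in> Fr (idl_prod J J') (d + d') p" by (rule x(2)[OF p])
    have "x \<in> idl_prod (Fr J d p) (Fr J' d' p)" by (rule Fr_idl_prod[OF pp J(3,4,1,2) xF])
    then have "\<exists>m \<alpha> \<beta>. (\<forall>i<m. \<alpha> i \<in> Fr J d p \<and> \<beta> i \<in> Fr J' d' p) \<and> x = (\<Sum>i<(m::nat). \<alpha> i * \<beta> i)"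
      by (rule idl_prod_as_sum)
    then obtain m \<alpha> \<beta> where ab0: "\<forall>i<m. \<alpha> i \<in> Fr J d p \<and> \<beta> i \<in> Fr J' d' p"
      and ab3: "x = (\<Sum>i<(m::nat). \<alpha> i * \<beta> i)" by blast
    have ab: "\<alpha> i \<in> Fr J d p" "\<beta> i \<in> Fr J' d' p" if "i < m" for i
      using ab0 that by auto
    \<comment> \<open>Intersecting the neighbourhoods of the factors, one index at a time.\<close>
    have "\<exists>V. openin Pn V \<and> p \<in> V \<and> V \<subseteq> U \<and> (\<forall>i<n. \<forall>q\<in>V. \<alpha> i \<in> Fr J d q \<and> \<beta> i \<in> Fr J' d' q)"
      if "n \<le> m" for n using that
    proof (induction n)
      case 0
      then show ?case using U p by blast
    next
      case (Suc n)
      then obtain V where V: "openin Pn V" "p \<in> V" "V \<subseteq> U"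
        "\<And>i q. i < n \<Longrightarrow> q \<in> V \<Longrightarrow> \<alpha> i \<in> Fr J d q \<and> \<beta> i \<in> Fr J' d' q" by auto
      obtain V1 where V1: "openin Pn V1" "p \<in> V1" "\<And>q. q \<in> V1 \<Longrightarrow> \<alpha> n \<in> Fr J d q"
        using Fr_open[OF pp ab(1)[of n]] Suc.prems by auto
      obtain V2 where V2: "openin Pn V2" "p \<in> V2" "\<And>q. q \<in> V2 \<Longrightarrow> \<beta> n \<in> Fr J' d' q"
        using Fr_open[OF pp ab(2)[of n]] Suc.prems by auto
      show ?case
        by (rule exI[of _ "V \<inter> V1 \<inter> V2"]) (use V V1 V2 in \<open>auto simp: less_Suc_eq\<close>)
    qed
    from this[OF order_refl] obtain V where V: "openin Pn V" "p \<in> V" "V \<subseteq> U"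
      "\<And>i q. i < m \<Longrightarrow> q \<in> V \<Longrightarrow> \<alpha> i \<in> Fr J d q \<and> \<beta> i \<in> Fr J' d' q" by blast
    have "res V s = (\<lambda>q. \<Sum>i<m. res V (\<lambda>_. \<alpha> i) q * res V (\<lambda>_. \<beta> i) q)"
      using V(3) by (intro ext) (auto simp: res_def x(1) ab3)
    moreover have "\<forall>i<m. res V (\<lambda>_. \<alpha> i) \<in> F V \<and> res V (\<lambda>_. \<beta> i) \<in> G V"
      using V(4) by (simp add: is_sectnD[OF F V(1)] is_sectnD[OF G V(1)] sectnI)
    ultimately show ?thesis using V(1-3)
      by (intro exI[of _ V] conjI exI[of _ m] exI[of _ "\<lambda>i. res V (\<lambda>_. \<alpha> i)"] exI[of _ "\<lambda>i. res V (\<lambda>_. \<beta> i)"])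
  qed
  then show "s \<in> sheaf_mult Pn F G U" by (auto simp: sheaf_mult_def x(1) res_def)
qed

lemma is_sectn_twist:
  assumes "is_sectn F J 0" "idl J" "graded J"
  shows "is_sectn (twist F d) J d"
  using is_sectn_sheaf_mult[OF assms(1) is_sectn_OPn assms(2) _ assms(3), of d]
  by (simp add: twist_def idl_prod_UNIV assms(2))

lemma stalk_sectn:
  assumes F: "is_sectn F J d" and p: "p \<in> proj_points"
  shows "stalk Pn F p = Fr J d p"
proof (intro equalityI subsetI)
  fix x assume "x \<in> stalk Pn F p"
  then show "x \<in> Fr J d p"
    by (auto simp: stalk_def is_sectnD[OF F] sectn_def res_def)
next
  fix x assume "x \<in> Fr J d p"
  then obtain V where V: "openin Pn V" "p \<in> V" "\<And>q. q \<in> V \<Longrightarrow> x \<in> Fr J d q" using Fr_open[OF p] by blast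
  then have "res V (\<lambda>_. x) \<in> F V" by (simp add: is_sectnD[OF F] sectnI)
  moreover have "x = res V (\<lambda>_. x) p" using V(2) by (simp add: res_def)
  ultimately show "x \<in> stalk Pn F p" using V(1,2) unfolding stalk_def by blast
qed

text \<open>
  Projective normality of the subscheme of \<open>J\<close>: a family of germs \<open>G p\<close> that is locally the class
  of a section of \<open>\<O>(d)\<close> modulo \<open>J(d)\<close> is the class of a form of degree \<open>d\<close>.
\<close>

definition lifts_sections :: "('v::{finite,linorder}, 'k::field) mpoly set \<Rightarrow> nat \<Rightarrow> bool" where
  "lifts_sections J d \<longleftrightarrow> (\<forall>G. (\<forall>p\<in>proj_points. \<exists>V x. openin Pn V \<and> p \<in> V \<and>
       (\<forall>q\<in>V. x \<in> Fr UNIV d q \<and> G q - x \<in> Fr J d q)) \<longrightarrow>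
     (\<exists>f. homog d f \<and> (\<forall>p\<in>proj_points. to_fract f - G p \<in> Fr J d p)))"

lemma coset_eq_iff:
  assumes "p \<in> proj_points" "idl J"
  shows "{x + a | a. a \<in> Fr J d p} = {y + a | a. a \<in> Fr J d p} \<longleftrightarrow> x - y \<in> Fr J d p"
proof
  assume e: "{x + a | a. a \<in> Fr J d p} = {y + a | a. a \<in> Fr J d p}"
  have "x + 0 \<in> {x + a | a. a \<in> Fr J d p}" using Fr_0[OF assms] by blast
  then obtain a where "x + 0 = y + a" "a \<in> Fr J d p" unfolding e by blast
  then show "x - y \<in> Fr J d p" by (simp add: algebra_simps)
next
  have *: "{x + a | a. a \<in> Fr J d p} \<subseteq> {y + a | a. a \<in> Fr J d p}" if d: "x - y \<in> Fr J d p" for x y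
  proof
    fix z assume "z \<in> {x + a | a. a \<in> Fr J d p}"
    then obtain a where a: "z = x + a" "a \<in> Fr J d p" by blast
    then have "z = y + (x - y + a)" "x - y + a \<in> Fr J d p"
      using Fr_add[OF assms d] by auto
    then show "z \<in> {y + a | a. a \<in> Fr J d p}" by blast
  qed
  assume "x - y \<in> Fr J d p"
  then show "{x + a | a. a \<in> Fr J d p} = {y + a | a. a \<in> Fr J d p}"
    using *[of x y] *[of y x] Fr_uminus[OF assms, of "x - y" d] by (intro equalityI) auto
qed

lemma projectively_normal_iff:
  fixes F :: "(('v::{finite,linorder}, 'k::field) proj_point, ('v, 'k) mpoly fract) fsheaf"
  assumes F: "is_sectn F J 0" and J: "idl J" "graded J"
  shows "projectively_normal F \<longleftrightarrow> (\<forall>d. lifts_sections J d)"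
proof -
  let ?X = "proj_points :: ('v, 'k) proj_point set"
  have oX: "openin Pn ?X" using openin_topspace[of Pn] by simp
  have "quot_proj Pn (twist F d) (topspace Pn) ` OPn d (topspace Pn) =
     quot_sections Pn (OPn d) (twist F d) (topspace Pn) \<longleftrightarrow> lifts_sections J d" (is "?L \<longleftrightarrow> _") for d
  proof -
    note st = stalk_sectn[OF is_sectn_twist[OF F J, of d]]
    have qp: "quot_proj Pn (twist F d) U s q = {s q + a | a. a \<in> Fr J d q}"
      if "q \<in> U" "q \<in> ?X" for U s q
      using that by (simp add: quot_proj_def st)
    have O: "OPn d U = sectn UNIV d U" if "openin Pn U" for U :: "('v, 'k) proj_point set"
      using is_sectnD[OF is_sectn_OPn that] .
    have sub: "quot_proj Pn (twist F d) ?X ` OPn d ?X \<subseteq> quot_sections Pn (OPn d) (twist F d) ?X"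
    proof (intro image_subsetI)
      fix s assume s: "s \<in> OPn d ?X"
      show "quot_proj Pn (twist F d) ?X s \<in> quot_sections Pn (OPn d) (twist F d) ?X"
        unfolding quot_sections_def
      proof (intro CollectI conjI allI impI ballI)
        fix p assume "p \<in> ?X"
        then show "\<exists>V. openin Pn V \<and> p \<in> V \<and> V \<subseteq> ?X \<and>
            (\<exists>s'\<in>OPn d V. \<forall>q\<in>V. quot_proj Pn (twist F d) ?X s q = quot_proj Pn (twist F d) V s' q)"
          using oX s by (intro exI[of _ ?X] conjI bexI[of _ s] ballI refl subset_refl)
      qed (simp add: quot_proj_def)
    qed
    show ?thesis
    proof
      assume L: ?L
      show "lifts_sections J d" unfolding lifts_sections_def
      proof (intro allI impI)
        fix G assume G: "\<forall>p\<in>?X. \<exists>V x. openin Pn V \<and> p \<in> V \<and>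
          (\<forall>q\<in>V. x \<in> Fr UNIV d q \<and> G q - x \<in> Fr J d q)"
        define t where "t q = (if q \<in> ?X then {G q + a | a. a \<in> Fr J d q} else {})" for q
        have "t \<in> quot_sections Pn (OPn d) (twist F d) ?X"
          unfolding quot_sections_def
        proof (intro CollectI conjI allI impI ballI)
          fix p assume "p \<in> ?X"
          from bspec[OF G this] obtain V x where V: "openin Pn V" "p \<in> V"
            "\<And>q. q \<in> V \<Longrightarrow> x \<in> Fr UNIV d q \<and> G q - x \<in> Fr J d q" by blast
          have VX: "V \<subseteq> ?X" by (rule openin_Pn_subset[OF V(1)])
          have "res V (\<lambda>_. x) \<in> OPn d V" using V(3) by (simp add: O[OF V(1)] sectnI)
          moreover have "t q = quot_proj Pn (twist F d) V (res V (\<lambda>_. x)) q" if q: "q \<in> V" for q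
          proof -
            have qX: "q \<in> ?X" using q VX by blast
            have "{G q + a | a. a \<in> Fr J d q} = {x + a | a. a \<in> Fr J d q}"
              using coset_eq_iff[OF qX J(1)] V(3)[OF q] by blast
            then show ?thesis using q by (simp add: qp[OF q qX] t_def qX res_def)
          qed
          ultimately show "\<exists>V. openin Pn V \<and> p \<in> V \<and> V \<subseteq> ?X \<and>
              (\<exists>s\<in>OPn d V. \<forall>q\<in>V. t q = quot_proj Pn (twist F d) V s q)"
            using V(1,2) VX by blast
        qed (simp add: t_def)
        then obtain s where s: "s \<in> OPn d ?X" "t = quot_proj Pn (twist F d) ?X s"
          using L by auto
        then obtain x where x: "s = res ?X (\<lambda>_. x)" "\<And>p. p \<in> ?X \<Longrightarrow> x \<in> Fr UNIV d p"
          by (auto simp: O[OF oX] sectn_def)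
        obtain f where f: "homog d f" "x = to_fract f" using global_sections[OF x(2)] by blast
        have "to_fract f - G p \<in> Fr J d p" if p: "p \<in> ?X" for p
        proof -
          have "{x + a | a. a \<in> Fr J d p} = {G p + a | a. a \<in> Fr J d p}"
            using fun_cong[OF s(2), of p] qp[OF p p, of s] by (simp add: t_def p x(1) res_def)
          then show ?thesis using coset_eq_iff[OF p J(1)] f(2) by blast
        qed
        then show "\<exists>f. homog d f \<and> (\<forall>p\<in>?X. to_fract f - G p \<in> Fr J d p)" using f(1) by blast
      qed
    next
      assume R: "lifts_sections J d"
      have "t \<in> quot_proj Pn (twist F d) ?X ` OPn d ?X" if t: "t \<in> quot_sections Pn (OPn d) (twist F d) ?X" for t
      proof -
        have t0: "\<And>q. q \<notin> ?X \<Longrightarrow> t q = {}" and tl: "\<And>p. p \<in> ?X \<Longrightarrow> \<exists>V. openin Pn V \<and> p \<in> V \<and>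
            (\<exists>s\<in>OPn d V. \<forall>q\<in>V. t q = quot_proj Pn (twist F d) V s q)"
          using t by (simp_all add: quot_sections_def) blast
        have tl': "\<exists>V x. openin Pn V \<and> p \<in> V \<and> (\<forall>q\<in>V. x \<in> Fr UNIV d q \<and> t q = {x + a | a. a \<in> Fr J d q})"
          if p: "p \<in> ?X" for p
        proof -
          obtain V s where V: "openin Pn V" "p \<in> V" "s \<in> OPn d V" "\<And>q. q \<in> V \<Longrightarrow> t q = quot_proj Pn (twist F d) V s q"
            using tl[OF p] by blast
          then obtain x where x: "s = res V (\<lambda>_. x)" "\<And>p. p \<in> V \<Longrightarrow> x \<in> Fr UNIV d p"
            by (auto simp: O[OF V(1)] sectn_def)
          have "t q = {x + a | a. a \<in> Fr J d q}" if q: "q \<in> V" for q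
            using V(4)[OF q] qp[OF q, of s] openin_Pn_subset[OF V(1)] q by (auto simp: x(1) res_def)
          then show ?thesis using V(1,2) x(2) by blast
        qed
        then have "\<forall>p\<in>?X. \<exists>x. t p = {x + a | a. a \<in> Fr J d p}" by blast
        from bchoice[OF this] obtain G where G: "\<And>p. p \<in> ?X \<Longrightarrow> t p = {G p + a | a. a \<in> Fr J d p}" by blast
        have "\<exists>V x. openin Pn V \<and> p \<in> V \<and> (\<forall>q\<in>V. x \<in> Fr UNIV d q \<and> G q - x \<in> Fr J d q)"
          if p: "p \<in> ?X" for p
        proof -
          obtain V x where V: "openin Pn V" "p \<in> V" "\<And>q. q \<in> V \<Longrightarrow> x \<in> Fr UNIV d q"
            "\<And>q. q \<in> V \<Longrightarrow> t q = {x + a | a. a \<in> Fr J d q}" using tl'[OF p] by blast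
          have "G q - x \<in> Fr J d q" if q: "q \<in> V" for q
          proof -
            have qX: "q \<in> ?X" using openin_Pn_subset[OF V(1)] q by blast
            show ?thesis using coset_eq_iff[OF qX J(1)] V(4)[OF q] G[OF qX] by auto
          qed
          then show ?thesis using V by blast
        qed
        then have "\<forall>p\<in>?X. \<exists>V x. openin Pn V \<and> p \<in> V \<and> (\<forall>q\<in>V. x \<in> Fr UNIV d q \<and> G q - x \<in> Fr J d q)"
          by (intro ballI)
        with R have "\<exists>f. homog d f \<and> (\<forall>p\<in>?X. to_fract f - G p \<in> Fr J d p)"
          unfolding lifts_sections_def by (elim allE impE)
        then obtain f where f: "homog d f" "\<And>p. p \<in> ?X \<Longrightarrow> to_fract f - G p \<in> Fr J d p"
          by blast
        define s where "s = res ?X (\<lambda>_. to_fract f)"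
        have "s \<in> OPn d ?X" unfolding s_def O[OF oX]
          using f(1) proj_pointsD(5) by (intro sectnI Fr_to_fract) auto
        moreover have "t = quot_proj Pn (twist F d) ?X s"
        proof
          fix q show "t q = quot_proj Pn (twist F d) ?X s q"
          proof (cases "q \<in> ?X")
            case True
            then show ?thesis
              using iffD2[OF coset_eq_iff[OF True J(1)] f(2)[OF True]] G[OF True]
              by (simp add: qp s_def res_def)
          qed (simp add: t0 quot_proj_def)
        qed
        ultimately show ?thesis by blast
      qed
      then show ?L using sub by auto
    qed
  qed
  then show ?thesis by (simp add: projectively_normal_def)
qed

text \<open>
  Every family in \<open>K\<close> that is locally constant modulo \<open>\<O>(d)\<close> is globally constant modulo \<open>\<O>(d)\<close>,
  which is \<open>H\<^sup>1(\<P>\<^sup>n, \<O>(d)) = 0\<close> since the constant sheaf \<open>K\<close> is flasque. The forms \<open>f\<close> for which the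
  family \<open>f g\<close> has this property generate an ideal that contains a power of every variable, by
  quasi-compactness.
\<close>

lemma finite_basic_cover:
  fixes f :: "('v::{finite,linorder}, 'k::field) proj_point \<Rightarrow> ('v, 'k) mpoly"
  assumes f: "\<And>p. p \<in> proj_points \<Longrightarrow> homog (m p) (f p) \<and> f p \<notin> p"
  obtains A where "finite A" "A \<subseteq> proj_points" "\<And>q. q \<in> proj_points \<Longrightarrow> \<exists>p\<in>A. f p \<notin> q"
proof -
  let ?B = "f ` proj_points"
  have fin: "\<exists>A. finite A \<and> A \<subseteq> proj_points \<and> s \<in> idl_prod UNIV (f ` A)" if "s \<in> idl_prod UNIV ?B" for s
    using that
  proof induction
    case zero
    show ?case by (intro exI[of _ "{}"]) (auto intro: idl_prod.zero)
  next
    case (add a b s)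
    then obtain A p where A: "finite A" "A \<subseteq> proj_points" "s \<in> idl_prod UNIV (f ` A)"
      and p: "b = f p" "p \<in> proj_points" by blast
    have "s \<in> idl_prod UNIV (f ` insert p A)"
      using A(3) by induction (auto intro: idl_prod.intros)
    then have "a * b + s \<in> idl_prod UNIV (f ` insert p A)"
      by (intro idl_prod.add) (auto simp: p)
    then show ?case using A p by (intro exI[of _ "insert p A"]) auto
  qed
  have "graded (idl_prod UNIV ?B)" unfolding graded_def
  proof (intro ballI allI)
    fix s d assume "s \<in> idl_prod UNIV ?B"
    then show "hcomp d s \<in> idl_prod UNIV ?B"
    proof induction
      case (add a b s)
      then obtain p where p: "b = f p" "p \<in> proj_points" by blast
      have "hcomp d (a * b) = (if m p \<le> d then hcomp (d - m p) a * b else 0)"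
        using hcomp_mult_homog[of "m p" b d a] f[OF p(2)] p(1) by (simp add: mult.commute)
      then have "hcomp d (a * b) \<in> idl_prod UNIV ?B"
        using add.hyps(2) by (auto intro: idl_prod_mem idl_prod.zero)
      then show ?case using add.IH by (simp add: hcomp_add idl_prod_add)
    qed (simp add: idl_prod.zero)
  qed
  moreover have "\<exists>g\<in>idl_prod UNIV ?B. g \<notin> p" if p: "p \<in> proj_points" for p
    using f[OF p] p idl_prod_mem[of 1 UNIV "f p" ?B] by auto
  ultimately have v_ex: "\<exists>K. var i ^ K \<in> idl_prod UNIV ?B" for i
    by (intro var_power_mem idl_idl_prod idl_UNIV)
  have "\<exists>A. finite A \<and> A \<subseteq> proj_points \<and> (\<exists>K. var i ^ K \<in> idl_prod UNIV (f ` A))" for i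
  proof -
    obtain K where "var i ^ K \<in> idl_prod UNIV ?B" using v_ex[of i] by blast
    from fin[OF this] show ?thesis by blast
  qed
  then have "\<forall>i. \<exists>A. finite A \<and> A \<subseteq> proj_points \<and> (\<exists>K. var i ^ K \<in> idl_prod UNIV (f ` A))" ..
  from choice[OF this] obtain A where A0: "\<forall>i. finite (A i) \<and> A i \<subseteq> proj_points \<and>
    (\<exists>K. var i ^ K \<in> idl_prod UNIV (f ` A i))" ..
  have A: "finite (A i)" "A i \<subseteq> proj_points" "\<exists>K. var i ^ K \<in> idl_prod UNIV (f ` A i)" for i
    using A0 by simp_all
  show ?thesis
  proof (rule that[of "\<Union>i. A i"])
    fix q :: "('v, 'k) proj_point" assume q: "q \<in> proj_points"
    then obtain i where i: "var i \<notin> q" using proj_points_var by blast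
    show "\<exists>p\<in>\<Union>i. A i. f p \<notin> q"
    proof (rule ccontr)
      assume "\<not> ?thesis"
      then have *: "f ` A i \<subseteq> q" by blast
      have "s \<in> q" if "s \<in> idl_prod UNIV (f ` A i)" for s
        using that by induction
          (use * proj_pointsD[OF q] in \<open>auto intro!: idl_add idl_mult\<close>)
      then obtain K where "var i ^ K \<in> q" using A(3)[of i] by blast
      then show False using i prime_idl_power[OF proj_pointsD(1)[OF q], of "var i" K] by blast
    qed
  qed (use A(1,2) in auto)
qed

lemma locally_constant_mod_sections:
  fixes g :: "('v::{finite,linorder}, 'k::field) proj_point \<Rightarrow> ('v, 'k) mpoly fract"
  assumes g: "\<And>p. p \<in> proj_points \<Longrightarrow>
    \<exists>V. openin Pn V \<and> p \<in> V \<and> (\<forall>q\<in>V. g p - g q \<in> Fr UNIV d q)"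
  shows "\<exists>\<gamma>. \<forall>p\<in>proj_points. \<gamma> - g p \<in> Fr UNIV d p"
proof -
  have "\<forall>p\<in>proj_points. \<exists>f. \<exists>m. homog m f \<and> f \<notin> p \<and> (\<forall>q\<in>basic_open f. g p - g q \<in> Fr UNIV d q)"
  proof
    fix p :: "('v, 'k) proj_point" assume p: "p \<in> proj_points"
    from g[OF this] obtain V where V: "openin Pn V" "p \<in> V" "\<And>q. q \<in> V \<Longrightarrow> g p - g q \<in> Fr UNIV d q"
      by blast
    obtain f m where "homog m f" "p \<in> basic_open f" "basic_open f \<subseteq> V" by (rule openin_Pn_base[OF V(1,2)])
    then show "\<exists>f. \<exists>m. homog m f \<and> f \<notin> p \<and> (\<forall>q\<in>basic_open f. g p - g q \<in> Fr UNIV d q)"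
      using V(3) by (intro exI[of _ f] exI[of _ m]) (auto simp: basic_open_def)
  qed
  from bchoice[OF this] obtain f where
    f0: "\<And>p. p \<in> proj_points \<Longrightarrow> \<exists>m. homog m (f p) \<and> f p \<notin> p \<and> (\<forall>q\<in>basic_open (f p). g p - g q \<in> Fr UNIV d q)"
    by blast
  define m where "m p = (SOME m. homog m (f p))" for p
  have f: "homog (m p) (f p)" "f p \<notin> p" "\<And>q. q \<in> proj_points \<Longrightarrow> f p \<notin> q \<Longrightarrow> g p - g q \<in> Fr UNIV d q"
    if "p \<in> proj_points" for p
  proof -
    have "\<exists>m. homog m (f p)" using f0[OF that] by blast
    then show "homog (m p) (f p)" unfolding m_def by (rule someI_ex)
  qed (use f0[OF that] in \<open>auto simp: basic_open_def\<close>)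
  obtain A where A: "finite A" "A \<subseteq> proj_points" "\<And>q. q \<in> proj_points \<Longrightarrow> \<exists>p\<in>A. f p \<notin> q"
    using finite_basic_cover[of m f] f by blast
  \<comment> \<open>As with denominators, the condition is imposed on each component, with the twist
    raised by its degree e, so that T is graded.\<close>
  define T where "T = {h. \<forall>e. \<exists>G. \<forall>p\<in>proj_points. G - to_fract (hcomp e h) * g p \<in> Fr UNIV (e + d) p}"
  have TI: "idl T" unfolding idl_def
  proof (intro conjI ballI allI)
    show "0 \<in> T" by (auto simp: T_def intro!: exI[of _ 0] Fr_0)
    show "a + b \<in> T" if ab: "a \<in> T" "b \<in> T" for a b
      unfolding T_def
    proof (intro CollectI allI)
      fix e
      obtain G where G: "\<And>p. p \<in> proj_points \<Longrightarrow> G - to_fract (hcomp e a) * g p \<in> Fr UNIV (e + d) p"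
        using ab(1) unfolding T_def by blast
      obtain G' where G': "\<And>p. p \<in> proj_points \<Longrightarrow> G' - to_fract (hcomp e b) * g p \<in> Fr UNIV (e + d) p"
        using ab(2) unfolding T_def by blast
      have "G + G' - to_fract (hcomp e (a + b)) * g p \<in> Fr UNIV (e + d) p" if p: "p \<in> proj_points" for p
        using Fr_add[OF p idl_UNIV G[OF p] G'[OF p]] by (simp add: hcomp_add algebra_simps)
      then show "\<exists>G. \<forall>p\<in>proj_points. G - to_fract (hcomp e (a + b)) * g p \<in> Fr UNIV (e + d) p" by blast
    qed
    show "r * a \<in> T" if a: "a \<in> T" for a r
      unfolding T_def
    proof (intro CollectI allI)
      fix e
      have "\<forall>e. \<exists>G. \<forall>p\<in>proj_points. G - to_fract (hcomp e a) * g p \<in> Fr UNIV (e + d) p"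
        using a unfolding T_def by blast
      from choice[OF this] obtain G where
        G: "\<And>e p. p \<in> proj_points \<Longrightarrow> G e - to_fract (hcomp e a) * g p \<in> Fr UNIV (e + d) p" by blast
      define H where "H = (\<Sum>j\<le>e. to_fract (hcomp j r) * G (e - j))"
      have "H - to_fract (hcomp e (r * a)) * g p \<in> Fr UNIV (e + d) p" if p: "p \<in> proj_points" for p
      proof -
        have "H - to_fract (hcomp e (r * a)) * g p =
            (\<Sum>j\<le>e. to_fract (hcomp j r) * (G (e - j) - to_fract (hcomp (e - j) a) * g p))"
          by (simp add: H_def hcomp_mult to_fract_sum sum_distrib_right sum_subtractf right_diff_distrib mult.assoc)
        also have "\<dots> \<in> Fr UNIV (e + d) p"
        proof (rule Fr_sum[OF p idl_UNIV])
          fix j assume "j \<in> {..e}"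
          have "to_fract (hcomp j r) * (G (e - j) - to_fract (hcomp (e - j) a) * g p) \<in> Fr UNIV (j + (e - j + d)) p"
            using proj_pointsD(5)[OF p] by (intro Fr_mult_UNIV p idl_UNIV G Fr_to_fract) auto
          then show "to_fract (hcomp j r) * (G (e - j) - to_fract (hcomp (e - j) a) * g p) \<in> Fr UNIV (e + d) p"
            using \<open>j \<in> {..e}\<close> by simp
        qed
        finally show ?thesis .
      qed
      then show "\<exists>G. \<forall>p\<in>proj_points. G - to_fract (hcomp e (r * a)) * g p \<in> Fr UNIV (e + d) p" by blast
    qed
  qed
  have Tgr: "graded T" unfolding graded_def
  proof (intro ballI allI)
    fix h e assume h: "h \<in> T"
    show "hcomp e h \<in> T" unfolding T_def
    proof (intro CollectI allI)
      fix e'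
      show "\<exists>G. \<forall>p\<in>proj_points. G - to_fract (hcomp e' (hcomp e h)) * g p \<in> Fr UNIV (e' + d) p"
      proof (cases "e' = e")
        case True
        then have "hcomp e' (hcomp e h) = hcomp e' h" by (simp add: hcomp_homog[OF homog_hcomp])
        then show ?thesis using h unfolding T_def by simp
      next
        case False
        then have "hcomp e' (hcomp e h) = 0" by (simp add: hcomp_homog[OF homog_hcomp])
        then show ?thesis by (auto intro!: exI[of _ 0] Fr_0)
      qed
    qed
  qed
  have T_homog: "h \<in> T" if h: "homog e h" and G: "\<And>p. p \<in> proj_points \<Longrightarrow> G - to_fract h * g p \<in> Fr UNIV (e + d) p" for h e G
    unfolding T_def
  proof (intro CollectI allI)
    fix e'
    show "\<exists>G. \<forall>p\<in>proj_points. G - to_fract (hcomp e' h) * g p \<in> Fr UNIV (e' + d) p"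
    proof (cases "e' = e")
      case True
      then show ?thesis using G by (auto simp: hcomp_homog[OF h] intro!: exI[of _ G])
    next
      case False
      then show ?thesis by (auto simp: hcomp_homog[OF h] intro!: exI[of _ 0] Fr_0)
    qed
  qed
  have power_mem: "\<exists>K. (var i * f p) ^ K \<in> T" if p: "p \<in> A" for p i
  proof -
    have pp: "p \<in> proj_points" using p A by blast
    \<comment> \<open>The difference \<open>g p - g q\<close> is regular where both
      \<open>f p\<close> and \<open>f q\<close> are nonzero. The factor \<open>var i\<close>
      guarantees that a graded prime avoiding the product is a point, as
      \<open>denominator_power\<close> requires.\<close>
    have "\<exists>K h. homog (K * (1 + m p + m q) + d) h \<and> to_fract ((var i * f p * f q) ^ K) * (g p - g q) = to_fract h"
      if q: "q \<in> A" for q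
    proof (rule denominator_power)
      have qq: "q \<in> proj_points" using q A by blast
      show "homog (1 + m p + m q) (var i * f p * f q)" using f(1)[OF pp] f(1)[OF qq] by (intro homog_mult) auto
      show "g p - g q \<in> Fr UNIV d t" if t: "t \<in> proj_points" "var i * f p * f q \<notin> t" for t
      proof -
        have ft: "f p \<notin> t" "f q \<notin> t" using t by (auto simp: prime_idl_mult_iff proj_pointsD)
        have "(g p - g t) - (g q - g t) \<in> Fr UNIV d t"
          by (rule Fr_diff[OF t(1) idl_UNIV f(3)[OF pp t(1) ft(1)] f(3)[OF qq t(1) ft(2)]])
        then show ?thesis by simp
      qed
      show "\<exists>i. var i \<notin> t" if "prime_idl t" "var i * f p * f q \<notin> t" for t
        using that by (auto simp: prime_idl_mult_iff)
    qed
    then have "\<forall>q\<in>A. \<exists>K. \<exists>h. homog (K * (1 + m p + m q) + d) h \<and>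
        to_fract ((var i * f p * f q) ^ K) * (g p - g q) = to_fract h" by blast
    from bchoice[OF this] obtain K where
      K: "\<And>q. q \<in> A \<Longrightarrow> \<exists>h. homog (K q * (1 + m p + m q) + d) h \<and>
        to_fract ((var i * f p * f q) ^ K q) * (g p - g q) = to_fract h" by blast
    define M where "M = (\<Sum>q\<in>A. K q)"
    have KM: "K q \<le> M" if "q \<in> A" for q
      unfolding M_def using that A(1) by (intro member_le_sum) auto
    let ?x = "var i * f p"
    \<comment> \<open>At t some \<open>f q\<close> is a unit and can be divided out, so a power of
      \<open>?x\<close> makes \<open>g p - g q\<close> regular there, while \<open>g q - g t\<close>
      is regular anyway. Hence \<open>?x ^ M * g\<close> is constant modulo sections, with value
      that at p.\<close>
    have "to_fract (?x ^ M) * g p - to_fract (?x ^ M) * g t \<in> Fr UNIV (M * (1 + m p) + d) t"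
      if t: "t \<in> proj_points" for t
    proof -
      obtain q where q: "q \<in> A" "f q \<notin> t" using A(3)[OF t] by blast
      have qq: "q \<in> proj_points" using q A by blast
      obtain h where h: "homog (K q * (1 + m p + m q) + d) h"
        "to_fract ((?x * f q) ^ K q) * (g p - g q) = to_fract h" using K[OF q(1)] by blast
      have hx: "homog (1 + m p) ?x" using f(1)[OF pp] by (intro homog_mult) auto
      have fq: "f q ^ K q \<notin> t" using q(2) prime_idl_power[OF proj_pointsD(1)[OF t], of "f q" "K q"] by blast
      have fq0: "to_fract (f q ^ K q) \<noteq> 0" unfolding to_fract_eq_0_iff by (rule proj_nonzero[OF t fq])
      have "to_fract (?x ^ K q) * (g p - g q) = to_fract h / to_fract (f q ^ K q)"
      proof -
        have "to_fract (?x ^ K q) * (g p - g q) * to_fract (f q ^ K q) = to_fract h"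
          unfolding h(2)[symmetric] by (simp add: power_mult_distrib ac_simps)
        then show ?thesis by (rule iffD2[OF nonzero_eq_divide_eq[OF fq0]])
      qed
      also have "\<dots> \<in> Fr UNIV (K q * (1 + m p) + d) t"
      proof (rule FrI[of _ _ _ _ "K q * m q"])
        show "homog (K q * m q + (K q * (1 + m p) + d)) h" using h(1) by (simp add: algebra_simps)
      qed (use fq f(1)[OF qq] in \<open>auto intro: homog_power\<close>)
      finally have 1: "to_fract (?x ^ K q) * (g p - g q) \<in> Fr UNIV (K q * (1 + m p) + d) t" .
      have "to_fract (?x ^ (M - K q)) \<in> Fr UNIV ((M - K q) * (1 + m p)) t"
        using proj_pointsD(5)[OF t] by (intro Fr_to_fract homog_power hx) auto
      from Fr_mult_UNIV[OF t idl_UNIV this 1]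
      have "to_fract (?x ^ M) * (g p - g q) \<in> Fr UNIV (M * (1 + m p) + d) t"
      proof -
        have "?x ^ M = ?x ^ (M - K q) * ?x ^ K q" using KM[OF q(1)] by (simp flip: power_add)
        moreover have "(M - K q) * (1 + m p) + (K q * (1 + m p) + d) = M * (1 + m p) + d"
          using KM[OF q(1)] by (simp flip: add.assoc add_mult_distrib)
        moreover assume "to_fract (?x ^ (M - K q)) * (to_fract (?x ^ K q) * (g p - g q))
            \<in> Fr UNIV ((M - K q) * (1 + m p) + (K q * (1 + m p) + d)) t"
        ultimately show ?thesis by (simp only: to_fract_mult mult.assoc)
      qed
      moreover have "to_fract (?x ^ M) * (g q - g t) \<in> Fr UNIV (M * (1 + m p) + d) t"
        using proj_pointsD(5)[OF t]
        by (intro Fr_mult_UNIV t idl_UNIV f(3)[OF qq] q Fr_to_fract homog_power hx) auto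
      ultimately have "to_fract (?x ^ M) * (g p - g q) + to_fract (?x ^ M) * (g q - g t) \<in> Fr UNIV (M * (1 + m p) + d) t"
        by (intro Fr_add t idl_UNIV)
      then show ?thesis by (simp add: right_diff_distrib)
    qed
    moreover have "homog (M * (1 + m p)) (?x ^ M)"
      using f(1)[OF pp] by (intro homog_power homog_mult) auto
    ultimately have "?x ^ M \<in> T" by (intro T_homog)
    then show ?thesis by blast
  qed
  have "\<exists>h\<in>T. h \<notin> t" if t: "t \<in> proj_points" for t
  proof -
    obtain q where q: "q \<in> A" "f q \<notin> t" using A(3)[OF t] by blast
    obtain i where i: "var i \<notin> t" using proj_points_var[OF t] by blast
    obtain K where "(var i * f q) ^ K \<in> T" using power_mem[OF q(1)] by blast
    moreover have "(var i * f q) ^ K \<notin> t"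
      using q i prime_idl_power[of t "var i * f q" K] by (auto simp: prime_idl_mult_iff proj_pointsD[OF t])
    ultimately show ?thesis by blast
  qed
  then have "\<exists>K. var i ^ K \<in> T" for i by (intro var_power_mem TI Tgr)
  then have "\<forall>i. \<exists>K. var i ^ K \<in> T" by blast
  from choice[OF this] obtain K where K: "\<And>i. var i ^ K i \<in> T" by blast
  define M where "M = (\<Sum>i\<in>UNIV. K i)"
  have "var i ^ M \<in> T" for i
  proof -
    have "K i \<le> M" unfolding M_def by (rule member_le_sum) auto
    then have "var i ^ M = (var i ^ (M - K i) * var i ^ K i :: ('v, 'k) mpoly)" by (simp flip: power_add)
    then show ?thesis using idl_mult[OF TI K] by simp
  qed
  then have "\<exists>G. \<forall>p\<in>proj_points. G - to_fract (hcomp M (var i ^ M)) * g p \<in> Fr UNIV (M + d) p" for i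
    unfolding T_def by blast
  then have "\<forall>i. \<exists>G. \<forall>p\<in>proj_points. G - to_fract (var i ^ M) * g p \<in> Fr UNIV (M + d) p"
    by (simp only: hcomp_homog[OF homog_var_power] if_True simp_thms)
  from choice[OF this] obtain G where
    "\<And>i p. p \<in> proj_points \<Longrightarrow> G i - to_fract (var i ^ M) * g p \<in> Fr UNIV (M + d) p" by blast
  then show ?thesis by (rule descend_var_powers)
qed

subsection \<open>First cohomology and lifting of sections\<close>

text \<open>The class set is never empty because of the zero cocycle, so being a singleton means
  that every cocycle is a coboundary after refinement. Two trivializations are subtracted on the
  common refinement of their covers.\<close>

lemma H1_vanishes_iff:
  fixes F :: "('a, 'b::ab_group_add) fsheaf"
  assumes zero: "\<And>U. openin T U \<Longrightarrow> (\<lambda>_. 0) \<in> F U"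
    and diff: "\<And>U s t. openin T U \<Longrightarrow> s \<in> F U \<Longrightarrow> t \<in> F U \<Longrightarrow> (\<lambda>p. s p - t p) \<in> F U"
    and restr: "\<And>U V s. openin T U \<Longrightarrow> openin T V \<Longrightarrow> V \<subseteq> U \<Longrightarrow> s \<in> F U \<Longrightarrow> res V s \<in> F V"
  shows "H1_vanishes T F \<longleftrightarrow> (\<forall>\<U> c. (\<U>, c) \<in> cech_cocycles T F \<longrightarrow>
    (\<exists>\<V> r b. open_cover T \<V> \<and> (\<forall>V\<in>\<V>. r V \<in> \<U> \<and> V \<subseteq> r V \<and> b V \<in> F V) \<and>
      (\<forall>V\<in>\<V>. \<forall>W\<in>\<V>. \<forall>p\<in>V \<inter> W. c (r V) (r W) p = b W p - b V p)))" (is "_ \<longleftrightarrow> (\<forall>\<U> c. _ \<longrightarrow> ?triv \<U> c)")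
proof -
  \<comment> \<open>The zero cocycle on the cover by the whole space represents the trivial
    class.\<close>
  define z where "z = ({topspace T}, \<lambda>(_::'a set) (_::'a set) (_::'a). 0::'b)"
  have oc: "open_cover T {topspace T}" by (simp add: open_cover_def)
  have z: "z \<in> cech_cocycles T F" unfolding z_def cech_cocycles_def using oc zero by simp
  have "\<forall>\<U> c. (\<U>, c) \<in> cech_cocycles T F \<longrightarrow> ?triv \<U> c" if H1: "H1_vanishes T F"
  proof -
    obtain C where C: "cech_H1 T F = {C}" using H1 unfolding H1_vanishes_def is_singleton_def by blast
    show ?thesis
    proof (intro allI impI)
      fix \<U> c assume c: "(\<U>, c) \<in> cech_cocycles T F"
      have cov: "open_cover T \<U>" using c by (simp add: cech_cocycles_def)
      have "cech_cohomologous T F `` {z} = C" "cech_cohomologous T F `` {(\<U>, c)} = C"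
        using quotientI[OF z, of "cech_cohomologous T F"] quotientI[OF c, of "cech_cohomologous T F"]
        unfolding C[unfolded cech_H1_def] by simp_all
      then have "cech_cohomologous T F `` {z} = cech_cohomologous T F `` {(\<U>, c)}" by simp
      moreover have "((\<U>, c), (\<U>, c)) \<in> cech_cohomologous T F"
      proof -
        have "open_cover T \<U> \<and> (\<forall>V\<in>\<U>. V \<in> \<U> \<and> V \<subseteq> V \<and> V \<in> \<U> \<and> V \<subseteq> V \<and> (\<lambda>_. 0) \<in> F V) \<and>
            (\<forall>V\<in>\<U>. \<forall>W\<in>\<U>. \<forall>p\<in>V \<inter> W. c V W p - c V W p = 0 - 0)"
          using cov zero by (auto simp: open_cover_def)
        then have "\<exists>\<V> r r' b. open_cover T \<V> \<and>
            (\<forall>V\<in>\<V>. r V \<in> \<U> \<and> V \<subseteq> r V \<and> r' V \<in> \<U> \<and> V \<subseteq> r' V \<and> b V \<in> F V) \<and>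
            (\<forall>V\<in>\<V>. \<forall>W\<in>\<V>. \<forall>p\<in>V \<inter> W. c (r V) (r W) p - c (r' V) (r' W) p = b W p - b V p)"
          by (intro exI[of _ \<U>] exI[of _ "\<lambda>V. V"] exI[of _ "\<lambda>_ _. 0"])
        then show ?thesis by (simp add: cech_cohomologous_def c)
      qed
      ultimately have "(z, (\<U>, c)) \<in> cech_cohomologous T F" by blast
      then have "\<exists>\<V> r r' b. open_cover T \<V> \<and>
          (\<forall>V\<in>\<V>. r V \<in> {topspace T} \<and> V \<subseteq> r V \<and> r' V \<in> \<U> \<and> V \<subseteq> r' V \<and> b V \<in> F V) \<and>
          (\<forall>V\<in>\<V>. \<forall>W\<in>\<V>. \<forall>p\<in>V \<inter> W. 0 - c (r' V) (r' W) p = b W p - b V p)"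
        unfolding cech_cohomologous_def z_def by simp
      then obtain \<V> r r' b where "open_cover T \<V> \<and>
          (\<forall>V\<in>\<V>. r V \<in> {topspace T} \<and> V \<subseteq> r V \<and> r' V \<in> \<U> \<and> V \<subseteq> r' V \<and> b V \<in> F V) \<and>
          (\<forall>V\<in>\<V>. \<forall>W\<in>\<V>. \<forall>p\<in>V \<inter> W. 0 - c (r' V) (r' W) p = b W p - b V p)"
        by (elim exE) (rule that)
      then have b: "open_cover T \<V>" "\<And>V. V \<in> \<V> \<Longrightarrow> r' V \<in> \<U> \<and> V \<subseteq> r' V \<and> b V \<in> F V"
        "\<And>V W p. V \<in> \<V> \<Longrightarrow> W \<in> \<V> \<Longrightarrow> p \<in> V \<inter> W \<Longrightarrow> 0 - c (r' V) (r' W) p = b W p - b V p"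
        by simp_all
      have "(\<lambda>p. - b V p) \<in> F V" if "V \<in> \<V>" for V
        using diff[OF _ zero, of V "b V"] b(1) b(2)[OF that] that by (auto simp: open_cover_def)
      moreover have "c (r' V) (r' W) p = - b W p - - b V p" if "V \<in> \<V>" "W \<in> \<V>" "p \<in> V \<inter> W" for V W p
        using b(3)[OF that] by (simp add: algebra_simps)
      ultimately have "open_cover T \<V> \<and> (\<forall>V\<in>\<V>. r' V \<in> \<U> \<and> V \<subseteq> r' V \<and> (\<lambda>p. - b V p) \<in> F V) \<and>
          (\<forall>V\<in>\<V>. \<forall>W\<in>\<V>. \<forall>p\<in>V \<inter> W. c (r' V) (r' W) p = - b W p - - b V p)"
        using b(1,2) by (intro conjI ballI) auto
      then show "?triv \<U> c" by (intro exI[of _ \<V>] exI[of _ r'] exI[of _ "\<lambda>V p. - b V p"])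
    qed
  qed
  moreover have "H1_vanishes T F" if triv: "\<forall>\<U> c. (\<U>, c) \<in> cech_cocycles T F \<longrightarrow> ?triv \<U> c"
  proof -
    have rel: "(x, y) \<in> cech_cohomologous T F" if xy: "x \<in> cech_cocycles T F" "y \<in> cech_cocycles T F" for x y
    proof -
      obtain \<U> c where x: "x = (\<U>, c)" by (cases x)
      obtain \<U>' c' where y: "y = (\<U>', c')" by (cases y)
      from triv[rule_format, OF xy(1)[unfolded x]]
      obtain \<V> r b where b0: "open_cover T \<V> \<and> (\<forall>V\<in>\<V>. r V \<in> \<U> \<and> V \<subseteq> r V \<and> b V \<in> F V) \<and>
        (\<forall>V\<in>\<V>. \<forall>W\<in>\<V>. \<forall>p\<in>V \<inter> W. c (r V) (r W) p = b W p - b V p)"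
        by (elim exE) (rule that)
      note b = b0[THEN conjunct1] b0[THEN conjunct2, THEN conjunct1] b0[THEN conjunct2, THEN conjunct2]
      from triv[rule_format, OF xy(2)[unfolded y]]
      obtain \<V>' r' b' where b0': "open_cover T \<V>' \<and> (\<forall>V\<in>\<V>'. r' V \<in> \<U>' \<and> V \<subseteq> r' V \<and> b' V \<in> F V) \<and>
        (\<forall>V\<in>\<V>'. \<forall>W\<in>\<V>'. \<forall>p\<in>V \<inter> W. c' (r' V) (r' W) p = b' W p - b' V p)"
        by (elim exE) (rule that)
      note b' = b0'[THEN conjunct1] b0'[THEN conjunct2, THEN conjunct1] b0'[THEN conjunct2, THEN conjunct2]
      define \<W> where "\<W> = {V \<inter> V' | V V'. V \<in> \<V> \<and> V' \<in> \<V>'}"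
      \<comment> \<open>A member of the refinement may be an intersection in several ways; one pair
        is fixed.\<close>
      define s where "s W = (SOME V. \<exists>V'. V \<in> \<V> \<and> V' \<in> \<V>' \<and> W = V \<inter> V')" for W
      define s' where "s' W = (SOME V'. V' \<in> \<V>' \<and> W = s W \<inter> V')" for W
      have s: "s W \<in> \<V> \<and> s' W \<in> \<V>' \<and> W \<subseteq> s W \<and> W \<subseteq> s' W" if "W \<in> \<W>" for W
      proof -
        have "\<exists>V V'. V \<in> \<V> \<and> V' \<in> \<V>' \<and> W = V \<inter> V'" using that unfolding \<W>_def by blast
        then have 1: "\<exists>V'. s W \<in> \<V> \<and> V' \<in> \<V>' \<and> W = s W \<inter> V'" unfolding s_def by (rule someI_ex)
        then have "\<exists>V'. V' \<in> \<V>' \<and> W = s W \<inter> V'" by blast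
        then have "s' W \<in> \<V>' \<and> W = s W \<inter> s' W" unfolding s'_def by (rule someI_ex)
        then show ?thesis using 1 by blast
      qed
      have op: "openin T V" if "V \<in> \<V> \<or> V \<in> \<V>'" for V
        using that b(1) b'(1) by (auto simp: open_cover_def)
      have covW: "open_cover T \<W>"
        unfolding open_cover_def
      proof
        show "\<forall>U\<in>\<W>. openin T U" using op by (auto simp: \<W>_def)
        have "\<Union>\<W> = \<Union>\<V> \<inter> \<Union>\<V>'" by (auto simp: \<W>_def)
        then show "\<Union>\<W> = topspace T" using b(1) b'(1) by (simp add: open_cover_def)
      qed
      define B where "B W = (\<lambda>p. res W (b (s W)) p - res W (b' (s' W)) p)" for W
      have "B W \<in> F W" if W: "W \<in> \<W>" for W
      proof -
        have oW: "openin T W" using covW W by (simp add: open_cover_def)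
        have "b (s W) \<in> F (s W)" "b' (s' W) \<in> F (s' W)" "openin T (s W)" "openin T (s' W)"
          using s[OF W] b(2) b'(2) op by simp_all
        then show ?thesis unfolding B_def
          using s[OF W] by (intro diff[OF oW] restr[OF _ oW]) simp_all
      qed
      moreover have "r (s W) \<in> \<U> \<and> W \<subseteq> r (s W) \<and> r' (s' W) \<in> \<U>' \<and> W \<subseteq> r' (s' W)" if W: "W \<in> \<W>" for W
        using s[OF W] b(2) b'(2) by blast
      moreover have "c (r (s V)) (r (s W)) p - c' (r' (s' V)) (r' (s' W)) p = B W p - B V p"
        if VW: "V \<in> \<W>" "W \<in> \<W>" "p \<in> V \<inter> W" for V W p
      proof -
        have "p \<in> s V \<inter> s W" "p \<in> s' V \<inter> s' W" using s[OF VW(1)] s[OF VW(2)] VW(3) by blast+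
        then have "c (r (s V)) (r (s W)) p = b (s W) p - b (s V) p"
          "c' (r' (s' V)) (r' (s' W)) p = b' (s' W) p - b' (s' V) p"
          using b(3) b'(3) s[OF VW(1)] s[OF VW(2)] by simp_all
        then show ?thesis using VW(3) by (simp add: B_def res_def)
      qed
      ultimately have "open_cover T \<W> \<and>
        (\<forall>V\<in>\<W>. (r \<circ> s) V \<in> \<U> \<and> V \<subseteq> (r \<circ> s) V \<and> (r' \<circ> s') V \<in> \<U>' \<and> V \<subseteq> (r' \<circ> s') V \<and> B V \<in> F V) \<and>
        (\<forall>V\<in>\<W>. \<forall>W\<in>\<W>. \<forall>p\<in>V \<inter> W.
           c ((r \<circ> s) V) ((r \<circ> s) W) p - c' ((r' \<circ> s') V) ((r' \<circ> s') W) p = B W p - B V p)"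
        using covW by simp
      then have "\<exists>\<V> r r' b. open_cover T \<V> \<and>
        (\<forall>V\<in>\<V>. r V \<in> \<U> \<and> V \<subseteq> r V \<and> r' V \<in> \<U>' \<and> V \<subseteq> r' V \<and> b V \<in> F V) \<and>
        (\<forall>V\<in>\<V>. \<forall>W\<in>\<V>. \<forall>p\<in>V \<inter> W. c (r V) (r W) p - c' (r' V) (r' W) p = b W p - b V p)"
        by (intro exI[of _ \<W>] exI[of _ "r \<circ> s"] exI[of _ "r' \<circ> s'"] exI[of _ B])
      then show ?thesis using xy[unfolded x y] by (simp add: cech_cohomologous_def x y)
    qed
    have "cech_cohomologous T F `` {x} = cech_cocycles T F" if x: "x \<in> cech_cocycles T F" for x
    proof (intro equalityI subsetI)
      fix y assume "y \<in> cech_cohomologous T F `` {x}"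
      then show "y \<in> cech_cocycles T F" unfolding cech_cohomologous_def by blast
    qed (use rel x in blast)
    then have "cech_H1 T F = {cech_cocycles T F}"
      using z unfolding cech_H1_def quotient_def by blast
    then show ?thesis by (simp add: H1_vanishes_def)
  qed
  ultimately show ?thesis by (intro iffI)
qed

section \<open>First cohomology of sheaves of homogeneous ideals\<close>

lemma sectnE:
  assumes "s \<in> sectn J d U"
  obtains x where "s = res U (\<lambda>_. x)" "\<And>p. p \<in> U \<Longrightarrow> x \<in> Fr J d p"
  using assms unfolding sectn_def by blast

lemma sectn_value:
  assumes "s \<in> sectn J d U" "p \<in> U" "q \<in> U"
  shows "s p = s q" "s p \<in> Fr J d q"
  using assms by (auto elim!: sectnE simp: res_def)

lemma H1_sectn_iff:
  assumes F: "is_sectn F J d" and J: "idl J"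
  shows "H1_vanishes Pn F \<longleftrightarrow> (\<forall>\<U> c. (\<U>, c) \<in> cech_cocycles Pn F \<longrightarrow>
    (\<exists>\<V> r b. open_cover Pn \<V> \<and> (\<forall>V\<in>\<V>. r V \<in> \<U> \<and> V \<subseteq> r V \<and> b V \<in> F V) \<and>
      (\<forall>V\<in>\<V>. \<forall>W\<in>\<V>. \<forall>p\<in>V \<inter> W. c (r V) (r W) p = b W p - b V p)))"
proof (rule H1_vanishes_iff)
  fix U :: "('a, 'b) proj_point set" and s t assume U: "openin Pn U"
  have UX: "U \<subseteq> proj_points" by (rule openin_Pn_subset[OF U])
  show "(\<lambda>_. 0) \<in> F U" unfolding is_sectnD[OF F U]
    by (rule sectn_eqI[where x = 0]) (use UX Fr_0[OF _ J] in auto)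
  show "(\<lambda>p. s p - t p) \<in> F U" if "s \<in> F U" "t \<in> F U"
  proof -
    obtain x where x: "s = res U (\<lambda>_. x)" "\<And>p. p \<in> U \<Longrightarrow> x \<in> Fr J d p"
      using \<open>s \<in> F U\<close> unfolding is_sectnD[OF F U] sectn_def by blast
    obtain y where y: "t = res U (\<lambda>_. y)" "\<And>p. p \<in> U \<Longrightarrow> y \<in> Fr J d p"
      using \<open>t \<in> F U\<close> unfolding is_sectnD[OF F U] sectn_def by blast
    show ?thesis unfolding is_sectnD[OF F U]
      by (rule sectn_eqI[where x = "x - y"])
        (use UX in \<open>auto simp: x(1) y(1) res_def intro!: Fr_diff J x(2) y(2)\<close>)
  qed
  fix V :: "('a, 'b) proj_point set" assume V: "openin Pn V" "V \<subseteq> U" and s: "s \<in> F U"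
  obtain x where x: "s = res U (\<lambda>_. x)" "\<And>p. p \<in> U \<Longrightarrow> x \<in> Fr J d p"
    using s unfolding is_sectnD[OF F U] sectn_def by blast
  show "res V s \<in> F V" unfolding is_sectnD[OF F V(1)]
    by (rule sectn_eqI[where x = x]) (use V(2) in \<open>auto simp: x(1) res_def intro: x(2)\<close>)
qed

text \<open>The connecting map for O(d) modulo J(d): differences of local lifts of G form a cocycle
  of J(d), and a splitting of that cocycle corrects the lifts to one global section.\<close>

lemma H1_vanishes_imp_lifts:
  fixes F :: "(('v::{finite,linorder}, 'k::field) proj_point, ('v, 'k) mpoly fract) fsheaf"
  assumes F: "is_sectn F J d" and J: "idl J" and H1: "H1_vanishes Pn F"
  shows "lifts_sections J d"
  unfolding lifts_sections_def
proof (intro allI impI)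
  let ?X = "proj_points :: ('v, 'k) proj_point set"
  fix G assume G: "\<forall>p\<in>?X. \<exists>V x. openin Pn V \<and> p \<in> V \<and> (\<forall>q\<in>V. x \<in> Fr UNIV d q \<and> G q - x \<in> Fr J d q)"
  have "\<forall>p\<in>?X. \<exists>Vx. openin Pn (fst Vx) \<and> p \<in> fst Vx \<and>
      (\<forall>q\<in>fst Vx. snd Vx \<in> Fr UNIV d q \<and> G q - snd Vx \<in> Fr J d q)"
    using G by simp
  from bchoice[OF this] obtain Vx where Vx: "\<forall>p\<in>?X. openin Pn (fst (Vx p)) \<and> p \<in> fst (Vx p) \<and>
      (\<forall>q\<in>fst (Vx p). snd (Vx p) \<in> Fr UNIV d q \<and> G q - snd (Vx p) \<in> Fr J d q)" ..
  define V where "V p = fst (Vx p)" for p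
  define x where "x p = snd (Vx p)" for p
  have V: "openin Pn (V p)" "p \<in> V p" if "p \<in> ?X" for p using Vx that by (simp_all add: V_def)
  have x: "x p \<in> Fr UNIV d q" "G q - x p \<in> Fr J d q" if "p \<in> ?X" "q \<in> V p" for p q
    using Vx that by (simp_all add: V_def x_def)
  have sub: "V p \<subseteq> ?X" if "p \<in> ?X" for p by (rule openin_Pn_subset[OF V(1)[OF that]])
  \<comment> \<open>The cover is a set, and several points may give the same open set; one of them,
    and with it one local lift, is fixed for each set.\<close>
  define s where "s U = (SOME p. p \<in> ?X \<and> V p = U)" for U
  have s: "s U \<in> ?X" "V (s U) = U" if U: "U \<in> V ` ?X" for U
  proof -
    have "\<exists>p. p \<in> ?X \<and> V p = U" using U by blast
    from someI_ex[OF this] show "s U \<in> ?X" "V (s U) = U" unfolding s_def by blast+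
  qed
  define c where "c U W = res (U \<inter> W) (\<lambda>_. x (s W) - x (s U))" for U W
  have "(V ` ?X, c) \<in> cech_cocycles Pn F"
    unfolding cech_cocycles_def
  proof (intro CollectI case_prodI conjI ballI)
    show "open_cover Pn (V ` ?X)" unfolding open_cover_def topspace_Pn using V sub by blast
    show "c U W \<in> F (U \<inter> W)" if U: "U \<in> V ` ?X" and W: "W \<in> V ` ?X" for U W
    proof -
      have o: "openin Pn (U \<inter> W)" using V(1) U W by (auto intro: openin_Int)
      have "x (s W) - x (s U) \<in> Fr J d q" if q: "q \<in> U \<inter> W" for q
      proof -
        have qX: "q \<in> ?X" using openin_Pn_subset[OF o] q by blast
        have "G q - x (s U) \<in> Fr J d q" "G q - x (s W) \<in> Fr J d q"
          using x(2)[OF s(1)[OF U], of q] x(2)[OF s(1)[OF W], of q] s(2)[OF U] s(2)[OF W] q by auto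
        from Fr_diff[OF qX J this] show ?thesis by simp
      qed
      then show ?thesis unfolding c_def is_sectnD[OF F o] by (rule sectnI)
    qed
    show "c V' W p - c U W p + c U V' p = 0" if "p \<in> U \<inter> V' \<inter> W" for U V' W p
      using that by (simp add: c_def res_def)
  qed
  with H1[unfolded H1_sectn_iff[OF F J]] have "\<exists>\<V> r b. open_cover Pn \<V> \<and>
      (\<forall>W\<in>\<V>. r W \<in> V ` ?X \<and> W \<subseteq> r W \<and> b W \<in> F W) \<and>
      (\<forall>V\<in>\<V>. \<forall>W\<in>\<V>. \<forall>p\<in>V \<inter> W. c (r V) (r W) p = b W p - b V p)" by (elim allE impE)
  then obtain \<V> r b where b0: "open_cover Pn \<V> \<and>
      (\<forall>W\<in>\<V>. r W \<in> V ` ?X \<and> W \<subseteq> r W \<and> b W \<in> F W) \<and>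
      (\<forall>V\<in>\<V>. \<forall>W\<in>\<V>. \<forall>p\<in>V \<inter> W. c (r V) (r W) p = b W p - b V p)" by (elim exE) (rule that)
  have op: "openin Pn W" if "W \<in> \<V>" for W using b0 that by (simp add: open_cover_def)
  have r: "r W \<in> V ` ?X" "W \<subseteq> r W" and bF: "b W \<in> F W" if "W \<in> \<V>" for W
    using b0 that by simp_all
  have cb: "c (r V) (r W) p = b W p - b V p" if "V \<in> \<V>" "W \<in> \<V>" "p \<in> V \<inter> W" for V W p
    using b0[THEN conjunct2, THEN conjunct2] that by simp
  have cov: "\<Union>\<V> = ?X" using b0 by (simp add: open_cover_def)
  then obtain V0 where V0: "V0 \<in> \<V>" "{0} \<in> V0" using generic_point by blast
  \<comment> \<open>The corrected lift. It is computed on one member of the cover, but the cocycle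
    relation at the generic point gives the same value on all nonempty ones.\<close>
  define \<gamma> where "\<gamma> = x (s (r V0)) - b V0 {0}"
  have main: "\<gamma> \<in> Fr UNIV d q \<and> \<gamma> - G q \<in> Fr J d q" if q: "q \<in> ?X" for q
  proof -
    obtain W where W: "W \<in> \<V>" "q \<in> W" using cov q by blast
    have z: "{0} \<in> W" by (rule generic_in_open[OF op[OF W(1)] W(2)])
    have "c (r V0) (r W) {0} = x (s (r W)) - x (s (r V0))"
      using r(2)[OF V0(1)] r(2)[OF W(1)] V0(2) z by (auto simp: c_def res_def)
    then have \<gamma>: "\<gamma> = x (s (r W)) - b W {0}"
      using cb[OF V0(1) W(1), of "{0}"] V0(2) z by (simp add: \<gamma>_def algebra_simps)
    have bq: "b W {0} \<in> Fr J d q"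
      using bF[OF W(1)] unfolding is_sectnD[OF F op[OF W(1)]] by (rule sectn_value(2)[OF _ z W(2)])
    have "q \<in> V (s (r W))" using s(2)[OF r(1)[OF W(1)]] r(2)[OF W(1)] W(2) by auto
    from x[OF s(1)[OF r(1)[OF W(1)]] this]
    have xq: "x (s (r W)) \<in> Fr UNIV d q" "G q - x (s (r W)) \<in> Fr J d q" .
    have "\<gamma> \<in> Fr UNIV d q"
      unfolding \<gamma> using bq Fr_mono[of J UNIV d q] by (intro Fr_diff[OF q idl_UNIV xq(1)]) auto
    moreover have "\<gamma> - G q = - ((G q - x (s (r W))) + b W {0})" unfolding \<gamma> by simp
    moreover have "- ((G q - x (s (r W))) + b W {0}) \<in> Fr J d q"
      by (intro Fr_uminus Fr_add q J xq bq)
    ultimately show ?thesis by (simp only: simp_thms)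
  qed
  then obtain f where "homog d f" "\<gamma> = to_fract f" using global_sections[of \<gamma> d] by blast
  then show "\<exists>f. homog d f \<and> (\<forall>p\<in>?X. to_fract f - G p \<in> Fr J d p)" using main by blast
qed

text \<open>The cocycle splits in the constant sheaf of the function field. Since H^1 of O(d)
  vanishes, the splitting can be shifted by a constant \<delta> into O(d), where it is a section
  modulo J(d); a form lifting that section moves the splitting into J(d).\<close>

lemma lifts_imp_H1_vanishes:
  fixes F :: "(('v::{finite,linorder}, 'k::field) proj_point, ('v, 'k) mpoly fract) fsheaf"
  assumes F: "is_sectn F J d" and J: "idl J" and lifts: "lifts_sections J d"
  shows "H1_vanishes Pn F"
  unfolding H1_sectn_iff[OF F J]
proof (intro allI impI)
  let ?X = "proj_points :: ('v, 'k) proj_point set"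
  fix \<U> c assume c: "(\<U>, c) \<in> cech_cocycles Pn F"
  have cov: "open_cover Pn \<U>"
    and cF: "\<And>U V. U \<in> \<U> \<Longrightarrow> V \<in> \<U> \<Longrightarrow> c U V \<in> F (U \<inter> V)"
    and cc: "\<And>U V W p. U \<in> \<U> \<Longrightarrow> V \<in> \<U> \<Longrightarrow> W \<in> \<U> \<Longrightarrow> p \<in> U \<inter> V \<inter> W \<Longrightarrow> c V W p - c U W p + c U V p = 0"
    using c by (simp_all add: cech_cocycles_def)
  have op: "openin Pn U" if "U \<in> \<U>" for U using cov that by (simp add: open_cover_def)
  have UX: "\<Union>\<U> = ?X" using cov by (simp add: open_cover_def)
  have gen: "{0} \<in> U" if "U \<in> \<U>" "q \<in> U" for U q using generic_in_open op that by blast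
  define \<gamma> where "\<gamma> U W = c U W {0}" for U W
  have c_const: "c U W q = \<gamma> U W" "\<gamma> U W \<in> Fr J d q" if "U \<in> \<U>" "W \<in> \<U>" "q \<in> U" "q \<in> W" for U W q
  proof -
    have o: "openin Pn (U \<inter> W)" using op that by (intro openin_Int)
    have s: "c U W \<in> sectn J d (U \<inter> W)" using cF[OF that(1,2)] unfolding is_sectnD[OF F o] .
    have z: "{0} \<in> U \<inter> W" using gen that by blast
    have q: "q \<in> U \<inter> W" using that by blast
    show "c U W q = \<gamma> U W" "\<gamma> U W \<in> Fr J d q"
      unfolding \<gamma>_def using sectn_value[OF s q z] sectn_value[OF s z q] by simp_all
  qed
  obtain U0 where U0: "U0 \<in> \<U>" "{0} \<in> U0" using UX generic_point by blast
  define u where "u p = (SOME U. U \<in> \<U> \<and> p \<in> U)" for p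
  have u: "u p \<in> \<U>" "p \<in> u p" if "p \<in> ?X" for p
  proof -
    have "\<exists>U. U \<in> \<U> \<and> p \<in> U" using that UX by blast
    from someI_ex[OF this] show "u p \<in> \<U>" "p \<in> u p" unfolding u_def by blast+
  qed
  \<comment> \<open>All nonempty members of the cover meet in the generic point, so the values of
    the cocycle against the fixed set \<open>U0\<close> split it.\<close>
  define g where "g p = \<gamma> U0 (u p)" for p
  have coc: "\<gamma> U W = \<gamma> U0 W - \<gamma> U0 U" if "U \<in> \<U>" "W \<in> \<U>" "q \<in> U" "q' \<in> W" for U W q q'
    using cc[OF U0(1) that(1,2), of "{0}"] U0(2) gen that by (simp add: \<gamma>_def algebra_simps)
  have key: "\<gamma> U0 U - g q \<in> Fr J d q" if U: "U \<in> \<U>" "q \<in> U" for U q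
  proof -
    have q: "q \<in> ?X" using U UX by blast
    have "\<gamma> U0 U - g q = - \<gamma> U (u q)" using coc[OF U(1) u(1)[OF q] U(2) u(2)[OF q]] by (simp add: g_def)
    then show ?thesis using c_const(2)[OF U(1) u(1)[OF q] U(2) u(2)[OF q]] Fr_uminus[OF q J] by simp
  qed
  have JU: "Fr J d q \<subseteq> Fr UNIV d q" for q by (rule Fr_mono) simp
  have gpq: "g p - g q \<in> Fr J d q" if "p \<in> ?X" "q \<in> u p" for p q
    using key[OF u(1)[OF that(1)] that(2)] by (simp add: g_def)
  have "\<exists>V. openin Pn V \<and> p \<in> V \<and> (\<forall>q\<in>V. g p - g q \<in> Fr UNIV d q)" if p: "p \<in> ?X" for p
    using op[OF u(1)[OF p]] u(2)[OF p] gpq[OF p] JU by (intro exI[of _ "u p"]) blast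
  then have "\<exists>\<delta>. \<forall>p\<in>?X. \<delta> - g p \<in> Fr UNIV d p" by (rule locally_constant_mod_sections)
  then obtain \<delta> where \<delta>: "\<And>p. p \<in> ?X \<Longrightarrow> \<delta> - g p \<in> Fr UNIV d p" by blast
  have "\<forall>p\<in>?X. \<exists>V x. openin Pn V \<and> p \<in> V \<and> (\<forall>q\<in>V. x \<in> Fr UNIV d q \<and> (g q - \<delta>) - x \<in> Fr J d q)"
  proof
    fix p assume p: "p \<in> ?X"
    have "g p - \<delta> \<in> Fr UNIV d q \<and> (g q - \<delta>) - (g p - \<delta>) \<in> Fr J d q" if q: "q \<in> u p" for q
    proof -
      have qX: "q \<in> ?X" using q UX u(1)[OF p] by blast
      have "(g p - g q) - (\<delta> - g q) \<in> Fr UNIV d q"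
        by (rule Fr_diff[OF qX idl_UNIV subsetD[OF JU gpq[OF p q]] \<delta>[OF qX]])
      moreover have "- (g p - g q) \<in> Fr J d q" by (intro Fr_uminus qX J gpq p q)
      ultimately show ?thesis by simp
    qed
    then show "\<exists>V x. openin Pn V \<and> p \<in> V \<and> (\<forall>q\<in>V. x \<in> Fr UNIV d q \<and> (g q - \<delta>) - x \<in> Fr J d q)"
      using op[OF u(1)[OF p]] u(2)[OF p] by (intro exI[of _ "u p"] exI[of _ "g p - \<delta>"]) blast
  qed
  with lifts[unfolded lifts_sections_def, rule_format, of "\<lambda>q. g q - \<delta>"]
  obtain f where f: "\<And>p. p \<in> ?X \<Longrightarrow> to_fract f - (g p - \<delta>) \<in> Fr J d p" by blast
  \<comment> \<open>Subtracting constants leaves the coboundary unchanged; these two bring the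
    splitting into J(d).\<close>
  define b where "b U = res U (\<lambda>_. \<gamma> U0 U - \<delta> - to_fract f)" for U
  have "b U \<in> F U" if U: "U \<in> \<U>" for U
    unfolding b_def is_sectnD[OF F op[OF U]]
  proof (rule sectnI)
    fix q assume q: "q \<in> U"
    then have qX: "q \<in> ?X" using U UX by blast
    have "(\<gamma> U0 U - g q) - (to_fract f - (g q - \<delta>)) \<in> Fr J d q"
      by (intro Fr_diff qX J key U q f)
    then show "\<gamma> U0 U - \<delta> - to_fract f \<in> Fr J d q" by (simp add: algebra_simps)
  qed
  moreover have "c U W p = b W p - b U p" if "U \<in> \<U>" "W \<in> \<U>" "p \<in> U \<inter> W" for U W p
    using that c_const(1)[of U W p] coc[of U W p p] by (simp add: b_def res_def)
  ultimately have "open_cover Pn \<U> \<and> (\<forall>V\<in>\<U>. V \<in> \<U> \<and> V \<subseteq> V \<and> b V \<in> F V) \<and>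
      (\<forall>V\<in>\<U>. \<forall>W\<in>\<U>. \<forall>p\<in>V \<inter> W. c V W p = b W p - b V p)"
    using cov by simp
  then show "\<exists>\<V> r b. open_cover Pn \<V> \<and> (\<forall>V\<in>\<V>. r V \<in> \<U> \<and> V \<subseteq> r V \<and> b V \<in> F V) \<and>
      (\<forall>V\<in>\<V>. \<forall>W\<in>\<V>. \<forall>p\<in>V \<inter> W. c (r V) (r W) p = b W p - b V p)"
    by (intro exI[of _ \<U>] exI[of _ "\<lambda>V. V"] exI[of _ b])
qed

section \<open>Irreducible closed sets\<close>

lemma ex_homog_notin:
  assumes "idl p" "graded J" "\<not> J \<subseteq> p"
  obtains h e where "h \<in> J" "homog e h" "h \<notin> p"
proof -
  obtain f where f: "f \<in> J" "f \<notin> p" using assms(3) by blast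
  then obtain e where "hcomp e f \<notin> p" using idl_mem_if_hcomp[OF assms(1)] by blast
  then show ?thesis using that gradedD[OF assms(2) f(1)] homog_hcomp by blast
qed

text \<open>The intersection of all points of Z is its generic point: irreducibility applied to the
  zero loci of two forms makes it prime, and closedness puts every point containing it into
  Z.\<close>

lemma irreducible_closed:
  fixes Z :: "('v::{finite,linorder}, 'k::field) proj_point set"
  assumes cl: "closedin Pn Z" and irr: "irreducible_in Pn Z"
  shows "\<Inter>Z \<in> proj_points" "\<Inter>Z \<in> Z" "Z = {p\<in>proj_points. \<Inter>Z \<subseteq> p}"
proof -
  let ?P = "\<Inter>Z"
  have ZX: "Z \<subseteq> proj_points" using closedin_subset[OF cl] by simp
  have ne: "Z \<noteq> {}" using irr by (simp add: irreducible_in_def)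
  then obtain p0 where p0: "p0 \<in> Z" by blast
  have D: "idl p" "graded p" "1 \<notin> p" if "p \<in> Z" for p using proj_pointsD ZX that by blast+
  have I: "idl ?P" using D(1) by (auto simp: idl_def)
  have gr: "graded ?P" using D(2) by (auto simp: graded_def)
  have one: "1 \<notin> ?P" using D(3) p0 by blast
  have "prime_idl ?P"
  proof (rule prime_if_homogeneous[OF I gr one])
    fix a b d e assume ab: "homog d a" "homog e b" "a * b \<in> ?P"
    have closed: "closedin Pn {p\<in>proj_points. f \<in> p}" if "homog m f" for f :: "('v, 'k) mpoly" and m
    proof -
      have "{p\<in>proj_points. f \<in> p} = topspace Pn - basic_open f" by (auto simp: basic_open_def)
      then show ?thesis using openin_basic_open[OF that] by (metis closedin_diff closedin_topspace)
    qed
    have "Z \<subseteq> {p\<in>proj_points. a \<in> p} \<union> {p\<in>proj_points. b \<in> p}"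
    proof
      fix p assume p: "p \<in> Z"
      then have "a * b \<in> p" "p \<in> proj_points" using ab(3) ZX by blast+
      then show "p \<in> {p\<in>proj_points. a \<in> p} \<union> {p\<in>proj_points. b \<in> p}"
        by (simp add: prime_idl_mult_iff proj_pointsD)
    qed
    then have "Z \<subseteq> {p\<in>proj_points. a \<in> p} \<or> Z \<subseteq> {p\<in>proj_points. b \<in> p}"
      using irr closed[OF ab(1)] closed[OF ab(2)] unfolding irreducible_in_def by blast
    then show "a \<in> ?P \<or> b \<in> ?P" by blast
  qed
  moreover have "\<exists>i. var i \<notin> ?P" using proj_points_var[of p0] ZX p0 by blast
  ultimately show PX: "?P \<in> proj_points" using gr by (simp add: proj_points_iff)
  have in_Z: "p \<in> Z" if p: "p \<in> proj_points" "?P \<subseteq> p" for p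
  proof (rule ccontr)
    assume "p \<notin> Z"
    have "openin Pn (topspace Pn - Z)" using cl by (simp add: closedin_def)
    moreover have "p \<in> topspace Pn - Z" using p(1) \<open>p \<notin> Z\<close> by simp
    ultimately obtain f d where f: "homog d f" "p \<in> basic_open f" "basic_open f \<subseteq> topspace Pn - Z"
      by (rule openin_Pn_base)
    then have "f \<notin> p" by (simp add: basic_open_def)
    then have "f \<notin> ?P" using p(2) by blast
    then obtain q where "q \<in> Z" "f \<notin> q" by blast
    then have "q \<in> basic_open f" using ZX by (auto simp: basic_open_def)
    then show False using f(3) \<open>q \<in> Z\<close> by blast
  qed
  show "?P \<in> Z" using in_Z[OF PX] by simp
  show "Z = {p\<in>proj_points. ?P \<subseteq> p}"
  proof (intro equalityI subsetI)
    fix p assume "p \<in> Z"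
    then show "p \<in> {p\<in>proj_points. ?P \<subseteq> p}" using ZX by blast
  qed (use in_Z in simp)
qed

section \<open>The ideal sheaf of a variety and its square\<close>

locale projective_variety =
  fixes Z :: "('v::{finite,linorder}, 'k::field) proj_point set" and P
  assumes P_proj: "P \<in> proj_points" and Z_eq: "Z = {p\<in>proj_points. P \<subseteq> p}"
begin

lemma P_prime: "prime_idl P" and P_graded: "graded P" and P_idl: "idl P"
  using proj_pointsD[OF P_proj] by auto

lemma P_in_Z: "P \<in> Z"
  using P_proj by (simp add: Z_eq)

lemma ZD: "p \<in> Z \<Longrightarrow> p \<in> proj_points" "p \<in> Z \<Longrightarrow> P \<subseteq> p"
  by (auto simp: Z_eq)

lemma P2_idl: "idl (idl_prod P P)"
  by (rule idl_idl_prod[OF P_idl])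

lemma P2_graded: "graded (idl_prod P P)"
  by (rule graded_idl_prod[OF P_graded P_graded])

lemma P2_subset: "idl_prod P P \<subseteq> P"
  by (rule idl_prod_subset[OF P_idl])

text \<open>At a point off Z some form of P is a unit, and so is its square.\<close>

lemma off_Z:
  assumes p: "p \<in> proj_points" "p \<notin> Z"
  shows "Fr P d p = Fr UNIV d p" "Fr (idl_prod P P) d p = Fr UNIV d p"
proof -
  have "\<not> P \<subseteq> p" using p by (simp add: Z_eq)
  then obtain h e where h: "h \<in> P" "homog e h" "h \<notin> p"
    using ex_homog_notin[OF proj_pointsD(3)[OF p(1)] P_graded] by blast
  show "Fr P d p = Fr UNIV d p" by (rule Fr_eq_UNIV[OF p(1) P_idl h])
  show "Fr (idl_prod P P) d p = Fr UNIV d p"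
    using h by (intro Fr_eq_UNIV[OF p(1) P2_idl, of "h * h" "e + e"] idl_prod_mem homog_mult)
      (auto simp: prime_idl_mult_iff proj_pointsD[OF p(1)])
qed

lemma max_ideal_at_eq: "p \<in> proj_points \<Longrightarrow> max_ideal_at p = Fr p 0 p"
  unfolding max_ideal_at_def Fr_def by (auto simp: Fract_conv_to_fract)

text \<open>Every neighbourhood of a point of Z contains the generic point \<open>P\<close>, and
  vanishing there puts the numerator into the prime \<open>P\<close>. Off Z both sides impose no
  condition beyond regularity.\<close>

lemma is_sectn_ideal_sheaf: "is_sectn (ideal_sheaf Z) P 0"
  unfolding is_sectn_def
proof (intro allI impI equalityI subsetI)
  fix U s assume U: "openin Pn U" and "s \<in> ideal_sheaf Z U"
  then have s: "s \<in> sectn UNIV 0 U" "\<And>p. p \<in> U \<inter> Z \<Longrightarrow> s p \<in> max_ideal_at p"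
    by (simp_all add: ideal_sheaf_def is_sectnD[OF is_sectn_OPn U])
  then obtain x where x: "s = res U (\<lambda>_. x)" "\<And>p. p \<in> U \<Longrightarrow> x \<in> Fr UNIV 0 p" unfolding sectn_def by blast
  show "s \<in> sectn P 0 U" unfolding x(1)
  proof (rule sectnI)
    fix p assume p: "p \<in> U"
    then have pX: "p \<in> proj_points" using openin_Pn_subset[OF U] by blast
    show "x \<in> Fr P 0 p"
    proof (cases "p \<in> Z")
      case True
      obtain a b e where ab: "x = to_fract a / to_fract b" "b \<notin> p" "homog (e + 0) a" "homog e b"
        using x(2)[OF p] by (rule FrE)
      obtain f d where f: "homog d f" "p \<in> basic_open f" "basic_open f \<subseteq> U" by (rule openin_Pn_base[OF U p])
      then have "f \<notin> P" using ZD(2)[OF True] by (auto simp: basic_open_def)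
      then have PU: "P \<in> U" using f(3) P_proj by (auto simp: basic_open_def)
      then have "x \<in> Fr P 0 P"
        using s(2)[of P] P_in_Z by (simp add: max_ideal_at_eq[OF P_proj] x(1) res_def)
      moreover have bP: "b \<notin> P" using ab(2) ZD(2)[OF True] by blast
      ultimately obtain c where "c \<notin> P" "c * a \<in> P"
        using Fr_frac_iff[OF P_proj P_idl proj_nonzero[OF P_proj bP] ab(4,3) bP] ab(1) by auto
      then have "a \<in> P" by (simp add: prime_idl_mult_iff[OF P_prime])
      then show ?thesis unfolding ab(1) using ab by (intro FrI) auto
    qed (use x(2)[OF p] off_Z[OF pX] in simp)
  qed
next
  fix U s assume U: "openin Pn U" and "s \<in> sectn P 0 U"
  then obtain x where x: "s = res U (\<lambda>_. x)" "\<And>p. p \<in> U \<Longrightarrow> x \<in> Fr P 0 p" unfolding sectn_def by blast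
  have "s \<in> OPn 0 U" unfolding is_sectnD[OF is_sectn_OPn U] x(1)
    using x(2) Fr_mono[of P UNIV] by (intro sectnI) blast
  moreover have "s p \<in> max_ideal_at p" if "p \<in> U \<inter> Z" for p
    using x(2)[of p] that Fr_mono[OF ZD(2), of p 0 p] by (auto simp: max_ideal_at_eq ZD x(1) res_def)
  ultimately show "s \<in> ideal_sheaf Z U" by (simp add: ideal_sheaf_def)
qed

lemma is_sectn_ideal_sheaf_sq: "is_sectn (ideal_sheaf_sq Z) (idl_prod P P) 0"
  unfolding ideal_sheaf_sq_def
  using is_sectn_sheaf_mult[OF is_sectn_ideal_sheaf is_sectn_ideal_sheaf P_idl P_idl P_graded P_graded] by simp

lemma projectively_normal_ideal_sheaf: "projectively_normal (ideal_sheaf Z) \<longleftrightarrow> (\<forall>d. lifts_sections P d)"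
  by (rule projectively_normal_iff[OF is_sectn_ideal_sheaf P_idl P_graded])

lemma projectively_normal_ideal_sheaf_sq:
  "projectively_normal (ideal_sheaf_sq Z) \<longleftrightarrow> (\<forall>d. lifts_sections (idl_prod P P) d)"
  by (rule projectively_normal_iff[OF is_sectn_ideal_sheaf_sq P2_idl P2_graded])

lemma H1_ideal_sheaf_sq:
  "H1_vanishes Pn (twist (ideal_sheaf_sq Z) d) \<longleftrightarrow> lifts_sections (idl_prod P P) d"
  using H1_vanishes_imp_lifts[OF is_sectn_twist[OF is_sectn_ideal_sheaf_sq P2_idl P2_graded] P2_idl]
    lifts_imp_H1_vanishes[OF is_sectn_twist[OF is_sectn_ideal_sheaf_sq P2_idl P2_graded] P2_idl]
  by blast

text \<open>Because \<open>P\<close> is prime, membership of a form in \<open>P\<close> is decided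
  in the stalk at \<open>P\<close> itself.\<close>

lemma homogeneous_ideal_eq: "homogeneous_ideal Z = P"
proof (intro equalityI subsetI)
  have o: "openin Pn (topspace (Pn :: ('v, 'k) proj_point topology))" by (rule openin_topspace)
  note tw = is_sectnD[OF is_sectn_twist[OF is_sectn_ideal_sheaf P_idl P_graded] o]
  fix f
  {
    assume "f \<in> homogeneous_ideal Z"
    have "hcomp d f \<in> P" for d
    proof -
      have "res proj_points (\<lambda>_. to_fract (hcomp d f)) \<in> sectn P d proj_points"
        using \<open>f \<in> homogeneous_ideal Z\<close> tw by (simp add: homogeneous_ideal_def Fract_conv_to_fract)
      from sectn_value(2)[OF this P_proj P_proj]
      have "to_fract (hcomp d f) / to_fract 1 \<in> Fr P d P" using P_proj by (simp add: res_def)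
      then obtain c where "c \<notin> P" "c * hcomp d f \<in> P"
        using Fr_frac_iff[OF P_proj P_idl _ homog_1, of d "hcomp d f"] proj_pointsD(5)[OF P_proj] by auto
      then show ?thesis by (simp add: prime_idl_mult_iff[OF P_prime])
    qed
    then show "f \<in> P" by (rule idl_mem_if_hcomp[OF P_idl])
  next
    assume f: "f \<in> P"
    have "res proj_points (\<lambda>_. to_fract (hcomp d f)) \<in> sectn P d proj_points" for d
      by (intro sectnI Fr_to_fract gradedD[OF P_graded f] homog_hcomp) (rule proj_pointsD(5))
    then show "f \<in> homogeneous_ideal Z" using tw by (simp add: homogeneous_ideal_def Fract_conv_to_fract)
  }
qed

end

section \<open>Quotient modules and Kaehler differentials\<close>

lemma (in cring) finite_support_smult:
  "finite {i. f i \<noteq> \<zero>} \<Longrightarrow> a \<in> carrier R \<Longrightarrow> finite {i. a \<otimes> f i \<noteq> \<zero>}"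
  by (rule finite_subset[of _ "{i. f i \<noteq> \<zero>}"]) auto

lemma (in cring) free_module_is_module: "module R (free_module R B)"
proof (rule moduleI)
  let ?F = "free_module R B"
  have fin: "finite {i. f i \<oplus> g i \<noteq> \<zero>}" if "finite {i. f i \<noteq> \<zero>}" "finite {i. g i \<noteq> \<zero>}" for f g :: "_ \<Rightarrow> 'a"
    by (rule finite_subset[OF _ finite_UnI[OF that]]) auto
  show "abelian_group ?F"
  proof (rule abelian_groupI)
    fix f assume f: "f \<in> carrier ?F"
    have "finite {i. \<ominus> f i \<noteq> \<zero>}"
      by (rule finite_subset[of _ "{i. f i \<noteq> \<zero>}"]) (use f in \<open>auto simp: free_module_def\<close>)
    then show "\<exists>g\<in>carrier ?F. g \<oplus>\<^bsub>?F\<^esub> f = \<zero>\<^bsub>?F\<^esub>"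
      using f by (intro bexI[of _ "\<lambda>i. \<ominus> f i"]) (auto simp: free_module_def l_neg)
  qed (auto simp: free_module_def a_ac intro!: fin)
  show "cring R" ..
qed (auto simp: free_module_def l_distr r_distr m_assoc intro!: finite_support_smult)

lemma submodule_gen_is_submodule:
  fixes R :: "('a, 'm) ring_scheme" and M :: "('a, 'b) module"
  assumes "module R M" "A \<subseteq> carrier M"
  shows "submodule (submodule_gen R M A) R M"
proof -
  interpret module R M by fact
  have ex: "carrier M \<in> {H. submodule H R M \<and> A \<subseteq> H}" using carrier_is_submodule assms(2) by blast
  show ?thesis unfolding submodule_gen_def
  proof (rule submoduleI)
    show "\<Inter>{H. submodule H R M \<and> A \<subseteq> H} \<subseteq> carrier M" using ex by blast
    show "\<zero>\<^bsub>M\<^esub> \<in> \<Inter>{H. submodule H R M \<and> A \<subseteq> H}"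
      using subgroup.one_closed[OF submodule.axioms(1)] by fastforce
  qed (auto dest: submoduleE)
qed

lemma submodule_gen_subset:
  "submodule H R M \<Longrightarrow> A \<subseteq> H \<Longrightarrow> submodule_gen R M A \<subseteq> H"
  unfolding submodule_gen_def by blast

lemma submodule_gen_mem: "a \<in> A \<Longrightarrow> a \<in> submodule_gen R M A"
  unfolding submodule_gen_def by blast

locale quotient_module = module R M + submodule N R M
  for R :: "('a, 'm) ring_scheme" and M :: "('a, 'b) module" (structure) and N
begin

lemma additive: "abelian_subgroup N M"
  by (rule abelian_subgroupI3[OF additive_subgroup.intro[OF subgroup_axioms] abelian_group_axioms])

definition qcl :: "'b \<Rightarrow> 'b set" where "qcl x = N +> x"

lemma N_sub: "N \<subseteq> carrier M" using subgroup.subset[OF subgroup_axioms] by simp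

lemma qcl_carrier: "carrier (quot_module M N) = qcl ` carrier M"
  by (auto simp: quot_module_def A_RCOSETS_def' qcl_def)

lemma qcl_add: "x \<in> carrier M \<Longrightarrow> y \<in> carrier M \<Longrightarrow> qcl x \<oplus>\<^bsub>quot_module M N\<^esub> qcl y = qcl (x \<oplus> y)"
  using abelian_subgroup.a_rcos_sum[OF additive] by (simp add: quot_module_def qcl_def)

lemma qcl_eq_iff: "x \<in> carrier M \<Longrightarrow> y \<in> carrier M \<Longrightarrow> qcl x = qcl y \<longleftrightarrow> x \<ominus> y \<in> N"
proof -
  assume x: "x \<in> carrier M" and y: "y \<in> carrier M"
  interpret N: abelian_subgroup N M by (rule additive)
  show ?thesis
  proof
    assume "qcl x = qcl y"
    then have "x \<in> N +> y" using N.a_rcos_self[OF x] by (simp add: qcl_def)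
    then show "x \<ominus> y \<in> N" using N.a_rcos_module_imp[OF y] by (simp add: a_minus_def)
  next
    assume "x \<ominus> y \<in> N"
    then have "x \<in> N +> y" using N.a_rcos_module_rev[OF y x] by (simp add: a_minus_def)
    then show "qcl x = qcl y" unfolding qcl_def using N.a_repr_independence'[OF _ y] by simp
  qed
qed

lemma qcl_0: "\<zero>\<^bsub>quot_module M N\<^esub> = qcl \<zero>"
proof -
  show ?thesis using M.a_coset_add_zero[OF N_sub] by (simp add: quot_module_def qcl_def)
qed

lemma qcl_smult:
  assumes a: "a \<in> carrier R" and x: "x \<in> carrier M"
  shows "a \<odot>\<^bsub>quot_module M N\<^esub> qcl x = qcl (a \<odot> x)"
proof -
  interpret N: abelian_subgroup N M by (rule additive)
  have "qcl (a \<odot> y) = qcl (a \<odot> x)" if "y \<in> qcl x" for y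
  proof -
    have y: "y \<in> carrier M" using that x N_sub N.a_elemrcos_carrier by (auto simp: qcl_def)
    have "y \<ominus> x \<in> N" using that N.a_rcos_module_imp[OF x] by (simp add: qcl_def a_minus_def)
    then have "a \<odot> (y \<ominus> x) \<in> N" using a submodule.smult_closed[OF submodule_axioms] by blast
    moreover have "a \<odot> (y \<ominus> x) = a \<odot> y \<ominus> a \<odot> x"
      using a x y by (simp add: a_minus_def smult_r_distr smult_r_minus)
    ultimately show ?thesis using qcl_eq_iff a x y by simp
  qed
  moreover have "x \<in> qcl x" using N.a_rcos_self[OF x] by (simp add: qcl_def)
  ultimately have "(\<Union>y\<in>qcl x. qcl (a \<odot> y)) = qcl (a \<odot> x)" by blast
  then show ?thesis by (simp add: quot_module_def qcl_def)
qed

lemma qcl_module: "module R (quot_module M N)"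
proof (rule moduleI)
  let ?Q = "quot_module M N"
  show "abelian_group ?Q"
  proof (rule abelian_groupI)
    fix C assume "C \<in> carrier ?Q"
    then obtain x where x: "C = qcl x" "x \<in> carrier M" by (auto simp: qcl_carrier)
    then show "\<exists>D\<in>carrier ?Q. D \<oplus>\<^bsub>?Q\<^esub> C = \<zero>\<^bsub>?Q\<^esub>"
      by (intro bexI[of _ "qcl (\<ominus> x)"]) (auto simp: qcl_carrier qcl_add qcl_0 M.l_neg)
  qed (auto simp: qcl_carrier qcl_add qcl_0 M.a_ac)
qed (auto simp: qcl_carrier qcl_add qcl_smult smult_l_distr smult_r_distr smult_assoc1 R.is_cring)

end

section \<open>The module of Kaehler differentials\<close>

locale kaehler_setup = cring R for R :: "('a, 'm) ring_scheme" (structure) +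
  fixes h :: "'k \<Rightarrow> 'a"
  assumes h_closed: "h c \<in> carrier R"
begin

abbreviation "F \<equiv> free_module R (carrier R)"
abbreviation "N \<equiv> submodule_gen R F (kaehler_relations R h)"
abbreviation "\<Omega> \<equiv> kaehler R h"

lemma kaehler_eq: "\<Omega> = quot_module F N"
  by (simp add: kaehler_def Let_def)

sublocale F: module R F
  by (rule free_module_is_module)

lemma dsym_closed: "x \<in> carrier R \<Longrightarrow> dsym R x \<in> carrier F"
proof -
  assume x: "x \<in> carrier R"
  have "finite {i. dsym R x i \<noteq> \<zero>}" by (rule finite_subset[of _ "{x}"]) (auto simp: dsym_def)
  then show ?thesis using x by (auto simp: free_module_def dsym_def)
qed

lemma relations_closed: "kaehler_relations R h \<subseteq> carrier F"
  unfolding kaehler_relations_def Let_def using dsym_closed h_closed by (auto intro!: F.M.minus_closed)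

sublocale Q: quotient_module R F N
  by (rule quotient_module.intro[OF free_module_is_module submodule_gen_is_submodule[OF free_module_is_module relations_closed]])

sublocale K: module R \<Omega>
  unfolding kaehler_eq by (rule Q.qcl_module)

definition d :: "'a \<Rightarrow> ('a \<Rightarrow> 'a) set" where "d x = Q.qcl (dsym R x)"

lemma d_closed: "x \<in> carrier R \<Longrightarrow> d x \<in> carrier \<Omega>"
  unfolding kaehler_eq Q.qcl_carrier d_def using dsym_closed by blast

lemma d_add:
  assumes x: "x \<in> carrier R" and y: "y \<in> carrier R"
  shows "d (x \<oplus> y) = d x \<oplus>\<^bsub>\<Omega>\<^esub> d y"
proof -
  have "dsym R (x \<oplus> y) \<ominus>\<^bsub>F\<^esub> (dsym R x \<oplus>\<^bsub>F\<^esub> dsym R y) \<in> N"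
    using x y by (intro submodule_gen_mem) (auto simp: kaehler_relations_def Let_def)
  then show ?thesis unfolding d_def kaehler_eq using x y
    by (simp add: Q.qcl_add Q.qcl_eq_iff dsym_closed)
qed

lemma d_mult:
  assumes x: "x \<in> carrier R" and y: "y \<in> carrier R"
  shows "d (x \<otimes> y) = x \<odot>\<^bsub>\<Omega>\<^esub> d y \<oplus>\<^bsub>\<Omega>\<^esub> y \<odot>\<^bsub>\<Omega>\<^esub> d x"
proof -
  have "dsym R (x \<otimes> y) \<ominus>\<^bsub>F\<^esub> (x \<odot>\<^bsub>F\<^esub> dsym R y \<oplus>\<^bsub>F\<^esub> y \<odot>\<^bsub>F\<^esub> dsym R x) \<in> N"
    using x y by (intro submodule_gen_mem) (auto simp: kaehler_relations_def Let_def)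
  then show ?thesis unfolding d_def kaehler_eq using x y
    by (simp add: Q.qcl_add Q.qcl_smult Q.qcl_eq_iff dsym_closed)
qed

lemma d_const: "d (h c) = \<zero>\<^bsub>\<Omega>\<^esub>"
proof -
  have "dsym R (h c) \<in> N"
    by (intro submodule_gen_mem) (auto simp: kaehler_relations_def Let_def)
  moreover have "\<zero>\<^bsub>F\<^esub> \<in> N" using subgroup.one_closed[OF Q.subgroup_axioms] by simp
  ultimately have "dsym R (h c) \<ominus>\<^bsub>F\<^esub> \<zero>\<^bsub>F\<^esub> \<in> N"
    unfolding a_minus_def using F.submoduleE(3,5)[OF Q.submodule_axioms] by blast
  then show ?thesis unfolding d_def kaehler_eq
    by (simp add: Q.qcl_0 Q.qcl_eq_iff dsym_closed h_closed)
qed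

lemma spanned_by_d:
  assumes H: "submodule H R \<Omega>" and dH: "\<And>x. x \<in> carrier R \<Longrightarrow> d x \<in> H"
  shows "carrier \<Omega> \<subseteq> H"
proof -
  have "Q.qcl \<phi> \<in> H" if "finite S" "\<phi> \<in> carrier F" "{x. \<phi> x \<noteq> \<zero>} \<subseteq> S" for S \<phi>
    using that
  proof (induction S arbitrary: \<phi>)
    case empty
    then have "\<phi> = \<zero>\<^bsub>F\<^esub>" by (auto simp: free_module_def)
    then have "Q.qcl \<phi> = \<zero>\<^bsub>\<Omega>\<^esub>" by (simp add: kaehler_eq Q.qcl_0)
    then show ?case using subgroup.one_closed[OF submodule.axioms(1)[OF H]] by simp
  next
    case (insert x S)
    show ?case
    proof (cases "x \<in> carrier R")
      case False
      then have "\<phi> x = \<zero>" using insert.prems by (auto simp: free_module_def)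
      then show ?thesis using insert by (intro insert.IH) auto
    next
      case True
      define \<psi> where "\<psi> = \<phi>(x := \<zero>)"
      have fin: "finite {i. \<psi> i \<noteq> \<zero>}"
        by (rule finite_subset[of _ "{i. \<phi> i \<noteq> \<zero>}"]) (use insert.prems in \<open>auto simp: \<psi>_def free_module_def\<close>)
      have \<psi>: "\<psi> \<in> carrier F" using insert.prems(1) fin by (auto simp: \<psi>_def free_module_def)
      have \<phi>x: "\<phi> x \<in> carrier R" using insert.prems(1) by (auto simp: free_module_def)
      have "\<phi> i \<in> carrier R" for i using insert.prems(1) by (auto simp: free_module_def)
      then have "\<phi> = \<psi> \<oplus>\<^bsub>F\<^esub> \<phi> x \<odot>\<^bsub>F\<^esub> dsym R x"
        by (auto simp: \<psi>_def free_module_def dsym_def fun_eq_iff)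
      then have "Q.qcl \<phi> = Q.qcl \<psi> \<oplus>\<^bsub>\<Omega>\<^esub> \<phi> x \<odot>\<^bsub>\<Omega>\<^esub> d x"
        using \<psi> \<phi>x dsym_closed[OF True] by (simp add: kaehler_eq d_def Q.qcl_add Q.qcl_smult)
      moreover have "Q.qcl \<psi> \<in> H"
        using insert.prems(2) by (intro insert.IH \<psi>) (auto simp: \<psi>_def split: if_splits)
      moreover have "\<phi> x \<odot>\<^bsub>\<Omega>\<^esub> d x \<in> H" using K.submoduleE(4)[OF H \<phi>x dH[OF True]] .
      ultimately show ?thesis using K.submoduleE(5)[OF H] by simp
    qed
  qed
  moreover have "finite {x. \<phi> x \<noteq> \<zero>}" if "\<phi> \<in> carrier F" for \<phi>
    using that by (simp add: free_module_def)
  ultimately show ?thesis unfolding kaehler_eq Q.qcl_carrier by blast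
qed

end

section \<open>Quotients of subrings\<close>

text \<open>A common setting for the two rings that occur: the cone ring, with
  \<open>A = UNIV\<close> and \<open>I = P\<close>, and the local ring of Z at p, where A is a
  subring of the fraction field of S.\<close>

locale subring_quotient =
  fixes A :: "'a::comm_ring_1 set" and I :: "'a set"
  assumes A0: "0 \<in> A" and A1: "1 \<in> A" and Aadd: "a \<in> A \<Longrightarrow> b \<in> A \<Longrightarrow> a + b \<in> A"
    and Amult: "a \<in> A \<Longrightarrow> b \<in> A \<Longrightarrow> a * b \<in> A" and Aminus: "a \<in> A \<Longrightarrow> - a \<in> A"
    and IA: "I \<subseteq> A" and I0: "0 \<in> I" and Iadd: "a \<in> I \<Longrightarrow> b \<in> I \<Longrightarrow> a + b \<in> I"
    and Imult: "a \<in> A \<Longrightarrow> b \<in> I \<Longrightarrow> a * b \<in> I"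
begin

definition R0 :: "'a ring" where "R0 = ring_of_type_algebra\<lparr>carrier := A\<rparr>"
definition RQ :: "'a set ring" where "RQ = R0 Quot I"
definition cl :: "'a \<Rightarrow> 'a set" where "cl a = I +>\<^bsub>R0\<^esub> a"

lemma R0_simps: "carrier R0 = A" "x \<otimes>\<^bsub>R0\<^esub> y = x * y" "x \<oplus>\<^bsub>R0\<^esub> y = x + y" "\<one>\<^bsub>R0\<^esub> = 1" "\<zero>\<^bsub>R0\<^esub> = 0"
  by (simp_all add: R0_def ring_of_type_algebra_def)

lemma Imult2: "a \<in> A \<Longrightarrow> b \<in> I \<Longrightarrow> b * a \<in> I"
  using Imult by (simp add: mult.commute)

lemma Iminus: "a \<in> I \<Longrightarrow> - a \<in> I"
  using Imult[of "- 1" a] Aminus[OF A1] by simp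

lemma Idiff: "a \<in> I \<Longrightarrow> b \<in> I \<Longrightarrow> a - b \<in> I"
  using Iadd[of a "- b"] Iminus by simp

lemma Adiff: "a \<in> A \<Longrightarrow> b \<in> A \<Longrightarrow> a - b \<in> A"
  using Aadd[of a "- b"] Aminus by simp

lemma cring_R0: "cring R0"
proof (rule cringI)
  show "abelian_group R0"
    by (rule abelian_groupI) (auto simp: R0_simps Aadd A0 algebra_simps intro!: bexI[of _ "- _"] Aminus)
  show "Group.comm_monoid R0"
    by (rule comm_monoidI) (auto simp: R0_simps Amult A1 mult.assoc mult.commute)
qed (simp add: R0_simps distrib_right)

lemma inv_R0: "a \<in> A \<Longrightarrow> a_inv R0 a = - a"
  using abelian_group.minus_equality[OF ring.is_abelian_group[OF cring.axioms(1)[OF cring_R0]], of "- a" a] Aminus[of a]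
  by (simp add: R0_simps)

lemma ideal_I: "ideal I R0"
proof (rule idealI)
  show ring: "ring R0" by (rule cring.axioms(1)[OF cring_R0])
  show "subgroup I (add_monoid R0)"
  proof (rule group.subgroupI[OF abelian_group.a_group[OF ring.is_abelian_group[OF ring]]])
    fix a assume "a \<in> I"
    then have "m_inv (add_monoid R0) a = - a" using inv_R0[of a] IA by (auto simp: a_inv_def)
    then show "m_inv (add_monoid R0) a \<in> I" using Iminus \<open>a \<in> I\<close> by simp
  qed (use IA I0 Iadd in \<open>auto simp: R0_simps\<close>)
qed (auto simp: R0_simps Imult Imult2)

lemma cring_RQ: "cring RQ"
  unfolding RQ_def by (rule ideal.quotient_is_cring[OF ideal_I cring_R0])

lemma carrier_RQ: "carrier RQ = cl ` A"
  by (auto simp: RQ_def FactRing_def A_RCOSETS_def' cl_def R0_simps)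

lemma cl_closed: "a \<in> A \<Longrightarrow> cl a \<in> carrier RQ"
  by (simp add: carrier_RQ)

lemma cl_ring_hom: "cl \<in> ring_hom R0 RQ"
  using ideal.rcos_ring_hom[OF ideal_I] by (simp add: RQ_def cl_def[abs_def])

lemma cl_hom:
  "a \<in> A \<Longrightarrow> b \<in> A \<Longrightarrow> cl a \<oplus>\<^bsub>RQ\<^esub> cl b = cl (a + b)"
  "a \<in> A \<Longrightarrow> b \<in> A \<Longrightarrow> cl a \<otimes>\<^bsub>RQ\<^esub> cl b = cl (a * b)"
  "\<one>\<^bsub>RQ\<^esub> = cl 1"
  using ring_hom_add[OF cl_ring_hom] ring_hom_mult[OF cl_ring_hom] ring_hom_one[OF cl_ring_hom]
  by (simp_all add: R0_simps)

lemma cl_eq_iff: "a \<in> A \<Longrightarrow> b \<in> A \<Longrightarrow> cl a = cl b \<longleftrightarrow> a - b \<in> I"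
proof -
  assume ab: "a \<in> A" "b \<in> A"
  have mem: "x \<in> cl b \<longleftrightarrow> x - b \<in> I" for x b
    by (auto simp: cl_def a_r_coset_def' R0_simps algebra_simps intro!: bexI[of _ "x - b"])
  show ?thesis
  proof
    assume "cl a = cl b"
    then have "a \<in> cl b" using mem[of a a] I0 by simp
    then show "a - b \<in> I" by (simp add: mem)
  next
    assume d: "a - b \<in> I"
    have "x - a \<in> I \<longleftrightarrow> x - b \<in> I" for x
      using Iadd[of "x - a" "a - b"] Idiff[of "x - b" "a - b"] d by auto
    then show "cl a = cl b" using mem by blast
  qed
qed

lemma cl_0: "\<zero>\<^bsub>RQ\<^esub> = cl 0"
proof -
  have "cl 0 = I" by (auto simp: cl_def a_r_coset_def' R0_simps)
  then show ?thesis by (simp add: RQ_def FactRing_def)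
qed

definition rep :: "'a set \<Rightarrow> 'a" where "rep C = (SOME a. a \<in> A \<and> cl a = C)"

lemma rep: "C \<in> carrier RQ \<Longrightarrow> rep C \<in> A" "C \<in> carrier RQ \<Longrightarrow> cl (rep C) = C"
proof -
  assume "C \<in> carrier RQ"
  then have "\<exists>a. a \<in> A \<and> cl a = C" by (auto simp: carrier_RQ)
  from someI_ex[OF this] show "rep C \<in> A" "cl (rep C) = C" unfolding rep_def by blast+
qed

lemma rep_cl: "a \<in> A \<Longrightarrow> rep (cl a) - a \<in> I"
  using rep[OF cl_closed[of a]] cl_eq_iff by blast


lemma unit_cl: "a \<in> A \<Longrightarrow> b \<in> A \<Longrightarrow> a * b = 1 \<Longrightarrow> cl a \<in> Units RQ"
  unfolding Units_def by (auto simp: cl_hom cl_closed mult.commute intro!: bexI[of _ "cl b"])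

lemma nonzero_divisor_cl:
  assumes "\<And>a b. a \<in> A \<Longrightarrow> b \<in> A \<Longrightarrow> a * b \<in> I \<Longrightarrow> a \<in> I \<or> b \<in> I" "1 \<notin> I" and a: "a \<in> A"
  shows "(\<forall>b\<in>carrier RQ. cl a \<otimes>\<^bsub>RQ\<^esub> b = \<zero>\<^bsub>RQ\<^esub> \<longrightarrow> b = \<zero>\<^bsub>RQ\<^esub>) \<longleftrightarrow> a \<notin> I"
proof -
  have z: "cl b = cl 0 \<longleftrightarrow> b \<in> I" if "b \<in> A" for b using cl_eq_iff[OF that A0] by simp
  show ?thesis
  proof
    assume nz: "\<forall>b\<in>carrier RQ. cl a \<otimes>\<^bsub>RQ\<^esub> b = \<zero>\<^bsub>RQ\<^esub> \<longrightarrow> b = \<zero>\<^bsub>RQ\<^esub>"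
    show "a \<notin> I"
    proof
      assume "a \<in> I"
      moreover have "cl a \<otimes>\<^bsub>RQ\<^esub> cl 1 = cl a" using a A1 by (simp add: cl_hom)
      ultimately have "cl a \<otimes>\<^bsub>RQ\<^esub> cl 1 = \<zero>\<^bsub>RQ\<^esub>" using z[OF a] by (simp add: cl_0)
      then have "cl 1 = cl 0" using nz cl_closed[OF A1] by (simp add: cl_0)
      then show False using z[OF A1] assms(2) by simp
    qed
  next
    assume "a \<notin> I"
    then show "\<forall>b\<in>carrier RQ. cl a \<otimes>\<^bsub>RQ\<^esub> b = \<zero>\<^bsub>RQ\<^esub> \<longrightarrow> b = \<zero>\<^bsub>RQ\<^esub>"
      using assms(1)[OF a] a Amult by (auto simp: carrier_RQ cl_hom cl_0 z)
  qed
qed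

end

locale kaehler_quotient = subring_quotient A I
  for A I :: "'a::comm_ring_1 set" +
  fixes \<kappa> :: "'k \<Rightarrow> 'a"
  assumes \<kappa>: "\<kappa> c \<in> A"
begin

sublocale kaehler_setup RQ "\<lambda>c. cl (\<kappa> c)"
  by (rule kaehler_setup.intro[OF cring_RQ], unfold_locales, rule cl_closed[OF \<kappa>])

end

text \<open>
  A derivation \<open>D\<close> of \<open>A\<close> into \<open>C/L\<close> that kills \<open>I\<close> and the constants induces an \<open>A/I\<close>-linear map
  \<open>\<Omega> \<rightarrow> C/L\<close>, given here as the relation \<open>dval\<close> between elements of \<open>\<Omega>\<close> and of \<open>C\<close>.
\<close>

locale quotient_derivation = kaehler_quotient A I \<kappa>
  for A I :: "'a::comm_ring_1 set" and \<kappa> :: "'k \<Rightarrow> 'a" +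
  fixes sc :: "'a \<Rightarrow> 'b::ab_group_add \<Rightarrow> 'b"
    and D :: "'a \<Rightarrow> 'b" and C L :: "'b set"
  assumes sc_add: "sc (a + b) v = sc a v + sc b v" "sc a (v + w) = sc a v + sc a w"
    and sc_mult: "sc (a * b) v = sc a (sc b v)" and sc_one: "sc 1 v = v"
    and D_add: "a \<in> A \<Longrightarrow> b \<in> A \<Longrightarrow> D (a + b) = D a + D b"
    and D_mult: "a \<in> A \<Longrightarrow> b \<in> A \<Longrightarrow> D (a * b) = sc a (D b) + sc b (D a)"
    and D_const: "D (\<kappa> c) = 0"
    and CD: "a \<in> A \<Longrightarrow> D a \<in> C" and C_add: "v \<in> C \<Longrightarrow> w \<in> C \<Longrightarrow> v + w \<in> C"
    and C_sc: "a \<in> A \<Longrightarrow> v \<in> C \<Longrightarrow> sc a v \<in> C" and C_0: "0 \<in> C"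
    and L_add: "v \<in> L \<Longrightarrow> w \<in> L \<Longrightarrow> v + w \<in> L" and L_0: "0 \<in> L"
    and L_sc: "a \<in> A \<Longrightarrow> v \<in> L \<Longrightarrow> sc a v \<in> L"
    and L_I: "a \<in> I \<Longrightarrow> v \<in> C \<Longrightarrow> sc a v \<in> L" and L_D: "a \<in> I \<Longrightarrow> D a \<in> L"
begin

lemma sc_0: "sc 0 v = 0" "sc a 0 = 0"
  using sc_add(1)[of 0 0 v] sc_add(2)[of a 0 0] by simp_all

lemma sc_minus: "sc (- a) v = - sc a v" "sc a (- v) = - sc a v"
  using sc_add(1)[of a "- a" v] sc_add(2)[of a v "- v"] by (simp_all add: sc_0 eq_neg_iff_add_eq_0 add.commute)

lemma sc_diff: "sc (a - b) v = sc a v - sc b v" "sc a (v - w) = sc a v - sc a w"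
  using sc_add(1)[of a "- b" v] sc_add(2)[of a v "- w"] by (simp_all add: sc_minus)

lemma L_minus: "v \<in> L \<Longrightarrow> - v \<in> L"
  using L_sc[of "- 1" v] Aminus[OF A1] by (simp add: sc_minus sc_one)

lemma L_diff: "v \<in> L \<Longrightarrow> w \<in> L \<Longrightarrow> v - w \<in> L"
  using L_add[of v "- w"] L_minus by simp

lemma L_sum: "(\<And>i. i \<in> S \<Longrightarrow> f i \<in> L) \<Longrightarrow> sum f S \<in> L"
  by (induction S rule: infinite_finite_induct) (auto intro: L_add L_0)

lemma C_sum: "(\<And>i. i \<in> S \<Longrightarrow> f i \<in> C) \<Longrightarrow> sum f S \<in> C"
  by (induction S rule: infinite_finite_induct) (auto intro: C_add C_0)

lemma sc_sum: "sc a (sum f S) = (\<Sum>i\<in>S. sc a (f i))"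
  by (induction S rule: infinite_finite_induct) (auto simp: sc_add sc_0)

lemma D_diff: "a \<in> A \<Longrightarrow> b \<in> A \<Longrightarrow> D (a - b) = D a - D b"
  using D_add[of "a - b" b] Adiff by simp

text \<open>The induced map on the free module, computed with chosen representatives. Another choice
  changes the value by an element of L, so its algebraic laws hold modulo L.\<close>

definition V :: "('a set \<Rightarrow> 'a set) \<Rightarrow> 'b" where
  "V \<phi> = (\<Sum>x\<in>{x. \<phi> x \<noteq> \<zero>\<^bsub>RQ\<^esub>}. sc (rep (\<phi> x)) (D (rep x)))"

lemma F_simps:
  "\<phi> \<in> carrier F \<Longrightarrow> \<phi> x \<in> carrier RQ"
  "\<phi> \<in> carrier F \<Longrightarrow> x \<notin> carrier RQ \<Longrightarrow> \<phi> x = \<zero>\<^bsub>RQ\<^esub>"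
  "\<phi> \<in> carrier F \<Longrightarrow> finite {x. \<phi> x \<noteq> \<zero>\<^bsub>RQ\<^esub>}"
  "(\<phi> \<oplus>\<^bsub>F\<^esub> \<psi>) x = \<phi> x \<oplus>\<^bsub>RQ\<^esub> \<psi> x" "(c \<odot>\<^bsub>F\<^esub> \<phi>) x = c \<otimes>\<^bsub>RQ\<^esub> \<phi> x"
  by (auto simp: free_module_def)

lemma rep_zero: "rep \<zero>\<^bsub>RQ\<^esub> \<in> I"
  using rep_cl[OF A0] by (simp add: cl_0)

lemma V_superset:
  assumes \<phi>: "\<phi> \<in> carrier F" and S: "finite S" "{x. \<phi> x \<noteq> \<zero>\<^bsub>RQ\<^esub>} \<subseteq> S" "S \<subseteq> carrier RQ"
  shows "(\<Sum>x\<in>S. sc (rep (\<phi> x)) (D (rep x))) - V \<phi> \<in> L"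
proof -
  have "(\<Sum>x\<in>S. sc (rep (\<phi> x)) (D (rep x))) - V \<phi>
      = (\<Sum>x\<in>S - {x. \<phi> x \<noteq> \<zero>\<^bsub>RQ\<^esub>}. sc (rep (\<phi> x)) (D (rep x)))"
    unfolding V_def using S by (subst sum_diff) auto
  also have "\<dots> \<in> L"
    using S(3) by (intro L_sum) (auto intro!: L_I CD rep rep_zero)
  finally show ?thesis .
qed

lemma supp_carrier: "\<phi> \<in> carrier F \<Longrightarrow> {x. \<phi> x \<noteq> \<zero>\<^bsub>RQ\<^esub>} \<subseteq> carrier RQ"
  using F_simps(2) by blast

lemma V_C: "\<phi> \<in> carrier F \<Longrightarrow> V \<phi> \<in> C"
  unfolding V_def
proof (rule C_sum)
  fix x assume f: "\<phi> \<in> carrier F" and "x \<in> {x. \<phi> x \<noteq> \<zero>\<^bsub>RQ\<^esub>}"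
  then have "x \<in> carrier RQ" using supp_carrier by blast
  then show "sc (rep (\<phi> x)) (D (rep x)) \<in> C" using F_simps(1)[OF f] by (intro C_sc CD rep)
qed

lemma rep_add: "x \<in> carrier RQ \<Longrightarrow> y \<in> carrier RQ \<Longrightarrow> rep (x \<oplus>\<^bsub>RQ\<^esub> y) - (rep x + rep y) \<in> I"
  using rep_cl[of "rep x + rep y"] rep[of x] rep[of y] cl_hom(1)[of "rep x" "rep y"] by (simp add: Aadd)

lemma rep_mult: "x \<in> carrier RQ \<Longrightarrow> y \<in> carrier RQ \<Longrightarrow> rep (x \<otimes>\<^bsub>RQ\<^esub> y) - rep x * rep y \<in> I"
  using rep_cl[of "rep x * rep y"] rep[of x] rep[of y] cl_hom(2)[of "rep x" "rep y"] by (simp add: Amult)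

lemma V_add:
  assumes f: "\<phi> \<in> carrier F" and g: "\<psi> \<in> carrier F"
  shows "V (\<phi> \<oplus>\<^bsub>F\<^esub> \<psi>) - (V \<phi> + V \<psi>) \<in> L"
proof -
  have fg: "\<phi> \<oplus>\<^bsub>F\<^esub> \<psi> \<in> carrier F" using f g by simp
  define S where "S = {x. \<phi> x \<noteq> \<zero>\<^bsub>RQ\<^esub>} \<union> {x. \<psi> x \<noteq> \<zero>\<^bsub>RQ\<^esub>} \<union> {x. (\<phi> \<oplus>\<^bsub>F\<^esub> \<psi>) x \<noteq> \<zero>\<^bsub>RQ\<^esub>}"
  have S: "finite S" "S \<subseteq> carrier RQ"
    unfolding S_def using F_simps(3)[OF f] F_simps(3)[OF g] F_simps(3)[OF fg]
      supp_carrier[OF f] supp_carrier[OF g] supp_carrier[OF fg] by simp_all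
  let ?s = "\<lambda>\<chi>. \<Sum>x\<in>S. sc (rep (\<chi> x)) (D (rep x))"
  have 1: "?s \<phi> - V \<phi> \<in> L" by (rule V_superset[OF f S(1) _ S(2)]) (auto simp: S_def)
  have 2: "?s \<psi> - V \<psi> \<in> L" by (rule V_superset[OF g S(1) _ S(2)]) (auto simp: S_def)
  have 3: "?s (\<phi> \<oplus>\<^bsub>F\<^esub> \<psi>) - V (\<phi> \<oplus>\<^bsub>F\<^esub> \<psi>) \<in> L" by (rule V_superset[OF fg S(1) _ S(2)]) (auto simp: S_def)
  have "?s (\<phi> \<oplus>\<^bsub>F\<^esub> \<psi>) - (?s \<phi> + ?s \<psi>)
      = (\<Sum>x\<in>S. sc (rep (\<phi> x \<oplus>\<^bsub>RQ\<^esub> \<psi> x) - (rep (\<phi> x) + rep (\<psi> x))) (D (rep x)))"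
    by (simp add: F_simps(4) sc_diff sc_add sum_subtractf sum.distrib)
  also have "\<dots> \<in> L"
    using S(2) F_simps(1)[OF f] F_simps(1)[OF g] by (intro L_sum L_I rep_add CD rep) auto
  finally have 4: "?s (\<phi> \<oplus>\<^bsub>F\<^esub> \<psi>) - (?s \<phi> + ?s \<psi>) \<in> L" .
  have "V (\<phi> \<oplus>\<^bsub>F\<^esub> \<psi>) - (V \<phi> + V \<psi>) = (?s (\<phi> \<oplus>\<^bsub>F\<^esub> \<psi>) - (?s \<phi> + ?s \<psi>))
      - (?s (\<phi> \<oplus>\<^bsub>F\<^esub> \<psi>) - V (\<phi> \<oplus>\<^bsub>F\<^esub> \<psi>)) + ((?s \<phi> - V \<phi>) + (?s \<psi> - V \<psi>))" by (simp add: algebra_simps)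
  also have "\<dots> \<in> L" by (intro L_add L_diff 1 2 3 4)
  finally show ?thesis .
qed

lemma V_smult:
  assumes f: "\<phi> \<in> carrier F" and c: "c \<in> carrier RQ"
  shows "V (c \<odot>\<^bsub>F\<^esub> \<phi>) - sc (rep c) (V \<phi>) \<in> L"
proof -
  have cf: "c \<odot>\<^bsub>F\<^esub> \<phi> \<in> carrier F" using f c by simp
  define S where "S = {x. \<phi> x \<noteq> \<zero>\<^bsub>RQ\<^esub>} \<union> {x. (c \<odot>\<^bsub>F\<^esub> \<phi>) x \<noteq> \<zero>\<^bsub>RQ\<^esub>}"
  have S: "finite S" "S \<subseteq> carrier RQ"
    unfolding S_def using F_simps(3)[OF f] F_simps(3)[OF cf] supp_carrier[OF f] supp_carrier[OF cf] by simp_all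
  let ?s = "\<lambda>\<chi>. \<Sum>x\<in>S. sc (rep (\<chi> x)) (D (rep x))"
  have 1: "?s \<phi> - V \<phi> \<in> L" by (rule V_superset[OF f S(1) _ S(2)]) (auto simp: S_def)
  have 2: "?s (c \<odot>\<^bsub>F\<^esub> \<phi>) - V (c \<odot>\<^bsub>F\<^esub> \<phi>) \<in> L" by (rule V_superset[OF cf S(1) _ S(2)]) (auto simp: S_def)
  have "?s (c \<odot>\<^bsub>F\<^esub> \<phi>) - sc (rep c) (?s \<phi>)
      = (\<Sum>x\<in>S. sc (rep (c \<otimes>\<^bsub>RQ\<^esub> \<phi> x) - rep c * rep (\<phi> x)) (D (rep x)))"
    by (simp add: F_simps(5) sc_diff sc_mult sc_sum sum_subtractf)
  also have "\<dots> \<in> L"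
    using S(2) F_simps(1)[OF f] c by (intro L_sum L_I rep_mult CD rep) auto
  finally have 3: "?s (c \<odot>\<^bsub>F\<^esub> \<phi>) - sc (rep c) (?s \<phi>) \<in> L" .
  have "V (c \<odot>\<^bsub>F\<^esub> \<phi>) - sc (rep c) (V \<phi>) = (?s (c \<odot>\<^bsub>F\<^esub> \<phi>) - sc (rep c) (?s \<phi>))
      - (?s (c \<odot>\<^bsub>F\<^esub> \<phi>) - V (c \<odot>\<^bsub>F\<^esub> \<phi>)) + sc (rep c) (?s \<phi> - V \<phi>)" by (simp add: sc_diff)
  also have "\<dots> \<in> L" using rep(1)[OF c] by (intro L_add L_diff L_sc 1 2 3)
  finally show ?thesis .
qed

lemma V_dsym:
  assumes a: "a \<in> A"
  shows "V (dsym RQ (cl a)) - D a \<in> L"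
proof -
  have f: "dsym RQ (cl a) \<in> carrier F" by (rule dsym_closed[OF cl_closed[OF a]])
  have 1: "sc (rep \<one>\<^bsub>RQ\<^esub>) (D (rep (cl a))) - V (dsym RQ (cl a)) \<in> L"
  proof -
    have s: "{x. dsym RQ (cl a) x \<noteq> \<zero>\<^bsub>RQ\<^esub>} \<subseteq> {cl a}" by (auto simp: dsym_def split: if_splits)
    have e: "dsym RQ (cl a) (cl a) = \<one>\<^bsub>RQ\<^esub>" by (simp add: dsym_def)
    show ?thesis using V_superset[OF f _ s] cl_closed[OF a] by (simp add: e)
  qed
  have 2: "sc (rep \<one>\<^bsub>RQ\<^esub> - 1) (D (rep (cl a))) \<in> L"
    using rep_cl[OF A1] rep(1)[OF cl_closed[OF a]] by (intro L_I CD) (simp_all add: cl_hom)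
  have 3: "D (rep (cl a)) - D a \<in> L"
    using L_D[OF rep_cl[OF a]] D_diff rep(1)[OF cl_closed[OF a]] a by simp
  have "sc (rep \<one>\<^bsub>RQ\<^esub> - 1) (D (rep (cl a))) + (D (rep (cl a)) - D a)
      - (sc (rep \<one>\<^bsub>RQ\<^esub>) (D (rep (cl a))) - V (dsym RQ (cl a))) \<in> L"
    by (rule L_diff[OF L_add[OF 2 3] 1])
  then show ?thesis by (simp add: sc_diff sc_one)
qed

lemma L_cong: "v - w \<in> L \<Longrightarrow> v \<in> L \<longleftrightarrow> w \<in> L"
  using L_add[of "v - w" w] L_diff[of v "v - w"] by auto

lemma V_minus:
  assumes f: "\<phi> \<in> carrier F" and g: "\<psi> \<in> carrier F"
  shows "V (\<phi> \<ominus>\<^bsub>F\<^esub> \<psi>) - (V \<phi> - V \<psi>) \<in> L"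
proof -
  have "\<phi> \<ominus>\<^bsub>F\<^esub> \<psi> \<oplus>\<^bsub>F\<^esub> \<psi> = \<phi>" using f g by (simp add: a_minus_def F.M.a_assoc F.M.l_neg)
  then have "V \<phi> - (V (\<phi> \<ominus>\<^bsub>F\<^esub> \<psi>) + V \<psi>) \<in> L" using V_add[of "\<phi> \<ominus>\<^bsub>F\<^esub> \<psi>" \<psi>] f g by simp
  from L_minus[OF this] show ?thesis by (simp add: algebra_simps)
qed

lemma V_N: "\<phi> \<in> N \<Longrightarrow> V \<phi> \<in> L"
proof -
  let ?H = "{\<phi> \<in> carrier F. V \<phi> \<in> L}"
  have "submodule ?H RQ F"
  proof (rule F.submoduleI)
    show 0: "\<zero>\<^bsub>F\<^esub> \<in> ?H" by (auto simp: V_def free_module_def L_0)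
    show "\<phi> \<oplus>\<^bsub>F\<^esub> \<psi> \<in> ?H" if "\<phi> \<in> ?H" "\<psi> \<in> ?H" for \<phi> \<psi>
      using L_cong[OF V_add[of \<phi> \<psi>]] that by (auto intro: L_add)
    show "c \<odot>\<^bsub>F\<^esub> \<phi> \<in> ?H" if "c \<in> carrier RQ" "\<phi> \<in> ?H" for c \<phi>
      using L_cong[OF V_smult[of \<phi> c]] that rep(1) by (auto intro: L_sc)
    show "\<ominus>\<^bsub>F\<^esub> \<phi> \<in> ?H" if \<phi>: "\<phi> \<in> ?H" for \<phi>
    proof -
      have "\<zero>\<^bsub>F\<^esub> \<ominus>\<^bsub>F\<^esub> \<phi> = \<ominus>\<^bsub>F\<^esub> \<phi>" using \<phi> by (simp add: a_minus_def)
      then show ?thesis using L_cong[OF V_minus[of "\<zero>\<^bsub>F\<^esub>" \<phi>]] \<phi> 0 L_diff by simp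
    qed
  qed auto
  moreover have "kaehler_relations RQ (\<lambda>c. cl (\<kappa> c)) \<subseteq> ?H"
  proof
    fix \<phi> assume "\<phi> \<in> kaehler_relations RQ (\<lambda>c. cl (\<kappa> c))"
    then consider (add) x y where "\<phi> = dsym RQ (x \<oplus>\<^bsub>RQ\<^esub> y) \<ominus>\<^bsub>F\<^esub> (dsym RQ x \<oplus>\<^bsub>F\<^esub> dsym RQ y)"
        "x \<in> carrier RQ" "y \<in> carrier RQ"
      | (mult) x y where "\<phi> = dsym RQ (x \<otimes>\<^bsub>RQ\<^esub> y) \<ominus>\<^bsub>F\<^esub> (x \<odot>\<^bsub>F\<^esub> dsym RQ y \<oplus>\<^bsub>F\<^esub> y \<odot>\<^bsub>F\<^esub> dsym RQ x)"
        "x \<in> carrier RQ" "y \<in> carrier RQ"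
      | (const) c where "\<phi> = dsym RQ (cl (\<kappa> c))"
      unfolding kaehler_relations_def Let_def by auto
    then show "\<phi> \<in> ?H"
    proof cases
      case add
      obtain a b where ab: "x = cl a" "y = cl b" "a \<in> A" "b \<in> A" using add by (auto simp: carrier_RQ)
      have c: "dsym RQ (cl a) \<in> carrier F" "dsym RQ (cl b) \<in> carrier F" "dsym RQ (cl (a + b)) \<in> carrier F"
        using ab by (auto intro!: dsym_closed cl_closed Aadd)
      have \<phi>: "\<phi> = dsym RQ (cl (a + b)) \<ominus>\<^bsub>F\<^esub> (dsym RQ (cl a) \<oplus>\<^bsub>F\<^esub> dsym RQ (cl b))"
        using add(1) ab by (simp add: cl_hom)
      have 1: "V \<phi> - (V (dsym RQ (cl (a + b))) - V (dsym RQ (cl a) \<oplus>\<^bsub>F\<^esub> dsym RQ (cl b))) \<in> L"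
        unfolding \<phi> using c by (intro V_minus) auto
      have 2: "V (dsym RQ (cl a) \<oplus>\<^bsub>F\<^esub> dsym RQ (cl b)) - (V (dsym RQ (cl a)) + V (dsym RQ (cl b))) \<in> L"
        using c by (intro V_add)
      have "V \<phi> = (V \<phi> - (V (dsym RQ (cl (a + b))) - V (dsym RQ (cl a) \<oplus>\<^bsub>F\<^esub> dsym RQ (cl b))))
        + (V (dsym RQ (cl (a + b))) - D (a + b))
        - (V (dsym RQ (cl a) \<oplus>\<^bsub>F\<^esub> dsym RQ (cl b)) - (V (dsym RQ (cl a)) + V (dsym RQ (cl b))))
        - (V (dsym RQ (cl a)) - D a) - (V (dsym RQ (cl b)) - D b)"
        using ab by (simp add: D_add algebra_simps)
      also have "\<dots> \<in> L" using ab by (intro L_add L_diff 1 2 V_dsym Aadd)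
      finally show ?thesis using c \<phi> by simp
    next
      case mult
      obtain a b where ab: "x = cl a" "y = cl b" "a \<in> A" "b \<in> A" using mult by (auto simp: carrier_RQ)
      have c: "dsym RQ (cl a) \<in> carrier F" "dsym RQ (cl b) \<in> carrier F" "dsym RQ (cl (a * b)) \<in> carrier F"
        using ab by (auto intro!: dsym_closed cl_closed Amult)
      have cl': "cl a \<in> carrier RQ" "cl b \<in> carrier RQ" using ab cl_closed by auto
      have sm: "V (cl u \<odot>\<^bsub>F\<^esub> dsym RQ (cl v)) - sc u (D v) \<in> L" if uv: "u \<in> A" "v \<in> A" for u v
      proof -
        have f: "dsym RQ (cl v) \<in> carrier F" by (intro dsym_closed cl_closed uv)
        have r: "rep (cl u) \<in> A" by (intro rep cl_closed uv)
        have "V (cl u \<odot>\<^bsub>F\<^esub> dsym RQ (cl v)) - sc u (D v) =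
          (V (cl u \<odot>\<^bsub>F\<^esub> dsym RQ (cl v)) - sc (rep (cl u)) (V (dsym RQ (cl v))))
          + sc (rep (cl u)) (V (dsym RQ (cl v)) - D v) + sc (rep (cl u) - u) (D v)"
          by (simp add: sc_diff)
        also have "\<dots> \<in> L"
          using uv by (intro L_add V_smult f cl_closed L_sc r V_dsym L_I rep_cl CD)
        finally show ?thesis .
      qed
      define m where "m = cl a \<odot>\<^bsub>F\<^esub> dsym RQ (cl b) \<oplus>\<^bsub>F\<^esub> cl b \<odot>\<^bsub>F\<^esub> dsym RQ (cl a)"
      have m: "m \<in> carrier F" unfolding m_def using c cl' by simp
      have \<phi>: "\<phi> = dsym RQ (cl (a * b)) \<ominus>\<^bsub>F\<^esub> m"
        using mult(1) ab by (simp add: cl_hom m_def)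
      have 1: "V \<phi> - (V (dsym RQ (cl (a * b))) - V m) \<in> L"
        unfolding \<phi> using c m by (intro V_minus)
      have 2: "V m - (V (cl a \<odot>\<^bsub>F\<^esub> dsym RQ (cl b)) + V (cl b \<odot>\<^bsub>F\<^esub> dsym RQ (cl a))) \<in> L"
        unfolding m_def using c cl' by (intro V_add) auto
      have "V \<phi> = (V \<phi> - (V (dsym RQ (cl (a * b))) - V m)) + (V (dsym RQ (cl (a * b))) - D (a * b))
        - (V m - (V (cl a \<odot>\<^bsub>F\<^esub> dsym RQ (cl b)) + V (cl b \<odot>\<^bsub>F\<^esub> dsym RQ (cl a))))
        - (V (cl a \<odot>\<^bsub>F\<^esub> dsym RQ (cl b)) - sc a (D b)) - (V (cl b \<odot>\<^bsub>F\<^esub> dsym RQ (cl a)) - sc b (D a))"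
        using ab by (simp add: D_mult algebra_simps)
      also have "\<dots> \<in> L" using ab by (intro L_add L_diff 1 2 V_dsym Amult sm)
      finally show ?thesis using c m \<phi> by simp
    next
      case const
      then show ?thesis using V_dsym[OF \<kappa>] dsym_closed[OF cl_closed[OF \<kappa>]] by (simp add: D_const)
    qed
  qed
  ultimately have "N \<subseteq> ?H" by (rule submodule_gen_subset)
  then show "\<phi> \<in> N \<Longrightarrow> V \<phi> \<in> L" by blast
qed

definition dval :: "('a set \<Rightarrow> 'a set) set \<Rightarrow> 'b \<Rightarrow> bool" where
  "dval \<omega> v \<longleftrightarrow> v \<in> C \<and> (\<exists>\<phi>\<in>carrier F. \<omega> = Q.qcl \<phi> \<and> V \<phi> - v \<in> L)"

lemma dval_C: "dval \<omega> v \<Longrightarrow> v \<in> C"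
  by (simp add: dval_def)

lemma dval_ex: "\<omega> \<in> carrier \<Omega> \<Longrightarrow> \<exists>v. dval \<omega> v"
  unfolding dval_def kaehler_eq Q.qcl_carrier using V_C L_0 by force

lemma dval_d: "a \<in> A \<Longrightarrow> dval (d (cl a)) (D a)"
  unfolding dval_def d_def using V_dsym dsym_closed[OF cl_closed] CD by blast

lemma dval_add:
  assumes "dval \<omega> v" "dval \<omega>' w"
  shows "dval (\<omega> \<oplus>\<^bsub>\<Omega>\<^esub> \<omega>') (v + w)"
proof -
  obtain \<phi> \<psi> where f: "\<phi> \<in> carrier F" "\<omega> = Q.qcl \<phi>" "V \<phi> - v \<in> L"
    and g: "\<psi> \<in> carrier F" "\<omega>' = Q.qcl \<psi>" "V \<psi> - w \<in> L" using assms by (auto simp: dval_def)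
  have "V (\<phi> \<oplus>\<^bsub>F\<^esub> \<psi>) - (v + w) = (V (\<phi> \<oplus>\<^bsub>F\<^esub> \<psi>) - (V \<phi> + V \<psi>)) + (V \<phi> - v) + (V \<psi> - w)"
    by (simp add: algebra_simps)
  also have "\<dots> \<in> L" by (intro L_add V_add f g)
  finally show ?thesis
    using f g assms[THEN dval_C] unfolding dval_def kaehler_eq
    by (intro conjI bexI[of _ "\<phi> \<oplus>\<^bsub>F\<^esub> \<psi>"] C_add) (auto simp: Q.qcl_add)
qed

lemma dval_smult:
  assumes "dval \<omega> v" and a: "a \<in> A"
  shows "dval (cl a \<odot>\<^bsub>\<Omega>\<^esub> \<omega>) (sc a v)"
proof -
  obtain \<phi> where f: "\<phi> \<in> carrier F" "\<omega> = Q.qcl \<phi>" "V \<phi> - v \<in> L" using assms by (auto simp: dval_def)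
  have r: "rep (cl a) \<in> A" by (intro rep cl_closed a)
  have "V (cl a \<odot>\<^bsub>F\<^esub> \<phi>) - sc a v = (V (cl a \<odot>\<^bsub>F\<^esub> \<phi>) - sc (rep (cl a)) (V \<phi>))
      + sc (rep (cl a)) (V \<phi> - v) + sc (rep (cl a) - a) v" by (simp add: sc_diff)
  also have "\<dots> \<in> L" by (intro L_add V_smult L_sc r f cl_closed a L_I rep_cl dval_C[OF assms(1)])
  finally show ?thesis
    using f dval_C[OF assms(1)] cl_closed[OF a] unfolding dval_def kaehler_eq
    by (intro conjI bexI[of _ "cl a \<odot>\<^bsub>F\<^esub> \<phi>"] C_sc a) (auto simp: Q.qcl_smult)
qed

lemma dval_unique:
  assumes "dval \<omega> v" "dval \<omega> w"
  shows "v - w \<in> L"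
proof -
  obtain \<phi> \<psi> where f: "\<phi> \<in> carrier F" "\<omega> = Q.qcl \<phi>" "V \<phi> - v \<in> L"
    and g: "\<psi> \<in> carrier F" "\<omega> = Q.qcl \<psi>" "V \<psi> - w \<in> L" using assms by (auto simp: dval_def)
  have "\<phi> \<ominus>\<^bsub>F\<^esub> \<psi> \<in> N" using Q.qcl_eq_iff[OF f(1) g(1)] f(2) g(2) by simp
  then have "V (\<phi> \<ominus>\<^bsub>F\<^esub> \<psi>) \<in> L" by (rule V_N)
  then have 1: "V \<phi> - V \<psi> \<in> L" using L_cong[OF V_minus[OF f(1) g(1)]] by simp
  have "v - w = (V \<phi> - V \<psi>) - (V \<phi> - v) + (V \<psi> - w)" by (simp add: algebra_simps)
  also have "\<dots> \<in> L" by (intro L_add L_diff 1 f g)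
  finally show ?thesis .
qed

lemma dval_zero: "dval \<zero>\<^bsub>\<Omega>\<^esub> v \<Longrightarrow> v \<in> L"
proof -
  have "Q.qcl \<zero>\<^bsub>F\<^esub> = \<zero>\<^bsub>\<Omega>\<^esub>" by (simp add: kaehler_eq Q.qcl_0)
  then have "dval \<zero>\<^bsub>\<Omega>\<^esub> 0" unfolding dval_def
    by (intro conjI bexI[of _ "\<zero>\<^bsub>F\<^esub>"]) (auto simp: C_0 V_def free_module_def L_0)
  then show "dval \<zero>\<^bsub>\<Omega>\<^esub> v \<Longrightarrow> v \<in> L" using dval_unique[of _ v 0] by simp
qed

lemma dval_finsum:
  assumes "finite S" "\<And>i. i \<in> S \<Longrightarrow> f i \<in> carrier \<Omega>" "\<And>i. i \<in> S \<Longrightarrow> dval (f i) (v i)"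
  shows "dval (finsum \<Omega> f S) (sum v S)"
  using assms
proof (induction S)
  case empty
  have "Q.qcl \<zero>\<^bsub>F\<^esub> = \<zero>\<^bsub>\<Omega>\<^esub>" by (simp add: kaehler_eq Q.qcl_0)
  then have "dval \<zero>\<^bsub>\<Omega>\<^esub> 0" unfolding dval_def
    by (intro conjI bexI[of _ "\<zero>\<^bsub>F\<^esub>"]) (auto simp: C_0 V_def free_module_def L_0)
  then show ?case by simp
next
  case (insert x S)
  have "finsum \<Omega> f (insert x S) = f x \<oplus>\<^bsub>\<Omega>\<^esub> finsum \<Omega> f S"
    using insert by (intro K.M.finsum_insert) auto
  then show ?case using insert by (auto intro: dval_add)
qed

end

section \<open>Linear combinations of differentials\<close>

context kaehler_quotient
begin

lemma A_sum: "(\<And>i. i \<in> S \<Longrightarrow> f i \<in> A) \<Longrightarrow> sum f S \<in> A"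
  by (induction S rule: infinite_finite_induct) (auto intro: Aadd A0)

definition lc :: "('i \<Rightarrow> 'a) \<Rightarrow> ('i \<Rightarrow> 'a) \<Rightarrow> 'i set \<Rightarrow> ('a set \<Rightarrow> 'a set) set" where
  "lc u w S = finsum \<Omega> (\<lambda>i. cl (w i) \<odot>\<^bsub>\<Omega>\<^esub> d (cl (u i))) S"

lemma term_closed: "a \<in> A \<Longrightarrow> b \<in> A \<Longrightarrow> cl a \<odot>\<^bsub>\<Omega>\<^esub> d (cl b) \<in> carrier \<Omega>"
  by (intro K.smult_closed d_closed cl_closed)

lemma lc_closed: "(\<And>i. i \<in> S \<Longrightarrow> u i \<in> A) \<Longrightarrow> (\<And>i. i \<in> S \<Longrightarrow> w i \<in> A) \<Longrightarrow> lc u w S \<in> carrier \<Omega>"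
  unfolding lc_def by (intro K.M.finsum_closed) (auto intro: term_closed)

lemma lc_add:
  assumes "\<And>i. i \<in> S \<Longrightarrow> u i \<in> A" "\<And>i. i \<in> S \<Longrightarrow> w i \<in> A" "\<And>i. i \<in> S \<Longrightarrow> w' i \<in> A"
  shows "lc u w S \<oplus>\<^bsub>\<Omega>\<^esub> lc u w' S = lc u (\<lambda>i. w i + w' i) S"
proof -
  have "lc u w S \<oplus>\<^bsub>\<Omega>\<^esub> lc u w' S
      = finsum \<Omega> (\<lambda>i. cl (w i) \<odot>\<^bsub>\<Omega>\<^esub> d (cl (u i)) \<oplus>\<^bsub>\<Omega>\<^esub> cl (w' i) \<odot>\<^bsub>\<Omega>\<^esub> d (cl (u i))) S"
    unfolding lc_def using assms by (intro K.M.finsum_addf[symmetric]) (auto intro: term_closed)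
  also have "\<dots> = lc u (\<lambda>i. w i + w' i) S"
    unfolding lc_def
  proof (rule K.M.finsum_cong'[OF refl])
    fix i assume i: "i \<in> S"
    show "cl (w i) \<odot>\<^bsub>\<Omega>\<^esub> d (cl (u i)) \<oplus>\<^bsub>\<Omega>\<^esub> cl (w' i) \<odot>\<^bsub>\<Omega>\<^esub> d (cl (u i))
        = cl (w i + w' i) \<odot>\<^bsub>\<Omega>\<^esub> d (cl (u i))"
      using K.smult_l_distr[OF cl_closed[OF assms(2)[OF i]] cl_closed[OF assms(3)[OF i]]
          d_closed[OF cl_closed[OF assms(1)[OF i]]]] assms[OF i]
      by (simp add: cl_hom)
  qed (use assms in \<open>auto intro!: term_closed Aadd\<close>)
  finally show ?thesis .
qed

lemma lc_smult:
  assumes "finite S" "\<And>i. i \<in> S \<Longrightarrow> u i \<in> A" "\<And>i. i \<in> S \<Longrightarrow> w i \<in> A" "a \<in> A"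
  shows "cl a \<odot>\<^bsub>\<Omega>\<^esub> lc u w S = lc u (\<lambda>i. a * w i) S"
proof -
  have "cl a \<odot>\<^bsub>\<Omega>\<^esub> lc u w S = finsum \<Omega> (\<lambda>i. cl a \<odot>\<^bsub>\<Omega>\<^esub> (cl (w i) \<odot>\<^bsub>\<Omega>\<^esub> d (cl (u i)))) S"
    unfolding lc_def using assms by (intro K.finsum_smult_ldistr) (auto intro: term_closed cl_closed)
  also have "\<dots> = lc u (\<lambda>i. a * w i) S"
    unfolding lc_def
  proof (rule K.M.finsum_cong'[OF refl])
    fix i assume i: "i \<in> S"
    show "cl a \<odot>\<^bsub>\<Omega>\<^esub> (cl (w i) \<odot>\<^bsub>\<Omega>\<^esub> d (cl (u i))) = cl (a * w i) \<odot>\<^bsub>\<Omega>\<^esub> d (cl (u i))"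
      using K.smult_assoc1[OF cl_closed[OF assms(4)] cl_closed[OF assms(3)[OF i]]
          d_closed[OF cl_closed[OF assms(2)[OF i]]]] assms(2,3)[OF i] assms(4)
      by (simp add: cl_hom)
  qed (use assms in \<open>auto intro!: term_closed Amult\<close>)
  finally show ?thesis .
qed

lemma lc_cong:
  assumes "\<And>i. i \<in> S \<Longrightarrow> u i \<in> A" "\<And>i. i \<in> S \<Longrightarrow> w i \<in> A" "\<And>i. i \<in> S \<Longrightarrow> w' i \<in> A"
    and "\<And>i. i \<in> S \<Longrightarrow> w i - w' i \<in> I"
  shows "lc u w S = lc u w' S"
proof -
  have "cl (w i) = cl (w' i)" if "i \<in> S" for i using cl_eq_iff assms that by blast
  then show ?thesis unfolding lc_def using assms
    by (intro K.M.finsum_cong'[OF refl]) (auto intro: term_closed)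
qed

lemma lc_zero: "lc u (\<lambda>_. 0) S = \<zero>\<^bsub>\<Omega>\<^esub>" if "\<And>i. i \<in> S \<Longrightarrow> u i \<in> A"
proof -
  have "cl 0 \<odot>\<^bsub>\<Omega>\<^esub> d (cl (u i)) = \<zero>\<^bsub>\<Omega>\<^esub>" if "i \<in> S" for i
    using K.smult_l_null[OF d_closed[OF cl_closed]] \<open>\<And>i. i \<in> S \<Longrightarrow> u i \<in> A\<close>[OF that] by (simp add: cl_0)
  then show ?thesis unfolding lc_def
    using K.M.finsum_cong'[OF refl, of "\<lambda>_. \<zero>\<^bsub>\<Omega>\<^esub>" S "\<lambda>i. cl 0 \<odot>\<^bsub>\<Omega>\<^esub> d (cl (u i))"] K.M.finsum_zero
    by auto
qed

lemma lc_single: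
  assumes "finite S" "j \<in> S" "\<And>i. i \<in> S \<Longrightarrow> u i \<in> A" "a \<in> A"
  shows "lc u (\<lambda>i. if i = j then a else 0) S = cl a \<odot>\<^bsub>\<Omega>\<^esub> d (cl (u j))"
proof -
  have z: "cl 0 \<odot>\<^bsub>\<Omega>\<^esub> d (cl (u i)) = \<zero>\<^bsub>\<Omega>\<^esub>" if "i \<in> S" for i
    using K.smult_l_null[OF d_closed[OF cl_closed]] assms(3)[OF that] by (simp add: cl_0)
  have "lc u (\<lambda>i. if i = j then a else 0) S
      = finsum \<Omega> (\<lambda>i. if j = i then cl a \<odot>\<^bsub>\<Omega>\<^esub> d (cl (u i)) else \<zero>\<^bsub>\<Omega>\<^esub>) S"
    unfolding lc_def using assms z by (intro K.M.finsum_cong'[OF refl]) (auto intro!: term_closed)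
  also have "\<dots> = cl a \<odot>\<^bsub>\<Omega>\<^esub> d (cl (u j))"
    using assms by (intro K.M.finsum_singleton) (auto intro: term_closed)
  finally show ?thesis .
qed

lemma cl_one_smult: "x \<in> carrier \<Omega> \<Longrightarrow> cl 1 \<odot>\<^bsub>\<Omega>\<^esub> x = x"
  using K.smult_one by (simp add: cl_hom)

lemma d_mult_cl: "a \<in> A \<Longrightarrow> b \<in> A \<Longrightarrow> d (cl (a * b)) = cl a \<odot>\<^bsub>\<Omega>\<^esub> d (cl b) \<oplus>\<^bsub>\<Omega>\<^esub> cl b \<odot>\<^bsub>\<Omega>\<^esub> d (cl a)"
  using d_mult[OF cl_closed cl_closed] by (simp add: cl_hom)

lemma d_add_cl: "a \<in> A \<Longrightarrow> b \<in> A \<Longrightarrow> d (cl (a + b)) = d (cl a) \<oplus>\<^bsub>\<Omega>\<^esub> d (cl b)"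
  using d_add[OF cl_closed cl_closed] by (simp add: cl_hom)

lemma d_one: "d (cl 1) = \<zero>\<^bsub>\<Omega>\<^esub>"
proof -
  have c: "d (cl 1) \<in> carrier \<Omega>" by (intro d_closed cl_closed A1)
  have "d (cl 1) = d (cl 1) \<oplus>\<^bsub>\<Omega>\<^esub> d (cl 1)"
    using d_mult_cl[OF A1 A1] c by (simp add: cl_one_smult)
  then show ?thesis using c by (metis K.M.add.r_cancel_one')
qed

lemma d_zero: "d (cl 0) = \<zero>\<^bsub>\<Omega>\<^esub>"
proof -
  have c: "d (cl 0) \<in> carrier \<Omega>" by (intro d_closed cl_closed A0)
  have "d (cl 0) = d (cl 0) \<oplus>\<^bsub>\<Omega>\<^esub> d (cl 0)" using d_add_cl[OF A0 A0] by simp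
  then show ?thesis using c by (metis K.M.add.r_cancel_one')
qed

lemma span_submodule:
  assumes S: "finite S" and u: "\<And>i. i \<in> S \<Longrightarrow> u i \<in> A"
  shows "submodule {lc u w S | w. \<forall>i\<in>S. w i \<in> A} RQ \<Omega>"
proof (rule K.submoduleI)
  let ?H = "{lc u w S | w. \<forall>i\<in>S. w i \<in> A}"
  show "?H \<subseteq> carrier \<Omega>" using u lc_closed by blast
  show "\<zero>\<^bsub>\<Omega>\<^esub> \<in> ?H" by (intro CollectI exI[of _ "\<lambda>_. 0"]) (simp add: lc_zero[OF u] A0)
  show add: "x \<oplus>\<^bsub>\<Omega>\<^esub> y \<in> ?H" if xy: "x \<in> ?H" "y \<in> ?H" for x y
  proof -
    obtain w w' where w: "x = lc u w S" "\<forall>i\<in>S. w i \<in> A" "y = lc u w' S" "\<forall>i\<in>S. w' i \<in> A" using xy by blast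
    have "x \<oplus>\<^bsub>\<Omega>\<^esub> y = lc u (\<lambda>i. w i + w' i) S" unfolding w(1,3) using u w(2,4) by (intro lc_add) auto
    moreover have "\<forall>i\<in>S. w i + w' i \<in> A" using w(2,4) Aadd by simp
    ultimately show ?thesis by blast
  qed
  show smult: "c \<odot>\<^bsub>\<Omega>\<^esub> x \<in> ?H" if c: "c \<in> carrier RQ" and x: "x \<in> ?H" for c x
  proof -
    obtain a where a: "c = cl a" "a \<in> A" using c by (auto simp: carrier_RQ)
    obtain w where w: "x = lc u w S" "\<forall>i\<in>S. w i \<in> A" using x by blast
    have "c \<odot>\<^bsub>\<Omega>\<^esub> x = lc u (\<lambda>i. a * w i) S" unfolding a(1) w(1) using u w(2) a(2) S by (intro lc_smult) auto
    moreover have "\<forall>i\<in>S. a * w i \<in> A" using w(2) a(2) Amult by simp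
    ultimately show ?thesis by blast
  qed
  show "\<ominus>\<^bsub>\<Omega>\<^esub> x \<in> ?H" if x: "x \<in> ?H" for x
  proof -
    have xc: "x \<in> carrier \<Omega>" using x u lc_closed by blast
    have "\<ominus>\<^bsub>RQ\<^esub> \<one>\<^bsub>RQ\<^esub> \<odot>\<^bsub>\<Omega>\<^esub> x = \<ominus>\<^bsub>\<Omega>\<^esub> x"
      using K.smult_l_minus[OF one_closed xc] xc by simp
    then show ?thesis using smult[OF a_inv_closed[OF one_closed] x] by simp
  qed
qed

lemma span_mem:
  assumes S: "finite S" and u: "\<And>i. i \<in> S \<Longrightarrow> u i \<in> A" and j: "j \<in> S"
  shows "d (cl (u j)) \<in> {lc u w S | w. \<forall>i\<in>S. w i \<in> A}"
proof -
  have "lc u (\<lambda>i. if i = j then 1 else 0) S = d (cl (u j))"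
    using lc_single[OF S j u A1] d_closed[OF cl_closed[OF u[OF j]]] by (simp add: cl_one_smult)
  moreover have "\<forall>i\<in>S. (if i = j then 1 else 0) \<in> A" using A0 A1 by simp
  ultimately show ?thesis by blast
qed

lemma submodule_lc:
  assumes H: "submodule H RQ \<Omega>" and S: "finite S"
    and u: "\<And>i. i \<in> S \<Longrightarrow> u i \<in> A" "\<And>i. i \<in> S \<Longrightarrow> w i \<in> A"
    and m: "\<And>i. i \<in> S \<Longrightarrow> cl (w i) \<odot>\<^bsub>\<Omega>\<^esub> d (cl (u i)) \<in> H"
  shows "lc u w S \<in> H"
  using S u m unfolding lc_def
proof (induction S)
  case empty
  then show ?case using subgroup.one_closed[OF submodule.axioms(1)[OF H]] by simp
next
  case (insert x S)
  have "finsum \<Omega> (\<lambda>i. cl (w i) \<odot>\<^bsub>\<Omega>\<^esub> d (cl (u i))) (insert x S)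
      = cl (w x) \<odot>\<^bsub>\<Omega>\<^esub> d (cl (u x)) \<oplus>\<^bsub>\<Omega>\<^esub> finsum \<Omega> (\<lambda>i. cl (w i) \<odot>\<^bsub>\<Omega>\<^esub> d (cl (u i))) S"
    using insert by (intro K.M.finsum_insert) (auto intro: term_closed)
  then show ?case using insert K.submoduleE(5)[OF H] by simp
qed

lemma lc_finsum:
  assumes S: "finite S" and u: "\<And>i. i \<in> S \<Longrightarrow> u i \<in> A" and T: "finite T"
    and c: "\<And>l i. l \<in> T \<Longrightarrow> i \<in> S \<Longrightarrow> c l i \<in> A" and \<alpha>: "\<And>l. l \<in> T \<Longrightarrow> \<alpha> l \<in> A"
  shows "finsum \<Omega> (\<lambda>l. cl (\<alpha> l) \<odot>\<^bsub>\<Omega>\<^esub> lc u (c l) S) T = lc u (\<lambda>i. \<Sum>l\<in>T. \<alpha> l * c l i) S"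
  using T c \<alpha>
proof (induction T)
  case empty
  then show ?case using lc_zero[of S u] u by simp
next
  case (insert l T)
  have t: "cl (\<alpha> l') \<odot>\<^bsub>\<Omega>\<^esub> lc u (c l') S \<in> carrier \<Omega>" if "l' \<in> insert l T" for l'
    using insert.prems that u by (intro K.smult_closed cl_closed lc_closed) auto
  have sA: "(\<Sum>l\<in>T. \<alpha> l * c l i) \<in> A" if "i \<in> S" for i
    using insert.prems that by (intro A_sum Amult) auto
  have "finsum \<Omega> (\<lambda>l. cl (\<alpha> l) \<odot>\<^bsub>\<Omega>\<^esub> lc u (c l) S) (insert l T)
      = cl (\<alpha> l) \<odot>\<^bsub>\<Omega>\<^esub> lc u (c l) S \<oplus>\<^bsub>\<Omega>\<^esub> finsum \<Omega> (\<lambda>l. cl (\<alpha> l) \<odot>\<^bsub>\<Omega>\<^esub> lc u (c l) S) T"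
    using insert t by (intro K.M.finsum_insert) auto
  also have "\<dots> = lc u (\<lambda>i. \<alpha> l * c l i) S \<oplus>\<^bsub>\<Omega>\<^esub> lc u (\<lambda>i. \<Sum>l\<in>T. \<alpha> l * c l i) S"
    using insert lc_smult[of S u "c l" "\<alpha> l"] S u by simp
  also have "\<dots> = lc u (\<lambda>i. \<alpha> l * c l i + (\<Sum>l\<in>T. \<alpha> l * c l i)) S"
    using insert.prems u sA by (intro lc_add) (auto intro: Amult)
  finally show ?case using insert.hyps by simp
qed

end

section \<open>Differentials of the affine cone\<close>

definition torsion_lifts :: "('v::{finite,linorder}, 'k::field) mpoly set \<Rightarrow> bool" where
  "torsion_lifts P \<longleftrightarrow> (\<forall>w a f. a \<notin> P \<longrightarrow> f \<in> P \<longrightarrow> (\<forall>i. a * w i - pd i f \<in> P) \<longrightarrow>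
     (\<exists>g\<in>P. \<forall>i. w i - pd i g \<in> P))"

lemma ring_of_type_algebra_UNIV: "ring_of_type_algebra\<lparr>carrier := UNIV\<rparr> = (ring_of_type_algebra :: 'a::comm_ring_1 ring)"
  by (simp add: ring_of_type_algebra_def)

text \<open>The dx_i generate the differentials, and \<open>w\<close> gives zero exactly if it is in
  \<open>L\<close>. That \<open>L\<close> is killed is the formula for the differential of a
  polynomial; that nothing else is killed follows from the map on the differentials induced by
  taking gradients.\<close>

theorem (in projective_variety) cone_differentials_torsion_free_iff:
  "cone_differentials_torsion_free Z \<longleftrightarrow> torsion_lifts P"
proof -
  note PI = P_idl
  define L where "L = {w. \<exists>g\<in>P. \<forall>i. w i - pd i g \<in> P}"
  interpret Q: quotient_derivation UNIV P const "\<lambda>a v i. a * v i" "\<lambda>f i. pd i f" UNIV L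
  proof unfold_locales
    show "v + w \<in> L" if v: "v \<in> L" and w: "w \<in> L" for v w
    proof -
      obtain g g' where "g \<in> P" "\<And>i. v i - pd i g \<in> P" "g' \<in> P" "\<And>i. w i - pd i g' \<in> P"
        using v w by (auto simp: L_def)
      then have "g + g' \<in> P" "\<And>i. (v i - pd i g) + (w i - pd i g') \<in> P" using idl_add[OF PI] by blast+
      then show ?thesis by (auto simp: L_def pd_add algebra_simps intro!: bexI[of _ "g + g'"])
    qed
    show "(\<lambda>i. a * v i) \<in> L" if v: "v \<in> L" for a v
    proof -
      obtain g where g: "g \<in> P" "\<And>i. v i - pd i g \<in> P" using v by (auto simp: L_def)
      have "a * v i - pd i (a * g) \<in> P" for i
      proof -
        \<comment> \<open>A multiple of a gradient is again one modulo P: in the product rule the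
          term with g itself lies in P.\<close>
        have "a * v i - pd i (a * g) = a * (v i - pd i g) - pd i a * g" by (simp add: pd_mult algebra_simps)
        then show ?thesis using g by (simp add: idl_diff idl_mult PI)
      qed
      moreover have "a * g \<in> P" by (rule idl_mult[OF PI g(1)])
      ultimately show ?thesis unfolding L_def by blast
    qed
    show "(\<lambda>i. a * v i) \<in> L" if "a \<in> P" for a v
      using that by (auto simp: L_def idl_0[OF PI] idl_mult2[OF PI] intro!: bexI[of _ 0])
    show "(\<lambda>i. pd i a) \<in> L" if "a \<in> P" for a
      using that by (auto simp: L_def idl_0[OF PI] intro!: bexI[of _ a])
    show "0 \<in> L" by (auto simp: L_def idl_0[OF PI] intro!: bexI[of _ 0])
  qed (auto simp: idl_0 idl_add idl_mult PI pd_add pd_mult fun_eq_iff algebra_simps)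
  have R0: "Q.R0 = polyring" by (simp add: Q.R0_def ring_of_type_algebra_UNIV)
  have RQ: "cone_ring Z = Q.RQ" by (simp add: cone_ring_def Q.RQ_def R0 homogeneous_ideal_eq)
  have con: "cone_const Z = (\<lambda>c. Q.cl (const c))"
    by (simp add: cone_const_def[abs_def] Q.cl_def R0 homogeneous_ideal_eq)
  let ?O = "kaehler Q.RQ (\<lambda>c. Q.cl (const c))"
  have d_eq: "Q.d (Q.cl f) = Q.lc var (\<lambda>i. pd i f) UNIV" for f
  proof (induction f rule: mpoly_ring_induct)
    case (const c)
    then show ?case using Q.d_const[of c] Q.lc_zero[of UNIV var] by simp
  next
    case (var j)
    have "Q.lc var (\<lambda>i. if i = j then 1 else 0) UNIV = Q.cl 1 \<odot>\<^bsub>?O\<^esub> Q.d (Q.cl (var j))"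
      by (rule Q.lc_single) auto
    also have "\<dots> = Q.d (Q.cl (var j))" by (intro Q.cl_one_smult Q.d_closed Q.cl_closed) simp
    finally show ?case by (simp add: pd_var)
  next
    case (add f g)
    then show ?case using Q.lc_add[of UNIV var "\<lambda>i. pd i f" "\<lambda>i. pd i g"] by (simp add: Q.d_add_cl pd_add)
  next
    case (mult f g)
    have "Q.d (Q.cl (f * g)) = Q.lc var (\<lambda>i. f * pd i g) UNIV \<oplus>\<^bsub>?O\<^esub> Q.lc var (\<lambda>i. g * pd i f) UNIV"
      using Q.lc_smult[of UNIV var "\<lambda>i. pd i f" g] Q.lc_smult[of UNIV var "\<lambda>i. pd i g" f] mult
      by (simp add: Q.d_mult_cl)
    also have "\<dots> = Q.lc var (\<lambda>i. f * pd i g + g * pd i f) UNIV" by (rule Q.lc_add) auto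
    finally show ?case by (simp add: pd_mult ac_simps)
  qed
  have dP: "Q.lc var (\<lambda>i. pd i f) UNIV = \<zero>\<^bsub>?O\<^esub>" if "f \<in> P" for f
  proof -
    have "Q.cl f = Q.cl 0" using Q.cl_eq_iff[of f 0] that by simp
    then show ?thesis using Q.d_zero by (simp flip: d_eq)
  qed
  have dval_lc: "Q.dval (Q.lc var w UNIV) w" for w
  proof -
    have "Q.dval (Q.cl (w i) \<odot>\<^bsub>?O\<^esub> Q.d (Q.cl (var i))) (\<lambda>j. w i * pd j (var i))" for i
      by (intro Q.dval_smult Q.dval_d) auto
    then have "Q.dval (Q.lc var w UNIV) (\<Sum>i\<in>UNIV. (\<lambda>j. w i * pd j (var i)))"
      unfolding Q.lc_def by (intro Q.dval_finsum) (auto intro: Q.term_closed)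
    moreover have "(\<Sum>i\<in>UNIV. (\<lambda>j. w i * pd j (var i))) = w"
    proof
      fix j
      have "(\<Sum>i\<in>S. (\<lambda>j. w i * pd j (var i))) j = (\<Sum>i\<in>S. w i * pd j (var i))" if "finite S" for S
        using that by induction auto
      from this[OF finite] show "(\<Sum>i\<in>UNIV. (\<lambda>j. w i * pd j (var i))) j = w j"
        by (simp add: pd_var if_distrib[of "\<lambda>x. _ * x"] cong: if_cong)
    qed
    ultimately show ?thesis by simp
  qed
  have carr: "\<exists>w. x = Q.lc var w UNIV" if x: "x \<in> carrier ?O" for x
  proof -
    have "carrier ?O \<subseteq> {Q.lc var w UNIV | w. \<forall>i\<in>UNIV. w i \<in> UNIV}"
    proof (rule Q.spanned_by_d[OF Q.span_submodule])
      fix y assume "y \<in> carrier Q.RQ"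
      then obtain f where "y = Q.cl f" by (auto simp: Q.carrier_RQ)
      then show "Q.d y \<in> {Q.lc var w UNIV | w. \<forall>i\<in>UNIV. w i \<in> UNIV}" using d_eq[of f] by auto
    qed auto
    then show ?thesis using x by blast
  qed
  have nzd: "(\<forall>b\<in>carrier Q.RQ. Q.cl a \<otimes>\<^bsub>Q.RQ\<^esub> b = \<zero>\<^bsub>Q.RQ\<^esub> \<longrightarrow> b = \<zero>\<^bsub>Q.RQ\<^esub>) \<longleftrightarrow> a \<notin> P" for a
    using prime_idl_one[OF P_prime] by (intro Q.nonzero_divisor_cl) (auto simp: prime_idl_mult_iff[OF P_prime])
  have zero_lc: "Q.lc var w UNIV = \<zero>\<^bsub>?O\<^esub> \<longleftrightarrow> w \<in> L" for w
  proof
    assume "Q.lc var w UNIV = \<zero>\<^bsub>?O\<^esub>"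
    then show "w \<in> L" using dval_lc[of w] Q.dval_zero by simp
  next
    assume "w \<in> L"
    then obtain g where g: "g \<in> P" "\<And>i. w i - pd i g \<in> P" by (auto simp: L_def)
    then have "Q.lc var w UNIV = Q.lc var (\<lambda>i. pd i g) UNIV" by (intro Q.lc_cong) auto
    then show "Q.lc var w UNIV = \<zero>\<^bsub>?O\<^esub>" using dP[OF g(1)] by simp
  qed
  have tors: "Q.lc var w UNIV \<in> torsion_elements Q.RQ ?O \<longleftrightarrow> (\<exists>a. a \<notin> P \<and> (\<lambda>i. a * w i) \<in> L)" for w
  proof -
    have "Q.lc var w UNIV \<in> carrier ?O" by (rule Q.lc_closed) auto
    moreover have "Q.cl a \<odot>\<^bsub>?O\<^esub> Q.lc var w UNIV = Q.lc var (\<lambda>i. a * w i) UNIV" for a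
      by (rule Q.lc_smult) auto
    moreover have "(\<exists>c\<in>carrier Q.RQ. \<Phi> c) \<longleftrightarrow> (\<exists>a. \<Phi> (Q.cl a))" for \<Phi>
      by (auto simp: Q.carrier_RQ)
    ultimately show ?thesis
      by (simp only: torsion_elements_def mem_Collect_eq zero_lc nzd simp_thms)
  qed
  have "torsion_free_module Q.RQ ?O \<longleftrightarrow> torsion_lifts P"
  proof
    assume tf: "torsion_free_module Q.RQ ?O"
    show "torsion_lifts P" unfolding torsion_lifts_def
    proof (intro allI impI)
      fix w a f assume *: "a \<notin> P" "f \<in> P" "\<forall>i. a * w i - pd i f \<in> P"
      then have "(\<lambda>i. a * w i) \<in> L" by (auto simp: L_def)
      then have "Q.lc var w UNIV \<in> torsion_elements Q.RQ ?O" using *(1) tors by blast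
      then have "w \<in> L" using tf zero_lc by (simp add: torsion_free_module_def)
      then show "\<exists>g\<in>P. \<forall>i. w i - pd i g \<in> P" by (simp add: L_def)
    qed
  next
    assume tl: "torsion_lifts P"
    have "x = \<zero>\<^bsub>?O\<^esub>" if x: "x \<in> torsion_elements Q.RQ ?O" for x
    proof -
      obtain w where w: "x = Q.lc var w UNIV" using x carr by (auto simp: torsion_elements_def)
      then obtain a where "a \<notin> P" "(\<lambda>i. a * w i) \<in> L" using x tors by blast
      then have "w \<in> L" using tl by (auto simp: torsion_lifts_def L_def)
      then show ?thesis using w zero_lc by simp
    qed
    moreover have "\<zero>\<^bsub>?O\<^esub> \<in> torsion_elements Q.RQ ?O"
    proof -
      have z: "0 \<in> L" by (rule Q.L_0)
      then have "(\<lambda>i. 1 * (0::'v \<Rightarrow> ('v, 'k) mpoly) i) \<in> L" by (simp add: zero_fun_def)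
      then have "Q.lc var 0 UNIV \<in> torsion_elements Q.RQ ?O"
        using tors prime_idl_one[OF P_prime] by blast
      moreover have "Q.lc var 0 UNIV = \<zero>\<^bsub>?O\<^esub>" using z zero_lc by blast
      ultimately show ?thesis by simp
    qed
    ultimately show "torsion_free_module Q.RQ ?O" unfolding torsion_free_module_def by blast
  qed
  then show ?thesis by (simp add: cone_differentials_torsion_free_def RQ con)
qed

section \<open>Derivations of the fraction field\<close>

text \<open>Localization regardless of degrees; derivatives of fractions are placed here, so that no
  degrees have to be followed.\<close>

definition Loc :: "'a::idom set \<Rightarrow> 'a set \<Rightarrow> 'a fract set" where
  "Loc J p = {to_fract a / to_fract b | a b. a \<in> J \<and> b \<notin> p}"

lemma LocI: "a \<in> J \<Longrightarrow> b \<notin> p \<Longrightarrow> to_fract a / to_fract b \<in> Loc J p"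
  unfolding Loc_def by blast

lemma Fr_subset_Loc: "Fr J d p \<subseteq> Loc J p"
  unfolding Fr_def Loc_def by blast

lemma Loc_mono: "J \<subseteq> J' \<Longrightarrow> Loc J p \<subseteq> Loc J' p"
  unfolding Loc_def by blast

context
  fixes p :: "'a::idom set"
  assumes p: "prime_idl p"
begin

lemma notin_nonzero: "b \<notin> p \<Longrightarrow> b \<noteq> 0"
  using idl_0[OF prime_idl_idl[OF p]] by blast

lemma Loc_0: "0 \<in> J \<Longrightarrow> 0 \<in> Loc J p"
  using LocI[of 0 J 1 p] prime_idl_one[OF p] by simp

lemma Loc_add:
  assumes "idl J" "x \<in> Loc J p" "y \<in> Loc J p" shows "x + y \<in> Loc J p"
proof -
  obtain a b where x: "x = to_fract a / to_fract b" "a \<in> J" "b \<notin> p" using assms(2) by (auto simp: Loc_def)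
  obtain c d where y: "y = to_fract c / to_fract d" "c \<in> J" "d \<notin> p" using assms(3) by (auto simp: Loc_def)
  have "b \<noteq> 0" "d \<noteq> 0" using x y notin_nonzero by auto
  then have e: "x + y = to_fract (a * d + c * b) / to_fract (b * d)"
    unfolding x(1) y(1) by (simp add: field_simps)
  show ?thesis unfolding e using x y
    by (intro LocI idl_add[OF assms(1)] idl_mult2[OF assms(1)]) (auto simp: prime_idl_mult_iff[OF p])
qed

lemma Loc_mult:
  assumes "idl J" "x \<in> Loc J p" "y \<in> Loc UNIV p" shows "x * y \<in> Loc J p" "y * x \<in> Loc J p"
proof -
  obtain a b where x: "x = to_fract a / to_fract b" "a \<in> J" "b \<notin> p" using assms(2) by (auto simp: Loc_def)
  obtain c d where y: "y = to_fract c / to_fract d" "d \<notin> p" using assms(3) by (auto simp: Loc_def)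
  have e: "x * y = to_fract (a * c) / to_fract (b * d)" unfolding x(1) y(1) by simp
  show "x * y \<in> Loc J p" unfolding e using x y
    by (intro LocI idl_mult2[OF assms(1)]) (auto simp: prime_idl_mult_iff[OF p])
  then show "y * x \<in> Loc J p" by (simp add: mult.commute)
qed

lemma Loc_frac_iff: "b \<notin> p \<Longrightarrow> to_fract a / to_fract b \<in> Loc p p \<longleftrightarrow> a \<in> p"
proof
  assume b: "b \<notin> p" and "to_fract a / to_fract b \<in> Loc p p"
  then obtain c d where cd: "to_fract a / to_fract b = to_fract c / to_fract d" "c \<in> p" "d \<notin> p"
    by (auto simp: Loc_def)
  then have "to_fract (a * d) = to_fract (c * b)"
    using notin_nonzero[OF b] notin_nonzero[OF cd(3)] by (simp add: field_simps)
  then have "a * d = c * b" by (simp only: to_fract_eq_iff)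
  then have "a * d \<in> p" using idl_mult2[OF prime_idl_idl[OF p] cd(2)] by simp
  then show "a \<in> p" using cd(3) by (simp add: prime_idl_mult_iff[OF p])
qed (auto intro: LocI)

lemma Loc_prime:
  assumes x: "x \<in> Loc UNIV p" and y: "y \<in> Loc UNIV p" and xy: "x * y \<in> Loc p p"
  shows "x \<in> Loc p p \<or> y \<in> Loc p p"
proof -
  obtain a b where x: "x = to_fract a / to_fract b" "b \<notin> p" using x by (auto simp: Loc_def)
  obtain c d where y: "y = to_fract c / to_fract d" "d \<notin> p" using y by (auto simp: Loc_def)
  have "b * d \<notin> p" using x(2) y(2) by (simp add: prime_idl_mult_iff[OF p])
  moreover have "to_fract (a * c) / to_fract (b * d) \<in> Loc p p" using xy by (simp add: x(1) y(1))
  ultimately have "a * c \<in> p" using Loc_frac_iff by blast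
  then show ?thesis unfolding x(1) y(1) using Loc_frac_iff x(2) y(2) prime_idl_mult_iff[OF p] by blast
qed

lemma Loc_sum: "idl J \<Longrightarrow> (\<And>i. i \<in> S \<Longrightarrow> f i \<in> Loc J p) \<Longrightarrow> sum f S \<in> Loc J p"
  by (induction S rule: infinite_finite_induct) (auto intro: Loc_add Loc_0 idl_0)

lemma Loc_uminus: "idl J \<Longrightarrow> x \<in> Loc J p \<Longrightarrow> - x \<in> Loc J p"
  using Loc_mult(1)[of J x "- 1"] LocI[of "- 1" UNIV 1 p] prime_idl_one[OF p] by simp

end

text \<open>The quotient rule with the fraction x kept as a factor, which makes independence of the
  chosen numerator and denominator a linear computation.\<close>

definition fder :: "('v \<Rightarrow> ('v, 'k) mpoly) \<Rightarrow> ('v::{finite,linorder}, 'k::field) mpoly fract \<Rightarrow> ('v, 'k) mpoly fract" where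
  "fder e x = (SOME y. \<exists>a b. b \<noteq> 0 \<and> x = to_fract a / to_fract b \<and>
     y = (to_fract (der e a) - x * to_fract (der e b)) / to_fract b)"

text \<open>Two representations a/b and c/d satisfy a d = c b; applying the product rule to this
  equation shows that both give the same derivative.\<close>

lemma fder_frac:
  assumes b: "b \<noteq> 0" and x: "x = to_fract a / to_fract b"
  shows "fder e x = (to_fract (der e a) - x * to_fract (der e b)) / to_fract b"
  unfolding fder_def
proof (rule some_equality)
  show "\<exists>a' b'. b' \<noteq> 0 \<and> x = to_fract a' / to_fract b' \<and>
      (to_fract (der e a) - x * to_fract (der e b)) / to_fract b =
      (to_fract (der e a') - x * to_fract (der e b')) / to_fract b'"
    using b x by blast
next
  fix y assume "\<exists>a b. b \<noteq> 0 \<and> x = to_fract a / to_fract b \<and>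
     y = (to_fract (der e a) - x * to_fract (der e b)) / to_fract b"
  then obtain c d where d: "d \<noteq> 0" "x = to_fract c / to_fract d"
    "y = (to_fract (der e c) - x * to_fract (der e d)) / to_fract d" by blast
  have a: "to_fract a = x * to_fract b" unfolding x using b by simp
  have c: "to_fract c = x * to_fract d" unfolding d(2) using d(1) by simp
  have "to_fract (a * d) = to_fract (c * b)" by (simp add: a c)
  then have "a * d = c * b" by (simp only: to_fract_eq_iff)
  then have "der e (a * d) = der e (c * b)" by simp
  then have "to_fract (der e a * d + a * der e d) = to_fract (der e c * b + c * der e b)"
    by (simp only: der_mult)
  then have "to_fract (der e a) * to_fract d + x * to_fract b * to_fract (der e d)
      = to_fract (der e c) * to_fract b + x * to_fract d * to_fract (der e b)"
    by (simp add: a c)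
  then have "(to_fract (der e c) - x * to_fract (der e d)) * to_fract b
      = (to_fract (der e a) - x * to_fract (der e b)) * to_fract d"
    by (simp add: algebra_simps)
  then show "y = (to_fract (der e a) - x * to_fract (der e b)) / to_fract b"
    unfolding d(3) using b d(1) by (simp add: frac_eq_eq)
qed

lemma fract_cases':
  obtains a b where "x = to_fract a / to_fract b" "b \<noteq> 0"
  by (cases x) (auto simp: Fract_conv_to_fract)

lemma fder_eqI:
  assumes b: "b \<noteq> 0" and x: "x * to_fract b = to_fract a"
    and y: "y * to_fract b = to_fract (der e a) - x * to_fract (der e b)"
  shows "fder e x = y"
proof -
  have "x = to_fract a / to_fract b" using b by (simp add: x[symmetric])
  then have "fder e x = (to_fract (der e a) - x * to_fract (der e b)) / to_fract b" by (rule fder_frac[OF b])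
  also have "\<dots> = y" using b by (simp add: y[symmetric])
  finally show ?thesis .
qed

lemma fder_char:
  assumes b: "b \<noteq> 0" and x: "x * to_fract b = to_fract a"
  shows "fder e x * to_fract b = to_fract (der e a) - x * to_fract (der e b)"
proof -
  have "x = to_fract a / to_fract b" using b by (simp add: x[symmetric])
  then show ?thesis using fder_frac[OF b] b by simp
qed

lemma fder_add: "fder e (x + y) = fder e x + fder e y"
proof -
  obtain a b where x: "x = to_fract a / to_fract b" and b: "b \<noteq> 0" by (rule fract_cases')
  obtain c d where y: "y = to_fract c / to_fract d" and d: "d \<noteq> 0" by (rule fract_cases')
  have a: "x * to_fract b = to_fract a" and c: "y * to_fract d = to_fract c" using x b y d by simp_all
  show ?thesis
  proof (rule fder_eqI)
    show "b * d \<noteq> 0" using b d by simp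
    show "(x + y) * to_fract (b * d) = to_fract (a * d + c * b)"
      by (simp add: algebra_simps flip: a c)
    have "(fder e x + fder e y) * to_fract (b * d)
        = (fder e x * to_fract b) * to_fract d + (fder e y * to_fract d) * to_fract b" by (simp add: algebra_simps)
    also have "\<dots> = to_fract (der e (a * d + c * b)) - (x + y) * to_fract (der e (b * d))"
      unfolding fder_char[OF b a] fder_char[OF d c] by (simp add: der_add der_mult algebra_simps flip: a c)
    finally show "(fder e x + fder e y) * to_fract (b * d)
        = to_fract (der e (a * d + c * b)) - (x + y) * to_fract (der e (b * d))" .
  qed
qed

lemma fder_mult: "fder e (x * y) = x * fder e y + y * fder e x"
proof -
  obtain a b where x: "x = to_fract a / to_fract b" and b: "b \<noteq> 0" by (rule fract_cases')
  obtain c d where y: "y = to_fract c / to_fract d" and d: "d \<noteq> 0" by (rule fract_cases')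
  have a: "x * to_fract b = to_fract a" and c: "y * to_fract d = to_fract c" using x b y d by simp_all
  show ?thesis
  proof (rule fder_eqI)
    show "b * d \<noteq> 0" using b d by simp
    show "x * y * to_fract (b * d) = to_fract (a * c)"
      by (simp add: algebra_simps flip: a c)
    have "(x * fder e y + y * fder e x) * to_fract (b * d)
        = x * (fder e y * to_fract d) * to_fract b + y * (fder e x * to_fract b) * to_fract d" by (simp add: algebra_simps)
    also have "\<dots> = to_fract (der e (a * c)) - x * y * to_fract (der e (b * d))"
      unfolding fder_char[OF b a] fder_char[OF d c] by (simp add: der_mult algebra_simps flip: a c)
    finally show "(x * fder e y + y * fder e x) * to_fract (b * d)
        = to_fract (der e (a * c)) - x * y * to_fract (der e (b * d))" .
  qed
qed

lemma fder_to_fract: "fder e (to_fract a) = to_fract (der e a)"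
  by (rule fder_eqI[of 1]) auto

lemma fder_Loc:
  assumes p: "prime_idl p" and J: "idl J" and "a \<in> J" "der e a \<in> J" "b \<notin> p"
  shows "fder e (to_fract a / to_fract b) \<in> Loc J p"
proof -
  have b: "b \<noteq> 0" by (rule notin_nonzero[OF p assms(5)])
  have "fder e (to_fract a / to_fract b) = to_fract (der e a * b - a * der e b) / to_fract (b * b)"
    unfolding fder_frac[OF b refl] using b by (simp add: field_simps)
  also have "\<dots> \<in> Loc J p"
    using assms by (intro LocI idl_diff[OF J] idl_mult2[OF J]) (auto simp: prime_idl_mult_iff[OF p])
  finally show ?thesis .
qed

section \<open>Linear dependence modulo a prime\<close>

text \<open>Gaussian elimination over the domain A/I without fractions. The closure properties of A
  and I are explicit so that the lemma applies to both \<open>Loc\<close> and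
  \<open>Fr\<close>.\<close>

lemma dependent_mod_prime:
  fixes c :: "'i \<Rightarrow> nat \<Rightarrow> 'a::comm_ring_1" and A I :: "'a set"
  assumes ring: "0 \<in> A" "1 \<in> A" "\<And>a b. a \<in> A \<Longrightarrow> b \<in> A \<Longrightarrow> a + b \<in> A" "\<And>a b. a \<in> A \<Longrightarrow> b \<in> A \<Longrightarrow> a * b \<in> A"
      "\<And>a. a \<in> A \<Longrightarrow> - a \<in> A"
    and ideal: "0 \<in> I" "\<And>a b. a \<in> I \<Longrightarrow> b \<in> I \<Longrightarrow> a + b \<in> I" "\<And>a b. a \<in> A \<Longrightarrow> b \<in> I \<Longrightarrow> a * b \<in> I"
    and prime: "1 \<notin> I" "\<And>a b. a \<in> A \<Longrightarrow> b \<in> A \<Longrightarrow> a * b \<in> I \<Longrightarrow> a \<in> I \<or> b \<in> I"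
  shows "finite S \<Longrightarrow> card S > r \<Longrightarrow> (\<And>i l. i \<in> S \<Longrightarrow> l < r \<Longrightarrow> c i l \<in> A) \<Longrightarrow>
    \<exists>\<alpha>. (\<forall>i\<in>S. \<alpha> i \<in> A) \<and> (\<exists>i\<in>S. \<alpha> i \<notin> I) \<and> (\<forall>l<r. (\<Sum>i\<in>S. \<alpha> i * c i l) \<in> I)"
proof (induction r arbitrary: S c)
  case 0
  then have "S \<noteq> {}" by auto
  then show ?case using ring prime by (intro exI[of _ "\<lambda>_. 1"]) auto
next
  case (Suc r)
  have sumI: "sum f T \<in> I" if "\<And>i. i \<in> T \<Longrightarrow> f i \<in> I" for f :: "'i \<Rightarrow> 'a" and T
    using that by (induction T rule: infinite_finite_induct) (auto intro: ideal)
  have sumA: "sum f T \<in> A" if "\<And>i. i \<in> T \<Longrightarrow> f i \<in> A" for f :: "'i \<Rightarrow> 'a" and T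
    using that by (induction T rule: infinite_finite_induct) (auto intro: ring)
  show ?case
  proof (cases "\<forall>i\<in>S. c i r \<in> I")
    case True
    obtain \<alpha> where \<alpha>: "\<forall>i\<in>S. \<alpha> i \<in> A" "\<exists>i\<in>S. \<alpha> i \<notin> I" "\<forall>l<r. (\<Sum>i\<in>S. \<alpha> i * c i l) \<in> I"
      using Suc.IH[of S c] Suc.prems by auto
    have "(\<Sum>i\<in>S. \<alpha> i * c i r) \<in> I" using \<alpha>(1) True by (intro sumI ideal(3)) auto
    then show ?thesis using \<alpha> by (intro exI[of _ \<alpha>]) (auto simp: less_Suc_eq)
  next
    case False
    then obtain o' where o: "o' \<in> S" "c o' r \<notin> I" by blast
    define S' where "S' = S - {o'}"
    define c' where "c' i l = c o' r * c i l + - (c i r * c o' l)" for i l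
    have S': "finite S'" "card S' > r" using Suc.prems o by (auto simp: S'_def)
    have cA: "c i l \<in> A" if "i \<in> S" "l \<le> r" for i l using Suc.prems that by auto
    have "c' i l \<in> A" if "i \<in> S'" "l < r" for i l
      unfolding c'_def using that cA o by (intro ring) (auto simp: S'_def)
    then obtain \<alpha> where \<alpha>: "\<forall>i\<in>S'. \<alpha> i \<in> A" "\<exists>i\<in>S'. \<alpha> i \<notin> I" "\<forall>l<r. (\<Sum>i\<in>S'. \<alpha> i * c' i l) \<in> I"
      using Suc.IH[OF S', of c'] by blast
    \<comment> \<open>Undoing the elimination: the pivot row gets the coefficient that cancels
      coordinate r exactly and leaves the combination of the rows \<open>c'\<close> in the
      others.\<close>
    define \<beta> where "\<beta> i = (if i = o' then - (\<Sum>i\<in>S'. \<alpha> i * c i r) else \<alpha> i * c o' r)" for i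
    have "\<forall>i\<in>S. \<beta> i \<in> A"
      using \<alpha>(1) cA o by (auto simp: \<beta>_def S'_def intro!: ring sumA)
    moreover have "\<exists>i\<in>S. \<beta> i \<notin> I"
    proof -
      obtain i where i: "i \<in> S'" "\<alpha> i \<notin> I" using \<alpha>(2) by blast
      then have "\<alpha> i * c o' r \<notin> I" using prime(2)[of "\<alpha> i" "c o' r"] \<alpha>(1) cA[OF o(1)] o(2) by auto
      then show ?thesis using i by (intro bexI[of _ i]) (auto simp: \<beta>_def S'_def)
    qed
    moreover have "(\<Sum>i\<in>S. \<beta> i * c i l) \<in> I" if l: "l < Suc r" for l
    proof -
      have "(\<Sum>i\<in>S. \<beta> i * c i l) = \<beta> o' * c o' l + (\<Sum>i\<in>S'. \<beta> i * c i l)"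
        using Suc.prems(1) o(1) by (simp add: S'_def sum.remove)
      also have "(\<Sum>i\<in>S'. \<beta> i * c i l) = (\<Sum>i\<in>S'. \<alpha> i * c o' r * c i l)"
        by (intro sum.cong) (auto simp: \<beta>_def S'_def)
      also have "\<beta> o' * c o' l + (\<Sum>i\<in>S'. \<alpha> i * c o' r * c i l) = (\<Sum>i\<in>S'. \<alpha> i * c' i l)"
        by (simp add: \<beta>_def c'_def sum_distrib_left sum_distrib_right sum_subtractf algebra_simps)
      finally have e: "(\<Sum>i\<in>S. \<beta> i * c i l) = (\<Sum>i\<in>S'. \<alpha> i * c' i l)" .
      show ?thesis
      proof (cases "l = r")
        case True
        then show ?thesis unfolding e by (simp add: c'_def mult.commute ideal)
      next
        case False
        then show ?thesis unfolding e using \<alpha>(3) l by simp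
      qed
    qed
    ultimately show ?thesis by blast
  qed
qed

section \<open>Smoothness and the Jacobian\<close>

context projective_variety
begin

lemma Fr_P_subset: "Fr P d p \<subseteq> Fr UNIV d p"
  by (rule Fr_mono) simp

lemma local_kaehler_quotient:
  assumes p: "p \<in> Z"
  shows "kaehler_quotient (Fr UNIV 0 p) (Fr P 0 p) (\<lambda>c. to_fract (const c))"
proof -
  note pX = ZD(1)[OF p]
  have c: "to_fract (const c) \<in> Fr UNIV 0 p" for c
    using proj_pointsD(5)[OF pX] by (intro Fr_to_fract) auto
  show ?thesis
  proof unfold_locales
    show "1 \<in> Fr UNIV 0 p" using c[of 1] by simp
    show "a * b \<in> Fr UNIV 0 p" if "a \<in> Fr UNIV 0 p" "b \<in> Fr UNIV 0 p" for a b
      using Fr_mult_UNIV[OF pX idl_UNIV that] by simp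
    show "a * b \<in> Fr P 0 p" if "a \<in> Fr UNIV 0 p" "b \<in> Fr P 0 p" for a b
      using Fr_mult_UNIV[OF pX P_idl that(2,1)] by (simp add: mult.commute)
  qed (use c Fr_P_subset in \<open>auto intro: Fr_0[OF pX] Fr_add[OF pX] Fr_uminus[OF pX] P_idl\<close>)
qed

lemma local_ring_eq:
  assumes p: "p \<in> Z"
  shows "local_ring Z p = subring_quotient.RQ (Fr UNIV 0 p) (Fr P 0 p)"
    "local_ring_const Z p = (\<lambda>c. subring_quotient.cl (Fr UNIV 0 p) (Fr P 0 p) (to_fract (const c)))"
proof -
  note pX = ZD(1)[OF p]
  interpret kaehler_quotient "Fr UNIV 0 p" "Fr P 0 p" "\<lambda>c. to_fract (const c)"
    by (rule local_kaehler_quotient[OF p])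
  have 1: "local_ring_Pn p = R0"
    by (simp add: local_ring_Pn_def R0_def stalk_sectn[OF is_sectn_OPn pX])
  then show "local_ring Z p = RQ"
    by (simp add: local_ring_def RQ_def stalk_sectn[OF is_sectn_ideal_sheaf pX])
  show "local_ring_const Z p = (\<lambda>c. cl (to_fract (const c)))"
    by (simp add: fun_eq_iff local_ring_const_def cl_def 1 stalk_sectn[OF is_sectn_ideal_sheaf pX] to_fract_def)
qed

text \<open>The functionals given by the derivations \<open>der (e j)\<close> separate the \<open>d(x\<^sub>j/x\<^sub>0)\<close> in the fibre.\<close>

lemma fibre_dim_lower_bound:
  assumes p: "p \<in> Z"
    and fib: "fibre_has_dim (local_ring Z p) (kaehler (local_ring Z p) (local_ring_const Z p)) r"
    and o': "var o' \<notin> p" "o' \<notin> S" and b: "b \<notin> p"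
    and e: "\<And>i j. j \<in> S \<Longrightarrow> i \<in> insert o' S \<Longrightarrow> e j i = (if i = j then b else 0)"
    and eP: "\<And>j g. j \<in> S \<Longrightarrow> g \<in> P \<Longrightarrow> der (e j) g \<in> p"
  shows "card S \<le> r"
proof (rule ccontr)
  assume "\<not> card S \<le> r"
  then have card: "card S > r" by simp
  note pX = ZD(1)[OF p]
  note pp = proj_pointsD(1)[OF pX] and pI = proj_pointsD(3)[OF pX]
  let ?A = "Fr UNIV 0 p" and ?I = "Fr P 0 p"
  \<comment> \<open>One functional for each j in S; the remaining entries are filled with 0.\<close>
  define D where "D x = (\<lambda>j. if j \<in> S then fder (e j) x else 0)" for x
  define C :: "('v \<Rightarrow> ('v, 'k) mpoly fract) set" where "C = {v. \<forall>j. v j \<in> Loc UNIV p}"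
  define L :: "('v \<Rightarrow> ('v, 'k) mpoly fract) set" where "L = {v. \<forall>j. v j \<in> Loc p p}"
  note KQ = local_kaehler_quotient[OF p]
  have AL: "x \<in> Loc UNIV p" if "x \<in> ?A" for x using that Fr_subset_Loc by blast
  have IL: "x \<in> Loc p p" if "x \<in> ?I" for x
    using that Fr_subset_Loc[of P 0 p] Loc_mono[OF ZD(2)[OF p]] by blast
  interpret Q: quotient_derivation ?A ?I "\<lambda>c. to_fract (const c)" "\<lambda>a v j. a * v j" D C L
  proof (rule quotient_derivation.intro[OF KQ], unfold_locales)
    show "D (a + b) = D a + D b" for a b by (auto simp: D_def fder_add fun_eq_iff)
    show "D (a * b) = (\<lambda>j. a * D b j) + (\<lambda>j. b * D a j)" for a b by (auto simp: D_def fder_mult fun_eq_iff)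
    show "D (to_fract (const c)) = 0" for c by (auto simp: D_def fder_to_fract fun_eq_iff)
    show "D a \<in> C" if a: "a \<in> ?A" for a
    proof -
      obtain x y where "a = to_fract x / to_fract y" "y \<notin> p" using a by (rule FrE)
      then show ?thesis using fder_Loc[OF pp idl_UNIV, of x _ y] Loc_0[OF pp] by (auto simp: C_def D_def)
    qed
    show "D a \<in> L" if a: "a \<in> ?I" for a
    proof -
      obtain x y where xy: "a = to_fract x / to_fract y" "x \<in> P" "y \<notin> p" using a by (rule FrE)
      then have "x \<in> p" using ZD(2)[OF p] by blast
      then show ?thesis using fder_Loc[OF pp pI, of x _ y] xy eP Loc_0[OF pp] idl_0[OF pI] by (auto simp: L_def D_def)
    qed
    show "(\<lambda>j. a * v j) \<in> L" if "a \<in> ?I" "v \<in> C" for a v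
      using that IL by (auto simp: L_def C_def intro: Loc_mult[OF pp pI])
    show "(\<lambda>j. a * v j) \<in> L" if "a \<in> ?A" "v \<in> L" for a v
      using that AL by (auto simp: L_def intro: Loc_mult[OF pp pI])
    show "(\<lambda>j. a * v j) \<in> C" if "a \<in> ?A" "v \<in> C" for a v
      using that AL by (auto simp: C_def intro: Loc_mult[OF pp idl_UNIV])
    show "v + w \<in> L" if "v \<in> L" "w \<in> L" for v w using that by (auto simp: L_def intro: Loc_add[OF pp pI])
    show "v + w \<in> C" if "v \<in> C" "w \<in> C" for v w using that by (auto simp: C_def intro: Loc_add[OF pp idl_UNIV])
  qed (auto simp: C_def L_def fun_eq_iff algebra_simps intro: Loc_0[OF pp] idl_0[OF pI])
  let ?O = "kaehler Q.RQ (\<lambda>c. Q.cl (to_fract (const c)))"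
  define mM where "mM = submodule_gen Q.RQ ?O {a \<odot>\<^bsub>?O\<^esub> x | a x. a \<in> nonunits Q.RQ \<and> x \<in> carrier ?O}"
  obtain w where w: "w \<in> {..<r} \<rightarrow> carrier ?O"
    and span: "\<And>x. x \<in> carrier ?O \<Longrightarrow> \<exists>c \<in> {..<r} \<rightarrow> carrier Q.RQ. x \<ominus>\<^bsub>?O\<^esub> (\<Oplus>\<^bsub>?O\<^esub>i\<in>{..<r}. c i \<odot>\<^bsub>?O\<^esub> w i) \<in> mM"
    using fib unfolding fibre_has_dim_def Let_def local_ring_eq[OF p] mM_def by blast
  have nonunit: "a \<in> Loc p p" if a: "a \<in> ?A" "Q.cl a \<in> nonunits Q.RQ" for a
  proof (rule ccontr)
    assume n: "a \<notin> Loc p p"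
    obtain x y d where xy: "a = to_fract x / to_fract y" "y \<notin> p" "homog (d + 0) x" "homog d y"
      using a(1) by (rule FrE)
    then have x: "x \<notin> p" using n LocI[of x p y p] by blast
    have "to_fract y / to_fract x \<in> ?A" using xy x by (intro FrI) auto
    moreover have "a * (to_fract y / to_fract x) = 1"
      using notin_nonzero[OF pp x] notin_nonzero[OF pp xy(2)] by (simp add: xy(1))
    ultimately have "Q.cl a \<in> Units Q.RQ" using Q.unit_cl a(1) by blast
    then show False using a(2) by (simp add: nonunits_def)
  qed
  \<comment> \<open>The functionals descend to the fibre: a nonunit of the local ring has its
    numerator in p, so multiples by it have values in L.\<close>
  have mM_L: "\<exists>v\<in>L. Q.dval x v" if x: "x \<in> mM" for x
  proof -
    let ?H = "{x \<in> carrier ?O. \<exists>v\<in>L. Q.dval x v}"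
    have sm: "c \<odot>\<^bsub>?O\<^esub> x \<in> ?H" if c: "c \<in> carrier Q.RQ" and x: "x \<in> ?H" for c x
    proof -
      obtain a where a: "c = Q.cl a" "a \<in> ?A" using c by (auto simp: Q.carrier_RQ)
      obtain v where v: "v \<in> L" "Q.dval x v" using x by blast
      have "Q.dval (c \<odot>\<^bsub>?O\<^esub> x) (\<lambda>j. a * v j)" unfolding a(1) by (rule Q.dval_smult[OF v(2) a(2)])
      moreover have "(\<lambda>j. a * v j) \<in> L" by (rule Q.L_sc[OF a(2) v(1)])
      ultimately show ?thesis using c x Q.K.smult_closed by blast
    qed
    have "submodule ?H Q.RQ ?O"
    proof (rule Q.K.submoduleI)
      have "Q.lc (\<lambda>_::'v. 0) (\<lambda>_. 0) {} = \<zero>\<^bsub>?O\<^esub>" by (rule Q.lc_zero) simp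
      then have "Q.dval \<zero>\<^bsub>?O\<^esub> 0"
        using Q.dval_finsum[of "{}" "\<lambda>_. \<zero>\<^bsub>?O\<^esub>" "\<lambda>_. 0"] by simp
      then show "\<zero>\<^bsub>?O\<^esub> \<in> ?H" using Q.L_0 Q.K.zero_closed by blast
      show "x \<oplus>\<^bsub>?O\<^esub> y \<in> ?H" if "x \<in> ?H" "y \<in> ?H" for x y
        using that Q.dval_add Q.L_add Q.K.a_closed by blast
      show "\<ominus>\<^bsub>?O\<^esub> x \<in> ?H" if x: "x \<in> ?H" for x
      proof -
        have "\<ominus>\<^bsub>Q.RQ\<^esub> \<one>\<^bsub>Q.RQ\<^esub> \<odot>\<^bsub>?O\<^esub> x = \<ominus>\<^bsub>?O\<^esub> x"
          using Q.K.smult_l_minus[OF Q.one_closed, of x] x by simp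
        then show ?thesis using sm[OF Q.a_inv_closed[OF Q.one_closed] x] by simp
      qed
    qed (use sm in auto)
    moreover have "{a \<odot>\<^bsub>?O\<^esub> x | a x. a \<in> nonunits Q.RQ \<and> x \<in> carrier ?O} \<subseteq> ?H"
    proof safe
      fix a x assume a: "a \<in> nonunits Q.RQ" and x: "x \<in> carrier ?O"
      have ac: "a \<in> carrier Q.RQ" using a by (simp add: nonunits_def)
      then show "a \<odot>\<^bsub>?O\<^esub> x \<in> carrier ?O" using x by (rule Q.K.smult_closed)
      obtain u where u: "a = Q.cl u" "u \<in> ?A" using ac by (auto simp: Q.carrier_RQ)
      then have uL: "u \<in> Loc p p" using nonunit a by blast
      obtain v where v: "Q.dval x v" using Q.dval_ex[OF x] by blast
      have "Q.dval (a \<odot>\<^bsub>?O\<^esub> x) (\<lambda>j. u * v j)" unfolding u(1) by (rule Q.dval_smult[OF v u(2)])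
      moreover have "(\<lambda>j. u * v j) \<in> L"
        using Q.dval_C[OF v] uL by (auto simp: L_def C_def intro: Loc_mult[OF pp pI])
      ultimately show "\<exists>v\<in>L. Q.dval (a \<odot>\<^bsub>?O\<^esub> x) v" by blast
    qed
    ultimately have "mM \<subseteq> ?H" unfolding mM_def by (rule submodule_gen_subset)
    then show ?thesis using x by blast
  qed
  have "\<forall>l\<in>{..<r}. \<exists>v. Q.dval (w l) v" using w Q.dval_ex by blast
  from bchoice[OF this] obtain v where v: "\<And>l. l < r \<Longrightarrow> Q.dval (w l) (v l)" by auto
  define u :: "'v \<Rightarrow> ('v, 'k) mpoly fract" where "u i = to_fract (var i) / to_fract (var o')" for i
  have uA: "u i \<in> ?A" for i unfolding u_def using o'(1) by (intro FrI[of _ _ _ _ 1]) auto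
  have "\<exists>c. (\<forall>l<r. c l \<in> ?A) \<and> D (u i) - (\<Sum>l<r. (\<lambda>j. c l * v l j)) \<in> L" for i
  proof -
    let ?x = "Q.d (Q.cl (u i))"
    have x: "?x \<in> carrier ?O" by (intro Q.d_closed Q.cl_closed uA)
    obtain c where c: "c \<in> {..<r} \<rightarrow> carrier Q.RQ"
      "?x \<ominus>\<^bsub>?O\<^esub> (\<Oplus>\<^bsub>?O\<^esub>i\<in>{..<r}. c i \<odot>\<^bsub>?O\<^esub> w i) \<in> mM" using span[OF x] by blast
    define y where "y = (\<Oplus>\<^bsub>?O\<^esub>i\<in>{..<r}. c i \<odot>\<^bsub>?O\<^esub> w i)"
    have cw: "c l \<odot>\<^bsub>?O\<^esub> w l \<in> carrier ?O" if "l \<in> {..<r}" for l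
      using that c(1) w by (intro Q.K.smult_closed) auto
    then have yc: "y \<in> carrier ?O" unfolding y_def by (intro Q.K.M.finsum_closed) auto
    obtain t where t: "t \<in> L" "Q.dval (?x \<ominus>\<^bsub>?O\<^esub> y) t" using mM_L c(2) unfolding y_def by blast
    define c' where "c' l = Q.rep (c l)" for l
    have c': "c' l \<in> ?A" "Q.cl (c' l) = c l" if "l < r" for l
      using Q.rep[of "c l"] c(1) that by (auto simp: c'_def)
    have "Q.dval (c l \<odot>\<^bsub>?O\<^esub> w l) (\<lambda>j. c' l * v l j)" if "l \<in> {..<r}" for l
      using Q.dval_smult[OF v c'(1)] c'(2) that by force
    then have dy: "Q.dval y (\<Sum>l<r. (\<lambda>j. c' l * v l j))"
      unfolding y_def using cw by (intro Q.dval_finsum) auto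
    have "?x \<ominus>\<^bsub>?O\<^esub> y \<oplus>\<^bsub>?O\<^esub> y = ?x"
      using x yc by (simp add: a_minus_def Q.K.M.a_assoc Q.K.M.l_neg)
    then have "Q.dval ?x (t + (\<Sum>l<r. (\<lambda>j. c' l * v l j)))" using Q.dval_add[OF t(2) dy] by simp
    then have "D (u i) - (t + (\<Sum>l<r. (\<lambda>j. c' l * v l j))) \<in> L"
      by (rule Q.dval_unique[OF Q.dval_d[OF uA]])
    from Q.L_add[OF this t(1)] have "D (u i) - (\<Sum>l<r. (\<lambda>j. c' l * v l j)) \<in> L" by (simp add: algebra_simps)
    then show ?thesis using c'(1) by blast
  qed
  then have "\<forall>i. \<exists>c. (\<forall>l<r. c l \<in> ?A) \<and> D (u i) - (\<Sum>l<r. (\<lambda>j. c l * v l j)) \<in> L" ..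
  from choice[OF this] obtain c where c0: "\<forall>i. (\<forall>l<r. c i l \<in> ?A) \<and> D (u i) - (\<Sum>l<r. (\<lambda>j. c i l * v l j)) \<in> L" ..
  then have cA: "c i l \<in> Loc UNIV p" if "l < r" for i l using that AL by blast
  have sum_app: "(\<Sum>l<n. (\<lambda>j. f l * v l j)) j = (\<Sum>l<n. f l * v l j)" for n f j
    by (induction n) auto
  have cL: "D (u i) j - (\<Sum>l<r. c i l * v l j) \<in> Loc p p" for i j
    using c0[rule_format, of i] by (auto simp: L_def sum_app)
  \<comment> \<open>The differentials of the \<open>u i\<close> with i in S have r coordinates each
    in the fibre, but there are more than r of them.\<close>
  have "\<exists>\<alpha>. (\<forall>i\<in>S. \<alpha> i \<in> Loc UNIV p) \<and> (\<exists>i\<in>S. \<alpha> i \<notin> Loc p p) \<and> (\<forall>l<r. (\<Sum>i\<in>S. \<alpha> i * c i l) \<in> Loc p p)"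
  proof (rule dependent_mod_prime[where A = "Loc UNIV p" and I = "Loc p p"])
    show "1 \<in> Loc UNIV p" using LocI[of 1 UNIV 1 p] prime_idl_one[OF pp] by simp
    show "1 \<notin> Loc p p" using Loc_frac_iff[OF pp prime_idl_one[OF pp], of 1] prime_idl_one[OF pp] by simp
    show "x \<in> Loc p p \<or> y \<in> Loc p p" if "x \<in> Loc UNIV p" "y \<in> Loc UNIV p" "x * y \<in> Loc p p" for x y
      using that by (rule Loc_prime[OF pp])
  qed (use card cA pI in \<open>auto intro: Loc_0[OF pp] Loc_add[OF pp] Loc_mult[OF pp] Loc_uminus[OF pp] idl_0\<close>)
  then obtain \<alpha> where \<alpha>: "\<And>i. i \<in> S \<Longrightarrow> \<alpha> i \<in> Loc UNIV p" "\<exists>i\<in>S. \<alpha> i \<notin> Loc p p"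
    "\<And>l. l < r \<Longrightarrow> (\<Sum>i\<in>S. \<alpha> i * c i l) \<in> Loc p p" by blast
  then obtain j where j: "j \<in> S" "\<alpha> j \<notin> Loc p p" by blast
  have vL: "v l j \<in> Loc UNIV p" if "l < r" for l using Q.dval_C[OF v[OF that]] by (simp add: C_def)
  have "(\<Sum>i\<in>S. \<alpha> i * D (u i) j)
      = (\<Sum>i\<in>S. \<alpha> i * (D (u i) j - (\<Sum>l<r. c i l * v l j))) + (\<Sum>l<r. v l j * (\<Sum>i\<in>S. \<alpha> i * c i l))"
  proof -
    have "(\<Sum>l<r. v l j * (\<Sum>i\<in>S. \<alpha> i * c i l)) = (\<Sum>i\<in>S. \<alpha> i * (\<Sum>l<r. c i l * v l j))"
      unfolding sum_distrib_left by (subst sum.swap) (simp add: ac_simps)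
    then show ?thesis by (simp add: right_diff_distrib sum_subtractf)
  qed
  also have "\<dots> \<in> Loc p p"
  proof (rule Loc_add[OF pp pI])
    show "(\<Sum>i\<in>S. \<alpha> i * (D (u i) j - (\<Sum>l<r. c i l * v l j))) \<in> Loc p p"
      using \<alpha>(1) cL by (intro Loc_sum[OF pp pI] Loc_mult(2)[OF pp pI])
    show "(\<Sum>l<r. v l j * (\<Sum>i\<in>S. \<alpha> i * c i l)) \<in> Loc p p"
    proof (rule Loc_sum[OF pp pI])
      fix l assume "l \<in> {..<r}"
      then show "v l j * (\<Sum>i\<in>S. \<alpha> i * c i l) \<in> Loc p p"
        using \<alpha>(3) vL by (intro Loc_mult(2)[OF pp pI]) auto
    qed
  qed
  finally have 1: "(\<Sum>i\<in>S. \<alpha> i * D (u i) j) \<in> Loc p p" .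
  \<comment> \<open>As \<open>e j\<close> vanishes at o', the quotient rule leaves only the
    diagonal, with entries b / x_o' that are units at p. The dependency therefore cannot have a
    coefficient outside the maximal ideal.\<close>
  have Du: "D (u i) j = (if i = j then to_fract b / to_fract (var o') else 0)" if i: "i \<in> S" for i
  proof -
    have o0: "(var o' :: ('v, 'k) mpoly) \<noteq> 0" by simp
    have "der (e j) (var i) = (if i = j then b else 0)" "der (e j) (var o') = 0"
      using e[OF j(1), of i] e[OF j(1), of o'] i o'(2) j(1) by (auto simp: der_var)
    then show ?thesis using j(1) by (simp add: D_def u_def fder_frac[OF o0 refl])
  qed
  have "(\<Sum>i\<in>S. \<alpha> i * D (u i) j) = (\<Sum>i\<in>S. if i = j then \<alpha> i * (to_fract b / to_fract (var o')) else 0)"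
    by (intro sum.cong) (auto simp: Du)
  also have "\<dots> = \<alpha> j * (to_fract b / to_fract (var o'))" using j(1) by simp
  finally have "\<alpha> j * (to_fract b / to_fract (var o')) \<in> Loc p p" using 1 by simp
  moreover have "to_fract b / to_fract (var o') \<notin> Loc p p" using Loc_frac_iff[OF pp o'(1)] b by blast
  moreover have "to_fract b / to_fract (var o') \<in> Loc UNIV p" using o'(1) by (intro LocI) auto
  ultimately show False using Loc_prime[OF pp \<alpha>(1)[OF j(1)]] j(2) by blast
qed

end

text \<open>The factor x restores the degree lost by differentiation; in degree 0 the derivative is
  zero, which is homogeneous of every degree.\<close>

lemma homog_pd_mult: "homog n f \<Longrightarrow> homog 1 x \<Longrightarrow> homog n (pd i f * x)"
proof (cases n)
  case (Suc m)
  assume "homog n f" "homog 1 x"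
  then show ?thesis using homog_mult[OF pd_homog[of m f] \<open>homog 1 x\<close>] Suc by simp
qed (simp add: pd_homog_0)

context projective_variety
begin

text \<open>
  At the generic point \<open>P\<close> the \<open>d(x\<^sub>j/x\<^sub>0)\<close> with \<open>j \<notin> Y\<close> generate \<open>\<Omega>\<close>, since the relation \<open>df\<^sub>y = 0\<close>
  expresses \<open>d(x\<^sub>y/x\<^sub>0)\<close> by them.
\<close>

lemma fibre_dim_upper_bound:
  assumes fib: "fibre_has_dim (local_ring Z P) (kaehler (local_ring Z P) (local_ring_const Z P)) r"
    and piv: "pivots P Y b f" and b: "b \<notin> P" "homog e b" and f: "\<And>y. y \<in> Y \<Longrightarrow> homog (Suc e) (f y)"
    and o': "var o' \<notin> P" "o' \<notin> Y"
  shows "r \<le> card (- Y - {o'})"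
proof (rule ccontr)
  assume r: "\<not> r \<le> card (- Y - {o'})"
  define S where "S = - Y - {o'}"
  let ?A = "Fr UNIV 0 P" and ?I = "Fr P 0 P"
  interpret Q: kaehler_quotient ?A ?I "\<lambda>c. to_fract (const c)" by (rule local_kaehler_quotient[OF P_in_Z])
  let ?O = "kaehler Q.RQ (\<lambda>c. Q.cl (to_fract (const c)))"
  define x where "x = (var o' :: ('v, 'k) mpoly)"
  have x: "x \<notin> P" "homog 1 x" "x \<noteq> 0" using o' by (auto simp: x_def)
  have xn: "x ^ n \<notin> P" "homog n (x ^ n)" "x ^ n \<noteq> 0" for n
    using x prime_idl_power[OF P_prime] by (auto simp: x_def)
  define u where "u i = to_fract (var i) / to_fract x" for i
  have uA: "u i \<in> ?A" for i unfolding u_def using x by (intro FrI[of _ _ _ _ 1]) auto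
  \<comment> \<open>Dehomogenization of a form of degree n by the variable x = x_o'.\<close>
  define h where "h n g = to_fract g / to_fract (x ^ n)" for n g
  have hA: "h n g \<in> ?A" if "homog n g" for n g
    unfolding h_def using xn that by (intro FrI[of _ _ _ _ n]) auto
  have hI: "h n g \<in> ?I" if "homog n g" "g \<in> P" for n g
    unfolding h_def using xn that by (intro FrI[of _ _ _ _ n]) auto
  have h_add: "h n (g + g') = h n g + h n g'" for n g g' by (simp add: h_def add_divide_distrib)
  have h_mult: "h (n + n') (g * g') = h n g * h n' g'" for n n' g g' by (simp add: h_def power_add)
  have h_0: "h n 0 = 0" and h_x: "h (Suc 0) x = 1" for n using x by (simp_all add: h_def)
  have u_h: "u i = h (Suc 0) (var i)" for i by (simp add: u_def h_def)
  have W: "h n (pd i g * x) \<in> ?A" if "homog n g" for n g i by (rule hA[OF homog_pd_mult[OF that x(2)]])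
  \<comment> \<open>The chain rule on the affine chart: for a form g of degree n, d(g / x^n) is the
    sum of the (x * \<open>pd i g\<close> / x^n) d(x_i / x). The term with i = o' is zero. Monomials
    come first, by the product rule.\<close>
  have d_monom: "Q.d (Q.cl (h (mdeg m) (Poly_Mapping.single m 1)))
      = Q.lc u (\<lambda>i. h (mdeg m) (pd i (Poly_Mapping.single m 1) * x)) UNIV" for m
  proof (induction m rule: monom_induct)
    case zero
    have "(Poly_Mapping.single 0 1 :: ('v, 'k) mpoly) = 1" by simp
    then show ?case using Q.d_one Q.lc_zero[of UNIV u] uA by (simp add: h_def)
  next
    case (add m j)
    define t :: "('v, 'k) mpoly" where "t = Poly_Mapping.single m 1"
    define n where "n = mdeg m"
    have t: "homog n t" by (simp add: t_def n_def homog_def)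
    have IH: "Q.d (Q.cl (h n t)) = Q.lc u (\<lambda>i. h n (pd i t * x)) UNIV" using add by (simp add: t_def n_def)
    have e: "h (Suc n) (t * var j) = h n t * u j" using h_mult[of n "Suc 0" t "var j"] by (simp add: u_h)
    have "Q.d (Q.cl (h n t * u j)) = Q.cl (h n t) \<odot>\<^bsub>?O\<^esub> Q.d (Q.cl (u j)) \<oplus>\<^bsub>?O\<^esub> Q.cl (u j) \<odot>\<^bsub>?O\<^esub> Q.d (Q.cl (h n t))"
      by (rule Q.d_mult_cl[OF hA[OF t] uA])
    also have "Q.cl (h n t) \<odot>\<^bsub>?O\<^esub> Q.d (Q.cl (u j)) = Q.lc u (\<lambda>i. if i = j then h n t else 0) UNIV"
      using uA hA[OF t] by (intro Q.lc_single[symmetric]) auto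
    also have "Q.cl (u j) \<odot>\<^bsub>?O\<^esub> Q.d (Q.cl (h n t)) = Q.lc u (\<lambda>i. u j * h n (pd i t * x)) UNIV"
      unfolding IH using uA W[OF t] by (intro Q.lc_smult) auto
    also have "Q.lc u (\<lambda>i. if i = j then h n t else 0) UNIV \<oplus>\<^bsub>?O\<^esub> Q.lc u (\<lambda>i. u j * h n (pd i t * x)) UNIV
        = Q.lc u (\<lambda>i. (if i = j then h n t else 0) + u j * h n (pd i t * x)) UNIV"
      using uA hA[OF t] W[OF t] Q.Amult Q.A0 by (intro Q.lc_add) auto
    also have "(\<lambda>i. (if i = j then h n t else 0) + u j * h n (pd i t * x)) = (\<lambda>i. h (Suc n) (pd i (t * var j) * x))"
    proof
      fix i
      have "h (Suc n) (pd i (t * var j) * x) = h (Suc n) ((pd i t * x) * var j + (if i = j then t * x else 0))"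
        by (auto simp: pd_mult pd_var algebra_simps)
      also have "\<dots> = h n (pd i t * x) * u j + (if i = j then h n t else 0)"
        using h_mult[of n "Suc 0" "pd i t * x" "var j"] h_mult[of n "Suc 0" t x] h_x
        by (simp add: h_add u_h h_0)
      finally show "(if i = j then h n t else 0) + u j * h n (pd i t * x) = h (Suc n) (pd i (t * var j) * x)"
        by (simp add: ac_simps)
    qed
    finally have "Q.d (Q.cl (h (Suc n) (t * var j))) = Q.lc u (\<lambda>i. h (Suc n) (pd i (t * var j) * x)) UNIV"
      by (simp add: e)
    moreover have "mdeg (m + Poly_Mapping.single j 1) = Suc n" by (simp add: mdeg_add n_def)
    ultimately show ?case by (simp only: single_monom_add t_def)
  qed
  have d_sum: "Q.d (Q.cl (h n (\<Sum>m\<in>M. Poly_Mapping.single m (c m))))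
      = Q.lc u (\<lambda>i. h n (pd i (\<Sum>m\<in>M. Poly_Mapping.single m (c m)) * x)) UNIV"
    if "finite M" "\<And>m. m \<in> M \<Longrightarrow> mdeg m = n" for M and c :: "('v \<Rightarrow>\<^sub>0 nat) \<Rightarrow> 'k" and n
    using that
  proof (induction M)
    case empty
    then show ?case using Q.d_zero Q.lc_zero[of UNIV u] uA by (simp add: h_0)
  next
    case (insert m M)
    define s where "s = (\<Sum>m\<in>M. Poly_Mapping.single m (c m))"
    define t :: "('v, 'k) mpoly" where "t = Poly_Mapping.single m 1"
    have t: "homog n t" using insert.prems by (simp add: t_def homog_def)
    have s: "homog n s" unfolding s_def using insert.prems by (intro homog_sum) (auto simp: homog_def)
    have ct: "homog n (const (c m) * t)" using homog_mult[OF homog_const t, of "c m"] by simp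
    have cA: "to_fract (const (c m)) \<in> ?A"
      using prime_idl_one[OF P_prime] by (intro Fr_to_fract) auto
    have hc: "h n (const (c m) * g) = to_fract (const (c m)) * h n g" for g by (simp add: h_def)
    have "Q.d (Q.cl (h n (const (c m) * t))) = Q.cl (to_fract (const (c m))) \<odot>\<^bsub>?O\<^esub> Q.d (Q.cl (h n t))
        \<oplus>\<^bsub>?O\<^esub> Q.cl (h n t) \<odot>\<^bsub>?O\<^esub> Q.d (Q.cl (to_fract (const (c m))))"
      unfolding hc by (rule Q.d_mult_cl[OF cA hA[OF t]])
    also have "\<dots> = Q.cl (to_fract (const (c m))) \<odot>\<^bsub>?O\<^esub> Q.d (Q.cl (h n t))"
      using Q.term_closed[OF cA hA[OF t]] Q.K.smult_r_null[OF Q.cl_closed[OF hA[OF t]]] Q.d_const by simp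
    also have "Q.d (Q.cl (h n t)) = Q.lc u (\<lambda>i. h n (pd i t * x)) UNIV"
      using d_monom[of m] insert.prems by (simp add: t_def)
    also have "Q.cl (to_fract (const (c m))) \<odot>\<^bsub>?O\<^esub> Q.lc u (\<lambda>i. h n (pd i t * x)) UNIV
        = Q.lc u (\<lambda>i. to_fract (const (c m)) * h n (pd i t * x)) UNIV"
      using uA W[OF t] cA by (intro Q.lc_smult) auto
    also have "(\<lambda>i. to_fract (const (c m)) * h n (pd i t * x)) = (\<lambda>i. h n (pd i (const (c m) * t) * x))"
      by (simp add: pd_const_mult mult.assoc flip: hc)
    finally have 1: "Q.d (Q.cl (h n (const (c m) * t))) = Q.lc u (\<lambda>i. h n (pd i (const (c m) * t) * x)) UNIV" .
    have "Q.d (Q.cl (h n (const (c m) * t + s)))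
        = Q.lc u (\<lambda>i. h n (pd i (const (c m) * t) * x)) UNIV \<oplus>\<^bsub>?O\<^esub> Q.lc u (\<lambda>i. h n (pd i s * x)) UNIV"
      unfolding h_add Q.d_add_cl[OF hA[OF ct] hA[OF s]] 1 using insert by (simp add: s_def)
    also have "\<dots> = Q.lc u (\<lambda>i. h n (pd i (const (c m) * t) * x) + h n (pd i s * x)) UNIV"
      using uA W[OF ct] W[OF s] by (intro Q.lc_add) auto
    also have "(\<lambda>i. h n (pd i (const (c m) * t) * x) + h n (pd i s * x)) = (\<lambda>i. h n (pd i (const (c m) * t + s) * x))"
      by (simp add: pd_add distrib_right h_add)
    finally show ?case
      using insert.hyps by (simp add: s_def t_def single_const_mult[of m "c m"])
  qed
  have d_homog: "Q.d (Q.cl (h n g)) = Q.lc u (\<lambda>i. h n (pd i g * x)) UNIV" if "homog n g" for n g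
    using d_sum[of "Poly_Mapping.keys g" n "Poly_Mapping.lookup g"] that
    by (simp add: homog_def poly_mapping_sum_singles)
  \<comment> \<open>The submodule generated by the d(x_j / x) with j outside Y and different from
    o'; the following steps show that it is everything.\<close>
  define H where "H = {Q.lc u w S | w. \<forall>i\<in>S. w i \<in> ?A}"
  have H: "submodule H Q.RQ ?O" unfolding H_def using uA by (intro Q.span_submodule) auto
  note HE = Q.K.submoduleE[OF H]
  have H_cancel: "\<omega> \<in> H" if "Q.cl a \<odot>\<^bsub>?O\<^esub> \<omega> \<in> H" "a \<in> ?A" "a' \<in> ?A" "a' * a = 1" "\<omega> \<in> carrier ?O" for a a' \<omega>
  proof -
    have "Q.cl a' \<odot>\<^bsub>?O\<^esub> (Q.cl a \<odot>\<^bsub>?O\<^esub> \<omega>) = (Q.cl a' \<otimes>\<^bsub>Q.RQ\<^esub> Q.cl a) \<odot>\<^bsub>?O\<^esub> \<omega>"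
      using that by (intro Q.K.smult_assoc1[symmetric] Q.cl_closed)
    also have "Q.cl a' \<otimes>\<^bsub>Q.RQ\<^esub> Q.cl a = Q.cl 1" using that Q.cl_hom by metis
    also have "Q.cl 1 \<odot>\<^bsub>?O\<^esub> \<omega> = \<omega>" using that(5) by (rule Q.cl_one_smult)
    finally show ?thesis using HE(4)[OF Q.cl_closed[OF that(3)] that(1)] by simp
  qed
  have H_diff: "\<omega> \<in> H" if "\<omega> \<oplus>\<^bsub>?O\<^esub> \<omega>' \<in> H" "\<omega>' \<in> H" "\<omega> \<in> carrier ?O" for \<omega> \<omega>'
  proof -
    have c: "\<omega>' \<in> carrier ?O" using HE(1) that(2) by blast
    have "\<omega> \<oplus>\<^bsub>?O\<^esub> \<omega>' \<oplus>\<^bsub>?O\<^esub> (\<ominus>\<^bsub>?O\<^esub> \<omega>') = \<omega>"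
      using c that(3) by (simp add: Q.K.M.a_assoc Q.K.M.r_neg)
    then show ?thesis using HE(5)[OF that(1) HE(3)[OF that(2)]] by simp
  qed
  have zero_H: "\<zero>\<^bsub>?O\<^esub> \<in> H" using subgroup.one_closed[OF submodule.axioms(1)[OF H]] by simp
  have du1: "Q.d (Q.cl (u i)) \<in> H" if "i \<notin> Y" for i
  proof (cases "i = o'")
    case True
    then have "u i = 1" using x by (simp add: u_def x_def)
    then show ?thesis using zero_H Q.d_one by simp
  next
    case False
    then show ?thesis unfolding H_def using that uA by (intro Q.span_mem) (auto simp: S_def)
  qed
  have du: "Q.d (Q.cl (u i)) \<in> H" for i
  proof (cases "i \<in> Y")
    case True
    note fy = f[OF True]
    have fP: "f i \<in> P" using piv True by (simp add: pivots_def)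
    have "Q.cl (h (Suc e) (f i)) = Q.cl 0"
      using hI[OF fy fP] hA[OF fy] Q.A0 by (subst Q.cl_eq_iff) auto
    then have 0: "Q.lc u (\<lambda>j. h (Suc e) (pd j (f i) * x)) UNIV = \<zero>\<^bsub>?O\<^esub>"
      using d_homog[OF fy] Q.d_zero by simp
    \<comment> \<open>The relation d(f_i / x^(e+1)) = 0 is split into its part at Y, where only b at
      the place i survives modulo P, and the rest, which lies in H. As b is a unit at P, the
      relation can be solved for d(u i).\<close>
    define W1 where "W1 = (\<lambda>j. if j = i then h e b else 0)"
    define W2 where "W2 j = (if j \<in> Y then 0 else h (Suc e) (pd j (f i) * x))" for j
    have W1A: "W1 j \<in> ?A" and W2A: "W2 j \<in> ?A" for j
      using hA[OF b(2)] W[OF fy] Q.A0 by (auto simp: W1_def W2_def)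
    have "Q.lc u (\<lambda>j. h (Suc e) (pd j (f i) * x)) UNIV = Q.lc u (\<lambda>j. W1 j + W2 j) UNIV"
    proof (rule Q.lc_cong)
      fix j
      have hx: "h (Suc e) (g * x) = h e g" for g using h_mult[of e "Suc 0" g x] h_x by simp
      show "h (Suc e) (pd j (f i) * x) - (W1 j + W2 j) \<in> ?I"
      proof (cases "j \<in> Y")
        case jY: True
        define g where "g = pd j (f i) - (if j = i then b else 0)"
        have "g \<in> P" using piv True jY by (simp add: pivots_def g_def)
        moreover have "homog e g" using pd_homog[OF fy] b(2) by (auto simp: g_def intro: homog_diff)
        ultimately have "h e g \<in> ?I" by (intro hI)
        moreover have "h (Suc e) (pd j (f i) * x) - (W1 j + W2 j) = h e g"
          using jY by (simp add: W1_def W2_def hx g_def) (simp add: h_def diff_divide_distrib)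
        ultimately show ?thesis by simp
      qed (use True in \<open>auto simp: W1_def W2_def Q.I0\<close>)
    qed (use uA W[OF fy] W1A W2A Q.Aadd in auto)
    also have "\<dots> = Q.lc u W1 UNIV \<oplus>\<^bsub>?O\<^esub> Q.lc u W2 UNIV"
      using uA W1A W2A by (intro Q.lc_add[symmetric]) auto
    finally have sum: "Q.lc u W1 UNIV \<oplus>\<^bsub>?O\<^esub> Q.lc u W2 UNIV \<in> H" using 0 zero_H by simp
    have "Q.lc u W2 UNIV \<in> H"
    proof (rule Q.submodule_lc[OF H finite])
      fix j
      show "Q.cl (W2 j) \<odot>\<^bsub>?O\<^esub> Q.d (Q.cl (u j)) \<in> H"
      proof (cases "j \<in> Y")
        case True
        then have "Q.cl (W2 j) \<odot>\<^bsub>?O\<^esub> Q.d (Q.cl (u j)) = \<zero>\<^bsub>?O\<^esub>"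
          using Q.K.smult_l_null[OF Q.d_closed[OF Q.cl_closed[OF uA]]] by (simp add: W2_def Q.cl_0)
        then show ?thesis using zero_H by simp
      qed (use du1 HE(4) Q.cl_closed[OF W2A] in auto)
    qed (use uA W2A in auto)
    then have "Q.lc u W1 UNIV \<in> H" using H_diff[OF sum] uA W1A by (simp add: Q.lc_closed)
    moreover have "Q.lc u W1 UNIV = Q.cl (h e b) \<odot>\<^bsub>?O\<^esub> Q.d (Q.cl (u i))"
      unfolding W1_def using uA hA[OF b(2)] by (intro Q.lc_single) auto
    moreover have "to_fract (x ^ e) / to_fract b \<in> ?A" using xn b by (intro FrI[of _ _ _ _ e]) auto
    moreover have "to_fract (x ^ e) / to_fract b * h e b = 1"
      using xn(3)[of e] proj_nonzero[OF P_proj b(1)] by (simp add: h_def)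
    ultimately show ?thesis using H_cancel hA[OF b(2)] Q.d_closed[OF Q.cl_closed[OF uA]] by simp
  qed (rule du1)
  have dh: "Q.d (Q.cl (h n g)) \<in> H" if "homog n g" for n g
    unfolding d_homog[OF that] using uA W[OF that] HE(4)[OF Q.cl_closed du]
    by (intro Q.submodule_lc[OF H]) auto
  have dA: "Q.d (Q.cl a) \<in> H" if a: "a \<in> ?A" for a
  proof -
    obtain g q n where gq: "a = to_fract g / to_fract q" "q \<notin> P" "homog (n + 0) g" "homog n q"
      using a by (rule FrE)
    have q0: "q \<noteq> 0" using proj_nonzero[OF P_proj gq(2)] .
    have g: "homog n g" using gq(3) by simp
    have "h n q * a = h n g" using q0 by (simp add: gq(1) h_def)
    then have "Q.cl (h n q) \<odot>\<^bsub>?O\<^esub> Q.d (Q.cl a) \<oplus>\<^bsub>?O\<^esub> Q.cl a \<odot>\<^bsub>?O\<^esub> Q.d (Q.cl (h n q)) \<in> H"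
      using Q.d_mult_cl[OF hA[OF gq(4)] a] dh[OF g] by simp
    then have "Q.cl (h n q) \<odot>\<^bsub>?O\<^esub> Q.d (Q.cl a) \<in> H"
      by (rule H_diff[OF _ HE(4)[OF Q.cl_closed[OF a] dh[OF gq(4)]] Q.term_closed[OF hA[OF gq(4)] a]])
    moreover have "to_fract (x ^ n) / to_fract q \<in> ?A" using xn gq by (intro FrI[of _ _ _ _ n]) auto
    moreover have "to_fract (x ^ n) / to_fract q * h n q = 1"
      using xn(3)[of n] q0 by (simp add: h_def)
    ultimately show ?thesis using H_cancel hA[OF gq(4)] Q.d_closed[OF Q.cl_closed[OF a]] by simp
  qed
  have carr: "carrier ?O \<subseteq> H"
    by (rule Q.spanned_by_d[OF H]) (use dA in \<open>auto simp: Q.carrier_RQ\<close>)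
  define mM where "mM = submodule_gen Q.RQ ?O {a \<odot>\<^bsub>?O\<^esub> x | a x. a \<in> nonunits Q.RQ \<and> x \<in> carrier ?O}"
  obtain w where w: "w \<in> {..<r} \<rightarrow> carrier ?O"
    and ind: "\<And>c. c \<in> {..<r} \<rightarrow> carrier Q.RQ \<Longrightarrow> (\<Oplus>\<^bsub>?O\<^esub>i\<in>{..<r}. c i \<odot>\<^bsub>?O\<^esub> w i) \<in> mM \<Longrightarrow> \<forall>i<r. c i \<in> nonunits Q.RQ"
    using fib unfolding fibre_has_dim_def Let_def local_ring_eq[OF P_in_Z] mM_def by blast
  have "\<forall>l\<in>{..<r}. \<exists>c. w l = Q.lc u c S \<and> (\<forall>i\<in>S. c i \<in> ?A)" using w carr by (auto simp: H_def)
  from bchoice[OF this] obtain c where c: "\<And>l. l < r \<Longrightarrow> w l = Q.lc u (c l) S" "\<And>l i. l < r \<Longrightarrow> i \<in> S \<Longrightarrow> c l i \<in> ?A"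
    by auto
  \<comment> \<open>\<open>dependent_mod_prime\<close> numbers coordinates by natural numbers, so S
    is enumerated.\<close>
  obtain en where en: "bij_betw en {0..<card S} S" using ex_bij_betw_nat_finite[of S] by auto
  have I_iff: "to_fract a / to_fract q \<in> ?I \<longleftrightarrow> a \<in> P" if "q \<notin> P" "homog n q" "homog (n + 0) a" for a q n
    using Fr_frac_iff[OF P_proj P_idl proj_nonzero[OF P_proj that(1)] that(2,3,1)] FrI[OF _ that(1,3,2), of P]
    by (auto simp: prime_idl_mult_iff[OF P_prime])
  \<comment> \<open>The r elements \<open>w l\<close> are combinations of fewer than r generators,
    so a combination with some coefficient outside the maximal ideal is zero, against their
    independence in the fibre.\<close>
  have "\<exists>\<alpha>. (\<forall>l\<in>{..<r}. \<alpha> l \<in> ?A) \<and> (\<exists>l\<in>{..<r}. \<alpha> l \<notin> ?I) \<and> (\<forall>k<card S. (\<Sum>l\<in>{..<r}. \<alpha> l * c l (en k)) \<in> ?I)"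
  proof (rule dependent_mod_prime[where A = ?A and I = ?I])
    show "1 \<notin> ?I" using I_iff[of 1 0 1] prime_idl_one[OF P_prime] by simp
    show "a \<in> ?I \<or> a' \<in> ?I" if a: "a \<in> ?A" and a': "a' \<in> ?A" and aa: "a * a' \<in> ?I" for a a'
    proof -
      obtain g q n where g: "a = to_fract g / to_fract q" "q \<notin> P" "homog (n + 0) g" "homog n q" using a by (rule FrE)
      obtain g' q' n' where g': "a' = to_fract g' / to_fract q'" "q' \<notin> P" "homog (n' + 0) g'" "homog n' q'"
        using a' by (rule FrE)
      have "q * q' \<notin> P" using g g' by (simp add: prime_idl_mult_iff[OF P_prime])
      then have "g * g' \<in> P"
        using I_iff[of "q * q'" "n + n'" "g * g'"] aa homog_mult[OF g(4) g'(4)] homog_mult[of n g n' g'] g(3) g'(3)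
        by (simp add: g(1) g'(1))
      then show ?thesis using I_iff[OF g(2,4,3)] I_iff[OF g'(2,4,3)]
        by (auto simp: g(1) g'(1) prime_idl_mult_iff[OF P_prime])
    qed
    show "c l (en k) \<in> ?A" if "l \<in> {..<r}" "k < card S" for l k
      using that c(2)[of l "en k"] bij_betwE[OF en] by auto
  qed (use r in \<open>auto simp: S_def intro: Q.A0 Q.A1 Q.Aadd Q.Amult Q.Aminus Q.I0 Q.Iadd Q.Imult\<close>)
  then obtain \<alpha> where \<alpha>: "\<And>l. l < r \<Longrightarrow> \<alpha> l \<in> ?A" "\<exists>l<r. \<alpha> l \<notin> ?I"
    "\<And>k. k < card S \<Longrightarrow> (\<Sum>l<r. \<alpha> l * c l (en k)) \<in> ?I" by auto
  have \<alpha>I: "(\<Sum>l<r. \<alpha> l * c l i) \<in> ?I" if i: "i \<in> S" for i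
  proof -
    have "i \<in> en ` {0..<card S}" using i bij_betw_imp_surj_on[OF en] by simp
    then obtain k where "k < card S" "i = en k" by auto
    then show ?thesis using \<alpha>(3) by simp
  qed
  have "(\<Oplus>\<^bsub>?O\<^esub>l\<in>{..<r}. Q.cl (\<alpha> l) \<odot>\<^bsub>?O\<^esub> w l) = (\<Oplus>\<^bsub>?O\<^esub>l\<in>{..<r}. Q.cl (\<alpha> l) \<odot>\<^bsub>?O\<^esub> Q.lc u (c l) S)"
    using c \<alpha>(1) uA by (intro Q.K.M.finsum_cong') (auto intro!: Q.K.smult_closed Q.cl_closed Q.lc_closed)
  also have "\<dots> = Q.lc u (\<lambda>i. \<Sum>l<r. \<alpha> l * c l i) S"
    using c(2) \<alpha>(1) uA by (intro Q.lc_finsum) auto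
  also have "\<dots> = Q.lc u (\<lambda>_. 0) S"
    using uA \<alpha>I Q.IA Q.A0 by (intro Q.lc_cong) auto
  also have "\<dots> = \<zero>\<^bsub>?O\<^esub>" using uA by (intro Q.lc_zero)
  finally have "(\<Oplus>\<^bsub>?O\<^esub>l\<in>{..<r}. Q.cl (\<alpha> l) \<odot>\<^bsub>?O\<^esub> w l) = \<zero>\<^bsub>?O\<^esub>" .
  moreover have "\<zero>\<^bsub>?O\<^esub> \<in> mM"
    unfolding mM_def submodule_gen_def
    using subgroup.one_closed[OF submodule.axioms(1)] by force
  ultimately have nu: "\<forall>l<r. Q.cl (\<alpha> l) \<in> nonunits Q.RQ"
    using ind[of "\<lambda>l. Q.cl (\<alpha> l)"] \<alpha>(1) Q.cl_closed by auto
  obtain l where l: "l < r" "\<alpha> l \<notin> ?I" using \<alpha>(2) by blast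
  obtain g q n where g: "\<alpha> l = to_fract g / to_fract q" "q \<notin> P" "homog (n + 0) g" "homog n q"
    using \<alpha>(1)[OF l(1)] by (rule FrE)
  have gP: "g \<notin> P" using l(2) I_iff[OF g(2,4,3)] g(1) by simp
  have "to_fract q / to_fract g \<in> ?A" using g gP by (intro FrI[of _ _ _ _ n]) auto
  moreover have "\<alpha> l * (to_fract q / to_fract g) = 1"
    using proj_nonzero[OF P_proj gP] proj_nonzero[OF P_proj g(2)] by (simp add: g(1))
  ultimately have "Q.cl (\<alpha> l) \<in> Units Q.RQ" using Q.unit_cl \<alpha>(1)[OF l(1)] by blast
  then show False using nu l(1) by (simp add: nonunits_def)
qed

end

lemma pd_idl_prod: "idl J \<Longrightarrow> g \<in> idl_prod J J \<Longrightarrow> pd i g \<in> J"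
proof -
  assume J: "idl J" and "g \<in> idl_prod J J"
  from this(2) show ?thesis
  proof induction
    case (add a b s)
    then show ?case by (simp add: pd_add pd_mult idl_add[OF J] idl_mult[OF J] idl_mult2[OF J])
  qed (simp add: idl_0[OF J])
qed

lemma idl_diff_trans: "idl J \<Longrightarrow> x - y \<in> J \<Longrightarrow> y - z \<in> J \<Longrightarrow> x - z \<in> J"
  using idl_add[of J "x - y" "y - z"] by simp

section \<open>Enlarging invertible minors of the Jacobian\<close>

context projective_variety
begin

text \<open>Homogeneous pivots usable near p. The degrees are matched so that b and all derivatives
  of the \<open>f y\<close> have degree e.\<close>

definition hpivots :: "('v, 'k) proj_point \<Rightarrow> 'v set \<Rightarrow> ('v, 'k) mpoly \<Rightarrow> ('v \<Rightarrow> ('v, 'k) mpoly) \<Rightarrow> nat \<Rightarrow> bool" where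
  "hpivots p Y b f e \<longleftrightarrow> pivots P Y b f \<and> b \<notin> p \<and> homog e b \<and> (\<forall>y\<in>Y. homog (Suc e) (f y))"

text \<open>At the places in Y the condition of \<open>pivots_span\<close> holds automatically,
  since the Jacobian of the \<open>f y\<close> is b times the identity there.\<close>

lemma pivots_reduce:
  assumes piv: "pivots P Y b f" and y': "y' \<in> Y"
  shows "b * pd y' g - (\<Sum>y\<in>Y. pd y g * pd y' (f y)) \<in> P"
proof -
  have "b * pd y' g - (\<Sum>y\<in>Y. pd y g * pd y' (f y))
      = (\<Sum>y\<in>Y. pd y g * (if y' = y then b else 0)) - (\<Sum>y\<in>Y. pd y g * pd y' (f y))"
    using y' by (simp add: if_distrib[of "\<lambda>z. _ * z"] mult.commute cong: if_cong)
  also have "\<dots> = - (\<Sum>y\<in>Y. pd y g * (pd y' (f y) - (if y' = y then b else 0)))"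
    by (simp add: sum_subtractf right_diff_distrib)
  also have "\<dots> \<in> P"
    using piv y' by (intro idl_uminus[OF P_idl] idl_sum[OF P_idl] idl_mult[OF P_idl]) (auto simp: pivots_def)
  finally show ?thesis .
qed

text \<open>One step of Gauss-Jordan elimination: g is first cleared at the places in Y, then its
  entry at j is used to clear column j of the old pivots. The new diagonal entry is the product of b
  and the new pivot, still outside p.\<close>

lemma hpivots_extend:
  assumes hp: "hpivots p Y b f e" and pr: "prime_idl p" and g: "g \<in> P" "homog d g" and j: "j \<notin> Y"
    and c: "b * pd j g - (\<Sum>y\<in>Y. pd y g * pd j (f y)) \<notin> p"
  shows "\<exists>b' f' e'. hpivots p (insert j Y) b' f' e'"
proof (cases d)
  case 0
  then have "pd i g = 0" for i using pd_homog_0 g(2) by blast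
  then show ?thesis using c idl_0[OF prime_idl_idl[OF pr]] by simp
next
  case (Suc d')
  have piv: "pivots P Y b f" and b: "b \<notin> p" "homog e b" and f: "\<And>y. y \<in> Y \<Longrightarrow> homog (Suc e) (f y)"
    using hp by (auto simp: hpivots_def)
  have fP: "f y \<in> P" if "y \<in> Y" for y using piv that by (simp add: pivots_def)
  have pg: "homog d' (pd i g)" for i using g(2) Suc pd_homog by blast
  have pf: "homog e (pd i (f y))" if "y \<in> Y" for i y by (rule pd_homog[OF f[OF that]])
  \<comment> \<open>Modulo P, q is the gradient of the cleared element F, and it vanishes at
    Y.\<close>
  define q where "q k = b * pd k g - (\<Sum>y\<in>Y. pd y g * pd k (f y))" for k
  define F where "F = b * g - (\<Sum>y\<in>Y. pd y g * f y)"
  define f' where "f' y = (if y = j then b * F else q j * f y - pd j (f y) * F)" for y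
  have hq: "homog (e + d') (q k)" for k
    unfolding q_def using homog_mult[OF b(2) pg] homog_mult[OF pg pf]
    by (intro homog_diff homog_sum) (auto simp: add.commute)
  have hF: "homog (Suc (e + d')) F"
    unfolding F_def using homog_mult[OF b(2) g(2)] homog_mult[OF pg f] Suc
    by (intro homog_diff homog_sum) (auto simp: add.commute)
  have FP: "F \<in> P" unfolding F_def using g(1) fP
    by (intro idl_diff[OF P_idl] idl_sum[OF P_idl] idl_mult[OF P_idl])
  have pF: "pd k F - q k \<in> P" for k
  proof -
    have "pd k F - q k = pd k b * g - (\<Sum>y\<in>Y. pd k (pd y g) * f y)"
      by (simp add: F_def q_def pd_diff pd_mult pd_sum sum.distrib algebra_simps)
    also have "\<dots> \<in> P" using g(1) fP by (intro idl_diff[OF P_idl] idl_sum[OF P_idl] idl_mult[OF P_idl])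
    finally show ?thesis .
  qed
  have f'j: "pd k (f' j) - b * q k \<in> P" for k
  proof -
    have "pd k (f' j) - b * q k = pd k b * F + b * (pd k F - q k)" by (simp add: f'_def pd_mult algebra_simps)
    also have "\<dots> \<in> P" using FP pF by (intro idl_add[OF P_idl] idl_mult[OF P_idl])
    finally show ?thesis .
  qed
  have f'y: "pd k (f' y) - (q j * pd k (f y) - pd j (f y) * q k) \<in> P" if "y \<in> Y" for k y
  proof -
    have "pd k (f' y) - (q j * pd k (f y) - pd j (f y) * q k)
        = pd k (q j) * f y - pd k (pd j (f y)) * F - pd j (f y) * (pd k F - q k)"
      using that j by (auto simp: f'_def pd_mult pd_diff algebra_simps)
    also have "\<dots> \<in> P"
      by (rule idl_diff[OF P_idl idl_diff[OF P_idl idl_mult[OF P_idl fP[OF that]] idl_mult[OF P_idl FP]] idl_mult[OF P_idl pF]])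
    finally show ?thesis .
  qed
  have qY: "q k \<in> P" if "k \<in> Y" for k unfolding q_def by (rule pivots_reduce[OF piv that])
  have fY: "pd k (f y) - (if k = y then b else 0) \<in> P" if "k \<in> Y" "y \<in> Y" for k y
    using piv that by (auto simp: pivots_def)
  have piv': "pd k (f' y) - (if k = y then b * q j else 0) \<in> P" if k: "k \<in> insert j Y" and y: "y \<in> insert j Y" for k y
  proof (cases "y = j")
    case True
    have "b * q k - (if k = j then b * q j else 0) \<in> P"
      using k qY idl_mult[OF P_idl] idl_0[OF P_idl] by auto
    from idl_diff_trans[OF P_idl f'j this] show ?thesis by (simp only: True)
  next
    case False
    then have yY: "y \<in> Y" using y by simp
    have "(q j * pd k (f y) - pd j (f y) * q k) - (if k = y then b * q j else 0) \<in> P"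
    proof (cases "k = j")
      case True
      then show ?thesis using False idl_0[OF P_idl] by (simp add: mult.commute)
    next
      case kj: False
      then have kY: "k \<in> Y" using k by simp
      have "(q j * pd k (f y) - pd j (f y) * q k) - (if k = y then b * q j else 0)
          = q j * (pd k (f y) - (if k = y then b else 0)) - pd j (f y) * q k" by (simp add: algebra_simps)
      also have "\<dots> \<in> P"
        by (rule idl_diff[OF P_idl idl_mult[OF P_idl fY[OF kY yY]] idl_mult[OF P_idl qY[OF kY]]])
      finally show ?thesis .
    qed
    from idl_diff_trans[OF P_idl f'y[OF yY] this] show ?thesis .
  qed
  have "f' y \<in> P" if "y \<in> insert j Y" for y
    using that FP fP by (auto simp: f'_def intro: idl_diff[OF P_idl] idl_mult[OF P_idl])
  then have 1: "pivots P (insert j Y) (b * q j) f'" using piv' by (simp add: pivots_def)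
  have 2: "b * q j \<notin> p" using b(1) c by (simp add: prime_idl_mult_iff[OF pr] q_def)
  have 3: "homog (e + (e + d')) (b * q j)" by (rule homog_mult[OF b(2) hq])
  have 4: "homog (Suc (e + (e + d'))) (f' y)" if "y \<in> insert j Y" for y
  proof -
    have a: "e + Suc (e + d') = Suc (e + (e + d'))" "e + d' + Suc e = Suc (e + (e + d'))" by simp_all
    show ?thesis
      using that homog_mult[OF b(2) hF] homog_mult[OF hq f] homog_mult[OF pf hF] unfolding a f'_def
      by (auto intro: homog_diff)
  qed
  show ?thesis unfolding hpivots_def using 1 2 3 4 by blast
qed

text \<open>A homogeneous component of g violating the relation would provide a further pivot by
  \<open>hpivots_extend\<close>.\<close>

lemma maximal_hpivots:
  assumes hp: "hpivots p Y b f e" and p: "p \<in> Z" and g: "g \<in> P"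
    and max: "\<And>j b' f' e'. j \<notin> Y \<Longrightarrow> \<not> hpivots p (insert j Y) b' f' e'"
  shows "b * pd j g - (\<Sum>y\<in>Y. pd y g * pd j (f y)) \<in> p"
proof (cases "j \<in> Y")
  case True
  then show ?thesis using pivots_reduce[of Y b f j g] hp ZD(2)[OF p] by (auto simp: hpivots_def)
next
  case False
  note pI = proj_pointsD(3)[OF ZD(1)[OF p]]
  show ?thesis
  proof (rule homog_induct_sum[of "\<lambda>g. b * pd j g - (\<Sum>y\<in>Y. pd y g * pd j (f y)) \<in> p"])
    show "b * pd j 0 - (\<Sum>y\<in>Y. pd y 0 * pd j (f y)) \<in> p" using idl_0[OF pI] by simp
    show "b * pd j (g + h) - (\<Sum>y\<in>Y. pd y (g + h) * pd j (f y)) \<in> p"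
      if "b * pd j g - (\<Sum>y\<in>Y. pd y g * pd j (f y)) \<in> p" "b * pd j h - (\<Sum>y\<in>Y. pd y h * pd j (f y)) \<in> p" for g h
      using idl_add[OF pI that] by (simp add: pd_add sum.distrib algebra_simps)
    show "b * pd j (hcomp d g) - (\<Sum>y\<in>Y. pd y (hcomp d g) * pd j (f y)) \<in> p" for d
    proof (rule ccontr)
      assume "b * pd j (hcomp d g) - (\<Sum>y\<in>Y. pd y (hcomp d g) * pd j (f y)) \<notin> p"
      from hpivots_extend[OF hp proj_pointsD(1)[OF ZD(1)[OF p]] gradedD[OF P_graded g] homog_hcomp False this]
      show False using max[OF False] by (elim exE) simp
    qed
  qed
qed

text \<open>If all variables outside Y were in p, Euler's relation for \<open>f y\<close> would
  reduce to b x_y modulo p, so p would contain every variable.\<close>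

lemma hpivots_var:
  assumes hp: "hpivots p Y b f e" and p: "p \<in> Z"
  obtains o' where "var o' \<notin> p" "o' \<notin> Y"
proof (rule ccontr)
  assume "\<not> thesis"
  note ex = that
  have all: "var i \<in> p" if "i \<notin> Y" for i using ex[of i] that \<open>\<not> thesis\<close> by blast
  note pI = proj_pointsD(3)[OF ZD(1)[OF p]] and pp = proj_pointsD(1)[OF ZD(1)[OF p]]
  have "var y \<in> p" if y: "y \<in> Y" for y
  proof -
    have fy: "f y \<in> P" "homog (Suc e) (f y)" using hp y by (auto simp: hpivots_def pivots_def)
    have 1: "(\<Sum>i\<in>UNIV. var i * pd i (f y)) \<in> p"
      unfolding euler[OF fy(2)] using fy(1) ZD(2)[OF p] by (intro idl_mult[OF pI]) auto
    have 2: "(\<Sum>i\<in>UNIV. var i * (pd i (f y) - (if i = y then b else 0))) \<in> p"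
    proof (rule idl_sum[OF pI])
      fix i
      show "var i * (pd i (f y) - (if i = y then b else 0)) \<in> p"
      proof (cases "i \<in> Y")
        case True
        then have "pd i (f y) - (if i = y then b else 0) \<in> P" using hp y by (auto simp: hpivots_def pivots_def)
        then show ?thesis using ZD(2)[OF p] by (intro idl_mult[OF pI]) auto
      qed (use all idl_mult2[OF pI] in blast)
    qed
    have "(\<Sum>i\<in>UNIV. var i * (pd i (f y) - (if i = y then b else 0)))
        = (\<Sum>i\<in>UNIV. var i * pd i (f y)) - var y * b"
      by (simp add: right_diff_distrib sum_subtractf if_distrib[of "\<lambda>z. _ * z"] cong: if_cong)
    then have "var y * b \<in> p" using idl_diff[OF pI 1 2] by simp
    then show ?thesis using hp by (simp add: prime_idl_mult_iff[OF pp] hpivots_def)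
  qed
  then show False using all proj_points_var[OF ZD(1)[OF p]] by blast
qed

text \<open>
  A maximal set \<open>Y\<close> of pivots at \<open>p\<close> has \<open>n - dim Z\<close> elements by the lower bound for the fibre at \<open>p\<close>. By the
  upper bound for the fibre at the generic point it cannot be enlarged there, so the \<open>df\<^sub>y\<close> span the
  conormal directions generically.
\<close>

lemma local_pivots:
  assumes smooth: "smooth_variety Z" and p: "p \<in> Z"
  obtains Y b f e where "hpivots p Y b f e" "pivots_span P Y b f"
proof -
  note pX = ZD(1)[OF p]
  obtain r where r: "krull_dim Pn Z = enat r"
      "fibre_has_dim (local_ring Z p) (kaehler (local_ring Z p) (local_ring_const Z p)) r"
    using smooth p unfolding smooth_variety_def by blast
  obtain r' where "krull_dim Pn Z = enat r'"
      "fibre_has_dim (local_ring Z P) (kaehler (local_ring Z P) (local_ring_const Z P)) r'"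
    using smooth P_in_Z unfolding smooth_variety_def by blast
  then have rP: "fibre_has_dim (local_ring Z P) (kaehler (local_ring Z P) (local_ring_const Z P)) r"
    using r(1) by simp
  \<comment> \<open>The empty minor starts the search for a maximal one.\<close>
  have "hpivots p {} 1 (\<lambda>_. 0) 0" using proj_pointsD(5)[OF pX] by (simp add: hpivots_def pivots_def)
  then have ex0: "\<exists>b f e. hpivots p {} b f e" by (intro exI)
  have le: "\<forall>Y. (\<exists>b f e. hpivots p Y b f e) \<longrightarrow> card Y < Suc (card (UNIV :: 'v set))"
    by (simp add: less_Suc_eq_le card_mono)
  obtain Y where Y': "(\<exists>b f e. hpivots p Y b f e) \<and> (\<forall>Y'. (\<exists>b f e. hpivots p Y' b f e) \<longrightarrow> card Y' \<le> card Y)"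
    using ex_has_greatest_nat[of "\<lambda>Y. \<exists>b f e. hpivots p Y b f e" "{}" card "Suc (card (UNIV :: 'v set))", OF ex0 le]
    by (elim exE)
  note Y = conjunct1[OF Y'] conjunct2[OF Y', rule_format]
  obtain b f e where hp: "hpivots p Y b f e" using Y(1) by (elim exE)
  have max: "\<not> hpivots p (insert j Y) b' f' e'" if "j \<notin> Y" for j b' f' e'
  proof
    assume "hpivots p (insert j Y) b' f' e'"
    then have "card (insert j Y) \<le> card Y" by (intro Y(2) exI)
    then show False using that by simp
  qed
  obtain o' where o': "var o' \<notin> p" "o' \<notin> Y" by (rule hpivots_var[OF hp p])
  \<comment> \<open>The derivation b \<open>pd j\<close> minus the sum of
    (\<open>pd j (f y)\<close>) \<open>pd y\<close> over Y. By maximality at p it sends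
    \<open>P\<close> into p, so its values are functionals on the fibre at p.\<close>
  define E where "E j i = (if i = j then b else if i \<in> Y then - pd j (f i) else 0)" for j i
  have "card (- Y - {o'}) \<le> r"
  proof (rule fibre_dim_lower_bound[OF p r(2) o'(1)])
    show "b \<notin> p" using hp by (simp add: hpivots_def)
    show "E j i = (if i = j then b else 0)" if "j \<in> - Y - {o'}" "i \<in> insert o' (- Y - {o'})" for i j
      using that o'(2) by (auto simp: E_def)
    show "der (E j) g \<in> p" if j: "j \<in> - Y - {o'}" and g: "g \<in> P" for j g
    proof -
      have jY: "j \<notin> Y" using j by simp
      have "der (E j) g = (\<Sum>i\<in>UNIV. (if i = j then b * pd i g else 0) - (if i \<in> Y then pd i g * pd j (f i) else 0))"
        unfolding der_def using jY by (intro sum.cong) (auto simp: E_def)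
      also have "\<dots> = b * pd j g - (\<Sum>y\<in>Y. pd y g * pd j (f y))"
        by (simp add: sum_subtractf flip: sum.inter_restrict)
      finally show ?thesis using maximal_hpivots[OF hp p g max] by simp
    qed
  qed simp
  moreover have "pivots_span P Y b f"
  proof (rule ccontr)
    assume "\<not> pivots_span P Y b f"
    then obtain g i where g: "g \<in> P" "b * pd i g - (\<Sum>y\<in>Y. pd y g * pd i (f y)) \<notin> P"
      by (auto simp: pivots_span_def)
    have hP: "hpivots P Y b f e" using hp ZD(2)[OF p] by (auto simp: hpivots_def)
    have "\<exists>j b' f' e'. j \<notin> Y \<and> hpivots P (insert j Y) b' f' e'"
    proof (rule ccontr)
      assume n: "\<nexists>j b' f' e'. j \<notin> Y \<and> hpivots P (insert j Y) b' f' e'"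
      have "b * pd i g - (\<Sum>y\<in>Y. pd y g * pd i (f y)) \<in> P"
        by (rule maximal_hpivots[OF hP P_in_Z g(1)]) (use n in blast)
      then show False using g(2) by simp
    qed
    then obtain j b' f' e' where j: "j \<notin> Y" and hj: "hpivots P (insert j Y) b' f' e'" by (elim exE conjE)
    obtain u where u: "var u \<notin> P" "u \<notin> insert j Y" by (rule hpivots_var[OF hj P_in_Z])
    have "r \<le> card (- insert j Y - {u})"
      by (rule fibre_dim_upper_bound[OF rP, of _ b' f' e']) (use hj u in \<open>auto simp: hpivots_def\<close>)
    also have "- insert j Y - {u} = (- Y - {u}) - {j}" by blast
    also have "card \<dots> < card (- Y - {u})" using j u by (intro card_Diff1_less) auto
    also have "card (- Y - {u}) = card (- Y - {o'})" using o' u by (simp add: card_Diff_singleton)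
    finally show False using \<open>card (- Y - {o'}) \<le> r\<close> by simp
  qed
  ultimately show ?thesis using that hp by blast
qed

end

section \<open>Local consequences of smoothness\<close>

locale smooth_projective_variety = projective_variety Z P
  for Z :: "('v::{finite,linorder}, 'k::field_char_0) proj_point set" and P +
  assumes smooth: "smooth_variety Z"
begin

lemma dker_locally_square:
  assumes g: "g \<in> dker P" and p: "p \<in> Z"
  shows "\<exists>c l. homog l c \<and> c \<notin> p \<and> c * g \<in> idl_prod P P"
proof -
  note pp = proj_pointsD(1)[OF ZD(1)[OF p]]
  obtain Y b f e where hp: "hpivots p Y b f e" and sp: "pivots_span P Y b f" by (rule local_pivots[OF smooth p])
  have b: "b \<notin> p" "homog e b" "pivots P Y b f" using hp by (auto simp: hpivots_def)
  have "b \<notin> P" using b(1) ZD(2)[OF p] by blast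
  then obtain K where K: "\<And>g. g \<in> dker P \<Longrightarrow> b ^ K * g \<in> idl_prod P P"
    using dker_subset_square[OF P_prime _ b(3) sp] by blast
  have "b ^ K \<notin> p" using prime_idl_power[OF pp] b(1) by blast
  then show ?thesis using K[OF g] homog_power[OF b(2), of K] by blast
qed

text \<open>By \<open>pivots_span\<close> the entries of grad F outside Y depend linearly on those
  in Y. This linear condition passes from a w to w because a is cancellable modulo P, and it says
  that b w is the gradient of the combination of the \<open>f y\<close> with coefficients
  \<open>w y\<close>.\<close>

lemma locally_exact:
  assumes a: "a \<notin> P" and F: "F \<in> P" and w: "\<And>i. a * w i - pd i F \<in> P" and p: "p \<in> Z"
  shows "\<exists>b e g. b \<notin> p \<and> homog e b \<and> g \<in> P \<and> (\<forall>i. b * w i - pd i g \<in> P)"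
proof -
  obtain Y b f e where hp: "hpivots p Y b f e" and sp: "pivots_span P Y b f" by (rule local_pivots[OF smooth p])
  have b: "b \<notin> p" "homog e b" "\<And>y. y \<in> Y \<Longrightarrow> f y \<in> P" using hp by (auto simp: hpivots_def pivots_def)
  define g where "g = (\<Sum>y\<in>Y. w y * f y)"
  have "b * w i - pd i g \<in> P" for i
  proof -
    have "a * (b * w i - (\<Sum>y\<in>Y. w y * pd i (f y)))
        = b * (a * w i - pd i F) - (\<Sum>y\<in>Y. (a * w y - pd y F) * pd i (f y))
          + (b * pd i F - (\<Sum>y\<in>Y. pd y F * pd i (f y)))"
      by (simp add: algebra_simps sum_subtractf sum_distrib_left)
    also have "\<dots> \<in> P"
    proof (rule idl_add[OF P_idl idl_diff[OF P_idl idl_mult[OF P_idl w] idl_sum[OF P_idl]]])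
      show "b * pd i F - (\<Sum>y\<in>Y. pd y F * pd i (f y)) \<in> P" using sp F by (simp add: pivots_span_def)
    qed (rule idl_mult2[OF P_idl w])
    finally have 1: "b * w i - (\<Sum>y\<in>Y. w y * pd i (f y)) \<in> P" using a by (simp add: prime_idl_mult_iff[OF P_prime])
    have 2: "(\<Sum>y\<in>Y. pd i (w y) * f y) \<in> P" using b(3) by (intro idl_sum[OF P_idl] idl_mult[OF P_idl])
    have 3: "b * w i - pd i g = (b * w i - (\<Sum>y\<in>Y. w y * pd i (f y))) - (\<Sum>y\<in>Y. pd i (w y) * f y)"
      by (simp add: g_def pd_sum pd_mult sum.distrib)
    show ?thesis unfolding 3 by (rule idl_diff[OF P_idl 1 2])
  qed
  moreover have "g \<in> P" unfolding g_def using b(3) by (intro idl_sum[OF P_idl] idl_mult[OF P_idl])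
  ultimately show ?thesis using b(1,2) by blast
qed

end

section \<open>Torsion differentials and sections modulo \<open>P\<^sup>2\<close>\<close>

context projective_variety
begin

text \<open>\<open>compat\<close> says that the fractions \<gamma>/\<beta> agree in the stalks
  modulo J, so they define a section of O(d)/J(d) along Z. Off Z this quotient is zero and the value
  0 extends it. It is applied to both P and its square.\<close>

lemma lift_fractions:
  assumes lifts: "lifts_sections J d" and J: "idl J"
    and off: "\<And>q. q \<in> proj_points \<Longrightarrow> q \<notin> Z \<Longrightarrow> Fr J d q = Fr UNIV d q"
    and \<beta>: "\<And>p. p \<in> Z \<Longrightarrow> \<beta> p \<notin> p" "\<And>p. p \<in> Z \<Longrightarrow> homog (\<epsilon> p) (\<beta> p)"
    and \<gamma>: "\<And>p. p \<in> Z \<Longrightarrow> homog (\<epsilon> p + d) (\<gamma> p)"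
    and compat: "\<And>p q. p \<in> Z \<Longrightarrow> q \<in> Z \<Longrightarrow> \<exists>c l. homog l c \<and> c \<notin> q \<and> c * (\<gamma> q * \<beta> p - \<gamma> p * \<beta> q) \<in> J"
  obtains f where "homog d f" "\<And>p. p \<in> Z \<Longrightarrow> \<exists>c l. homog l c \<and> c \<notin> p \<and> c * (f * \<beta> p - \<gamma> p) \<in> J"
proof -
  define G where "G p = (if p \<in> Z then to_fract (\<gamma> p) / to_fract (\<beta> p) else 0)" for p
  have "\<exists>V x. openin Pn V \<and> p \<in> V \<and> (\<forall>q\<in>V. x \<in> Fr UNIV d q \<and> G q - x \<in> Fr J d q)"
    if p: "p \<in> proj_points" for p
  proof (cases "p \<in> Z")
    case True
    define x where "x = to_fract (\<gamma> p) / to_fract (\<beta> p)"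
    have "x \<in> Fr UNIV d q \<and> G q - x \<in> Fr J d q" if q: "q \<in> basic_open (\<beta> p)" for q
    proof
      have qX: "q \<in> proj_points" and bq: "\<beta> p \<notin> q" using q by (auto simp: basic_open_def)
      show xU: "x \<in> Fr UNIV d q"
        unfolding x_def using bq \<gamma>[OF True] \<beta>(2)[OF True] by (intro FrI[of _ _ _ _ "\<epsilon> p"]) auto
      show "G q - x \<in> Fr J d q"
      proof (cases "q \<in> Z")
        case qZ: True
        note qq = proj_pointsD(1)[OF qX]
        have n: "\<beta> q \<noteq> 0" "\<beta> p \<noteq> 0" using proj_nonzero[OF qX] bq \<beta>(1)[OF qZ] by auto
        have e: "G q - x = to_fract (\<gamma> q * \<beta> p - \<gamma> p * \<beta> q) / to_fract (\<beta> q * \<beta> p)"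
          using n qZ by (simp add: G_def x_def to_fract_diff diff_frac_eq)
        have h1: "homog (\<epsilon> q + \<epsilon> p) (\<beta> q * \<beta> p)" by (rule homog_mult[OF \<beta>(2)[OF qZ] \<beta>(2)[OF True]])
        have h2: "homog (\<epsilon> q + \<epsilon> p + d) (\<gamma> q * \<beta> p - \<gamma> p * \<beta> q)"
          using homog_mult[OF \<gamma>[OF qZ] \<beta>(2)[OF True]] homog_mult[OF \<gamma>[OF True] \<beta>(2)[OF qZ]]
          by (intro homog_diff) (auto simp: ac_simps)
        have "\<beta> q * \<beta> p \<notin> q" using bq \<beta>(1)[OF qZ] by (simp add: prime_idl_mult_iff[OF qq])
        then show ?thesis unfolding e
          using Fr_frac_iff[OF qX J _ h1 h2] n compat[OF True qZ] by simp
      next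
        case False
        then show ?thesis using xU Fr_uminus[OF qX, of UNIV x d] off[OF qX] by (simp add: G_def)
      qed
    qed
    moreover have "openin Pn (basic_open (\<beta> p))" by (rule openin_basic_open[OF \<beta>(2)[OF True]])
    moreover have "p \<in> basic_open (\<beta> p)" using \<beta>(1)[OF True] p by (simp add: basic_open_def)
    ultimately show ?thesis by blast
  next
    case False
    then have "\<not> P \<subseteq> p" using p by (simp add: Z_eq)
    then obtain h e where h: "h \<in> P" "homog e h" "h \<notin> p" by (rule ex_homog_notin[OF proj_pointsD(3)[OF p] P_graded])
    have "0 \<in> Fr UNIV d q \<and> G q - 0 \<in> Fr J d q" if q: "q \<in> basic_open h" for q
    proof -
      have qX: "q \<in> proj_points" and "q \<notin> Z" using q h(1) ZD(2) by (auto simp: basic_open_def)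
      then show ?thesis using Fr_0[OF qX] J by (simp add: G_def)
    qed
    moreover have "openin Pn (basic_open h)" by (rule openin_basic_open[OF h(2)])
    moreover have "p \<in> basic_open h" using h(3) p by (simp add: basic_open_def)
    ultimately show ?thesis by blast
  qed
  then obtain f where f: "homog d f" "\<And>p. p \<in> proj_points \<Longrightarrow> to_fract f - G p \<in> Fr J d p"
    using lifts[unfolded lifts_sections_def, rule_format, of G] by blast
  have "\<exists>c l. homog l c \<and> c \<notin> p \<and> c * (f * \<beta> p - \<gamma> p) \<in> J" if p: "p \<in> Z" for p
  proof -
    note pX = ZD(1)[OF p]
    have n: "\<beta> p \<noteq> 0" by (rule proj_nonzero[OF pX \<beta>(1)[OF p]])
    have "to_fract f - G p = to_fract (f * \<beta> p - \<gamma> p) / to_fract (\<beta> p)"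
      using n p by (simp add: G_def to_fract_diff diff_divide_distrib)
    moreover have "homog (\<epsilon> p + d) (f * \<beta> p - \<gamma> p)"
      using homog_mult[OF \<beta>(2)[OF p] f(1)] \<gamma>[OF p] by (intro homog_diff) (auto simp: mult.commute)
    ultimately show ?thesis
      using f(2)[OF pX] Fr_frac_iff[OF pX J n \<beta>(2)[OF p] _ \<beta>(1)[OF p], of d "f * \<beta> p - \<gamma> p"] by simp
  qed
  then show ?thesis using that f(1) by blast
qed

end

context smooth_projective_variety
begin

lemma lifts_imp_torsion_lifts:
  assumes lifts: "\<And>d. lifts_sections (idl_prod P P) d"
  shows "torsion_lifts P"
  unfolding torsion_lifts_def
proof (intro allI impI)
  fix w a F assume a: "a \<notin> P" and F: "F \<in> P" and "\<forall>i. a * w i - pd i F \<in> P"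
  then have aw: "a * w i - pd i F \<in> P" for i by blast
  \<comment> \<open>Degree by degree: a vector of forms of degree D can only be the gradient of a
    form of degree D + 1.\<close>
  have hom: "\<exists>f\<in>P. \<forall>i. hcomp D (w i) - pd i f \<in> P" for D
  proof -
    define W where "W i = hcomp D (w i)" for i
    have "\<exists>b e g. b \<notin> p \<and> homog e b \<and> g \<in> P \<and> homog (e + Suc D) g \<and> (\<forall>i. b * W i - pd i g \<in> P)" if p: "p \<in> Z" for p
    proof -
      obtain b e g where b: "b \<notin> p" "homog e b" "g \<in> P" "\<forall>i. b * w i - pd i g \<in> P"
        using locally_exact[OF a F aw p] by (elim exE conjE)
      have "b * W i - pd i (hcomp (e + Suc D) g) \<in> P" for i
      proof -
        have "hcomp (e + D) (b * w i - pd i g) \<in> P" by (rule gradedD[OF P_graded b(4)[rule_format]])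
        then show ?thesis by (simp add: hcomp_diff hcomp_mult_homog[OF b(2)] W_def pd_hcomp)
      qed
      then show ?thesis using b(1,2) gradedD[OF P_graded b(3)] homog_hcomp by blast
    qed
    then have "\<forall>p\<in>Z. \<exists>t. case t of (b, e, g) \<Rightarrow> b \<notin> p \<and> homog e b \<and> g \<in> P \<and> homog (e + Suc D) g \<and> (\<forall>i. b * W i - pd i g \<in> P)"
      by (simp add: split_paired_Ex)
    from bchoice[OF this] obtain t where t: "\<forall>p\<in>Z. case t p of (b, e, g) \<Rightarrow>
        b \<notin> p \<and> homog e b \<and> g \<in> P \<and> homog (e + Suc D) g \<and> (\<forall>i. b * W i - pd i g \<in> P)" ..
    define \<beta> where "\<beta> p = fst (t p)" for p
    define \<epsilon> where "\<epsilon> p = fst (snd (t p))" for p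
    define \<gamma> where "\<gamma> p = snd (snd (t p))" for p
    have t': "\<beta> p \<notin> p" "homog (\<epsilon> p) (\<beta> p)" "\<gamma> p \<in> P" "homog (\<epsilon> p + Suc D) (\<gamma> p)"
      "\<And>i. \<beta> p * W i - pd i (\<gamma> p) \<in> P" if "p \<in> Z" for p
      using t[rule_format, OF that] by (auto simp: \<beta>_def \<epsilon>_def \<gamma>_def case_prod_beta)
    obtain f where f: "homog (Suc D) f" "\<And>p. p \<in> Z \<Longrightarrow> \<exists>c l. homog l c \<and> c \<notin> p \<and> c * (f * \<beta> p - \<gamma> p) \<in> idl_prod P P"
    proof (rule lift_fractions[OF lifts P2_idl, of "Suc D" \<beta> \<epsilon> \<gamma>])
      fix p q assume p: "p \<in> Z" and q: "q \<in> Z"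
      \<comment> \<open>Modulo P the gradients of \<gamma> p and \<gamma> q are W times their
        denominators, so the two products cancel and the difference is in
        \<open>dker P\<close>.\<close>
      have "pd i (\<gamma> q * \<beta> p - \<gamma> p * \<beta> q) \<in> P" for i
      proof -
        have "pd i (\<gamma> q * \<beta> p - \<gamma> p * \<beta> q) = \<gamma> q * pd i (\<beta> p) - \<gamma> p * pd i (\<beta> q)
            + \<beta> q * (\<beta> p * W i - pd i (\<gamma> p)) - \<beta> p * (\<beta> q * W i - pd i (\<gamma> q))"
          by (simp add: pd_diff pd_mult algebra_simps)
        also have "\<dots> \<in> P"
          by (rule idl_diff[OF P_idl idl_add[OF P_idl idl_diff[OF P_idl idl_mult2[OF P_idl t'(3)[OF q]]
            idl_mult2[OF P_idl t'(3)[OF p]]] idl_mult[OF P_idl t'(5)[OF p]]] idl_mult[OF P_idl t'(5)[OF q]]])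
        finally show ?thesis .
      qed
      moreover have "\<gamma> q * \<beta> p - \<gamma> p * \<beta> q \<in> P"
        using t'(3)[OF p] t'(3)[OF q] by (intro idl_diff[OF P_idl] idl_mult2[OF P_idl])
      ultimately show "\<exists>c l. homog l c \<and> c \<notin> q \<and> c * (\<gamma> q * \<beta> p - \<gamma> p * \<beta> q) \<in> idl_prod P P"
        by (intro dker_locally_square[OF _ q]) (simp add: dker_def)
    qed (use t' off_Z in auto)
    \<comment> \<open>The generic point suffices to identify f: modulo P it vanishes, and its
      gradient is that of \<gamma> P divided by \<beta> P, which is W.\<close>
    obtain c where c: "c \<notin> P" "c * (f * \<beta> P - \<gamma> P) \<in> idl_prod P P" using f(2)[OF P_in_Z] by blast
    have "c * (f * \<beta> P - \<gamma> P) \<in> P" using c(2) P2_subset by blast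
    then have fg: "f * \<beta> P - \<gamma> P \<in> P" using c(1) by (simp add: prime_idl_mult_iff[OF P_prime])
    then have "f * \<beta> P \<in> P" using idl_diff_iff[OF P_idl fg] t'(3)[OF P_in_Z] by simp
    then have fP: "f \<in> P" using t'(1)[OF P_in_Z] by (simp add: prime_idl_mult_iff[OF P_prime])
    have "W i - pd i f \<in> P" for i
    proof -
      have "pd i (c * (f * \<beta> P - \<gamma> P)) \<in> P" by (rule pd_idl_prod[OF P_idl c(2)])
      then have "pd i c * (f * \<beta> P - \<gamma> P) + c * pd i (f * \<beta> P - \<gamma> P) \<in> P" by (simp add: pd_mult)
      then have "c * pd i (f * \<beta> P - \<gamma> P) \<in> P" using idl_add_iff[OF P_idl idl_mult[OF P_idl fg]] by blast
      then have "pd i (f * \<beta> P - \<gamma> P) \<in> P" using c(1) by (simp add: prime_idl_mult_iff[OF P_prime])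
      from idl_diff[OF P_idl idl_add[OF P_idl t'(5)[OF P_in_Z, of i] idl_mult2[OF P_idl fP, of "pd i (\<beta> P)"]] this]
      have "\<beta> P * (W i - pd i f) \<in> P" by (simp add: pd_diff pd_mult algebra_simps)
      then show ?thesis using t'(1)[OF P_in_Z] by (simp add: prime_idl_mult_iff[OF P_prime])
    qed
    then show ?thesis using fP by (auto simp: W_def)
  qed
  then have "\<forall>D. \<exists>f. f \<in> P \<and> (\<forall>i. hcomp D (w i) - pd i f \<in> P)" by blast
  from choice[OF this] obtain f where f: "\<And>D. f D \<in> P" "\<And>D i. hcomp D (w i) - pd i (f D) \<in> P" by blast
  \<comment> \<open>A common bound for the degrees of all entries of w.\<close>
  define n where "n = (\<Sum>i\<in>UNIV. topdeg (w i))"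
  have "w i - pd i (\<Sum>D\<le>n. f D) \<in> P" for i
  proof -
    have "topdeg (w i) \<le> n" unfolding n_def by (rule member_le_sum) auto
    then have "w i - pd i (\<Sum>D\<le>n. f D) = (\<Sum>D\<le>n. hcomp D (w i) - pd i (f D))"
      by (simp add: sum_subtractf pd_sum sum_hcomp)
    also have "\<dots> \<in> P" using f(2) by (intro idl_sum[OF P_idl])
    finally show ?thesis .
  qed
  moreover have "(\<Sum>D\<le>n. f D) \<in> P" using f(1) by (intro idl_sum[OF P_idl])
  ultimately show "\<exists>g\<in>P. \<forall>i. w i - pd i g \<in> P" by blast
qed

lemma linear_form_zero:
  assumes "nondegenerate Z" "homog 1 l" "l \<in> P" shows "l = 0"
  using assms ZD unfolding nondegenerate_def by blast

lemma torsion_lifts_imp_lifts: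
  assumes nd: "nondegenerate Z" and lifts: "\<And>d. lifts_sections P d" and tl: "torsion_lifts P"
  shows "lifts_sections (idl_prod P P) d"
  unfolding lifts_sections_def
proof (intro allI impI)
  fix G assume G: "\<forall>p\<in>proj_points. \<exists>V x. openin Pn V \<and> p \<in> V \<and> (\<forall>q\<in>V. x \<in> Fr UNIV d q \<and> G q - x \<in> Fr (idl_prod P P) d q)"
  have sub: "Fr (idl_prod P P) d p \<subseteq> Fr P d p" for p by (rule Fr_mono[OF P2_subset])
  have "\<exists>V x. openin Pn V \<and> p \<in> V \<and> (\<forall>q\<in>V. x \<in> Fr UNIV d q \<and> G q - x \<in> Fr P d q)"
    if pX: "p \<in> proj_points" for p
  proof -
    obtain V x where V: "openin Pn V" "p \<in> V" "\<forall>q\<in>V. x \<in> Fr UNIV d q \<and> G q - x \<in> Fr (idl_prod P P) d q"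
      using bspec[OF G pX] by (elim exE conjE)
    then show ?thesis using sub by (intro exI[of _ V] exI[of _ x]) auto
  qed
  from lifts[unfolded lifts_sections_def, rule_format, of d G, OF this]
  obtain f where f: "homog d f" "\<And>p. p \<in> proj_points \<Longrightarrow> to_fract f - G p \<in> Fr P d p" by blast
  have "\<exists>t. case t of (b, e, g) \<Rightarrow> b \<notin> p \<and> homog e b \<and> g \<in> P \<and> homog (e + d) g \<and> G p - to_fract f = to_fract g / to_fract b"
    if p: "p \<in> Z" for p
  proof -
    have "- (to_fract f - G p) \<in> Fr P d p" by (rule Fr_uminus[OF ZD(1)[OF p] P_idl f(2)[OF ZD(1)[OF p]]])
    then have "G p - to_fract f \<in> Fr P d p" by simp
    then obtain g b e where "G p - to_fract f = to_fract g / to_fract b" "g \<in> P" "b \<notin> p" "homog (e + d) g" "homog e b"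
      by (rule FrE)
    then show ?thesis by (intro exI[of _ "(b, e, g)"]) simp
  qed
  from bchoice[OF ballI[OF this]] obtain t where t: "\<forall>p\<in>Z. case t p of (b, e, g) \<Rightarrow>
        b \<notin> p \<and> homog e b \<and> g \<in> P \<and> homog (e + d) g \<and> G p - to_fract f = to_fract g / to_fract b" ..
  define \<beta> where "\<beta> p = fst (t p)" for p
  define \<epsilon> where "\<epsilon> p = fst (snd (t p))" for p
  define \<gamma> where "\<gamma> p = snd (snd (t p))" for p
  have t': "\<beta> p \<notin> p" "homog (\<epsilon> p) (\<beta> p)" "\<gamma> p \<in> P" "homog (\<epsilon> p + d) (\<gamma> p)"
    "G p - to_fract f = to_fract (\<gamma> p) / to_fract (\<beta> p)" if "p \<in> Z" for p
    using t[rule_format, OF that] by (auto simp: \<beta>_def \<epsilon>_def \<gamma>_def case_prod_beta)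
  have \<beta>P: "\<beta> p \<notin> P" if "p \<in> Z" for p using t'(1)[OF that] ZD(2)[OF that] by blast
  \<comment> \<open>Near p the family G is given modulo the square of P by one fraction x, and
    \<open>P\<close> belongs to that neighbourhood. So the fractions at p and at \<open>P\<close>
    differ by an element of the square localized at \<open>P\<close>, and their gradients agree
    modulo P.\<close>
  have compatP: "pd i (\<gamma> P) * \<beta> p - pd i (\<gamma> p) * \<beta> P \<in> P" if p: "p \<in> Z" for i p
  proof -
    obtain V x where V: "openin Pn V" "p \<in> V" "\<forall>q\<in>V. x \<in> Fr UNIV d q \<and> G q - x \<in> Fr (idl_prod P P) d q"
      using bspec[OF G ZD(1)[OF p]] by (elim exE conjE)
    have Vx: "G q - x \<in> Fr (idl_prod P P) d q" if "q \<in> V" for q using V(3) that by simp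
    obtain h m where h: "homog m h" "p \<in> basic_open h" "basic_open h \<subseteq> V" by (rule openin_Pn_base[OF V(1,2)])
    have "P \<in> V" using h(2,3) ZD(2)[OF p] P_proj by (auto simp: basic_open_def)
    then have 1: "G P - x \<in> Fr (idl_prod P P) d P" by (rule Vx)
    have 2: "G p - x \<in> Fr (idl_prod P P) d P"
    proof -
      obtain g b e where "G p - x = to_fract g / to_fract b" "g \<in> idl_prod P P" "b \<notin> p" "homog (e + d) g" "homog e b"
        using Vx[OF V(2)] by (rule FrE)
      then show ?thesis using ZD(2)[OF p] by (auto intro!: FrI)
    qed
    have n: "\<beta> P \<noteq> 0" "\<beta> p \<noteq> 0" using proj_nonzero[OF P_proj] \<beta>P p P_in_Z by blast+
    have "(G P - x) - (G p - x) = to_fract (\<gamma> P) / to_fract (\<beta> P) - to_fract (\<gamma> p) / to_fract (\<beta> p)"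
      using t'(5)[OF P_in_Z] t'(5)[OF p] by (simp add: algebra_simps)
    also have "\<dots> = to_fract (\<gamma> P * \<beta> p - \<gamma> p * \<beta> P) / to_fract (\<beta> P * \<beta> p)"
      using n by (simp add: to_fract_diff diff_frac_eq)
    finally have 3: "to_fract (\<gamma> P * \<beta> p - \<gamma> p * \<beta> P) / to_fract (\<beta> P * \<beta> p) \<in> Fr (idl_prod P P) d P"
      using Fr_diff[OF P_proj P2_idl 1 2] by simp
    have h1: "homog (\<epsilon> P + \<epsilon> p) (\<beta> P * \<beta> p)" by (rule homog_mult[OF t'(2)[OF P_in_Z] t'(2)[OF p]])
    have h2: "homog (\<epsilon> P + \<epsilon> p + d) (\<gamma> P * \<beta> p - \<gamma> p * \<beta> P)"
      using homog_mult[OF t'(4)[OF P_in_Z] t'(2)[OF p]] homog_mult[OF t'(4)[OF p] t'(2)[OF P_in_Z]]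
      by (intro homog_diff) (auto simp: ac_simps)
    have "\<beta> P * \<beta> p \<notin> P" using \<beta>P p P_in_Z by (simp add: prime_idl_mult_iff[OF P_prime])
    then obtain c where c: "c \<notin> P" "c * (\<gamma> P * \<beta> p - \<gamma> p * \<beta> P) \<in> idl_prod P P"
      using Fr_frac_iff[OF P_proj P2_idl _ h1 h2] n 3 by auto
    have gP: "\<gamma> P * \<beta> p - \<gamma> p * \<beta> P \<in> P"
      using t'(3)[OF p] t'(3)[OF P_in_Z] by (intro idl_diff[OF P_idl] idl_mult2[OF P_idl])
    have "pd i c * (\<gamma> P * \<beta> p - \<gamma> p * \<beta> P) + c * pd i (\<gamma> P * \<beta> p - \<gamma> p * \<beta> P) \<in> P"
      using pd_idl_prod[OF P_idl c(2), of i] by (simp add: pd_mult)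
    then have "c * pd i (\<gamma> P * \<beta> p - \<gamma> p * \<beta> P) \<in> P" using idl_add_iff[OF P_idl idl_mult[OF P_idl gP]] by blast
    then have 4: "pd i (\<gamma> P * \<beta> p - \<gamma> p * \<beta> P) \<in> P" using c(1) by (simp add: prime_idl_mult_iff[OF P_prime])
    have "pd i (\<gamma> P) * \<beta> p - pd i (\<gamma> p) * \<beta> P = pd i (\<gamma> P * \<beta> p - \<gamma> p * \<beta> P)
        - (\<gamma> P * pd i (\<beta> p) - \<gamma> p * pd i (\<beta> P))" by (simp add: pd_diff pd_mult)
    also have "\<dots> \<in> P" using 4 t'(3)[OF p] t'(3)[OF P_in_Z] by (intro idl_diff[OF P_idl] idl_mult2[OF P_idl])
    finally show ?thesis .
  qed
  \<comment> \<open>Both points are compared with the generic one, and \<beta> P is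
    cancelled.\<close>
  have compat: "pd i (\<gamma> q) * \<beta> p - pd i (\<gamma> p) * \<beta> q \<in> P" if p: "p \<in> Z" and q: "q \<in> Z" for i p q
  proof -
    have "\<beta> P * (pd i (\<gamma> q) * \<beta> p - pd i (\<gamma> p) * \<beta> q)
        = \<beta> q * (pd i (\<gamma> P) * \<beta> p - pd i (\<gamma> p) * \<beta> P) - \<beta> p * (pd i (\<gamma> P) * \<beta> q - pd i (\<gamma> q) * \<beta> P)"
      by (simp add: algebra_simps)
    also have "\<dots> \<in> P"
      by (rule idl_diff[OF P_idl idl_mult[OF P_idl compatP[OF p]] idl_mult[OF P_idl compatP[OF q]]])
    finally show ?thesis using \<beta>P[OF P_in_Z] by (simp add: prime_idl_mult_iff[OF P_prime])
  qed
  have one: "\<exists>c l. homog l c \<and> c \<notin> q \<and> c * x \<in> P" if "x \<in> P" "q \<in> Z" for x q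
    using that proj_pointsD(5)[OF ZD(1)[OF that(2)]] by (intro exI[of _ 1] exI[of _ 0]) simp
  have "\<exists>F\<in>P. homog d F \<and> (\<forall>i. \<beta> P * pd i F - pd i (\<gamma> P) \<in> P)"
  proof (cases d)
    case (Suc D)
    \<comment> \<open>As \<gamma> p is in P, the gradient of \<gamma> p / \<beta> p reduces modulo P
      to (\<open>pd i (\<gamma> p)\<close>) / \<beta> p, a section of degree d - 1 to which
      projective normality applies.\<close>
    have "\<exists>w. homog D w \<and> \<beta> P * w - pd i (\<gamma> P) \<in> P" for i
    proof -
      obtain w where w: "homog D w"
        "\<And>p. p \<in> Z \<Longrightarrow> \<exists>c l. homog l c \<and> c \<notin> p \<and> c * (w * \<beta> p - pd i (\<gamma> p)) \<in> P"
      proof (rule lift_fractions[OF lifts P_idl, of D \<beta> \<epsilon> "\<lambda>p. pd i (\<gamma> p)"])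
        show "homog (\<epsilon> p + D) (pd i (\<gamma> p))" if "p \<in> Z" for p
          using t'(4)[OF that] Suc by (intro pd_homog) simp
      qed (use t' off_Z one compat in auto)
      then show ?thesis using w(2)[OF P_in_Z] by (auto simp: prime_idl_mult_iff[OF P_prime] mult.commute)
    qed
    then have "\<forall>i. \<exists>w. homog D w \<and> \<beta> P * w - pd i (\<gamma> P) \<in> P" ..
    from choice[OF this] obtain w where w: "\<And>i. homog D (w i)" "\<And>i. \<beta> P * w i - pd i (\<gamma> P) \<in> P" by blast
    obtain g where g: "g \<in> P" "\<And>i. w i - pd i g \<in> P"
      using tl[unfolded torsion_lifts_def, rule_format, of "\<beta> P" "\<gamma> P" w] \<beta>P[OF P_in_Z] t'(3)[OF P_in_Z] w(2) by blast
    have "\<beta> P * pd i (hcomp d g) - pd i (\<gamma> P) \<in> P" for i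
    proof -
      have "hcomp D (w i - pd i g) \<in> P" by (rule gradedD[OF P_graded g(2)])
      then have "w i - pd i (hcomp d g) \<in> P" using w(1)[of i] by (simp add: hcomp_diff hcomp_homog Suc pd_hcomp)
      from idl_diff[OF P_idl w(2)[of i] idl_mult[OF P_idl this, of "\<beta> P"]] show ?thesis by (simp add: algebra_simps)
    qed
    then show ?thesis using gradedD[OF P_graded g(1)] homog_hcomp by blast
  next
    case 0
    obtain l where l: "(var l :: ('v, 'k) mpoly) \<notin> P" using proj_points_var[OF P_proj] by blast
    have g: "homog (\<epsilon> P) (\<gamma> P)" using t'(4)[OF P_in_Z] 0 by simp
    have "pd i (\<gamma> P) \<in> P" for i
    proof (cases "\<exists>m. m \<noteq> l")
      case True
      then obtain m where m: "m \<noteq> l" by blast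
      \<comment> \<open>For d = 0 the gradient would have degree -1; multiplication by a variable
        brings it to degree 0, where sections lift to constants.\<close>
      have ex: "\<exists>w. homog 0 w \<and> \<beta> P * w - pd i (\<gamma> P) * var k \<in> P" for k
      proof -
        obtain w where w: "homog 0 w"
          "\<And>p. p \<in> Z \<Longrightarrow> \<exists>c l. homog l c \<and> c \<notin> p \<and> c * (w * \<beta> p - pd i (\<gamma> p) * var k) \<in> P"
        proof (rule lift_fractions[OF lifts P_idl, of 0 \<beta> \<epsilon> "\<lambda>p. pd i (\<gamma> p) * var k"])
          show "homog (\<epsilon> p + 0) (pd i (\<gamma> p) * var k)" if "p \<in> Z" for p
            using t'(4)[OF that] 0 by (intro homog_pd_mult) auto
          show "\<exists>c l. homog l c \<and> c \<notin> q \<and> c * (pd i (\<gamma> q) * var k * \<beta> p - pd i (\<gamma> p) * var k * \<beta> q) \<in> P"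
            if p: "p \<in> Z" and q: "q \<in> Z" for p q
          proof (rule one[OF _ q])
            show "pd i (\<gamma> q) * var k * \<beta> p - pd i (\<gamma> p) * var k * \<beta> q \<in> P"
              using idl_mult[OF P_idl compat[OF p q], of "var k" i] by (simp add: algebra_simps)
          qed
        qed (use t' off_Z in auto)
        then show ?thesis using w(2)[OF P_in_Z] by (auto simp: prime_idl_mult_iff[OF P_prime] mult.commute)
      qed
      obtain w where w: "homog 0 w" "\<beta> P * w - pd i (\<gamma> P) * var l \<in> P" using ex by blast
      obtain w' where w': "homog 0 w'" "\<beta> P * w' - pd i (\<gamma> P) * var m \<in> P" using ex by blast
      \<comment> \<open>The constants w and w' come from the same gradient entry times x_l and x_m,
        so w x_m - w' x_l is a linear form in P. Nondegeneracy makes it zero, hence w = 0.\<close>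
      have "\<beta> P * (w * var m - w' * var l) = var m * (\<beta> P * w - pd i (\<gamma> P) * var l) - var l * (\<beta> P * w' - pd i (\<gamma> P) * var m)"
        by (simp add: algebra_simps)
      also have "\<dots> \<in> P" by (rule idl_diff[OF P_idl idl_mult[OF P_idl w(2)] idl_mult[OF P_idl w'(2)]])
      finally have "w * var m - w' * var l \<in> P" using \<beta>P[OF P_in_Z] by (simp add: prime_idl_mult_iff[OF P_prime])
      moreover have "homog 1 (w * var m - w' * var l)"
        using homog_mult[OF w(1) homog_var(1)] homog_mult[OF w'(1) homog_var(1)] by (intro homog_diff) auto
      ultimately have "w * var m - w' * var l = 0" by (intro linear_form_zero[OF nd])
      then have "pd m (w * var m - w' * var l) = 0" by simp
      then have "w = 0" using m by (simp add: pd_diff pd_mult pd_var pd_homog_0[OF w(1)] pd_homog_0[OF w'(1)])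
      then have "pd i (\<gamma> P) * var l \<in> P" using idl_uminus[OF P_idl w(2)] by simp
      then show ?thesis using l by (simp add: prime_idl_mult_iff[OF P_prime])
    next
      case False
      then have U: "UNIV = {l}" by auto
      \<comment> \<open>With one variable no second one is available for comparison; Euler's
        relation shows directly that the gradient vanishes modulo P.\<close>
      have "var l * pd l (\<gamma> P) = of_nat (\<epsilon> P) * \<gamma> P" using euler[OF g] by (simp add: U)
      then have "var l * pd l (\<gamma> P) \<in> P" using idl_mult[OF P_idl t'(3)[OF P_in_Z]] by simp
      moreover have "i = l" using False by blast
      ultimately show ?thesis using l by (simp add: prime_idl_mult_iff[OF P_prime])
    qed
    then have "\<forall>i. \<beta> P * pd i 0 - pd i (\<gamma> P) \<in> P" using idl_uminus[OF P_idl] by simp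
    then show ?thesis using idl_0[OF P_idl] homog_0 by blast
  qed
  then obtain F where F: "F \<in> P" "homog d F" "\<And>i. \<beta> P * pd i F - pd i (\<gamma> P) \<in> P" by blast
  \<comment> \<open>f lifts G modulo P, and F has modulo P the same gradient as the error \<gamma> p
    / \<beta> p. So F \<beta> p - \<gamma> p is in \<open>dker P\<close>, hence locally in the
    square.\<close>
  have "to_fract (f + F) - G p \<in> Fr (idl_prod P P) d p" if pX: "p \<in> proj_points" for p
  proof (cases "p \<in> Z")
    case p: True
    have n: "\<beta> p \<noteq> 0" by (rule proj_nonzero[OF pX t'(1)[OF p]])
    have "pd i (F * \<beta> p - \<gamma> p) \<in> P" for i
    proof -
      have "\<beta> P * pd i (F * \<beta> p - \<gamma> p) = \<beta> p * (\<beta> P * pd i F - pd i (\<gamma> P))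
          + (pd i (\<gamma> P) * \<beta> p - pd i (\<gamma> p) * \<beta> P) + \<beta> P * pd i (\<beta> p) * F"
        by (simp add: pd_diff pd_mult algebra_simps)
      also have "\<dots> \<in> P" by (intro idl_add[OF P_idl] idl_mult[OF P_idl] F compatP p)
      finally show ?thesis using \<beta>P[OF P_in_Z] by (simp add: prime_idl_mult_iff[OF P_prime])
    qed
    moreover have "F * \<beta> p - \<gamma> p \<in> P"
      using F(1) t'(3)[OF p] by (intro idl_diff[OF P_idl] idl_mult2[OF P_idl])
    ultimately have "F * \<beta> p - \<gamma> p \<in> dker P" by (simp add: dker_def)
    note sq = dker_locally_square[OF this p]
    have "homog (\<epsilon> p + d) (F * \<beta> p - \<gamma> p)"
      using homog_mult[OF t'(2)[OF p] F(2)] t'(4)[OF p] by (intro homog_diff) (auto simp: mult.commute)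
    then have "to_fract (F * \<beta> p - \<gamma> p) / to_fract (\<beta> p) \<in> Fr (idl_prod P P) d p"
      using Fr_frac_iff[OF pX P2_idl n t'(2)[OF p] _ t'(1)[OF p]] sq by blast
    moreover have "to_fract (f + F) - G p = to_fract (F * \<beta> p - \<gamma> p) / to_fract (\<beta> p)"
    proof -
      have "to_fract (f + F) - G p = to_fract F - (G p - to_fract f)" by simp
      also have "\<dots> = to_fract (F * \<beta> p - \<gamma> p) / to_fract (\<beta> p)"
        using n unfolding t'(5)[OF p] by (simp add: to_fract_diff diff_divide_distrib)
      finally show ?thesis .
    qed
    ultimately show ?thesis by simp
  next
    case False
    have "to_fract f - G p \<in> Fr UNIV d p" using f(2)[OF pX] off_Z[OF pX False] by simp
    moreover have "to_fract F \<in> Fr UNIV d p" using proj_pointsD(5)[OF pX] F(2) by (intro Fr_to_fract) auto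
    ultimately have "(to_fract f - G p) + to_fract F \<in> Fr UNIV d p" by (intro Fr_add[OF pX]) auto
    then show ?thesis using off_Z[OF pX False] by (simp add: algebra_simps)
  qed
  then show "\<exists>f. homog d f \<and> (\<forall>p\<in>proj_points. to_fract f - G p \<in> Fr (idl_prod P P) d p)"
    using homog_add[OF f(1) F(2)] by blast
qed

end

theorem theorem1p3:
  fixes Z :: "('v::{finite,linorder}, 'k::field_char_0) proj_point set"
  assumes "closedin Pn Z"
    and "irreducible_in Pn Z"
    and "smooth_variety Z"
    and "nondegenerate Z"
  shows "((\<forall>d. H1_vanishes Pn (twist (ideal_sheaf_sq Z) d)) \<longrightarrow>
           cone_differentials_torsion_free Z) \<and>
         (projectively_normal (ideal_sheaf Z) \<longrightarrow>
           (cone_differentials_torsion_free Z \<longleftrightarrow> projectively_normal (ideal_sheaf_sq Z)) \<and>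
           (cone_differentials_torsion_free Z \<longleftrightarrow>
              (\<forall>d. H1_vanishes Pn (twist (ideal_sheaf_sq Z) d))))"
proof -
  \<comment> \<open>The homogeneous prime of Z is its generic point, the intersection of all its
    points.\<close>
  interpret smooth_projective_variety Z "\<Inter>Z"
    using irreducible_closed[OF assms(1,2)] assms(3) by unfold_locales
  have "(\<forall>d. lifts_sections (idl_prod (\<Inter>Z) (\<Inter>Z)) d) \<Longrightarrow> torsion_lifts (\<Inter>Z)"
    using lifts_imp_torsion_lifts by blast
  moreover have "(\<forall>d. lifts_sections (\<Inter>Z) d) \<Longrightarrow> torsion_lifts (\<Inter>Z) \<Longrightarrow>
      (\<forall>d. lifts_sections (idl_prod (\<Inter>Z) (\<Inter>Z)) d)"
    using torsion_lifts_imp_lifts[OF assms(4)] by blast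
  ultimately show ?thesis
    unfolding H1_ideal_sheaf_sq cone_differentials_torsion_free_iff
      projectively_normal_ideal_sheaf projectively_normal_ideal_sheaf_sq by blast
qed

end
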